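(* Let $n\geqslant 1$, let $1\leqslant p,q\leqslant\infty$ satisfy $(1/p-1/2)(1/q-1/p)\geqslant 0$, and let $\Phi:\mathbb{R}^n\to[0,\infty)$ be a nonnegative measurable function satisfying $$\int_{B(0,1)}|y|^n\Phi(y)\,dy<\infty\quad\text{and}\quad\int_{B(0,1)^c}\Phi(y)\,dy<\infty .$$ Then the Hausdorff operator $H_\Phi f(x)=\int_{\mathbb{R}^n}\Phi(y)f(x/|y|)\,dy$ is bounded on the modulation space $M_{p,q}$ if and only if $$\int_{\mathbb{R}^n}\left(|y|^{n/p}+|y|^{n/q'}\right)\Phi(y)\,dy<\infty .$$
   Context: Here $1/\infty=0$, $q'$ is the conjugate exponent of $q$ ($1/q+1/q'=1$), and $B(0,1)$ is the open unit ball of $\mathbb{R}^n$. Fourier transform: $\mathscr{F}f(\xi)=\hat f(\xi)=\int_{\mathbb{R}^n}f(x)e^{-2\pi i x\cdot\xi}\,dx$ for $f\in\mathscr{S}=\mathscr{S}(\mathbb{R}^n)$ (Schwartz space), extended to tempered distributions $\mathscr{S}'$; $\mathscr{F}^{-1}$ is its inverse. Hausdorff operator: under the two integrability conditions on $\Phi$, for every $f\in\mathscr{S}$ the integral $H_\Phi f(x)=\int_{\mathbb{R}^n}\Phi(y)f(x/|y|)\,dy$ converges absolutely for $x\ne0$ and defines a locally integrable function which is a tempered distribution; $H_\Phi:\mathscr{S}\to\mathscr{S}'$. Modulation space: let $\eta:\mathbb{R}^n\to[0,1]$ be a smooth function with $\eta(\xi)=1$ for $|\xi|_\infty\leqslant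 1/2$ and $\eta(\xi)=0$ for $|\xi|_\infty\geqslant 3/4$, where $|\xi|_\infty=\max_i|\xi_i|$. For $k\in\mathbb{Z}^n$ put $\eta_k(\xi)=\eta(\xi-k)$, $\sigma_k=\eta_k\big(\sum_{l\in\mathbb{Z}^n}\eta_l\big)^{-1}$ and $\Box_k=\mathscr{F}^{-1}\sigma_k\mathscr{F}$. The space $M_{p,q}$ consists of all $f\in\mathscr{S}'$ with $\|f\|_{M_{p,q}}=\big(\sum_{k\in\mathbb{Z}^n}\|\Box_kf\|_{L^p}^q\big)^{1/q}<\infty$ (supremum over $k$ if $q=\infty$). Different choices of $\eta$ give equivalent norms. Boundedness: "$H_\Phi$ is bounded on $M_{p,q}$" means there is a constant $C$ such that $\|H_\Phi f\|_{M_{p,q}}\leqslant C\|f\|_{M_{p,q}}$ for all $f\in\mathscr{S}(\mathbb{R}^n)$. *)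

theory Defs
  imports "HOL-Analysis.Analysis" "HOL-Probability.Essential_Supremum"
begin

text \<open>Smooth functions and Schwartz functions. Requiring every iterated partial derivative to be
  totally differentiable (hence continuous) is the usual \<open>C\<close>-infinity condition; it also guarantees
  that \<^const>\<open>frechet_derivative\<close> is meaningful at each step.\<close>

primrec iter_partial ::
    "'n list \<Rightarrow> (real^'n \<Rightarrow> 'b::real_normed_vector) \<Rightarrow> real^'n::finite \<Rightarrow> 'b" where
  "iter_partial [] f = f"
| "iter_partial (i # is) f = (\<lambda>x. frechet_derivative (iter_partial is f) (at x) (axis i 1))"

definition smooth :: "(real^'n::finite \<Rightarrow> 'b::real_normed_vector) \<Rightarrow> bool" where
  "smooth f \<longleftrightarrow> (\<forall>is x. iter_partial is f differentiable (at x))"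

definition schwartz :: "(real^'n::finite \<Rightarrow> complex) set" where
  "schwartz = {f. smooth f \<and>
     (\<forall>(m::nat) is. bounded (range (\<lambda>x. norm x ^ m *\<^sub>R iter_partial is f x)))}"

definition fourier :: "(real^'n::finite \<Rightarrow> complex) \<Rightarrow> real^'n \<Rightarrow> complex" where
  "fourier f \<xi> = (LINT x|lebesgue. f x * exp (- 2 * of_real pi * \<i> * of_real (x \<bullet> \<xi>)))"

definition inv_fourier :: "(real^'n::finite \<Rightarrow> complex) \<Rightarrow> real^'n \<Rightarrow> complex" where
  "inv_fourier = inv_into schwartz fourier"

text \<open>A tempered distribution is represented by a functional on functions, of which only the
  values on Schwartz functions matter. The Fourier transform and multiplication by a smooth
  function are transposed from test functions without complex conjugation.\<close>

type_synonym 'n distr = "(real^'n \<Rightarrow> complex) \<Rightarrow> complex"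

definition distr_of :: "(real^'n::finite \<Rightarrow> complex) \<Rightarrow> 'n distr" where
  "distr_of g \<phi> = (LINT x|lebesgue. g x * \<phi> x)"

definition distr_fourier :: "'n::finite distr \<Rightarrow> 'n distr" where
  "distr_fourier u \<phi> = u (fourier \<phi>)"

definition distr_inv_fourier :: "'n::finite distr \<Rightarrow> 'n distr" where
  "distr_inv_fourier u \<phi> = u (inv_fourier \<phi>)"

definition distr_mult :: "(real^'n::finite \<Rightarrow> real) \<Rightarrow> 'n distr \<Rightarrow> 'n distr" where
  "distr_mult s u \<phi> = u (\<lambda>x. of_real (s x) * \<phi> x)"

text \<open>Real powers of extended nonnegative numbers, used for positive exponents only.\<close>

definition enn_powr :: "ennreal \<Rightarrow> real \<Rightarrow> ennreal" where
  "enn_powr x r = (if x = \<infinity> then \<infinity> else ennreal (enn2real x powr r))"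

definition Lp_norm :: "ereal \<Rightarrow> (real^'n::finite \<Rightarrow> complex) \<Rightarrow> ennreal" where
  "Lp_norm p g =
     (if p = \<infinity> then esssup lebesgue (\<lambda>x. ennreal (norm (g x)))
      else enn_powr (\<integral>\<^sup>+x. ennreal (norm (g x) powr real_of_ereal p) \<partial>lebesgue)
             (1 / real_of_ereal p))"

text \<open>The \<open>L\<close>-\<open>p\<close> norm of a distribution: the norm of the function representing it, which is
  unique almost everywhere, and \<open>\<infinity>\<close> (the infimum of the empty set, or a value of
  \<^const>\<open>Lp_norm\<close>) if no \<open>L\<close>-\<open>p\<close> function represents it.\<close>

definition distr_Lp_norm :: "ereal \<Rightarrow> 'n::finite distr \<Rightarrow> ennreal" where
  "distr_Lp_norm p u =
     (INF g \<in> {g \<in> borel_measurable lebesgue. \<forall>\<phi>\<in>schwartz. u \<phi> = distr_of g \<phi>}. Lp_norm p g)"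

text \<open>\<^const>\<open>infnorm\<close> is the maximum norm on \<open>\<real>^'n\<close>.\<close>

definition modulation_window :: "(real^'n::finite \<Rightarrow> real) \<Rightarrow> bool" where
  "modulation_window \<eta> \<longleftrightarrow> smooth \<eta> \<and> (\<forall>\<xi>. 0 \<le> \<eta> \<xi> \<and> \<eta> \<xi> \<le> 1) \<and>
     (\<forall>\<xi>. infnorm \<xi> \<le> 1/2 \<longrightarrow> \<eta> \<xi> = 1) \<and> (\<forall>\<xi>. infnorm \<xi> \<ge> 3/4 \<longrightarrow> \<eta> \<xi> = 0)"

definition translate_window :: "(real^'n::finite \<Rightarrow> real) \<Rightarrow> int^'n \<Rightarrow> real^'n \<Rightarrow> real" where
  "translate_window \<eta> k \<xi> = \<eta> (\<xi> - (\<chi> i. of_int (k $ i)))"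

definition sigma_window :: "(real^'n::finite \<Rightarrow> real) \<Rightarrow> int^'n \<Rightarrow> real^'n \<Rightarrow> real" where
  "sigma_window \<eta> k \<xi> = translate_window \<eta> k \<xi> / (\<Sum>\<^sub>\<infinity>l. translate_window \<eta> l \<xi>)"

definition box_op :: "(real^'n::finite \<Rightarrow> real) \<Rightarrow> int^'n \<Rightarrow> 'n distr \<Rightarrow> 'n distr" where
  "box_op \<eta> k u = distr_inv_fourier (distr_mult (sigma_window \<eta> k) (distr_fourier u))"

text \<open>A tempered distribution belongs to the modulation space iff this norm is finite.\<close>

definition modulation_norm ::
    "(real^'n::finite \<Rightarrow> real) \<Rightarrow> ereal \<Rightarrow> ereal \<Rightarrow> 'n distr \<Rightarrow> ennreal" where
  "modulation_norm \<eta> p q u =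
     (if q = \<infinity> then (SUP k. distr_Lp_norm p (box_op \<eta> k u))
      else enn_powr (\<Sum>\<^sub>\<infinity>k. enn_powr (distr_Lp_norm p (box_op \<eta> k u)) (real_of_ereal q))
             (1 / real_of_ereal q))"

definition hausdorff_op ::
    "(real^'n::finite \<Rightarrow> real) \<Rightarrow> (real^'n \<Rightarrow> complex) \<Rightarrow> real^'n \<Rightarrow> complex" where
  "hausdorff_op \<Phi> f x = (LINT y|lebesgue. of_real (\<Phi> y) * f (x /\<^sub>R norm y))"

definition bounded_on_modulation ::
    "(real^'n::finite \<Rightarrow> real) \<Rightarrow> ereal \<Rightarrow> ereal
      \<Rightarrow> ((real^'n \<Rightarrow> complex) \<Rightarrow> real^'n \<Rightarrow> complex) \<Rightarrow> bool" where
  "bounded_on_modulation \<eta> p q H \<longleftrightarrow>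
     (\<exists>C::real. C \<ge> 0 \<and> (\<forall>f\<in>schwartz.
        modulation_norm \<eta> p q (distr_of (H f)) \<le> ennreal C * modulation_norm \<eta> p q (distr_of f)))"

end

theory Submission
 imports Defs "HOL-Probability.Probability"
begin

text \<open>
 Write \<open>D t\<close> for the dilation taking \<open>f\<close> to \<open>x \<mapsto> f (x / t)\<close>. Since \<open>H f\<close> is the integral of
 \<open>\<Phi> y\<close> times \<open>D (norm y) f\<close>, Minkowski's inequality reduces sufficiency to the bound
 \<open>O(t\<^sup>n\<^sup>/\<^sup>p + t\<^sup>n\<^sup>/\<^sup>q\<^sup>')\<close> for the norm of \<open>D t\<close> on the modulation space. For \<open>t \<le> 1\<close> a block of \<open>D t f\<close>
 involves boundedly many dilated blocks of \<open>f\<close>, each spread over about \<open>t\<^sup>-\<^sup>n\<close> blocks; for \<open>t \<ge> 1\<close> the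
 roles are exchanged. The losses in the outer sum are recovered by a Bessel inequality: directly when
 the inner exponent is at least 2, by local constancy of the dilated blocks when it is below 2, and by duality
 for \<open>t \<ge> 1\<close>.

 For necessity, \<open>H\<close> is tested on sums of \<open>J\<close> dyadic dilates of a positive definite band-limited bump, normalised
 in \<open>L\<^sup>p\<close>. They live in the single block 0, and the \<open>p\<close>-th power of their norm is \<open>O(J)\<close>, while \<open>H f\<close>
 exceeds a constant times \<open>norm x\<^sup>-\<^sup>n\<^sup>/\<^sup>p\<close> times the integral of \<open>norm y\<^sup>n\<^sup>/\<^sup>p \<Phi> y\<close> over
 \<open>2\<^sup>-\<^sup>d \<le> norm y \<le> 2\<^sup>d\<close> on \<open>J - O(1)\<close> dyadic shells; \<open>J\<close> cancels and \<open>d\<close> is arbitrary. The Fourier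
 transforms of such sums, normalised with \<open>q\<close> and observed on dyadic shells of the frequency lattice,
 give the second integral in the same way.
\<close>

text \<open>Blocks are treated as functions throughout. \<open>HH f\<close> is integrable against a
  fixed weight, so its blocks are genuine convolutions, and a wider window reproducing each block
  compares its norm with the infimum over representatives that defines the distributional norm. The
  hypothesis on the exponents says p <= 2 and q <= p, or p >= 2 and p <= q. Two losses are possible:
  one from Bessel's inequality when the inner exponent lies on the wrong side of 2, one from
  comparing an l^p with an l^q sum over many blocks. The hypothesis makes both occur in the same
  range of t (t <= 1 in the first case, t >= 1 in the second), where together they give exactly
  t^(n/q'); in the other range neither occurs and t^(n/p) remains. For necessity at a finite
  exponent, single bumps bound each dyadic shell of y separately, and such bounds do not add up. The
  weights of the dyadic sums are critical, so that all scales contribute equally, and the number of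
  shells lost at the two ends depends on d but not on J.\<close>

abbreviation cor :: "real => complex" where "cor \<equiv> of_real"

abbreviation enorm :: "'a::real_normed_vector => ennreal" where "enorm x \<equiv> ennreal (norm x)"

abbreviation lborel_nn_integral :: "('a::euclidean_space => ennreal) => ennreal" (binder "NBINT " 10) where
 "lborel_nn_integral f \<equiv> integral\<^sup>N lborel f"

abbreviation borelM :: "('a::topological_space => 'b::topological_space) set" where "borelM \<equiv> borel_measurable borel"

section \<open>Coordinates and affine changes of variables\<close>

lemma prod_Basis_vec: "(\<Prod>b\<in>(Basis::(real^'n::finite) set). h b) = (\<Prod>i\<in>UNIV. h (axis i 1))"
proof -
 have "Basis = range (\<lambda>i. axis i (1::real) :: real^'n)"
  by (auto simp: Basis_vec_def)
 moreover have "inj (\<lambda>i. axis i (1::real) :: real^'n)"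
  by (rule injI) (simp add: axis_eq_axis)
 ultimately show ?thesis by (metis prod.reindex comp_apply prod.cong)
qed

lemma nn_integral_affine:
 fixes f :: "'a::euclidean_space => ennreal"
 assumes [measurable]: "f \<in> borelM" and c: "c \<noteq> 0"
 shows "(NBINT x. f x) = ennreal (\<bar>c\<bar>^DIM('a)) * (NBINT x. f (t + c *\<^sub>R x))"
 by (subst lborel_affine[OF c, of t])
   (simp add: nn_integral_density nn_integral_distr nn_integral_cmult)

lemma integrable_affine:
 fixes f :: "'a::euclidean_space => 'b::{banach,second_countable_topology}"
 assumes f: "integrable lborel f" and c: "c \<noteq> 0"
 shows "integrable lborel (\<lambda>x. f (t + c *\<^sub>R x))"
proof -
 have [measurable]: "f \<in> borelM" using f by auto
 have "(NBINT x. enorm (f x)) < \<infinity>" using f by (simp add: integrable_iff_bounded)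
 then have "(NBINT x. enorm (f (t + c *\<^sub>R x))) < \<infinity>"
  using c by (subst (asm) nn_integral_affine[OF _ c, of _ t]) (auto simp: ennreal_mult_less_top)
 then show ?thesis by (simp add: integrable_iff_bounded)
qed

lemma integral_affine:
 fixes f :: "'a::euclidean_space => 'b::{banach,second_countable_topology}"
 assumes [measurable]: "f \<in> borelM" and c: "c \<noteq> 0"
 shows "(LBINT x. f x) = (\<bar>c\<bar>^DIM('a)) *\<^sub>R (LBINT x. f (t + c *\<^sub>R x))"
 by (subst lborel_affine[OF c, of t])
   (simp add: integral_density integral_distr)

lemma nn_integral_shift:
 fixes f :: "'a::euclidean_space => ennreal"
 assumes "f \<in> borelM"
 shows "(NBINT x. f (t + x)) = (NBINT x. f x)"
  "(NBINT x. f (x + t)) = (NBINT x. f x)"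
  "(NBINT x. f (t - x)) = (NBINT x. f x)"
 using nn_integral_affine[OF assms, of 1 t] nn_integral_affine[OF assms, of "-1" t]
 by (simp_all add: add.commute)

lemma integral_shift:
 fixes f :: "'a::euclidean_space => 'b::{banach,second_countable_topology}"
 assumes "f \<in> borelM"
 shows "(LBINT x. f (t + x)) = (LBINT x. f x)"
  "(LBINT x. f (x + t)) = (LBINT x. f x)"
  "(LBINT x. f (t - x)) = (LBINT x. f x)"
 using integral_affine[OF assms, of 1 t] integral_affine[OF assms, of "-1" t]
 by (simp_all add: add.commute)

lemma integrable_shift:
 fixes f :: "'a::euclidean_space => 'b::{banach,second_countable_topology}"
 assumes "integrable lborel f"
 shows "integrable lborel (\<lambda>x. f (t + x))" "integrable lborel (\<lambda>x. f (x + t))"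
  "integrable lborel (\<lambda>x. f (t - x))"
 using integrable_affine[OF assms, of 1 t] integrable_affine[OF assms, of "-1" t]
 by (simp_all add: add.commute)

section \<open>A product weight\<close>

text \<open>The product form reduces integrability to one variable, so the first power is integrable
  in every dimension and no exponent has to depend on n.\<close>

definition wt :: "real^'n::finite => real" where
 "wt x = (\<Prod>i\<in>UNIV. inverse (1 + (x$i)^2))"

lemma wt_pos [simp]: "wt x > 0"
 unfolding wt_def by (intro prod_pos) (simp add: add_pos_nonneg)

lemma wt_nonneg [simp]: "wt x \<ge> 0"
 using wt_pos[of x] by linarith

lemma wt_nz [simp]: "wt x \<noteq> 0"
 using wt_pos[of x] by linarith

lemma wt_le_1 [simp]: "wt x <= 1"
 unfolding wt_def by (intro prod_le_1) (auto simp: divide_simps add_pos_nonneg)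

lemma wt_minus [simp]: "wt (- x) = wt x" by (simp add: wt_def)

lemma wt_0 [simp]: "wt 0 = 1" by (simp add: wt_def)

lemma wt_diff_commute: "wt (x - y) = wt (y - x)"
 using wt_minus[of "x - y"] by simp

lemma wt_power_le: "m <= k ==> wt x ^ k <= wt x ^ m"
 by (intro power_decreasing) auto

lemma wt_power_le1: "0 < k ==> wt x ^ k <= wt x"
 using wt_power_le[of 1 k x] by simp

lemma continuous_on_wt [continuous_intros]: "continuous_on A (wt :: real^'n::finite => real)"
 unfolding wt_def by (intro continuous_intros) (auto simp: add_pos_nonneg less_imp_neq add_nonneg_eq_0_iff)

lemma borel_measurable_wt [measurable]: "(wt :: real^'n::finite => real) \<in> borelM"
 by (intro borel_measurable_continuous_onI continuous_on_wt)

text \<open>A Peetre inequality: moving the weight by \<open>z\<close> costs one factor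
  \<open>1 / wt z\<close>. In each coordinate the difference of the two sides is an explicit sum of
  squares.\<close>

lemma wt_add: "wt (x + z) * wt z <= 2 ^ CARD('n) * wt (x :: real^'n::finite)"
proof -
 have *: "inverse (1 + (a + b)^2) * inverse (1 + b^2) <= 2 * inverse (1 + a^2)" for a b :: real
 proof -
  have "2 * ((1 + (a+b)^2) * (1 + b^2)) - (1 + a^2) = 1 + (a + 2*b)^2 + 2 * ((a+b) * b)^2"
   by (simp add: power2_eq_square algebra_simps)
  moreover have "0 <= 1 + (a + 2*b)^2 + 2 * ((a+b) * b)^2" by simp
  ultimately have le: "1 + a^2 <= 2 * ((1 + (a+b)^2) * (1 + b^2))" by linarith
  have pos: "1 + a^2 > 0" "(1 + (a+b)^2) * (1 + b^2) > 0"
   by (simp_all add: add_pos_nonneg)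
  have "2 * inverse (2 * ((1 + (a+b)^2) * (1 + b^2))) <= 2 * inverse (1 + a^2)"
   using le pos by (intro mult_left_mono le_imp_inverse_le) auto
  then show ?thesis by (simp only: inverse_mult_distrib) simp
 qed
 have "wt (x + z) * wt z = (\<Prod>i\<in>UNIV. inverse (1 + (x$i + z$i)^2) * inverse (1 + (z$i)^2))"
  by (simp add: wt_def prod.distrib)
 also have "... <= (\<Prod>i\<in>(UNIV::'n set). 2 * inverse (1 + (x$i)^2))"
  by (intro prod_mono) (use * in auto)
 also have "... = 2 ^ CARD('n) * wt x" by (simp add: wt_def prod.distrib)
 finally show ?thesis .
qed

lemma wt_add': "wt (x + z) <= 2 ^ CARD('n) * wt (x :: real^'n::finite) / wt z"
 using wt_add[of x z] by (simp add: field_simps)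

lemma wt_lower: "wt x * wt z <= 2 ^ CARD('n) * wt (x + (z :: real^'n::finite))"
 using wt_add[of "x + z" "- z"] by simp

lemma wt_scale_le: "1 <= \<bar>c\<bar> ==> wt (c *\<^sub>R x) <= wt x"
proof -
 assume c: "1 <= \<bar>c\<bar>"
 have "(x$i)\<^sup>2 <= (c * x$i)\<^sup>2" for i
 proof -
  have "\<bar>x$i\<bar> <= \<bar>c\<bar> * \<bar>x$i\<bar>" using c mult_right_mono[of 1 "\<bar>c\<bar>" "\<bar>x$i\<bar>"] by simp
  then show ?thesis by (simp add: abs_le_square_iff[symmetric] abs_mult)
 qed
 then show ?thesis unfolding wt_def
  by (intro prod_mono) (auto simp: add_pos_nonneg intro!: le_imp_inverse_le)
qed

text \<open>With \<open>wt_le_norm\<close> this lets powers of \<open>wt\<close> and inverse powers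
  of the norm be exchanged, so decay may be measured by either.\<close>

lemma inverse_wt_le: "1 <= wt (x::real^'n::finite) * (1 + norm x ^ 2) ^ CARD('n)"
proof -
 have "(\<Prod>i\<in>(UNIV::'n set). 1 + (x$i)^2) <= (\<Prod>i\<in>(UNIV::'n set). 1 + norm x ^ 2)"
  using component_le_norm_cart[of x] 
  by (intro prod_mono) (auto simp: abs_le_square_iff[symmetric])
 moreover have "wt x = inverse (\<Prod>i\<in>(UNIV::'n set). 1 + (x$i)^2)" by (simp add: wt_def prod_inversef[symmetric] o_def)
 moreover have "(\<Prod>i\<in>(UNIV::'n set). 1 + (x$i)^2) > 0" by (intro prod_pos) (simp add: add_pos_nonneg)
 ultimately show ?thesis by (simp add: field_simps)
qed

lemma wt_le_norm: "wt (x::real^'n::finite) * norm x ^ 2 <= CARD('n)"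
proof -
 have "wt x * (x$i)^2 <= 1" for i
 proof -
  have "wt x = inverse (1 + (x$i)^2) * (\<Prod>i\<in>UNIV-{i}. inverse (1 + (x$i)^2))"
   unfolding wt_def by (subst prod.remove[of _ i]) auto
  also have "... <= inverse (1 + (x$i)^2) * 1"
   by (intro mult_left_mono prod_le_1) (auto simp: divide_simps add_pos_nonneg)
  finally have "wt x * (x$i)^2 <= inverse (1 + (x$i)^2) * 1 * (x$i)^2"
   by (rule mult_right_mono) simp
  also have "... <= 1" by (simp add: divide_simps add_pos_nonneg)
  finally show ?thesis .
 qed
 then have "(\<Sum>i\<in>(UNIV::'n set). wt x * (x$i)^2) <= (\<Sum>i\<in>(UNIV::'n set). 1)" by (intro sum_mono)
 then show ?thesis
  by (simp add: sum_distrib_left[symmetric] norm_vec_def L2_set_def sum_nonneg)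
qed

lemma integrable_wt: "integrable lborel (wt :: real^'n::finite => real)"
proof -
 have 1: "(NBINT x. ennreal (inverse (1 + x^2))) < \<infinity>"
  using integrable_inverse_1_plus_square
  by (simp add: set_integrable_def einterval_def integrable_iff_bounded)
 have "(NBINT x. ennreal (wt (x::real^'n))) =
   (NBINT x. (\<Prod>b\<in>Basis. ennreal (inverse (1 + ((x::real^'n) \<bullet> b)^2))))"
  by (intro nn_integral_cong)
   (simp add: prod_Basis_vec wt_def inner_axis prod_ennreal)
 also have "... = (\<Prod>b\<in>(Basis::(real^'n) set). (NBINT x. ennreal (inverse (1 + x^2))))"
  by (rule nn_integral_lborel_prod) auto
 also have "... < \<infinity>" using 1 by (simp add: power_less_top_ennreal)
 finally show ?thesis by (simp add: integrable_iff_bounded)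
qed

section \<open>Characters and the Gaussian\<close>

definition ee :: "real => complex" where
 "ee t = exp (- 2 * of_real pi * \<i> * of_real t)"

lemma ee_cis: "ee t = cis (- 2 * pi * t)" by (simp add: ee_def cis_conv_exp mult_ac)

lemma norm_ee [simp]: "norm (ee t) = 1" by (simp add: ee_cis)

lemma ee_add: "ee (s + t) = ee s * ee t" by (simp add: ee_cis cis_mult algebra_simps)

lemma ee_0 [simp]: "ee 0 = 1" by (simp add: ee_def)

lemma cnj_ee: "cnj (ee t) = ee (- t)" by (simp add: ee_cis cis_cnj)

lemma continuous_on_ee [continuous_intros]: "continuous_on A f ==> continuous_on A (\<lambda>x. ee (f x))"
 unfolding ee_def by (intro continuous_intros)

lemma borel_measurable_ee [measurable]: "ee \<in> borelM"
 by (intro borel_measurable_continuous_onI continuous_intros)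

text \<open>The characteristic function of the standard normal law, rescaled by sqrt(2 pi) so that
  with the normalisation of \<open>ee\<close> the Gaussian becomes its own transform.\<close>

lemma gauss_fourier_1:
 "integrable lborel (\<lambda>x. of_real (exp (- pi * x^2)) * ee (x * t))"
 "(LBINT x. of_real (exp (- pi * x^2)) * ee (x * t)) = of_real (exp (- pi * t^2))"
proof -
 define s where "s = - sqrt (2 * pi) * t"
 let ?f = "\<lambda>x. std_normal_density x *\<^sub>R iexp (s * x)"
 have c: "sqrt (2*pi) \<noteq> 0" by simp
 have "of_real (exp (- (s^2)/2)) = char std_normal_distribution s"
  by (simp add: char_std_normal_distribution)
 also have "... = (LBINT x. ?f x)"
  by (simp add: char_def integral_density)
 also have "... = \<bar>sqrt (2*pi)\<bar> *\<^sub>R (LBINT x. ?f (0 + sqrt (2*pi) * x))"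
  by (rule lborel_integral_real_affine[OF c])
 also have "... = (LBINT x. \<bar>sqrt (2*pi)\<bar> *\<^sub>R ?f (0 + sqrt (2*pi) * x))"
  by (rule integral_scaleR_right[symmetric])
 also have e: "(\<lambda>x. \<bar>sqrt (2*pi)\<bar> *\<^sub>R ?f (0 + sqrt (2*pi) * x)) = (\<lambda>x. of_real (exp (- pi * x^2)) * ee (x * t))"
 proof
  fix x
  have "s * (0 + sqrt (2*pi) * x) = - 2 * pi * (x * t)"
   using real_sqrt_mult_self[of "2*pi"] by (simp add: s_def algebra_simps del: real_sqrt_mult_self) 
  then have "iexp (s * (0 + sqrt (2*pi) * x)) = ee (x * t)"
   unfolding ee_cis cis_conv_exp by (metis)
  moreover have "\<bar>sqrt (2*pi)\<bar> * std_normal_density (0 + sqrt (2*pi) * x) = exp (- pi * x^2)"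
   by (simp add: normal_density_def power_mult_distrib)
  ultimately show "\<bar>sqrt (2*pi)\<bar> *\<^sub>R ?f (0 + sqrt (2*pi) * x) = of_real (exp (- pi * x^2)) * ee (x * t)"
   by (metis scaleR_conv_of_real scaleR_scaleR)
 qed
 finally show "(LBINT x. of_real (exp (- pi * x^2)) * ee (x * t)) = of_real (exp (- pi * t^2))"
  by (simp add: s_def power_mult_distrib)
 have "integrable lborel std_normal_density" by simp
 then have "integrable lborel ?f"
  by (rule Bochner_Integration.integrable_bound) auto
 from lborel_integrable_real_affine[OF this c, of 0]
 have "integrable lborel (\<lambda>x. \<bar>sqrt (2*pi)\<bar> *\<^sub>R ?f (0 + sqrt (2*pi) * x))"
  by (intro integrable_scaleR_right) 
 then show "integrable lborel (\<lambda>x. of_real (exp (- pi * x^2)) * ee (x * t))" by (simp only: e)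
qed

lemma lborel_integral_prod:
 fixes h :: "'a::euclidean_space => real => complex"
 assumes i: "\<And>b. b \<in> Basis ==> integrable lborel (h b)"
 shows "integrable lborel (\<lambda>x::'a. \<Prod>b\<in>Basis. h b (x \<bullet> b))"
  "(LBINT x. (\<Prod>b\<in>Basis. h b ((x::'a) \<bullet> b))) = (\<Prod>b\<in>Basis. LBINT x. h b x)"
proof -
 interpret product_sigma_finite "\<lambda>_::'a. lborel :: real measure" ..
 have [measurable]: "b \<in> Basis ==> h b \<in> borelM" for b using i[of b] by auto
 have 1: "(\<lambda>f. \<Prod>b\<in>Basis. h b ((\<Sum>b\<in>Basis. f b *\<^sub>R b) \<bullet> b)) = (\<lambda>f. \<Prod>b\<in>Basis. h b (f b))"
  by (auto intro!: prod.cong ext)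
 show "integrable lborel (\<lambda>x::'a. \<Prod>b\<in>Basis. h b (x \<bullet> b))"
  by (subst lborel_eq, subst integrable_distr_eq) (auto simp: 1 intro!: product_integrable_prod i)
 show "(LBINT x. (\<Prod>b\<in>Basis. h b ((x::'a) \<bullet> b))) = (\<Prod>b\<in>Basis. LBINT x. h b x)"
  by (subst lborel_eq, subst integral_distr) (auto simp: 1 intro!: product_integral_prod i)
qed

definition gauss :: "real^'n::finite => real" where "gauss x = exp (- pi * norm x ^ 2)"

lemma gauss_pos [simp]: "gauss x > 0" by (simp add: gauss_def)
lemma gauss_le_1 [simp]: "gauss x <= 1" by (simp add: gauss_def)
lemma gauss_minus [simp]: "gauss (-x) = gauss x" by (simp add: gauss_def)
lemma borel_measurable_gauss [measurable]: "(gauss :: real^'n::finite => real) \<in> borelM"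
 unfolding gauss_def by measurable

lemma gauss_fourier:
 fixes \<xi> :: "real^'n::finite"
 shows "integrable lborel (\<lambda>x. of_real (gauss x) * ee (x \<bullet> \<xi>))"
  "(LBINT x. of_real (gauss x) * ee (x \<bullet> \<xi>)) = of_real (gauss \<xi>)"
proof -
 let ?h = "\<lambda>(b::real^'n) x. of_real (exp (- pi * x^2)) * ee (x * (\<xi> \<bullet> b))"
 have ee_sum: "ee (sum f A) = (\<Prod>i\<in>A. ee (f i))" for f :: "real^'n => real" and A
  by (induction A rule: infinite_finite_induct) (auto simp: ee_add)
 have g: "gauss x = (\<Prod>b\<in>Basis. exp (- pi * (x \<bullet> b)^2))" for x :: "real^'n"
  by (simp add: gauss_def norm_eq_sqrt_inner euclidean_inner[of x x] sum_nonneg sum_distrib_left power2_eq_square flip: exp_sum)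
 have 1: "of_real (gauss x) * ee (x \<bullet> \<xi>) = (\<Prod>b\<in>Basis. ?h b (x \<bullet> b))" for x :: "real^'n"
  by (simp add: g prod.distrib euclidean_inner[of x \<xi>] ee_sum)
 show "integrable lborel (\<lambda>x. of_real (gauss x) * ee (x \<bullet> \<xi>))"
  unfolding 1 by (rule lborel_integral_prod) (rule gauss_fourier_1)
 show "(LBINT x. of_real (gauss x) * ee (x \<bullet> \<xi>)) = of_real (gauss \<xi>)"
  unfolding 1 by (subst lborel_integral_prod) (rule gauss_fourier_1, simp only: gauss_fourier_1 g of_real_prod)
qed

lemma integrable_gauss: "integrable lborel (gauss :: real^'n::finite => real)"
 and integral_gauss: "(LBINT x. gauss (x::real^'n)) = 1"
proof -
 have "integrable lborel (\<lambda>x::real^'n. cor (gauss x))" 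
  using gauss_fourier(1)[of 0] by simp
 then show "integrable lborel (gauss :: real^'n::finite => real)" by (simp only: complex_of_real_integrable_eq)
 have "cor (LBINT x. gauss (x::real^'n)) = 1"
  using gauss_fourier(2)[of 0] by (simp add: gauss_def)
 then show "(LBINT x. gauss (x::real^'n)) = 1" by simp
qed

section \<open>Smooth and Schwartz functions\<close>

abbreviation pd :: "'n => (real^'n::finite => 'b::real_normed_vector) => real^'n => 'b" where
 "pd i f \<equiv> (\<lambda>x. frechet_derivative f (at x) (axis i 1))"

lemma iter_partial_append: "iter_partial (is @ js) f = iter_partial is (iter_partial js f)"
 by (induction "is") auto

lemma pd_eq: "(f has_derivative f') (at x) ==> pd i f x = f' (axis i 1)"
 using frechet_derivative_at[of f f' x] by simp

lemma iter_partial_in: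
 assumes "f \<in> P" "\<And>g i. g \<in> P ==> pd i g \<in> P"
 shows "iter_partial is f \<in> P"
 by (induction "is") (auto intro: assms)

text \<open>Smoothness concerns all iterated partials at once, so it is proved by exhibiting a class
  of differentiable functions closed under partial derivatives. Each closure property below amounts
  to guessing such a class.\<close>

lemma smooth_coinduct:
 assumes "f \<in> P" "\<And>g x. g \<in> P ==> g differentiable (at x)" "\<And>g i. g \<in> P ==> pd i g \<in> P"
 shows "smooth f"
 unfolding smooth_def using iter_partial_in[of f P, OF assms(1,3)] assms(2) by blast

lemma smooth_differentiable: "smooth f ==> f differentiable (at x)"
 unfolding smooth_def by (metis iter_partial.simps(1))

lemma smooth_has_derivative: "smooth f ==> (f has_derivative frechet_derivative f (at x)) (at x)"
 using smooth_differentiable frechet_derivative_works by blast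

lemma iter_partial_pd: "iter_partial is (pd i f) = iter_partial (is @ [i]) f"
 by (simp add: iter_partial_append)

lemma smooth_pd: "smooth f ==> smooth (pd i f)"
 unfolding smooth_def iter_partial_pd by blast

lemma smooth_continuous: "smooth f ==> continuous_on A f"
 by (meson smooth_differentiable differentiable_imp_continuous_within continuous_at_imp_continuous_on)

lemma smooth_measurable: "smooth f ==> f \<in> borelM"
 by (intro borel_measurable_continuous_onI smooth_continuous)

lemma smooth_add:
 assumes "smooth f" "smooth g" shows "smooth (\<lambda>x. f x + g x)"
proof (rule smooth_coinduct[where P="{\<lambda>x. f x + g x | f g. smooth f \<and> smooth g}"])
 show "(\<lambda>x. f x + g x) \<in> {\<lambda>x. f x + g x | f g. smooth f \<and> smooth g}" using assms by blast
 fix h i assume "h \<in> {\<lambda>x. f x + g x | f g. smooth f \<and> smooth g}"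
 then obtain f g where h: "h = (\<lambda>x. f x + g x)" "smooth f" "smooth g" by blast
 have "pd i h = (\<lambda>x. pd i f x + pd i g x)"
  unfolding h(1) by (intro ext pd_eq derivative_intros smooth_has_derivative h)
 then show "pd i h \<in> {\<lambda>x. f x + g x | f g. smooth f \<and> smooth g}"
  by (intro CollectI exI[of _ "pd i f"] exI[of _ "pd i g"] conjI smooth_pd h)
 show "h differentiable (at x)" for x
  unfolding h(1) by (intro differentiable_add smooth_differentiable h)
qed

text \<open>By Leibniz's rule this class is closed under partial derivatives, so that products are smooth
 by coinduction.\<close>

inductive_set prods :: "(real^'n::finite => 'b::real_normed_field) set => (real^'n => 'b) set" for A where
 base: "f \<in> A ==> g \<in> A ==> (\<lambda>x. f x * g x) \<in> prods A"
| plus: "f \<in> prods A ==> g \<in> prods A ==> (\<lambda>x. f x + g x) \<in> prods A"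

lemma prods_pd:
 assumes A: "\<And>f. f \<in> A ==> smooth f" "\<And>f i. f \<in> A ==> pd i f \<in> A"
 assumes "h \<in> prods A"
 shows "h differentiable (at x) \<and> pd i h \<in> prods A"
 using assms(3)
proof (induction arbitrary: x)
 case (base f g)
 have d: "(f has_derivative frechet_derivative f (at x)) (at x)"
  "(g has_derivative frechet_derivative g (at x)) (at x)" for x
  using smooth_has_derivative[OF A(1)[OF base(1)]] smooth_has_derivative[OF A(1)[OF base(2)]] by auto
 have "pd i (\<lambda>x. f x * g x) = (\<lambda>x. f x * pd i g x + pd i f x * g x)"
  by (intro ext pd_eq has_derivative_mult d)
 then have "pd i (\<lambda>x. f x * g x) \<in> prods A" using base A(2) by (auto intro!: prods.intros)
 then show ?case using differentiableI[OF has_derivative_mult[OF d(1)[of x] d(2)[of x]]] by auto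
next
 case (plus f g)
 have d: "(f has_derivative frechet_derivative f (at x)) (at x)"
  "(g has_derivative frechet_derivative g (at x)) (at x)" for x
  using plus.IH frechet_derivative_works by blast+
 have "pd i (\<lambda>x. f x + g x) = (\<lambda>x. pd i f x + pd i g x)"
  by (intro ext pd_eq derivative_intros d)
 then have "pd i (\<lambda>x. f x + g x) \<in> prods A" using plus by (auto intro!: prods.intros)
 then show ?case using differentiableI[OF has_derivative_add[OF d(1)[of x] d(2)[of x]]] by auto
qed

lemma smooth_mult:
 fixes f g :: "real^'n::finite => 'b::real_normed_field"
 assumes "smooth f" "smooth g" shows "smooth (\<lambda>x. f x * g x)"
proof (rule smooth_coinduct[where P="prods (Collect smooth)"])
 show "(\<lambda>x. f x * g x) \<in> prods (Collect smooth)" using assms by (auto intro!: prods.base)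
qed (use prods_pd[of "Collect smooth"] smooth_pd in auto)

lemma smooth_const: "smooth (\<lambda>x::real^'n::finite. c)"
 by (rule smooth_coinduct[where P="range (\<lambda>c x. c)"]) auto

text \<open>The scalar \<open>a\<close> in the invariant class absorbs the factor \<open>c\<close>
  that the chain rule produces at each derivative.\<close>

lemma smooth_affine:
 fixes f :: "real^'n::finite => 'b::real_normed_vector"
 assumes "smooth f" shows "smooth (\<lambda>x. f (c *\<^sub>R x + b))"
proof (rule smooth_coinduct[where P="{\<lambda>x. a *\<^sub>R f (c *\<^sub>R x + b) | a f. smooth f}"])
 show "(\<lambda>x. f (c *\<^sub>R x + b)) \<in> {\<lambda>x. a *\<^sub>R f (c *\<^sub>R x + b) | a f. smooth f}"
  using assms by (intro CollectI exI[of _ 1] exI[of _ f]) simp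
 fix h assume "h \<in> {\<lambda>x. a *\<^sub>R f (c *\<^sub>R x + b) | a f. smooth f}"
 then obtain a f where h: "h = (\<lambda>x. a *\<^sub>R f (c *\<^sub>R x + b))" "smooth f" by blast
 have d: "(h has_derivative (\<lambda>y. a *\<^sub>R (frechet_derivative f (at (c *\<^sub>R x + b)) (c *\<^sub>R y)))) (at x)" for x
  unfolding h(1)
  by (auto intro!: derivative_eq_intros has_derivative_compose[where g=f and f="\<lambda>x. c *\<^sub>R x + b", OF _ smooth_has_derivative[OF h(2)]])
 show "h differentiable (at x)" for x using d differentiable_def by blast
 have "pd i h = (\<lambda>x. (a * c) *\<^sub>R pd i f (c *\<^sub>R x + b))" for i
 proof
  fix x
  have "linear (frechet_derivative f (at (c *\<^sub>R x + b)))"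
   using smooth_has_derivative[OF h(2)] has_derivative_linear by blast
  then show "pd i h x = (a * c) *\<^sub>R pd i f (c *\<^sub>R x + b)"
   by (simp add: pd_eq[OF d] linear_cmul)
 qed
 then show "pd i h \<in> {\<lambda>x. a *\<^sub>R f (c *\<^sub>R x + b) | a f. smooth f}" for i
  by (intro CollectI exI[of _ "a * c"] exI[of _ "pd i f"] conjI smooth_pd h)
qed

lemma smooth_cmult:
 fixes f :: "real^'n::finite => 'b::real_normed_field"
 shows "smooth f ==> smooth (\<lambda>x. c * f x)"
 by (intro smooth_mult smooth_const)

lemma smooth_sum:
 fixes f :: "'a => real^'n::finite => 'b::real_normed_vector"
 shows "(\<And>i. i \<in> I ==> smooth (f i)) ==> smooth (\<lambda>x. \<Sum>i\<in>I. f i x)"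
 by (induction I rule: infinite_finite_induct) (auto simp: smooth_const intro!: smooth_add)

text \<open>Derivatives of 1/f bring in higher powers of 1/f with smooth numerators; the quotients g
  / f^m form a class that is closed under this.\<close>

lemma smooth_inverse:
 fixes f :: "real^'n::finite => real"
 assumes f: "smooth f" and nz: "\<And>x. f x \<noteq> 0" shows "smooth (\<lambda>x. inverse (f x))"
proof (rule smooth_coinduct[where P="{\<lambda>x. g x * inverse (f x) ^ m | g m. smooth g}"])
 show "(\<lambda>x. inverse (f x)) \<in> {\<lambda>x. g x * inverse (f x) ^ m | g m. smooth g}"
  by (intro CollectI exI[of _ "\<lambda>x. 1"] exI[of _ 1]) (simp add: smooth_const)
 fix h assume "h \<in> {\<lambda>x. g x * inverse (f x) ^ m | g m. smooth g}"
 then obtain g m where h: "h = (\<lambda>x. g x * inverse (f x) ^ m)" "smooth g" by blast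
 let ?D = "\<lambda>x y. (frechet_derivative g (at x) y * f x - of_nat m * g x * frechet_derivative f (at x) y)
   * inverse (f x) ^ Suc m"
 have d: "(h has_derivative ?D x) (at x)" for x
 proof -
  have "((\<lambda>x. g x * inverse (f x) ^ m) has_derivative
    (\<lambda>y. g x * (of_nat m * (- (inverse (f x) * frechet_derivative f (at x) y * inverse (f x))) * inverse (f x) ^ (m - 1))
     + frechet_derivative g (at x) y * inverse (f x) ^ m)) (at x)"
   by (rule has_derivative_mult[OF smooth_has_derivative[OF h(2)]
      has_derivative_power[OF Deriv.has_derivative_inverse[OF nz smooth_has_derivative[OF f]]]])
  moreover have "g x * (of_nat m * (- (inverse (f x) * frechet_derivative f (at x) y * inverse (f x))) * inverse (f x) ^ (m - 1))
     + frechet_derivative g (at x) y * inverse (f x) ^ m = ?D x y" for y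
   using nz[of x] by (cases m) (auto simp: field_simps)
  ultimately show ?thesis unfolding h(1) by simp
 qed
 show "h differentiable (at x)" for x using d differentiable_def by blast
 have "pd i h = (\<lambda>x. (pd i g x * f x + (- of_nat m) * (g x * pd i f x)) * inverse (f x) ^ Suc m)" for i
  by (intro ext) (simp add: pd_eq[OF d] algebra_simps)
 moreover have "smooth (\<lambda>x. pd i g x * f x + (- of_nat m) * (g x * pd i f x))" for i
  by (intro smooth_add smooth_mult smooth_const smooth_pd h f)
 ultimately show "pd i h \<in> {\<lambda>x. g x * inverse (f x) ^ m | g m. smooth g}" for i
  by (intro CollectI exI[of _ "\<lambda>x. pd i g x * f x + (- of_nat m) * (g x * pd i f x)"] exI[of _ "Suc m"] conjI)
qed

text \<open>The decay half of the Schwartz condition, expressed by powers of \<open>wt\<close>,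
  whose behaviour under shifts and integration is already known; \<open>rapid_bounded\<close> and
  \<open>rapidD_bounded\<close> translate to and from norms.\<close>

definition rapid :: "(real^'n::finite => complex) => bool" where
 "rapid f \<longleftrightarrow> (\<forall>N::nat. \<exists>C. \<forall>x. norm (f x) <= C * wt x ^ N)"

lemma norm_wt_le: "norm x * wt (x::real^'n::finite) <= 1 + CARD('n)"
proof -
 have "2 * norm x <= 1 + norm x ^ 2" 
  using zero_le_power2[of "norm x - 1"] by (simp add: power2_diff)
 then have "norm x <= 1 + norm x ^ 2" using norm_ge_zero[of x] by linarith
 then have "norm x * wt x <= (1 + norm x ^ 2) * wt x" by (intro mult_right_mono) auto
 also have "... <= 1 + CARD('n)" using add_mono[OF wt_le_1[of x] wt_le_norm[of x]] by (simp add: algebra_simps)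
 finally show ?thesis .
qed

lemma rapid_bounded:
 assumes "\<forall>m::nat. bounded (range (\<lambda>x. norm x ^ m *\<^sub>R f x))" shows "rapid (f :: real^'n::finite => complex)"
 unfolding rapid_def
proof
 fix N :: nat
 \<comment> \<open>\<open>inverse_wt_le\<close> bounds 1/wt by the n-th power of 1 + |x|^2, so N
   powers of \<open>wt\<close> require n * N of these factors, that is 2M powers of the norm. The
   bound with exponent 0 takes care of small x.\<close>
 define M where "M = CARD('n) * N"
 obtain a where a: "norm (norm x ^ 0 *\<^sub>R f x) <= a" for x using assms[rule_format, of 0] by (auto simp: bounded_iff)
 obtain b where b: "norm (norm x ^ (2*M) *\<^sub>R f x) <= b" for x using assms[rule_format, of "2*M"] unfolding bounded_iff by blast
 have "norm (f x) <= (2^M * (a + b)) * wt x ^ N" for x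
 proof -
  have "1 <= (wt x * (1 + norm x ^ 2) ^ CARD('n)) ^ N" by (intro one_le_power inverse_wt_le)
  then have 1: "1 <= wt x ^ N * (1 + norm x ^ 2) ^ M" by (simp add: M_def power_mult_distrib power_mult)
  have "(1 + norm x ^ 2) ^ M <= (2 * max 1 (norm x ^ 2)) ^ M" by (intro power_mono) auto
  also have "... = 2^M * max 1 (norm x ^ 2) ^ M" by (simp add: power_mult_distrib)
  also have "... <= 2^M * (1 + (norm x ^ 2) ^ M)" by (intro mult_left_mono) (auto simp: max_def)
  also have "(norm x ^ 2) ^ M = norm x ^ (2*M)" by (simp add: power_mult)
  finally have 2: "(1 + norm x ^ 2) ^ M <= 2^M * (1 + norm x ^ (2*M))" .
  have "norm (f x) <= (wt x ^ N * (1 + norm x ^ 2) ^ M) * norm (f x)"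
   using mult_right_mono[OF 1, of "norm (f x)"] by simp
  also have "... <= (wt x ^ N * (2^M * (1 + norm x ^ (2*M)))) * norm (f x)"
   by (intro mult_right_mono mult_left_mono 2) auto
  also have "... = wt x ^ N * 2^M * (norm (norm x ^ 0 *\<^sub>R f x) + norm (norm x ^ (2*M) *\<^sub>R f x))"
   by (simp add: algebra_simps)
  also have "... <= wt x ^ N * 2^M * (a + b)" by (intro mult_left_mono add_mono a b) auto
  finally show ?thesis by (simp add: mult_ac)
 qed
 then show "\<exists>C. \<forall>x. norm (f x) <= C * wt x ^ N" by blast
qed

lemma rapidD_bounded:
 assumes "rapid (f :: real^'n::finite => complex)" shows "bounded (range (\<lambda>x. norm x ^ m *\<^sub>R f x))"
proof -
 obtain C where C: "\<And>x. norm (f x) <= C * wt x ^ m" using assms unfolding rapid_def by blast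
 have "C \<ge> 0" using C[of 0] norm_ge_zero[of "f 0"] by (simp del: norm_ge_zero)
 have "norm (norm x ^ m *\<^sub>R f x) <= C * (1 + real CARD('n)) ^ m" for x
 proof -
  have "norm (norm x ^ m *\<^sub>R f x) <= norm x ^ m * (C * wt x ^ m)"
   using C[of x] by (simp add: mult_left_mono)
  also have "... = C * (norm x * wt x) ^ m" by (simp add: power_mult_distrib)
  also have "... <= C * (1 + real CARD('n)) ^ m"
   using \<open>C \<ge> 0\<close> norm_wt_le[of x] by (intro mult_left_mono power_mono) auto
  finally show ?thesis .
 qed
 then show ?thesis unfolding bounded_iff by blast
qed

lemma schwartz_coinduct:
 assumes "f \<in> P" "\<And>g x. g \<in> P ==> g differentiable (at x)" "\<And>g i. g \<in> P ==> pd i g \<in> P"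
  "\<And>g. g \<in> P ==> rapid g"
 shows "f \<in> schwartz"
 unfolding schwartz_def
 using smooth_coinduct[of f P, OF assms(1-3)] iter_partial_in[of f P, OF assms(1,3)] assms(4) rapidD_bounded
 by blast

lemma schwartz_smooth: "f \<in> schwartz ==> smooth f" by (simp add: schwartz_def)

lemma schwartz_rapid: "f \<in> schwartz ==> rapid f"
proof (rule rapid_bounded, rule allI)
 fix m :: nat
 assume "f \<in> schwartz"
 then have "bounded (range (\<lambda>x. norm x ^ m *\<^sub>R iter_partial [] f x))" unfolding schwartz_def by blast
 then show "bounded (range (\<lambda>x. norm x ^ m *\<^sub>R f x))" by simp
qed

lemma schwartz_pd: "f \<in> schwartz ==> pd i f \<in> schwartz"
 using smooth_pd[of f i] by (simp add: schwartz_def iter_partial_pd)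

lemmas schwartz_has_derivative = smooth_has_derivative[OF schwartz_smooth]
lemmas schwartz_differentiable = smooth_differentiable[OF schwartz_smooth]
lemmas schwartz_measurable = smooth_measurable[OF schwartz_smooth]

lemma schwartz_bound: 
 assumes "f \<in> schwartz" obtains C where "C > 0" "\<And>x. norm (f x) <= C * wt x ^ N"
proof -
 obtain C where C: "\<And>x. norm (f x) <= C * wt x ^ N" using schwartz_rapid[OF assms] unfolding rapid_def by blast
 have "norm (f x) <= (\<bar>C\<bar> + 1) * wt x ^ N" for x
  by (rule order_trans[OF C mult_right_mono]) auto
 then show ?thesis by (intro that[of "\<bar>C\<bar> + 1"]) auto
qed

lemma rapid_add: 
 assumes "rapid f" "rapid g" shows "rapid (\<lambda>x. f x + g x)"
 unfolding rapid_def
proof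
 fix N :: nat
 obtain C D where "\<And>x. norm (f x) <= C * wt x ^ N" "\<And>x. norm (g x) <= D * wt x ^ N"
  using assms unfolding rapid_def by metis
 then have "norm (f x + g x) <= (C + D) * wt x ^ N" for x
  by (metis (no_types, opaque_lifting) add_mono norm_triangle_le distrib_right)
 then show "\<exists>C. \<forall>x. norm (f x + g x) <= C * wt x ^ N" by blast
qed

lemma rapid_mult: 
 assumes "rapid f" "rapid g" shows "rapid (\<lambda>x. f x * g x)"
 unfolding rapid_def
proof
 fix N :: nat
 obtain C D where CD: "\<And>x. norm (f x) <= C * wt x ^ N" "\<And>x. norm (g x) <= D * wt x ^ 0"
  using assms unfolding rapid_def by metis
 have "norm (f x * g x) <= (C * wt x ^ N) * (D * wt x ^ 0)" for x
  unfolding norm_mult by (intro mult_mono CD order_trans[OF norm_ge_zero CD(1)]) auto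
 then show "\<exists>C. \<forall>x. norm (f x * g x) <= C * wt x ^ N" by (intro exI[of _ "C * D"]) (simp add: mult_ac)
qed

lemma rapid_coord: 
 assumes "rapid f" shows "rapid (\<lambda>x. of_real (x $ i) * f x :: complex)"
 unfolding rapid_def
proof
 fix N :: nat
 obtain C where C: "\<And>x. norm (f x) <= C * wt x ^ Suc N"
  using assms unfolding rapid_def by metis
 have "C \<ge> 0" using C[of 0] norm_ge_zero[of "f 0"] by (simp del: norm_ge_zero)
 have "norm (of_real (x $ i) * f x) <= C * (1 + real CARD('a)) * wt x ^ N" for x
 proof -
  have "norm (of_real (x $ i) * f x) <= norm x * (C * wt x ^ Suc N)"
   unfolding norm_mult by (intro mult_mono C) (auto simp: component_le_norm_cart)
  also have "... = C * (norm x * wt x) * wt x ^ N" by simp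
  also have "... <= C * (1 + real CARD('a)) * wt x ^ N"
   using \<open>C \<ge> 0\<close> norm_wt_le[of x] by (intro mult_left_mono mult_right_mono) auto
  finally show ?thesis .
 qed
 then show "\<exists>C. \<forall>x. norm (of_real (x $ i) * f x) <= C * wt x ^ N" by blast
qed

lemma schwartz_add:
 assumes "f \<in> schwartz" "g \<in> schwartz" shows "(\<lambda>x. f x + g x) \<in> schwartz"
proof (rule schwartz_coinduct[where P="{\<lambda>x. f x + g x | f g. f \<in> schwartz \<and> g \<in> schwartz}"])
 show "(\<lambda>x. f x + g x) \<in> {\<lambda>x. f x + g x | f g. f \<in> schwartz \<and> g \<in> schwartz}" using assms by blast
 fix h i assume "h \<in> {\<lambda>x. f x + g x | f g. f \<in> schwartz \<and> g \<in> (schwartz :: (real^'a => complex) set)}"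
 then obtain f g where h: "h = (\<lambda>x. f x + g x)" "f \<in> schwartz" "g \<in> schwartz" by blast
 have "pd i h = (\<lambda>x. pd i f x + pd i g x)"
  unfolding h(1) by (intro ext pd_eq derivative_intros schwartz_has_derivative h)
 then show "pd i h \<in> {\<lambda>x. f x + g x | f g. f \<in> schwartz \<and> g \<in> schwartz}"
  by (intro CollectI exI[of _ "pd i f"] exI[of _ "pd i g"] conjI schwartz_pd h)
 show "h differentiable (at x)" for x
  unfolding h(1) by (intro differentiable_add schwartz_differentiable h)
 show "rapid h" unfolding h(1) by (intro rapid_add schwartz_rapid h)
qed

lemma schwartz_mult:
 assumes "f \<in> schwartz" "g \<in> schwartz" shows "(\<lambda>x. f x * g x) \<in> schwartz"
proof (rule schwartz_coinduct[where P="prods schwartz"])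
 show "(\<lambda>x. f x * g x) \<in> prods schwartz" using assms by (auto intro!: prods.base)
 show "rapid h" if "h \<in> prods schwartz" for h
  using that by induction (auto intro: rapid_add rapid_mult schwartz_rapid)
qed (use prods_pd[of schwartz] schwartz_smooth schwartz_pd in blast)+

lemma rapid_0: "rapid (\<lambda>x. 0)" unfolding rapid_def by (auto intro!: exI[of _ 0])

lemma schwartz_0: "(\<lambda>x. 0) \<in> schwartz"
 by (rule schwartz_coinduct[where P="{\<lambda>x. 0}"]) (auto simp: rapid_0)

lemma rapid_cmult: "rapid f ==> rapid (\<lambda>x. c * f x)"
 unfolding rapid_def norm_mult by (metis mult.assoc mult_left_mono norm_ge_zero)

lemma schwartz_cmult:
 assumes "f \<in> schwartz" shows "(\<lambda>x. c * f x) \<in> schwartz"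
proof (rule schwartz_coinduct[where P="{\<lambda>x. c * f x | f. f \<in> schwartz}"])
 show "(\<lambda>x. c * f x) \<in> {\<lambda>x. c * f x | f. f \<in> schwartz}" using assms by blast
 fix h i assume "h \<in> {\<lambda>x. c * f x | f. f \<in> (schwartz :: (real^'a => complex) set)}"
 then obtain f where h: "h = (\<lambda>x. c * f x)" "f \<in> schwartz" by blast
 have "pd i h = (\<lambda>x. c * pd i f x)"
  unfolding h(1) by (intro ext pd_eq has_derivative_mult_right schwartz_has_derivative h)
 then show "pd i h \<in> {\<lambda>x. c * f x | f. f \<in> schwartz}"
  by (intro CollectI exI[of _ "pd i f"] conjI schwartz_pd h)
 show "h differentiable (at x)" for x
  unfolding h(1) by (rule differentiableI[OF has_derivative_mult_right[OF schwartz_has_derivative[OF h(2)]]])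
 show "rapid h" unfolding h(1) by (intro rapid_cmult schwartz_rapid h)
qed

lemma schwartz_sum:
 "(\<And>i. i \<in> I ==> f i \<in> schwartz) ==> (\<lambda>x. \<Sum>i\<in>I. f i x) \<in> schwartz"
 by (induction I rule: infinite_finite_induct) (auto simp: schwartz_0 intro!: schwartz_add)

text \<open>Differentiating the coordinate factor leaves a term without it; the summand
  \<open>g\<close> in the invariant class collects these remainders.\<close>

lemma schwartz_coord:
 assumes "f \<in> schwartz" shows "(\<lambda>x. of_real (x $ i) * f x) \<in> schwartz"
proof (rule schwartz_coinduct[where P="{\<lambda>x. of_real (x $ i) * f x + g x | f g. f \<in> schwartz \<and> g \<in> schwartz}"])
 show "(\<lambda>x. of_real (x $ i) * f x) \<in> {\<lambda>x. of_real (x $ i) * f x + g x | f g. f \<in> schwartz \<and> g \<in> schwartz}"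
  using assms schwartz_0 by (intro CollectI exI[of _ f] exI[of _ "\<lambda>x. 0"]) simp
 fix h assume "h \<in> {\<lambda>x. of_real (x $ i) * f x + g x | f g. f \<in> schwartz \<and> g \<in> (schwartz :: (real^'a => complex) set)}"
 then obtain f g where h: "h = (\<lambda>x. of_real (x $ i) * f x + g x)" "f \<in> schwartz" "g \<in> schwartz" by blast
 have c: "((\<lambda>x. cor (x $ i)) has_derivative (\<lambda>y. of_real (y $ i))) (at x)" for x :: "real^'a"
  by (intro bounded_linear_imp_has_derivative bounded_linear_compose[OF bounded_linear_of_real] bounded_linear_vec_nth)
 have d: "(h has_derivative (\<lambda>y. of_real (x $ i) * frechet_derivative f (at x) y + of_real (y $ i) * f x
   + frechet_derivative g (at x) y)) (at x)" for x
  unfolding h(1) by (intro has_derivative_add has_derivative_mult c schwartz_has_derivative h)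
 show "h differentiable (at x)" for x using d differentiable_def by blast
 have "pd j h = (\<lambda>x. of_real (x $ i) * pd j f x + (of_real (axis j 1 $ i) * f x + pd j g x))" for j
  by (intro ext) (simp add: pd_eq[OF d] add_ac)
 then show "pd j h \<in> {\<lambda>x. of_real (x $ i) * f x + g x | f g. f \<in> schwartz \<and> g \<in> schwartz}" for j
  by (intro CollectI exI[of _ "pd j f"] exI[of _ "\<lambda>x. of_real (axis j 1 $ i) * f x + pd j g x"]
    conjI schwartz_pd schwartz_add schwartz_cmult h)
 show "rapid h" unfolding h(1) by (intro rapid_add rapid_coord schwartz_rapid h)
qed

lemma schwartz_dilate:
 assumes "f \<in> schwartz" "c \<noteq> 0" shows "(\<lambda>x. f (c *\<^sub>R x)) \<in> schwartz"
proof (rule schwartz_coinduct[where P="{\<lambda>x. of_real a * f (c *\<^sub>R x) | a f. f \<in> schwartz}"])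
 show "(\<lambda>x. f (c *\<^sub>R x)) \<in> {\<lambda>x. of_real a * f (c *\<^sub>R x) | a f. f \<in> schwartz}"
  using assms by (intro CollectI exI[of _ 1] exI[of _ f]) simp
 fix h assume "h \<in> {\<lambda>x. of_real a * f (c *\<^sub>R x) | a f. f \<in> (schwartz :: (real^'a => complex) set)}"
 then obtain a f where h: "h = (\<lambda>x. of_real a * f (c *\<^sub>R x))" "f \<in> schwartz" by blast
 have d: "(h has_derivative (\<lambda>y. of_real a * (frechet_derivative f (at (c *\<^sub>R x)) (c *\<^sub>R y)))) (at x)" for x
  unfolding h(1)
  by (auto intro!: derivative_eq_intros has_derivative_compose[where g=f and f="\<lambda>x. c *\<^sub>R x", OF _ schwartz_has_derivative[OF h(2)]])
 show "h differentiable (at x)" for x using d differentiable_def by blast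
 have "pd i h = (\<lambda>x. of_real (a * c) * pd i f (c *\<^sub>R x))" for i
 proof
  fix x
  have "linear (frechet_derivative f (at (c *\<^sub>R x)))"
   using schwartz_has_derivative[OF h(2)] has_derivative_linear by blast
  then show "pd i h x = of_real (a * c) * pd i f (c *\<^sub>R x)"
   by (simp add: pd_eq[OF d] linear_cmul scaleR_conv_of_real[symmetric])
 qed
 then show "pd i h \<in> {\<lambda>x. of_real a * f (c *\<^sub>R x) | a f. f \<in> schwartz}" for i
  by (intro CollectI exI[of _ "a * c"] exI[of _ "pd i f"] conjI schwartz_pd h)
 have "rapid (\<lambda>x. f (c *\<^sub>R x))"
 proof (intro rapid_bounded allI)
  fix m :: nat
  obtain B where B: "\<And>x. norm (norm x ^ m *\<^sub>R f x) <= B" 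
   using rapidD_bounded[OF schwartz_rapid[OF h(2)], of m] unfolding bounded_iff by blast
  have "norm (norm x ^ m *\<^sub>R f (c *\<^sub>R x)) <= B / \<bar>c\<bar> ^ m" for x
   using B[of "c *\<^sub>R x"] assms(2) by (simp add: field_simps power_mult_distrib)
  then show "bounded (range (\<lambda>x. norm x ^ m *\<^sub>R f (c *\<^sub>R x)))" unfolding bounded_iff by blast
 qed
 then show "rapid h" unfolding h(1) by (rule rapid_cmult)
qed

lemma schwartz_reflect: "f \<in> schwartz ==> (\<lambda>x. f (- x)) \<in> schwartz"
 using schwartz_dilate[of f "-1"] by simp

text \<open>The function vanishes on the open set of points with norm above \<open>R\<close>, hence
  so do its partials, and the class is closed under differentiation. Decay then comes from
  boundedness on a compact ball.\<close>

lemma schwartz_compact_support: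
 fixes f :: "real^'n::finite => real"
 assumes "smooth f" and R: "\<And>x. norm x > R ==> f x = 0"
 shows "(\<lambda>x. of_real (f x)) \<in> schwartz"
proof -
 define P where "P = {h. \<exists>f. h = (\<lambda>x::real^'n. cor (f x)) \<and> smooth f \<and> (\<forall>x. norm x > R --> f x = 0)}"
 have P_I: "h \<in> P" if "h = (\<lambda>x. of_real (f x))" "smooth f" "\<forall>x. norm x > R --> f x = 0" for f h
  unfolding P_def by (rule CollectI, rule exI[of _ f], intro conjI that)
 have *: "(\<forall>x. h differentiable (at x)) \<and> (\<forall>i. pd i h \<in> P) \<and> rapid h" if hP: "h \<in> P" for h
 proof -
 have "\<exists>f. h = (\<lambda>x. of_real (f x)) \<and> smooth f \<and> (\<forall>x. norm x > R --> f x = 0)"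
  using hP unfolding P_def by (rule CollectD)
 then obtain f where h': "h = (\<lambda>x. of_real (f x)) \<and> smooth f \<and> (\<forall>x. norm x > R --> f x = 0)"
  by (rule exE)
 have h: "h = (\<lambda>x. of_real (f x))" "smooth f" and f0: "\<And>x. norm x > R ==> f x = 0"
  using h' by (blast+)
 have d: "(h has_derivative (\<lambda>y. of_real (frechet_derivative f (at x) y))) (at x)" for x
  unfolding h(1) by (intro has_derivative_of_real smooth_has_derivative h)
 have 1: "h differentiable (at x)" for x using d differentiable_def by blast
 have "pd i h = (\<lambda>x. of_real (pd i f x))" for i by (intro ext pd_eq d)
 moreover have "pd i f x = 0" if "norm x > R" for i x
 proof -
  have "open {x::real^'n. norm x > R}" by (intro open_Collect_less continuous_intros)
  then have "(f has_derivative (\<lambda>y. 0)) (at x)"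
   by (rule has_derivative_transform_within_open[where f="\<lambda>x. 0", rotated 1]) (use that f0 in auto)
  then show ?thesis by (simp add: pd_eq)
 qed
 ultimately have 2: "pd i h \<in> P" for i
  by (intro P_I[of _ "pd i f"] allI impI smooth_pd h)
 have 3: "rapid h"
 proof (intro rapid_bounded allI)
  fix m :: nat
  let ?g = "\<lambda>x. norm x ^ m *\<^sub>R h x"
  let ?t1 = "?g ` cball 0 \<bar>R\<bar>"
  have "compact ?t1" unfolding h(1)
   by (intro compact_continuous_image continuous_intros smooth_continuous h) auto
  then have "bounded (insert 0 ?t1)" by (simp add: compact_imp_bounded)
  moreover have "range ?g \<subseteq> insert 0 ?t1"
  proof
   fix y assume "y \<in> range ?g"
   then obtain x where x: "y = ?g x" by blast
   show "y \<in> insert 0 ?t1"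
   proof (cases "norm x > R")
    case True then show ?thesis by (simp add: x h(1) f0)
   qed (auto simp: x)
  qed
  ultimately show "bounded (range ?g)" by (rule bounded_subset)
 qed
 show ?thesis using 1 2 3 by blast
 qed
 show ?thesis
  by (rule schwartz_coinduct[of _ P]) (use * P_I[OF refl assms(1)] R in blast)+
qed

lemma schwartz_integrable_power:
 assumes "f \<in> schwartz" shows "integrable lborel (\<lambda>x. norm x ^ m * norm (f x))"
proof -
 obtain C where C: "C > 0" "\<And>x. norm (f x) <= C * wt x ^ (m + 1)" using schwartz_bound[OF assms] by blast
 have [measurable]: "f \<in> borelM" using assms by (rule schwartz_measurable)
 have i: "integrable lborel (\<lambda>x. (C * (1 + real CARD('a)) ^ m) * wt x)"
  using integrable_wt by (intro integrable_mult_right)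
 show ?thesis
 proof (rule Bochner_Integration.integrable_bound[OF i])
  have "norm x ^ m * norm (f x) <= (C * (1 + real CARD('a)) ^ m) * wt x" for x
  proof -
   have "norm x ^ m * norm (f x) <= norm x ^ m * (C * wt x ^ (m+1))" using C by (intro mult_left_mono) auto
   also have "... = C * (norm x * wt x) ^ m * wt x" by (simp add: power_mult_distrib)
   also have "... <= C * (1 + real CARD('a)) ^ m * wt x"
    using C norm_wt_le[of x] by (intro mult_right_mono mult_left_mono power_mono) auto
   finally show ?thesis .
  qed
  then show "AE x in lborel. norm (norm x ^ m * norm (f x)) <= norm ((C * (1 + real CARD('a)) ^ m) * wt x)"
   using C by (auto simp: abs_mult)
 qed measurable
qed

lemma schwartz_integrable: "f \<in> schwartz ==> integrable lborel f"
 using schwartz_integrable_power[of f 0] schwartz_measurable[of f]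
 by (simp add: integrable_norm_iff)

section \<open>The Fourier transform on Schwartz functions\<close>

lemma schwartz_borel: "f \<in> schwartz ==> f \<in> borelM"
 by (rule schwartz_measurable)

lemma fourier_lborel:
 assumes [measurable]: "f \<in> borelM"
 shows "fourier f \<xi> = (LBINT x. f x * ee (x \<bullet> \<xi>))"
 unfolding fourier_def ee_def[symmetric] by (rule integral_completion) measurable

lemma integrable_times_ee:
 assumes "integrable lborel (f :: real^'n::finite => complex)"
 shows "integrable lborel (\<lambda>x. f x * ee (x \<bullet> \<xi>))"
proof (rule Bochner_Integration.integrable_bound[OF assms])
 have [measurable]: "f \<in> borelM" using assms by auto
 show "(\<lambda>x. f x * ee (x \<bullet> \<xi>)) \<in> borel_measurable lborel" by measurable
qed (simp add: norm_mult)

lemma norm_fourier_le: "norm (fourier f \<xi>) <= (LBINT x. norm (f x))" if "f \<in> borelM"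
 unfolding fourier_lborel[OF that]
 by (rule order_trans[OF integral_norm_bound]) (simp add: norm_mult)

text \<open>Suited to Fourier integrals: Taylor's formula for the character gives a remainder that
  is quadratic for all increments, not only small ones.\<close>

lemma quadratic_has_derivative:
 fixes f :: "'a::euclidean_space => 'b::real_normed_vector"
 assumes "linear L" and C: "\<And>h. norm (f (x + h) - f x - L h) <= C * norm h ^ 2"
 shows "(f has_derivative L) (at x)"
 unfolding has_derivative_at
proof
 show "bounded_linear L" using assms(1) by (simp add: linear_conv_bounded_linear)
 show "(\<lambda>h. norm (f (x + h) - f x - L h) / norm h) \<midarrow>0\<rightarrow> 0"
 proof (rule tendsto_sandwich[of "\<lambda>_. 0" _ _ "\<lambda>h. C * norm h"])
  show "\<forall>\<^sub>F h in at 0. norm (f (x + h) - f x - L h) / norm h <= C * norm h"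
  proof (rule always_eventually, rule allI)
   fix h show "norm (f (x + h) - f x - L h) / norm h <= C * norm h"
    using C[of h] by (cases "h = 0") (auto simp: field_simps power2_eq_square)
  qed
  show "(\<lambda>h::'a. C * norm h) \<midarrow>0\<rightarrow> 0" by (rule tendsto_eq_rhs, (rule tendsto_intros)+, simp)
 qed auto
qed

text \<open>Difference quotients along a sequence, the form in which dominated convergence can be
  applied to them.\<close>

lemma directional_limit:
 fixes f :: "'a::real_normed_vector => 'b::real_normed_vector"
 assumes d: "(f has_derivative f') (at x)" and h: "h \<longlonglongrightarrow> 0" "\<And>k. h k \<noteq> (0::real)" and e: "norm e = 1"
 shows "(\<lambda>k. (f (x + h k *\<^sub>R e) - f x) /\<^sub>R h k) \<longlonglongrightarrow> f' e"
proof -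
 have l: "linear f'" and lim: "(\<lambda>h. norm (f (x + h) - f x - f' h) / norm h) \<midarrow>0\<rightarrow> 0"
  using d has_derivative_at[of f f' x] has_derivative_linear[OF d] by auto
 have "filterlim (\<lambda>k. h k *\<^sub>R e) (at 0) sequentially"
  using h e tendsto_scaleR[OF h(1) tendsto_const[of e]] by (auto simp: filterlim_at)
 from filterlim_compose[OF lim this]
 have 0: "(\<lambda>k. norm (f (x + h k *\<^sub>R e) - f x - f' (h k *\<^sub>R e)) / norm (h k *\<^sub>R e)) \<longlonglongrightarrow> 0" .
 have "norm ((f (x + h k *\<^sub>R e) - f x) /\<^sub>R h k - f' e) = norm (f (x + h k *\<^sub>R e) - f x - f' (h k *\<^sub>R e)) / norm (h k *\<^sub>R e)" for k
 proof -
  have "(f (x + h k *\<^sub>R e) - f x) /\<^sub>R h k - f' e = (f (x + h k *\<^sub>R e) - f x - f' (h k *\<^sub>R e)) /\<^sub>R h k"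
   using h(2)[of k] by (simp add: linear_cmul[OF l] algebra_simps)
  then show ?thesis using e by (simp add: divide_inverse mult.commute)
 qed
 then have "(\<lambda>k. norm ((f (x + h k *\<^sub>R e) - f x) /\<^sub>R h k - f' e)) \<longlonglongrightarrow> 0" using 0 by simp
 then have "(\<lambda>k. (f (x + h k *\<^sub>R e) - f x) /\<^sub>R h k - f' e) \<longlonglongrightarrow> 0" by (rule tendsto_norm_zero_cancel)
 then show ?thesis by (simp add: LIM_zero_iff)
qed

lemma ee_taylor: "norm (ee (s + t) - ee s - of_real t * (- 2 * of_real pi * \<i>) * ee s) <= (2 * pi * t)\<^sup>2"
proof -
 let ?x = "- 2 * pi * t"
 have "norm (iexp ?x - (\<Sum>k\<le>1. (\<i> * ?x) ^ k / fact k)) <= \<bar>?x\<bar> ^ Suc 1 / fact (Suc 1)"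
  by (rule iexp_approx1)
 then have "norm (ee t - 1 - of_real t * (- 2 * of_real pi * \<i>)) <= \<bar>?x\<bar> ^ 2 / 2"
  by (simp add: ee_cis cis_conv_exp algebra_simps power2_eq_square)
 also have "... <= \<bar>?x\<bar> ^ 2" by simp
 also have "... = (2 * pi * t)\<^sup>2" by (simp add: power_mult_distrib)
 finally have "norm (ee s * (ee t - 1 - of_real t * (- 2 * of_real pi * \<i>))) <= (2 * pi * t)\<^sup>2"
  by (simp add: norm_mult)
 then show ?thesis by (simp add: ee_add algebra_simps)
qed

text \<open>The second order Taylor estimate for the character, integrated against \<open>f\<close>,
  is finite because Schwartz functions have second moments; it is exactly a quadratic
  remainder.\<close>

lemma fourier_has_derivative:
 assumes f: "f \<in> schwartz"
 shows "(fourier f has_derivative (\<lambda>h. LBINT x. f x * (of_real (x \<bullet> h) * (- 2 * of_real pi * \<i>)) * ee (x \<bullet> \<xi>))) (at \<xi>)"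
  (is "(_ has_derivative ?L) _")
proof -
 have [measurable]: "f \<in> borelM" using f by (rule schwartz_borel)
 let ?t1 = "- 2 * of_real pi * \<i>"
 have i1: "integrable lborel (\<lambda>x. f x * (of_real (x \<bullet> h) * ?t1) * ee (x \<bullet> \<xi>))" for h
 proof (rule Bochner_Integration.integrable_bound)
  show "integrable lborel (\<lambda>x. (norm x ^ 1 * norm (f x)) * (2 * pi * norm h))"
   by (intro integrable_mult_left schwartz_integrable_power f)
  show "AE x in lborel. norm (f x * (of_real (x \<bullet> h) * ?t1) * ee (x \<bullet> \<xi>))
    <= norm ((norm x ^ 1 * norm (f x)) * (2 * pi * norm h))"
  proof (rule AE_I2)
   fix x
   have "norm (f x) * \<bar>x \<bullet> h\<bar> * (2 * pi) <= norm (f x) * (norm x * norm h) * (2 * pi)"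
    by (intro mult_right_mono mult_left_mono Cauchy_Schwarz_ineq2) auto
   then show "norm (f x * (of_real (x \<bullet> h) * ?t1) * ee (x \<bullet> \<xi>))
    <= norm ((norm x ^ 1 * norm (f x)) * (2 * pi * norm h))" by (simp add: norm_mult mult_ac abs_mult)
  qed
 qed measurable
 have i0: "integrable lborel (\<lambda>x. f x * ee (x \<bullet> \<xi>))" for \<xi>
  by (intro integrable_times_ee schwartz_integrable f)
 have i2: "integrable lborel (\<lambda>x. norm x ^ 2 * norm (f x))" by (rule schwartz_integrable_power[OF f])
 show ?thesis
 proof (rule quadratic_has_derivative)
  show "linear ?L"
  proof (rule linearI)
   fix a b
   show "?L (a + b) = ?L a + ?L b"
    by (subst Bochner_Integration.integral_add[OF i1 i1, symmetric])
     (simp add: inner_add_right algebra_simps)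
   fix r :: real
   show "?L (r *\<^sub>R a) = r *\<^sub>R ?L a"
   proof -
    have "f x * (of_real (x \<bullet> (r *\<^sub>R a)) * ?t1) * ee (x \<bullet> \<xi>) =
     r *\<^sub>R (f x * (of_real (x \<bullet> a) * ?t1) * ee (x \<bullet> \<xi>))" for x
     by (simp add: scaleR_conv_of_real[where 'a=complex])
    then show ?thesis by (simp only: integral_scaleR_right)
   qed
  qed
  fix h
  have "fourier f (\<xi> + h) - fourier f \<xi> - ?L h =
   (LBINT x. f x * (ee (x \<bullet> \<xi> + x \<bullet> h) - ee (x \<bullet> \<xi>) - of_real (x \<bullet> h) * ?t1 * ee (x \<bullet> \<xi>)))"
   unfolding fourier_lborel[OF schwartz_borel[OF f]]
   by (subst Bochner_Integration.integral_diff[OF i0 i0, symmetric],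
     subst Bochner_Integration.integral_diff[OF Bochner_Integration.integrable_diff[OF i0 i0] i1, symmetric])
    (simp add: inner_add_right algebra_simps)
  also have "norm ... <= (LBINT x. ((2 * pi)^2 * norm h ^ 2) * (norm x ^ 2 * norm (f x)))"
  proof (rule Bochner_Integration.integral_norm_bound_integral[OF _ integrable_mult_right[OF i2]])
   have eq: "f x * (ee (x \<bullet> \<xi> + x \<bullet> h) - ee (x \<bullet> \<xi>) - of_real (x \<bullet> h) * ?t1 * ee (x \<bullet> \<xi>))
    = f x * ee (x \<bullet> (\<xi> + h)) - f x * ee (x \<bullet> \<xi>) - f x * (of_real (x \<bullet> h) * ?t1) * ee (x \<bullet> \<xi>)" for x
    by (simp add: inner_add_right algebra_simps)
   show "integrable lborel (\<lambda>x. f x * (ee (x \<bullet> \<xi> + x \<bullet> h) - ee (x \<bullet> \<xi>) - of_real (x \<bullet> h) * ?t1 * ee (x \<bullet> \<xi>)))"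
    unfolding eq by (intro Bochner_Integration.integrable_diff i0 i1)
   fix x
   have "norm (f x * (ee (x \<bullet> \<xi> + x \<bullet> h) - ee (x \<bullet> \<xi>) - of_real (x \<bullet> h) * ?t1 * ee (x \<bullet> \<xi>)))
    <= norm (f x) * (2 * pi * (x \<bullet> h))\<^sup>2"
    unfolding norm_mult[of "f x"] by (intro mult_left_mono ee_taylor) auto
   also have "... <= norm (f x) * (2 * pi * (norm x * norm h))\<^sup>2"
   proof (intro mult_left_mono)
    have "\<bar>2 * pi * (x \<bullet> h)\<bar> <= 2 * pi * (norm x * norm h)"
     using Cauchy_Schwarz_ineq2[of x h] by (simp add: abs_mult)
    then show "(2 * pi * (x \<bullet> h))\<^sup>2 <= (2 * pi * (norm x * norm h))\<^sup>2"
     using abs_le_square_iff[of "2 * pi * (x \<bullet> h)"  "2 * pi * (norm x * norm h)"] by (simp add: abs_mult)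
   qed simp
   finally show "norm (f x * (ee (x \<bullet> \<xi> + x \<bullet> h) - ee (x \<bullet> \<xi>) - of_real (x \<bullet> h) * ?t1 * ee (x \<bullet> \<xi>)))
    <= ((2 * pi)^2 * norm h ^ 2) * (norm x ^ 2 * norm (f x))" by (simp add: power_mult_distrib mult_ac)
  qed
  also have "... = ((2 * pi)^2 * (LBINT x. norm x ^ 2 * norm (f x))) * norm h ^ 2"
   by (subst integral_mult_right_zero) (simp add: mult_ac)
  finally show "norm (fourier f (\<xi> + h) - fourier f \<xi> - ?L h) <= ((2 * pi)^2 * (LBINT x. norm x ^ 2 * norm (f x))) * norm h ^ 2" .
 qed
qed

lemma fourier_pd:
 assumes f: "f \<in> schwartz"
 shows "pd i (fourier f) = fourier (\<lambda>x. (- 2 * of_real pi * \<i>) * (of_real (x $ i) * f x))"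
proof
 fix \<xi>
 have [measurable]: "f \<in> borelM" using f by (rule schwartz_borel)
 have "(\<lambda>x. (- 2 * of_real pi * \<i>) * (of_real (x $ i) * f x)) \<in> schwartz"
  by (intro schwartz_cmult schwartz_coord f)
 then show "pd i (fourier f) \<xi> = fourier (\<lambda>x. (- 2 * of_real pi * \<i>) * (of_real (x $ i) * f x)) \<xi>"
  unfolding pd_eq[OF fourier_has_derivative[OF f]] 
  by (subst fourier_lborel[OF schwartz_borel]) (auto simp: inner_axis mult_ac)
qed

text \<open>Instead of integrating by parts, transform a difference quotient in direction
  \<open>i\<close>. Translation invariance evaluates it exactly as a difference quotient of a
  character times \<open>fourier f\<close>, and both sides have limits, the left one by dominated
  convergence.\<close>

lemma fourier_of_pd:
 assumes f: "f \<in> schwartz"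
 shows "fourier (pd i f) \<xi> = 2 * of_real pi * \<i> * of_real (\<xi> $ i) * fourier f \<xi>"
proof -
 have [measurable]: "f \<in> borelM" using f by (rule schwartz_borel)
 have [measurable]: "pd i f \<in> borelM" using schwartz_pd[OF f] by (rule schwartz_borel)
 define e :: "real^'a" where "e = axis i 1"
 have ne: "norm e = 1" by (simp add: e_def)
 define h :: "nat => real" where "h k = inverse (of_nat (Suc k))" for k
 have h: "h \<longlonglongrightarrow> 0" "h k \<noteq> 0" "0 < h k" "h k <= 1" for k
  unfolding h_def using LIMSEQ_inverse_real_of_nat by (auto simp: field_simps)
 obtain C where C: "C > 0" "\<And>x. norm (pd i f x) <= C * wt x ^ 1" using schwartz_bound[OF schwartz_pd[OF f]] by blast
 define D where "D = C * 2 ^ CARD('a) * 2 ^ CARD('a)"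
 \<comment> \<open>Shifts of length at most 1 change \<open>wt\<close> by a bounded factor only, so
   a multiple of \<open>wt\<close> dominates all difference quotients simultaneously.\<close>
 have bnd: "norm (pd i f (x + t *\<^sub>R e)) <= D * wt x" if "\<bar>t\<bar> <= 1" for x t
 proof -
  have "1 <= wt (t *\<^sub>R e) * (1 + norm (t *\<^sub>R e) ^ 2) ^ CARD('a)" by (rule inverse_wt_le)
  also have "... <= wt (t *\<^sub>R e) * 2 ^ CARD('a)"
   using that ne by (intro mult_left_mono power_mono) (auto simp: abs_square_le_1)
  finally have 1: "1 / wt (t *\<^sub>R e) <= 2 ^ CARD('a)" by (simp add: field_simps)
  have "norm (pd i f (x + t *\<^sub>R e)) <= C * wt (x + t *\<^sub>R e)" using C(2) by simp
  also have "... <= C * (2 ^ CARD('a) * wt x / wt (t *\<^sub>R e))" using C(1) wt_add' by (intro mult_left_mono) auto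
  also have "... = (C * 2 ^ CARD('a) * wt x) * (1 / wt (t *\<^sub>R e))" by simp
  also have "... <= (C * 2 ^ CARD('a) * wt x) * 2 ^ CARD('a)" using C(1) 1 by (intro mult_left_mono) auto
  finally show ?thesis by (simp add: D_def mult_ac)
 qed
 have mv: "norm (f (x + h k *\<^sub>R e) - f x) <= D * wt x * h k" for x k
 proof -
  let ?g = "\<lambda>t. f (x + t *\<^sub>R e)"
  have d: "(?g has_derivative (\<lambda>s. s *\<^sub>R pd i f (x + t *\<^sub>R e))) (at t within {0..1})" for t
  proof -
   have "(?g has_derivative (\<lambda>s. frechet_derivative f (at (x + t *\<^sub>R e)) (s *\<^sub>R e))) (at t within {0..1})"
    by (rule has_derivative_compose[where g=f and f="\<lambda>t. x + t *\<^sub>R e", OF _ schwartz_has_derivative[OF f]])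
      (auto intro!: derivative_eq_intros)
   moreover have "linear (frechet_derivative f (at (x + t *\<^sub>R e)))"
    using schwartz_has_derivative[OF f] has_derivative_linear by blast
   ultimately show ?thesis by (simp add: linear_cmul e_def)
  qed
  have "norm (?g (h k) - ?g 0) <= (D * wt x) * norm (h k - 0)"
  proof (rule differentiable_bound[OF _ d])
   fix t :: real assume "t \<in> {0..1}"
   then have "norm (pd i f (x + t *\<^sub>R e)) <= D * wt x" by (intro bnd) auto
   then show "onorm (\<lambda>s. s *\<^sub>R pd i f (x + t *\<^sub>R e)) <= D * wt x"
    by (intro onorm_le) (simp add: mult.commute mult_left_mono)
  qed (use h(3)[of k] h(4)[of k] in auto)
  then show ?thesis using h(3)[of k] by simp
 qed
 let ?S = "\<lambda>k x. ((f (x + h k *\<^sub>R e) - f x) /\<^sub>R h k) * ee (x \<bullet> \<xi>)"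
 have l1: "(\<lambda>k. LBINT x. ?S k x) \<longlonglongrightarrow> (LBINT x. pd i f x * ee (x \<bullet> \<xi>))"
 proof (rule integral_dominated_convergence)
  show "integrable lborel (\<lambda>x. D * wt (x::real^'a))" by (intro integrable_mult_right integrable_wt)
  show "AE x in lborel. (\<lambda>k. ?S k x) \<longlonglongrightarrow> pd i f x * ee (x \<bullet> \<xi>)"
   using directional_limit[OF schwartz_has_derivative[OF f] h(1,2) ne]
   by (intro AE_I2 tendsto_mult tendsto_const) (simp add: e_def)
  show "AE x in lborel. norm (?S k x) <= D * wt x" for k
  proof (rule AE_I2)
   fix x show "norm (?S k x) <= D * wt x"
   proof -
    have "norm (?S k x) = norm (f (x + h k *\<^sub>R e) - f x) / h k"
     using h(3)[of k] by (simp add: norm_mult divide_inverse mult.commute)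
    also have "... <= D * wt x" using mv[of x k] h(3)[of k] by (simp add: pos_divide_le_eq)
    finally show ?thesis .
   qed
  qed
 qed measurable
 have S_eq: "(LBINT x. ?S k x) = ((ee (0 + h k *\<^sub>R (- (\<xi> $ i))) - ee 0) /\<^sub>R h k) * fourier f \<xi>" for k
 proof -
  have fi: "integrable lborel f" by (rule schwartz_integrable[OF f])
  have i1: "integrable lborel (\<lambda>x. f x * ee (x \<bullet> \<xi>))" using fi by (rule integrable_times_ee)
  have i2: "integrable lborel (\<lambda>x. f (x + h k *\<^sub>R e) * ee (x \<bullet> \<xi>))"
   using integrable_shift[OF fi] by (intro integrable_times_ee)
  have "(LBINT x. f (x + h k *\<^sub>R e) * ee (x \<bullet> \<xi>)) = (LBINT x. f (x + h k *\<^sub>R e) * ee ((x + h k *\<^sub>R e - h k *\<^sub>R e) \<bullet> \<xi>))"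
   by simp
  also have "... = (LBINT x. f x * ee ((x - h k *\<^sub>R e) \<bullet> \<xi>))"
   by (rule integral_shift(2)[of "\<lambda>x. f x * ee ((x - h k *\<^sub>R e) \<bullet> \<xi>)"]) measurable
  also have "... = (LBINT x. ee (- (h k * \<xi> $ i)) * (f x * ee (x \<bullet> \<xi>)))"
   by (intro Bochner_Integration.integral_cong refl)
    (simp add: inner_diff_left e_def inner_axis' ee_add[symmetric] mult_ac)
  also have "... = ee (- (h k * \<xi> $ i)) * fourier f \<xi>" by (simp add: fourier_lborel)
  finally have sh: "(LBINT x. f (x + h k *\<^sub>R e) * ee (x \<bullet> \<xi>)) = ee (- (h k * \<xi> $ i)) * fourier f \<xi>" .
  have "(LBINT x. ?S k x) = (LBINT x. (f (x + h k *\<^sub>R e) * ee (x \<bullet> \<xi>) - f x * ee (x \<bullet> \<xi>)) /\<^sub>R h k)"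
   by (simp add: algebra_simps)
  also have "... = (ee (- (h k * \<xi> $ i)) * fourier f \<xi> - fourier f \<xi>) /\<^sub>R h k"
   using i1 i2 sh by (simp add: fourier_lborel)
  finally show ?thesis by (simp add: algebra_simps)
 qed
 have "((\<lambda>t. ee (t * (- (\<xi> $ i)))) has_derivative (\<lambda>t. of_real (t * (- (\<xi> $ i))) * (- 2 * of_real pi * \<i>) * ee 0)) (at 0)"
 proof (rule quadratic_has_derivative[where C="(2 * pi * \<xi> $ i)^2"])
  show "linear (\<lambda>t. of_real (t * (- (\<xi> $ i))) * (- 2 * of_real pi * \<i>) * ee 0)"
   by (auto simp: linear_iff algebra_simps scaleR_conv_of_real)
  fix t :: real
  show "norm (ee ((0 + t) * (- (\<xi> $ i))) - ee (0 * (- (\<xi> $ i))) - of_real (t * (- (\<xi> $ i))) * (- 2 * of_real pi * \<i>) * ee 0)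
    <= (2 * pi * \<xi> $ i)^2 * norm t ^ 2"
   using ee_taylor[of 0 "t * (- (\<xi> $ i))"] by (simp add: power_mult_distrib mult_ac)
 qed
 from directional_limit[OF this h(1,2), of 1]
 have l2: "(\<lambda>k. ((ee (0 + h k *\<^sub>R (- (\<xi> $ i))) - ee 0) /\<^sub>R h k) * fourier f \<xi>) \<longlonglongrightarrow>
   (of_real (1 * (- (\<xi> $ i))) * (- 2 * of_real pi * \<i>) * ee 0) * fourier f \<xi>"
  by (intro tendsto_mult tendsto_const) simp
 show ?thesis using LIMSEQ_unique[OF l1[unfolded S_eq] l2] by (simp add: fourier_lborel mult_ac)
qed

lemma fourier_coord_bounded:
 assumes "f \<in> schwartz" shows "\<exists>C. \<forall>\<xi>. \<bar>\<xi> $ i\<bar> ^ m * norm (fourier f \<xi>) <= C"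
 using assms
proof (induction m arbitrary: f)
 case 0
 then show ?case using norm_fourier_le[OF schwartz_borel] by auto
next
 case (Suc m)
 then obtain C where C: "\<And>\<xi>. \<bar>\<xi> $ i\<bar> ^ m * norm (fourier (pd i f) \<xi>) <= C" using schwartz_pd by blast
 have "\<bar>\<xi> $ i\<bar> ^ Suc m * norm (fourier f \<xi>) <= C / (2 * pi)" for \<xi>
  using C[of \<xi>] unfolding fourier_of_pd[OF Suc.prems]
  by (simp add: norm_mult field_simps)
 then show ?case by blast
qed

lemma fourier_rapid:
 assumes "f \<in> schwartz" shows "rapid (fourier f)"
proof (intro rapid_bounded allI)
 fix m :: nat
 obtain C where C: "\<And>i \<xi>. \<bar>\<xi> $ i\<bar> ^ m * norm (fourier f \<xi>) <= C i"
  using fourier_coord_bounded[OF assms, of _ m] by metis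
 have "norm (norm \<xi> ^ m *\<^sub>R fourier f \<xi>) <= real CARD('a) ^ m * (\<Sum>i\<in>UNIV. \<bar>C i\<bar>)" for \<xi>
 proof -
  \<comment> \<open>The largest coordinate controls the norm up to the factor n, which reduces decay
    to the one-coordinate bounds.\<close>
  have "Max (range (\<lambda>j. \<bar>\<xi> $ j\<bar>)) \<in> range (\<lambda>j. \<bar>\<xi> $ j\<bar>)" by (rule Max_in) auto
  then obtain i where i': "Max (range (\<lambda>j. \<bar>\<xi> $ j\<bar>)) = \<bar>\<xi> $ i\<bar>" by blast
  have i: "\<bar>\<xi> $ j\<bar> <= \<bar>\<xi> $ i\<bar>" for j
   unfolding i'[symmetric] by (rule Max_ge) auto
  have "norm \<xi> <= (\<Sum>j\<in>UNIV. \<bar>\<xi> $ j\<bar>)" by (rule norm_le_l1_cart)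
  also have "... <= (\<Sum>j\<in>(UNIV::'a set). \<bar>\<xi> $ i\<bar>)" by (intro sum_mono i)
  finally have "norm \<xi> <= real CARD('a) * \<bar>\<xi> $ i\<bar>" by simp
  then have "norm \<xi> ^ m * norm (fourier f \<xi>) <= (real CARD('a) * \<bar>\<xi> $ i\<bar>) ^ m * norm (fourier f \<xi>)"
   by (intro mult_right_mono power_mono) auto
  also have "... = real CARD('a) ^ m * (\<bar>\<xi> $ i\<bar> ^ m * norm (fourier f \<xi>))" by (simp add: power_mult_distrib)
  also have "... <= real CARD('a) ^ m * C i" by (intro mult_left_mono C) auto
  also have "... <= real CARD('a) ^ m * (\<Sum>i\<in>UNIV. \<bar>C i\<bar>)"
   using member_le_sum[of i UNIV "\<lambda>i. \<bar>C i\<bar>"] abs_ge_self[of "C i"]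
   by (intro mult_left_mono) auto
  finally show ?thesis by simp
 qed
 then show "bounded (range (\<lambda>x. norm x ^ m *\<^sub>R fourier f x))" unfolding bounded_iff by blast
qed

lemma schwartz_fourier:
 assumes "f \<in> schwartz" shows "fourier f \<in> schwartz"
proof (rule schwartz_coinduct[of _ "fourier ` schwartz"])
 fix g assume "g \<in> fourier ` (schwartz :: (real^'a => complex) set)"
 then obtain f where f: "g = fourier f" "f \<in> schwartz" by blast
 show "g differentiable (at x)" for x
  unfolding f(1) by (rule differentiableI[OF fourier_has_derivative[OF f(2)]])
 show "pd i g \<in> fourier ` schwartz" for i
  unfolding f(1) fourier_pd[OF f(2)] by (intro imageI schwartz_cmult schwartz_coord f)
 show "rapid g" unfolding f(1) by (rule fourier_rapid[OF f(2)])
qed (use assms in blast)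

lemma integrable_pair_product:
 fixes a b :: "real^'n::finite => real"
 assumes a: "integrable lborel a" and b: "integrable lborel b"
 shows "integrable (lborel \<Otimes>\<^sub>M lborel) (\<lambda>(x,y). a x * b y)"
proof -
 have [measurable]: "a \<in> borelM" "b \<in> borelM" using a b by auto
 show ?thesis
  by (rule lborel_pair.Fubini_integrable) (use a b in \<open>auto simp: abs_mult intro!: integrable_mult_left\<close>)
qed

lemma integrable_pair_bound:
 fixes f :: "real^'n::finite => real^'n => complex"
 assumes m: "(\<lambda>(x,y). f x y) \<in> borel_measurable (lborel \<Otimes>\<^sub>M lborel)"
  and a: "integrable lborel a" and b: "integrable lborel b"
  and le: "\<And>x y. norm (f x y) <= a x * b y"
 shows "integrable (lborel \<Otimes>\<^sub>M lborel) (\<lambda>(x,y). f x y)"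
 by (rule Bochner_Integration.integrable_bound[OF integrable_pair_product[OF a b] m])
   (use le order_trans[OF le abs_ge_self] in auto)

lemma integral_swap:
 fixes f :: "real^'n::finite => real^'n => complex"
 assumes m: "(\<lambda>(x,y). f x y) \<in> borel_measurable (lborel \<Otimes>\<^sub>M lborel)"
  and a: "integrable lborel a" and b: "integrable lborel b"
  and le: "\<And>x y. norm (f x y) <= a x * b y"
 shows "(LBINT x. LBINT y. f x y) = (LBINT y. LBINT x. f x y)"
 using lborel_pair.Fubini_integral[OF integrable_pair_bound[OF assms]] by simp

text \<open>Gaussian summation. The factor \<open>gauss (h k *\<^sub>R \<xi>)\<close> makes the
  double integral absolutely convergent; after Fubini the inner integral is again a Gaussian, and
  the result averages \<open>f\<close> around \<open>-x\<close> at scale \<open>h k\<close>.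
  Dominated convergence on both sides finishes the proof.\<close>

lemma fourier_inversion:
 assumes f: "f \<in> schwartz" shows "fourier (fourier f) x = f (- x)"
proof -
 have [measurable]: "f \<in> borelM" using f by (rule schwartz_borel)
 have F: "fourier f \<in> schwartz" by (rule schwartz_fourier[OF f])
 have [measurable]: "fourier f \<in> borelM" using F by (rule schwartz_borel)
 define h :: "nat => real" where "h k = inverse (of_nat (Suc k))" for k
 have h: "h \<longlonglongrightarrow> 0" "h k \<noteq> 0" "0 < h k" for k
  unfolding h_def using LIMSEQ_inverse_real_of_nat by (auto simp: field_simps)
 let ?n = "CARD('a)"
 have hl: "(\<lambda>k. h k *\<^sub>R y) \<longlonglongrightarrow> 0" for y :: "real^'a"
  using tendsto_scaleR[OF h(1) tendsto_const[of y]] by simp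
 have g0: "continuous_on UNIV (gauss :: real^'a => real)" unfolding gauss_def by (intro continuous_intros)
 have l1: "(\<lambda>k. LBINT \<xi>. fourier f \<xi> * ee (\<xi> \<bullet> x) * of_real (gauss (h k *\<^sub>R \<xi>))) \<longlonglongrightarrow>
   (LBINT \<xi>. fourier f \<xi> * ee (\<xi> \<bullet> x) * of_real (gauss (0::real^'a)))"
 proof (rule integral_dominated_convergence)
  show "integrable lborel (\<lambda>\<xi>. norm (fourier f \<xi>))" using schwartz_integrable[OF F] by simp
  show "AE \<xi> in lborel. (\<lambda>k. fourier f \<xi> * ee (\<xi> \<bullet> x) * of_real (gauss (h k *\<^sub>R \<xi>))) \<longlonglongrightarrow>
    fourier f \<xi> * ee (\<xi> \<bullet> x) * of_real (gauss (0::real^'a))"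
   by (intro AE_I2 tendsto_mult tendsto_const tendsto_of_real
    continuous_on_tendsto_compose[OF g0 hl]) auto
  show "AE \<xi> in lborel. norm (fourier f \<xi> * ee (\<xi> \<bullet> x) * of_real (gauss (h k *\<^sub>R \<xi>))) <= norm (fourier f \<xi>)" for k
   by (intro AE_I2) (simp add: norm_mult mult_left_le less_imp_le)
 qed measurable
 have gs: "(LBINT \<xi>. ee (y \<bullet> \<xi>) * ee (\<xi> \<bullet> x) * of_real (gauss (h k *\<^sub>R \<xi>)))
   = of_real (gauss ((x + y) /\<^sub>R h k)) / of_real (h k ^ ?n)" for y k
 proof -
  have "of_real (gauss ((x + y) /\<^sub>R h k)) = (LBINT \<zeta>. of_real (gauss \<zeta>) * ee (\<zeta> \<bullet> ((x + y) /\<^sub>R h k)))"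
   by (rule gauss_fourier(2)[symmetric])
  also have "... = \<bar>h k\<bar> ^ DIM(real^'a) *\<^sub>R
    (LBINT \<xi>. of_real (gauss (0 + h k *\<^sub>R \<xi>)) * ee ((0 + h k *\<^sub>R \<xi>) \<bullet> ((x + y) /\<^sub>R h k)))"
   by (rule integral_affine[OF _ h(2)]) measurable
  also have "(\<lambda>\<xi>. cor (gauss (0 + h k *\<^sub>R \<xi>)) * ee ((0 + h k *\<^sub>R \<xi>) \<bullet> ((x + y) /\<^sub>R h k))) =
    (\<lambda>\<xi>. ee (y \<bullet> \<xi>) * ee (\<xi> \<bullet> x) * of_real (gauss (h k *\<^sub>R \<xi>)))"
  proof
   fix \<xi> :: "real^'a"
   have "(h k *\<^sub>R \<xi>) \<bullet> ((x + y) /\<^sub>R h k) = y \<bullet> \<xi> + \<xi> \<bullet> x"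
    using h(2)[of k] by (simp add: inner_add_right inner_commute field_simps)
   then show "cor (gauss (0 + h k *\<^sub>R \<xi>)) * ee ((0 + h k *\<^sub>R \<xi>) \<bullet> ((x + y) /\<^sub>R h k)) =
    ee (y \<bullet> \<xi>) * ee (\<xi> \<bullet> x) * of_real (gauss (h k *\<^sub>R \<xi>))" by (simp add: ee_add)
  qed
  finally show ?thesis using h(2,3)[of k] by (simp add: field_simps scaleR_conv_of_real)
 qed
 have eq: "(LBINT \<xi>. fourier f \<xi> * ee (\<xi> \<bullet> x) * of_real (gauss (h k *\<^sub>R \<xi>))) =
   (LBINT u. f (- x + h k *\<^sub>R u) * of_real (gauss u))" for k
 proof -
  have ig: "integrable lborel (\<lambda>\<xi>::real^'a. gauss (h k *\<^sub>R \<xi>))"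
   using integrable_affine[OF integrable_gauss h(2), of 0] by simp
  have "(LBINT \<xi>. fourier f \<xi> * ee (\<xi> \<bullet> x) * of_real (gauss (h k *\<^sub>R \<xi>))) =
   (LBINT \<xi>. LBINT y. f y * (ee (y \<bullet> \<xi>) * ee (\<xi> \<bullet> x) * of_real (gauss (h k *\<^sub>R \<xi>))))"
   by (simp add: fourier_lborel flip: integral_mult_left_zero) (simp add: mult_ac)
  also have "... = (LBINT y. LBINT \<xi>. f y * (ee (y \<bullet> \<xi>) * ee (\<xi> \<bullet> x) * of_real (gauss (h k *\<^sub>R \<xi>))))"
   by (rule integral_swap[OF _ ig integrable_norm[OF schwartz_integrable[OF f]]])
     (auto simp: norm_mult less_imp_le mult.commute)
  also have "... = (LBINT y. f y * (of_real (gauss ((x + y) /\<^sub>R h k)) / of_real (h k ^ ?n)))"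
   by (subst integral_mult_right_zero) (simp only: gs)
  also have "... = \<bar>h k\<bar> ^ DIM(real^'a) *\<^sub>R
    (LBINT u. f (- x + h k *\<^sub>R u) * (of_real (gauss ((x + (- x + h k *\<^sub>R u)) /\<^sub>R h k)) / of_real (h k ^ ?n)))"
   by (rule integral_affine[OF _ h(2)]) measurable
  also have "... = (LBINT u. \<bar>h k\<bar> ^ DIM(real^'a) *\<^sub>R
    (f (- x + h k *\<^sub>R u) * (of_real (gauss ((x + (- x + h k *\<^sub>R u)) /\<^sub>R h k)) / of_real (h k ^ ?n))))"
   by (rule integral_scaleR_right[symmetric])
  also have "... = (LBINT u. f (- x + h k *\<^sub>R u) * of_real (gauss u))"
   using h(2,3)[of k] by (intro Bochner_Integration.integral_cong refl) (simp add: scaleR_conv_of_real[where 'a=complex] field_simps)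
  finally show ?thesis .
 qed
 obtain B where B: "B > 0" "\<And>x. norm (f x) <= B * wt x ^ 0" using schwartz_bound[OF f] by blast
 have l2: "(\<lambda>k. LBINT u. f (- x + h k *\<^sub>R u) * of_real (gauss u)) \<longlonglongrightarrow>
   (LBINT u. f (- x) * of_real (gauss (u::real^'a)))"
 proof (rule integral_dominated_convergence)
  show "integrable lborel (\<lambda>u. B * gauss (u::real^'a))" by (intro integrable_mult_right integrable_gauss)
  have "(\<lambda>k. f (- x + h k *\<^sub>R u)) \<longlonglongrightarrow> f (- x)" for u
   using tendsto_add[OF tendsto_const[of "-x"] hl[of u]]
   by (intro continuous_on_tendsto_compose[OF smooth_continuous[OF schwartz_smooth[OF f], of UNIV]]) auto
  then show "AE u in lborel. (\<lambda>k. f (- x + h k *\<^sub>R u) * of_real (gauss u)) \<longlonglongrightarrow> f (- x) * of_real (gauss u)"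
   by (intro AE_I2 tendsto_mult tendsto_const)
  show "AE u in lborel. norm (f (- x + h k *\<^sub>R u) * of_real (gauss u)) <= B * gauss u" for k
   using B(2) by (intro AE_I2) (simp add: norm_mult mult_right_mono less_imp_le)
 qed measurable
 have "(LBINT \<xi>. fourier f \<xi> * ee (\<xi> \<bullet> x) * of_real (gauss (0::real^'a))) =
   (LBINT u. f (- x) * of_real (gauss (u::real^'a)))"
  using l1 l2 unfolding eq by (rule LIMSEQ_unique)
 moreover have "(LBINT u. f (- x) * of_real (gauss (u::real^'a))) = f (- x) * of_real (LBINT u. gauss (u::real^'a))"
  by simp
 moreover have "gauss (0::real^'a) = 1" by (simp add: gauss_def)
 ultimately show ?thesis by (simp add: fourier_lborel integral_gauss)
qed

lemma fourier_reflect: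
 assumes "f \<in> schwartz" shows "fourier (\<lambda>x. f (- x)) \<xi> = fourier f (- \<xi>)"
proof -
 have [measurable]: "f \<in> borelM" using assms by (rule schwartz_borel)
 show ?thesis
  using integral_shift(3)[of "\<lambda>x. f x * ee (x \<bullet> (- \<xi>))" 0]
  by (simp add: fourier_lborel)
qed

lemma inv_fourier_eq:
 assumes "\<phi> \<in> schwartz" shows "inv_fourier \<phi> = (\<lambda>x. fourier \<phi> (- x))"
proof -
 have inj: "inj_on fourier schwartz"
 proof
  fix f g assume fg: "f \<in> schwartz" "g \<in> schwartz" "fourier f = fourier g"
  show "f = g"
  proof
   fix x show "f x = g x" using fourier_inversion[OF fg(1), of "-x"] fourier_inversion[OF fg(2), of "-x"] fg(3) by simp
  qed
 qed
 have S: "(\<lambda>x. fourier \<phi> (- x)) \<in> schwartz" by (intro schwartz_reflect schwartz_fourier assms)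
 have "fourier (\<lambda>x. fourier \<phi> (- x)) = \<phi>"
  by (intro ext) (simp add: fourier_reflect[OF schwartz_fourier[OF assms]] fourier_inversion[OF assms])
 then show ?thesis unfolding inv_fourier_def using inv_into_f_eq[OF inj S] by simp
qed

text \<open>Write one factor by inversion as a superposition of characters and apply Fubini.\<close>

lemma fourier_mult:
 assumes s: "\<sigma> \<in> schwartz" and p: "\<psi> \<in> schwartz"
 shows "fourier (\<lambda>\<xi>. \<sigma> \<xi> * \<psi> \<xi>) x = (LBINT y. fourier \<psi> y * fourier \<sigma> (x - y))"
proof -
 have [measurable]: "\<sigma> \<in> borelM" "\<psi> \<in> borelM" "fourier \<psi> \<in> borelM"
  using s p schwartz_fourier schwartz_borel by blast+
 have P: "\<psi> \<xi> = (LBINT y. fourier \<psi> y * ee (- (y \<bullet> \<xi>)))" for \<xi>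
  using fourier_inversion[OF p, of "-\<xi>"] by (simp add: fourier_lborel)
 have "fourier (\<lambda>\<xi>. \<sigma> \<xi> * \<psi> \<xi>) x = (LBINT \<xi>. \<sigma> \<xi> * (LBINT y. fourier \<psi> y * ee (- (y \<bullet> \<xi>))) * ee (\<xi> \<bullet> x))"
  unfolding P[symmetric] by (rule fourier_lborel) measurable
 also have "... = (LBINT \<xi>. LBINT y. \<sigma> \<xi> * (fourier \<psi> y * ee (- (y \<bullet> \<xi>))) * ee (\<xi> \<bullet> x))"
  by simp
 also have "... = (LBINT y. LBINT \<xi>. \<sigma> \<xi> * (fourier \<psi> y * ee (- (y \<bullet> \<xi>))) * ee (\<xi> \<bullet> x))"
  by (rule integral_swap[OF _ integrable_norm[OF schwartz_integrable[OF s]] integrable_norm[OF schwartz_integrable[OF schwartz_fourier[OF p]]]])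
    (auto simp: norm_mult)
 also have "... = (LBINT y. LBINT \<xi>. fourier \<psi> y * (\<sigma> \<xi> * ee (\<xi> \<bullet> (x - y))))"
 proof -
  have "ee (\<xi> \<bullet> (x - y)) = ee (- (y \<bullet> \<xi>)) * ee (\<xi> \<bullet> x)" for \<xi> y
   by (simp add: inner_diff_right inner_commute flip: ee_add)
  then show ?thesis by (simp add: mult_ac)
 qed
 also have "... = (LBINT y. fourier \<psi> y * fourier \<sigma> (x - y))"
  by (simp add: fourier_lborel)
 finally show ?thesis .
qed

section \<open>Convolution operators and Fourier multipliers\<close>

text \<open>Large enough to contain the Schwartz functions, the bounded Borel functions and the
  images \<open>HH f\<close>, and preserved by correlation with kernels decaying like the square of
  \<open>wt\<close>. This is why blocks of \<open>HH f\<close> can be computed as integrals.\<close>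

definition tame :: "(real^'n::finite => complex) => bool" where
 "tame g \<longleftrightarrow> g \<in> borelM \<and> integrable lborel (\<lambda>x. wt x * norm (g x))"

text \<open>Three exponents matter: 0 is boundedness, 1 gives integrability, and 2 leaves one
  integrable power after the other has paid for moving the weight across a shift.\<close>

definition wbound :: "nat => (real^'n::finite => complex) => bool" where
 "wbound N K \<longleftrightarrow> K \<in> borelM \<and> (\<exists>C>0. \<forall>x. norm (K x) <= C * wt x ^ N)"

text \<open>A correlation rather than a convolution: the inverse Fourier transform of \<open>m\<close> is the
 reflection of \<open>fourier m\<close>, so that \<open>Op m\<close> is the Fourier multiplier with symbol \<open>m\<close>.\<close>

definition cv :: "(real^'n::finite => complex) => (real^'n => complex) => real^'n => complex" where
 "cv K g y = (LBINT z. g (y + z) * K z)"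

abbreviation Op :: "(real^'n::finite => complex) => (real^'n => complex) => real^'n => complex" where
 "Op m \<equiv> cv (fourier m)"

lemma tame_borel: "tame g ==> g \<in> borelM" by (simp add: tame_def)

lemma wbound_borel: "wbound N g ==> g \<in> borelM" by (simp add: wbound_def)

lemma wboundE: assumes "wbound N K" obtains C where "C > 0" "\<And>x. norm (K x) <= C * wt x ^ N"
 using assms unfolding wbound_def by blast

lemma schwartz_wbound: "f \<in> schwartz ==> wbound N f"
 unfolding wbound_def using schwartz_borel schwartz_bound[of f N] by metis

lemma wbound_mono: assumes "wbound N K" "M <= N" shows "wbound M K"
proof -
 obtain C where C: "C > 0" "\<And>x. norm (K x) <= C * wt x ^ N" using assms(1) wboundE by blast
 have "norm (K x) <= C * wt x ^ M" for x
  using C assms(2) by (intro order_trans[OF C(2)] mult_left_mono wt_power_le) auto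
 then show ?thesis using C(1) wbound_borel[OF assms(1)] unfolding wbound_def by blast
qed

lemma wbound_reflect: assumes "wbound N K" shows "wbound N (\<lambda>z. K (- z))"
proof -
 have [measurable]: "K \<in> borelM" using assms by (rule wbound_borel)
 obtain C where C: "C > 0" "\<And>x. norm (K x) <= C * wt x ^ N" using assms wboundE by blast
 have "norm (K (- x)) <= C * wt x ^ N" for x using C(2)[of "-x"] by simp
 then show ?thesis using C(1) unfolding wbound_def by auto
qed

lemma wbound_integrable: assumes "wbound N K" "N > 0" shows "integrable lborel K"
proof -
 have [measurable]: "K \<in> borelM" using assms by (auto intro: wbound_borel)
 have "wbound 1 K" using assms by (intro wbound_mono[OF assms(1)]) auto
 then obtain C where C: "C > 0" "\<And>x. norm (K x) <= C * wt x ^ 1" using wboundE by blast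
 then have "norm (K x) <= C * wt x" for x by simp
 moreover have "integrable lborel (\<lambda>x. C * wt (x::real^'a))" by (intro integrable_mult_right integrable_wt)
 ultimately show ?thesis
  by (intro Bochner_Integration.integrable_bound[where f="\<lambda>x. C * wt x" and g=K]) (auto simp: C(1) less_imp_le)
qed

lemma wbound_tame: assumes "wbound 0 K" shows "tame K"
proof -
 have [measurable]: "K \<in> borelM" using assms by (auto intro: wbound_borel)
 obtain C where C: "C > 0" "\<And>x. norm (K x) <= C * wt x ^ 0" using assms wboundE by blast
 have "integrable lborel (\<lambda>x. C * wt (x::real^'a))" by (intro integrable_mult_right integrable_wt)
 then have "integrable lborel (\<lambda>x. wt x * norm (K x))"
  by (rule Bochner_Integration.integrable_bound) (use C in \<open>auto simp: mult.commute mult_right_mono less_imp_le\<close>)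
 then show ?thesis by (simp add: tame_def)
qed

lemma schwartz_tame: "f \<in> schwartz ==> tame f"
 by (intro wbound_tame schwartz_wbound)

lemma fourier_wbound: "m \<in> schwartz ==> wbound N (fourier m)"
 by (intro schwartz_wbound schwartz_fourier)

lemma wt_shift_le: "wt z <= 2 ^ CARD('n) * wt (y + z) / wt (y :: real^'n::finite)"
 using wt_add'[of "y + z" "- y"] by simp

lemma tame_shift_wt:
 assumes "tame g" shows "integrable lborel (\<lambda>z. norm (g (y + z)) * wt z)"
proof -
 have [measurable]: "g \<in> borelM" using assms by (rule tame_borel)
 have "integrable lborel (\<lambda>x. wt x * norm (g x))" using assms by (simp add: tame_def)
 from integrable_mult_left[OF integrable_shift(1)[OF this, of y], of "2 ^ CARD('a) / wt y"]
 show ?thesis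
 proof (rule Bochner_Integration.integrable_bound)
  have "norm (g (y + z)) * wt z <= norm (g (y + z)) * (2 ^ CARD('a) * wt (y + z) / wt y)" for z
   by (intro mult_left_mono wt_shift_le) auto
  then show "AE z in lborel. norm (norm (g (y + z)) * wt z) <= norm (wt (y + z) * norm (g (y + z)) * (2 ^ CARD('a) / wt y))"
   by (intro AE_I2) (simp add: mult_ac)
 qed measurable
qed

lemma cv_integrable:
 assumes g: "tame g" and K: "wbound N K" "N > 0"
 shows "integrable lborel (\<lambda>z. g (y + z) * K z)"
proof -
 have [measurable]: "g \<in> borelM" "K \<in> borelM"
  using g K by (auto intro: tame_borel wbound_borel)
 have "wbound 1 K" using K by (intro wbound_mono[OF K(1)]) auto
 then obtain C where C: "C > 0" "\<And>x. norm (K x) <= C * wt x ^ 1" using wboundE by blast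
 show ?thesis
 proof (rule Bochner_Integration.integrable_bound[OF integrable_mult_left[OF tame_shift_wt[OF g, of y], of C]])
  have "norm (g (y + z)) * norm (K z) <= norm (g (y + z)) * (C * wt z)" for z
   using C(2)[of z] by (intro mult_left_mono) auto
  then show "AE z in lborel. norm (g (y + z) * K z) <= norm (norm (g (y + z)) * wt z * C)"
   using C(1) by (intro AE_I2) (simp add: norm_mult mult_ac)
 qed measurable
qed

lemma borel_measurable_cv [measurable (raw)]:
 assumes [measurable]: "g \<in> borelM" "K \<in> borelM" "h \<in> borel_measurable M"
 shows "(\<lambda>x. cv K g (h x)) \<in> borel_measurable M"
proof -
 have "cv K g \<in> borelM" unfolding cv_def by measurable
 from measurable_compose[OF assms(3) this] show ?thesis .
qed

lemma norm_integral_le: "enorm (integral\<^sup>L M f) <= (\<integral>\<^sup>+x. enorm (f x) \<partial>M)"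
 by (cases "integrable M f") (auto intro: integral_norm_bound_ennreal simp: not_integrable_integral_eq)

lemma tame_cv:
 assumes g: "tame g" and K: "wbound 2 K"
 shows "tame (cv K g)"
proof -
 have [measurable]: "g \<in> borelM" "K \<in> borelM"
  using g K by (auto intro: tame_borel wbound_borel)
 obtain C where C: "C > 0" "\<And>x. norm (K x) <= C * wt x ^ 2" using K wboundE by blast
 define D where "D = C * 2 ^ CARD('a)"
 have D: "D > 0" using C by (simp add: D_def)
 have le: "wt y * norm (g (y + z) * K z) <= D * (wt (y + z) * norm (g (y + z))) * wt z" for y z
 proof -
  have "wt y * norm (g (y + z) * K z) <= (2 ^ CARD('a) * wt (y + z) / wt z) * (norm (g (y + z)) * (C * wt z ^ 2))"
   unfolding norm_mult using wt_add'[of "y + z" "- z"] C by (intro mult_mono) auto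
  then show ?thesis by (simp add: D_def power2_eq_square mult_ac)
 qed
 let ?t1 = "NBINT y. ennreal (wt y * norm (g y))"
 have "(NBINT y. ennreal (wt y * norm (cv K g y))) \<le>
   (NBINT y. (NBINT z. ennreal (D * (wt (y + z) * norm (g (y + z))) * wt z)))"
 proof (rule nn_integral_mono)
  fix y
  have "ennreal (wt y * norm (cv K g y)) <= ennreal (wt y) * (NBINT z. enorm (g (y + z) * K z))"
   unfolding cv_def by (auto simp: ennreal_mult intro!: mult_left_mono norm_integral_le)
  also have "... = (NBINT z. ennreal (wt y * norm (g (y + z) * K z)))"
   by (subst nn_integral_cmult[symmetric]) (auto simp: ennreal_mult)
  also have "... <= (NBINT z. ennreal (D * (wt (y + z) * norm (g (y + z))) * wt z))"
   by (intro nn_integral_mono ennreal_leI le)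
  finally show "ennreal (wt y * norm (cv K g y)) <= (NBINT z. ennreal (D * (wt (y + z) * norm (g (y + z))) * wt z))" .
 qed
 also have "... = (NBINT z. (NBINT y. ennreal (D * (wt (y + z) * norm (g (y + z))) * wt z)))"
  by (rule lborel_pair.Fubini'[symmetric]) measurable
 also have "... = (NBINT z. ennreal D * ?t1 * ennreal (wt (z::real^'a)))"
 proof (rule nn_integral_cong)
  fix z
  have "(NBINT y. ennreal (D * (wt (y + z) * norm (g (y + z))) * wt z))
   = (NBINT y. ennreal D * ennreal (wt (y + z) * norm (g (y + z))) * ennreal (wt z))"
   using D by (simp add: ennreal_mult)
  also have "... = ennreal D * (NBINT y. ennreal (wt (y + z) * norm (g (y + z)))) * ennreal (wt z)"
   by (simp add: nn_integral_cmult nn_integral_multc)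
  also have "(NBINT y. ennreal (wt (y + z) * norm (g (y + z)))) = ?t1"
   by (rule nn_integral_shift(2)[of "\<lambda>y. ennreal (wt y * norm (g y))"]) measurable
  finally show "(NBINT y. ennreal (D * (wt (y + z) * norm (g (y + z))) * wt z)) =
   ennreal D * ?t1 * ennreal (wt z)" .
 qed
 also have "... < \<infinity>"
  using g integrable_wt[where 'n='a] by (auto simp: tame_def integrable_iff_bounded nn_integral_cmult ennreal_mult_less_top)
 finally show ?thesis unfolding tame_def by (auto simp: integrable_iff_bounded)
qed

lemma wbound_cv:
 assumes u: "wbound 1 u" and K: "wbound 2 K"
 shows "wbound 1 (cv K u)"
proof -
 have [measurable]: "u \<in> borelM" "K \<in> borelM"
  using u K by (auto intro: wbound_borel)
 obtain C where C: "C > 0" "\<And>x. norm (K x) <= C * wt x ^ 2" using K wboundE by blast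
 obtain A where A: "A > 0" "\<And>x. norm (u x) <= A * wt x ^ 1" using u wboundE by blast
 define D where "D = A * C * 2 ^ CARD('a)"
 have "norm (cv K u y) <= (D * (LBINT z. wt (z::real^'a)) + 1) * wt y ^ 1" for y
 proof -
  have "norm (cv K u y) <= (LBINT z. (D * wt y) * wt (z::real^'a))"
   unfolding cv_def
  proof (rule Bochner_Integration.integral_norm_bound_integral)
   show "integrable lborel (\<lambda>z. u (y + z) * K z)"
    by (rule cv_integrable[OF wbound_tame[OF wbound_mono[OF u]] K]) auto
   show "integrable lborel (\<lambda>z. (D * wt y) * wt (z::real^'a))" by (intro integrable_mult_right integrable_wt)
   fix z
   have "norm (u (y + z) * K z) <= (A * (2 ^ CARD('a) * wt y / wt z)) * (C * wt z ^ 2)"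
    unfolding norm_mult using wt_add'[of y z] A C
    by (intro mult_mono order_trans[OF A(2)] C(2)) (auto intro!: mult_nonneg_nonneg)
   also have "... = (D * wt y) * wt z" by (simp add: D_def power2_eq_square)
   finally show "norm (u (y + z) * K z) <= (D * wt y) * wt z" .
  qed
  also have "... = D * (LBINT z. wt (z::real^'a)) * wt y" by simp
  also have "... <= (D * (LBINT z. wt (z::real^'a)) + 1) * wt y ^ 1" by (simp add: distrib_right)
  finally show ?thesis .
 qed
 moreover have "D * (LBINT z. wt (z::real^'a)) + 1 > 0"
  using A C by (intro add_nonneg_pos mult_nonneg_nonneg integral_nonneg_AE) (auto simp: D_def)
 ultimately show ?thesis unfolding wbound_def by (auto intro!: exI[of _ "D * (LBINT z. wt (z::real^'a)) + 1"])
qed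

lemma cv_cv:
 assumes g: "tame g" and K1: "wbound 2 K1" and K2: "wbound 2 K2"
 shows "cv K1 (cv K2 g) y = cv (\<lambda>v. LBINT z. K1 z * K2 (v - z)) g y"
proof -
 have [measurable]: "g \<in> borelM" "K1 \<in> borelM" "K2 \<in> borelM"
  using g K1 K2 by (auto intro: tame_borel wbound_borel)
 obtain C1 where C1: "C1 > 0" "\<And>x. norm (K1 x) <= C1 * wt x ^ 2" using K1 wboundE by blast
 have "wbound 1 K2" using K2 by (rule wbound_mono) auto
 then obtain C2 where C2: "C2 > 0" "\<And>x. norm (K2 x) <= C2 * wt x ^ 1" using wboundE by blast
 have "cv K1 (cv K2 g) y = (LBINT z. (LBINT u. g (y + z + u) * K2 u) * K1 z)"
  by (simp add: cv_def)
 also have "... = (LBINT z. (LBINT v. g (y + v) * K2 (v - z) * K1 z))"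
 proof (intro Bochner_Integration.integral_cong refl)
  fix z
  have "(LBINT u. g (y + z + u) * K2 u) = (LBINT u. g (y + (z + u)) * K2 ((z + u) - z))" by (simp add: add_ac)
  also have "... = (LBINT v. g (y + v) * K2 (v - z))"
   by (rule integral_shift(1)[of "\<lambda>v. g (y + v) * K2 (v - z)"]) measurable
  finally show "(LBINT u. g (y + z + u) * K2 u) * K1 z = (LBINT v. g (y + v) * K2 (v - z) * K1 z)" by simp
 qed
 also have "... = (LBINT v. (LBINT z. g (y + v) * K2 (v - z) * K1 z))"
 proof (rule integral_swap[where a="\<lambda>z. C1 * C2 * 2 ^ CARD('a) * wt z" and b="\<lambda>v. norm (g (y + v)) * wt v"])
  show "integrable lborel (\<lambda>z. C1 * C2 * 2 ^ CARD('a) * wt (z::real^'a))" by (intro integrable_mult_right integrable_wt)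
  show "integrable lborel (\<lambda>v. norm (g (y + v)) * wt v)" by (rule tame_shift_wt[OF g])
  fix z v
  have "norm (K2 (v - z)) <= C2 * (2 ^ CARD('a) * wt v / wt z)"
  proof -
   have "wt (v - z) <= 2 ^ CARD('a) * wt v / wt z" using wt_add'[of v "-z"] by simp
   from mult_left_mono[OF this, of C2] show ?thesis using C2(1) C2(2)[of "v - z"] by simp
  qed
  then have "norm (g (y + v) * K2 (v - z) * K1 z) <= norm (g (y + v)) * (C2 * (2 ^ CARD('a) * wt v / wt z)) * (C1 * wt z ^ 2)"
   unfolding norm_mult using C1 C2 by (intro mult_mono) (auto intro!: mult_nonneg_nonneg)
  then show "norm (g (y + v) * K2 (v - z) * K1 z) <= (C1 * C2 * 2 ^ CARD('a) * wt z) * (norm (g (y + v)) * wt v)"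
   by (simp add: power2_eq_square mult_ac)
 qed measurable
 also have "... = cv (\<lambda>v. LBINT z. K1 z * K2 (v - z)) g y"
  by (simp add: cv_def mult_ac flip: integral_mult_right_zero)
 finally show ?thesis .
qed

lemma Op_Op:
 assumes "tame g" "m1 \<in> schwartz" "m2 \<in> schwartz"
 shows "Op m1 (Op m2 g) = Op (\<lambda>\<xi>. m2 \<xi> * m1 \<xi>) g"
proof -
 have "fourier (\<lambda>\<xi>. m2 \<xi> * m1 \<xi>) = (\<lambda>v. LBINT z. fourier m1 z * fourier m2 (v - z))"
  by (intro ext fourier_mult assms)
 then show ?thesis using cv_cv[OF assms(1) fourier_wbound fourier_wbound] assms by auto
qed

lemma cv_sum:
 assumes "finite I" "\<And>i. i \<in> I ==> integrable lborel (\<lambda>z. g (y + z) * K i z)"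
 shows "cv (\<lambda>z. \<Sum>i\<in>I. K i z) g y = (\<Sum>i\<in>I. cv (K i) g y)"
 unfolding cv_def sum_distrib_left by (rule Bochner_Integration.integral_sum) (use assms in auto)

lemma fourier_sum:
 assumes "finite I" "\<And>i. i \<in> I ==> f i \<in> schwartz"
 shows "fourier (\<lambda>x. \<Sum>i\<in>I. f i x) \<xi> = (\<Sum>i\<in>I. fourier (f i) \<xi>)"
proof -
 have "(\<lambda>x. \<Sum>i\<in>I. f i x) \<in> schwartz" using assms by (intro schwartz_sum)
 then have "fourier (\<lambda>x. \<Sum>i\<in>I. f i x) \<xi> = (LBINT x. (\<Sum>i\<in>I. f i x * ee (x \<bullet> \<xi>)))"
  by (subst fourier_lborel[OF schwartz_borel]) (auto simp: sum_distrib_right)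
 also have "... = (\<Sum>i\<in>I. LBINT x. f i x * ee (x \<bullet> \<xi>))"
  by (rule Bochner_Integration.integral_sum) (intro integrable_times_ee schwartz_integrable assms)
 also have "... = (\<Sum>i\<in>I. fourier (f i) \<xi>)"
  by (intro sum.cong refl) (simp add: fourier_lborel[OF schwartz_borel] assms)
 finally show ?thesis .
qed

lemma fourier_cmult: "f \<in> borelM ==> fourier (\<lambda>x. c * f x) \<xi> = c * fourier f \<xi>"
 by (simp add: fourier_lborel mult.assoc)

lemma Op_sum:
 assumes "finite I" "\<And>i. i \<in> I ==> m i \<in> schwartz" "tame g"
 shows "Op (\<lambda>x. \<Sum>i\<in>I. m i x) g y = (\<Sum>i\<in>I. Op (m i) g y)"
proof -
 have "fourier (\<lambda>x. \<Sum>i\<in>I. m i x) = (\<lambda>\<xi>. \<Sum>i\<in>I. fourier (m i) \<xi>)" by (intro ext fourier_sum assms)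
 then show ?thesis
  using assms by (auto intro!: cv_sum cv_integrable[where N=1] fourier_wbound)
qed

lemma fourier_dilate:
 fixes f :: "real^'n::finite => complex"
 assumes [measurable]: "f \<in> borelM" and c: "c \<noteq> 0"
 shows "fourier (\<lambda>x. f (c *\<^sub>R x)) \<xi> = fourier f (\<xi> /\<^sub>R c) /\<^sub>R \<bar>c\<bar> ^ CARD('n)"
proof -
 have "fourier f (\<xi> /\<^sub>R c) = (LBINT x. f x * ee (x \<bullet> (\<xi> /\<^sub>R c)))" by (rule fourier_lborel) measurable
 also have "... = \<bar>c\<bar> ^ DIM(real^'n) *\<^sub>R (LBINT x. f (0 + c *\<^sub>R x) * ee ((0 + c *\<^sub>R x) \<bullet> (\<xi> /\<^sub>R c)))"
  by (rule integral_affine[OF _ c]) measurable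
 also have "(LBINT x. f (0 + c *\<^sub>R x) * ee ((0 + c *\<^sub>R x) \<bullet> (\<xi> /\<^sub>R c))) = fourier (\<lambda>x. f (c *\<^sub>R x)) \<xi>"
 proof -
  have "(0 + c *\<^sub>R x) \<bullet> (\<xi> /\<^sub>R c) = x \<bullet> \<xi>" for x using c by (simp add: field_simps)
  then have "(\<lambda>x. f (0 + c *\<^sub>R x) * ee ((0 + c *\<^sub>R x) \<bullet> (\<xi> /\<^sub>R c))) = (\<lambda>x. f (c *\<^sub>R x) * ee (x \<bullet> \<xi>))"
   by (simp only: add_0_left)
  moreover have "fourier (\<lambda>x. f (c *\<^sub>R x)) \<xi> = (LBINT x. f (c *\<^sub>R x) * ee (x \<bullet> \<xi>))"
   by (rule fourier_lborel) measurable
  ultimately show ?thesis by (simp only:)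
 qed
 finally show ?thesis using c by simp
qed

lemma fourier_translate:
 assumes [measurable]: "f \<in> borelM"
 shows "fourier (\<lambda>x. f (x - a)) \<xi> = ee (a \<bullet> \<xi>) * fourier f \<xi>"
proof -
 have "fourier (\<lambda>x. f (x - a)) \<xi> = (LBINT x. f (x - a) * ee (x \<bullet> \<xi>))" by (rule fourier_lborel) measurable
 also have "... = (LBINT x. f ((x + a) - a) * ee ((x + a) \<bullet> \<xi>))"
  by (rule integral_shift(2)[symmetric, of "\<lambda>x. f (x - a) * ee (x \<bullet> \<xi>)"]) measurable
 also have "... = (LBINT x. ee (a \<bullet> \<xi>) * (f x * ee (x \<bullet> \<xi>)))"
  by (simp add: inner_add_left ee_add mult_ac)
 finally show ?thesis by (simp add: fourier_lborel)
qed

lemma Op_dilate: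
 fixes g :: "real^'n::finite => complex"
 assumes m: "m \<in> schwartz" and [measurable]: "g \<in> borelM" and c: "c \<noteq> 0"
 shows "Op m (\<lambda>x. g (c *\<^sub>R x)) y = Op (\<lambda>\<xi>. m (c *\<^sub>R \<xi>)) g (c *\<^sub>R y)"
proof -
 have [measurable]: "m \<in> borelM" "fourier m \<in> borelM"
  using m schwartz_borel schwartz_fourier by auto
 have "Op (\<lambda>\<xi>. m (c *\<^sub>R \<xi>)) g (c *\<^sub>R y) = (LBINT u. (g (c *\<^sub>R y + u) * fourier m (u /\<^sub>R c)) /\<^sub>R \<bar>c\<bar> ^ CARD('n))"
  unfolding cv_def using c by (simp add: fourier_dilate)
 also have "... = \<bar>c\<bar> ^ DIM(real^'n) *\<^sub>R (LBINT z. (g (c *\<^sub>R y + (0 + c *\<^sub>R z)) * fourier m ((0 + c *\<^sub>R z) /\<^sub>R c)) /\<^sub>R \<bar>c\<bar> ^ CARD('n))"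
  by (rule integral_affine[OF _ c]) measurable
 also have "... = (LBINT z. \<bar>c\<bar> ^ CARD('n) *\<^sub>R ((g (c *\<^sub>R y + c *\<^sub>R z) * fourier m z) /\<^sub>R \<bar>c\<bar> ^ CARD('n)))"
  using c by (subst integral_scaleR_right[symmetric]) simp
 also have "... = Op m (\<lambda>x. g (c *\<^sub>R x)) y"
  using c by (simp add: cv_def scaleR_add_right)
 finally show ?thesis by simp
qed

text \<open>Transposing a correlation reflects its kernel. The duality argument of
  \<open>B_dil_synthesis\<close> uses this twice to move operators onto the dual function.\<close>

lemma cv_transpose:
 fixes u :: "real^'a::finite => complex"
 assumes u: "wbound 2 u" and K: "wbound 2 K" and p: "tame \<phi>"
 shows "(LBINT y. cv K u y * \<phi> y) = (LBINT x. u x * cv (\<lambda>z. K (- z)) \<phi> x)"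
proof -
 have [measurable]: "u \<in> borelM" "K \<in> borelM" "\<phi> \<in> borelM"
  using u K p by (auto intro: tame_borel wbound_borel)
 obtain C where C: "C > 0" "\<And>x. norm (K x) <= C * wt x ^ 2" using K wboundE by blast
 obtain A where A: "A > 0" "\<And>x. norm (u x) <= A * wt x ^ 2" using u wboundE by blast
 have "(LBINT y. cv K u y * \<phi> y) = (LBINT y. LBINT x. u x * K (x - y) * \<phi> y)"
 proof (intro Bochner_Integration.integral_cong refl)
  fix y
  show "cv K u y * \<phi> y = (LBINT x. u x * K (x - y) * \<phi> y)"
   using integral_shift(1)[of "\<lambda>x. u x * K (x - y) * \<phi> y" y] by (simp add: cv_def)
 qed
 also have "... = (LBINT x. LBINT y. u x * K (x - y) * \<phi> y)"
 proof (rule integral_swap[where b="\<lambda>x. A * C * 2 ^ CARD('a) * wt x" and a="\<lambda>y. wt y * norm (\<phi> y)"])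
  show "integrable lborel (\<lambda>z. A * C * 2 ^ CARD('a) * wt (z::real^'a))" by (intro integrable_mult_right integrable_wt)
  show "integrable lborel (\<lambda>y. wt y * norm (\<phi> y))" using p by (simp add: tame_def)
  fix y x :: "real^'a"
  have "wt (x - y) ^ 2 <= wt (x - y)" by (rule wt_power_le1) simp
  also have "... = wt (y + (- x))" by (simp add: wt_diff_commute)
  also have "... <= 2 ^ CARD('a) * wt y / wt x" using wt_add'[of y "-x"] by simp
  finally have "norm (K (x - y)) <= C * (2 ^ CARD('a) * wt y / wt x)"
   using C(1) by (intro order_trans[OF C(2)] mult_left_mono) auto
  then have "norm (u x * K (x - y) * \<phi> y) <= (A * wt x ^ 2) * (C * (2 ^ CARD('a) * wt y / wt x)) * norm (\<phi> y)"
   unfolding norm_mult using A C by (intro mult_mono) (auto intro!: mult_nonneg_nonneg)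
  then show "norm (u x * K (x - y) * \<phi> y) <= (wt y * norm (\<phi> y)) * (A * C * 2 ^ CARD('a) * wt x)"
   by (simp add: power2_eq_square mult_ac)
 qed measurable
 also have "... = (LBINT x. u x * cv (\<lambda>z. K (- z)) \<phi> x)"
 proof (intro Bochner_Integration.integral_cong refl)
  fix x
  show "(LBINT y. u x * K (x - y) * \<phi> y) = u x * cv (\<lambda>z. K (- z)) \<phi> x"
   using integral_shift(1)[of "\<lambda>y. u x * K (x - y) * \<phi> y" x] by (simp add: cv_def mult_ac)
 qed
 finally show ?thesis .
qed

section \<open>Lebesgue norms of extended nonnegative functions\<close>

lemma enn_powr_ennreal: "0 <= a ==> enn_powr (ennreal a) r = ennreal (a powr r)"
 by (simp add: enn_powr_def)

lemma enn_powr_top [simp]: "enn_powr \<top> r = \<top>" by (simp add: enn_powr_def)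

lemma enn_powr_0 [simp]: "enn_powr 0 r = 0"
 using enn_powr_ennreal[of 0 r] by simp

lemma enn_powr_eq_0_iff [simp]: "enn_powr x r = 0 \<longleftrightarrow> x = 0"
 by (cases x) (auto simp: enn_powr_ennreal)

lemma enn_powr_eq_top_iff [simp]: "enn_powr x r = \<top> \<longleftrightarrow> x = \<top>"
 by (cases x) (auto simp: enn_powr_ennreal)

lemma enn_powr_less_top_iff [simp]: "enn_powr x r < \<top> \<longleftrightarrow> x < \<top>"
 by (simp add: less_top[symmetric])

lemma enn_powr_mono: "x <= y ==> 0 <= r ==> enn_powr x r <= enn_powr y r"
 by (cases x; cases y) (auto simp: enn_powr_ennreal top_unique intro: powr_mono2)

lemma enn_powr_mult: "enn_powr (x * y) r = enn_powr x r * enn_powr y r"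
proof (cases "x = 0 \<or> y = 0")
 case False
 then show ?thesis
  by (cases x; cases y) (auto simp: enn_powr_ennreal ennreal_mult_top ennreal_top_mult powr_mult ennreal_mult[symmetric])
qed auto

lemma enn_powr_powr: "enn_powr (enn_powr x a) b = enn_powr x (a * b)"
 by (cases x) (auto simp: enn_powr_ennreal powr_powr)

lemma enn_powr_1 [simp]: "enn_powr x 1 = x"
 by (cases x) (auto simp: enn_powr_ennreal)

lemma enn_powr_inverse [simp]: "r \<noteq> 0 ==> enn_powr (enn_powr x r) (1 / r) = x"
  "r \<noteq> 0 ==> enn_powr (enn_powr x (1 / r)) r = x"
 by (simp_all add: enn_powr_powr)

lemma borel_measurable_enn_powr [measurable (raw)]:
 assumes "f \<in> borel_measurable M" shows "(\<lambda>x. enn_powr (f x) r) \<in> borel_measurable M"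
proof -
 have [measurable]: "{x\<in>space borel. x = (\<infinity>::ennreal)} \<in> sets borel" by simp
 have "(\<lambda>x. enn_powr x r) \<in> borelM"
  unfolding enn_powr_def by (intro measurable_If) auto
 from measurable_compose[OF assms this] show ?thesis .
qed

text \<open>The tangent at \<open>c\<close> to the convex function a^s lies below its graph; this is
  Young's inequality with second factor c^(s-1).\<close>

lemma powr_tangent:
 fixes a c s :: real
 assumes "1 <= s" "0 <= a" "0 < c"
 shows "s * c powr (s - 1) * a <= a powr s + (s - 1) * c powr s"
proof (cases "s = 1")
 case False
 then have s: "s > 1" using assms by simp
 define b where "b = c powr (s - 1)"
 define s' where "s' = s / (s - 1)"
 have s': "s' > 1" "1 / s + 1 / s' = 1" using s by (auto simp: s'_def field_simps)
 have "a * b <= a powr s / s + b powr s' / s'"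
  by (rule Youngs_inequality) (use s s' assms in \<open>auto simp: b_def\<close>)
 moreover have "b powr s' = c powr s" using s by (simp add: b_def s'_def powr_powr)
 ultimately have "s * (a * b) <= s * (a powr s / s + c powr s * ((s - 1) / s))"
  using s by (intro mult_left_mono) (auto simp: s'_def)
 also have "... = a powr s + (s - 1) * c powr s" using s by (simp add: distrib_left mult.commute)
 finally show ?thesis by (simp add: b_def mult_ac)
qed (use assms in simp)

lemma ennreal_le_of_finite: "(y < \<top> ==> x <= y) ==> x <= (y::ennreal)"
 by (cases "y < \<top>") (auto simp: less_top[symmetric])

text \<open>Integrate the tangent inequality and choose the point of tangency I / W, where I is the
  integral. The tangent at 1 serves first, to show that I is finite. Only an upper bound
  \<open>W\<close> for the total mass enters.\<close>

lemma jensen_powr: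
 fixes F :: "'a => ennreal"
 assumes [measurable]: "F \<in> borel_measurable N" and s: "1 <= s" and W: "0 < W"
  and N: "emeasure N (space N) <= ennreal W"
 shows "enn_powr (\<integral>\<^sup>+x. F x \<partial>N) s <= ennreal (W powr (s - 1)) * (\<integral>\<^sup>+x. enn_powr (F x) s \<partial>N)"
proof (rule ennreal_le_of_finite)
 let ?I = "\<integral>\<^sup>+x. F x \<partial>N" and ?J = "\<integral>\<^sup>+x. enn_powr (F x) s \<partial>N"
 assume "ennreal (W powr (s - 1)) * ?J < \<top>"
 then have J: "?J < \<top>" using W by (auto simp: ennreal_mult_less_top)
 have tan: "ennreal (s * c powr (s - 1)) * ?I <= ?J + ennreal ((s - 1) * c powr s * W)" if c: "c > 0" for c
 proof -
  have "ennreal (s * c powr (s - 1)) * ?I = (\<integral>\<^sup>+x. ennreal (s * c powr (s - 1)) * F x \<partial>N)"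
   by (rule nn_integral_cmult[symmetric]) measurable
  also have "... <= (\<integral>\<^sup>+x. enn_powr (F x) s + ennreal ((s - 1) * c powr s) \<partial>N)"
  proof (rule nn_integral_mono)
   fix x
   show "ennreal (s * c powr (s - 1)) * F x <= enn_powr (F x) s + ennreal ((s - 1) * c powr s)"
    using s c powr_tangent[OF s _ c, of "enn2real (F x)"]
    by (cases "F x") (auto simp: enn_powr_ennreal ennreal_mult[symmetric] ennreal_plus[symmetric] simp del: ennreal_plus)
  qed
  also have "... = ?J + ennreal ((s - 1) * c powr s) * emeasure N (space N)"
   by (simp add: nn_integral_add)
  also have "... <= ?J + ennreal ((s - 1) * c powr s) * ennreal W"
   by (intro add_left_mono mult_left_mono N) auto
  finally show ?thesis using s W by (simp add: ennreal_mult[symmetric])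
 qed
 have "?I < \<top>"
 proof -
  have "ennreal s * ?I <= ?J + ennreal ((s - 1) * W)" using tan[of 1] by simp
  also have "... < \<top>" using J by simp
  finally show ?thesis using s by (auto simp: ennreal_mult_less_top)
 qed
 then obtain i where i: "?I = ennreal i" "i \<ge> 0" by (cases ?I) auto
 obtain j where j: "?J = ennreal j" "j \<ge> 0" using J by (cases ?J) auto
 have "i powr s <= W powr (s - 1) * j"
 proof (cases "i = 0")
  case False
  then have c: "i / W > 0" using i W by simp
  have "s * (i / W) powr (s - 1) * i <= j + (s - 1) * (i / W) powr s * W"
   using tan[OF c] i j s W c
   by (simp add: ennreal_mult[symmetric] ennreal_plus[symmetric] del: ennreal_plus)
  moreover have "(i / W) powr s * W = (i / W) powr (s - 1) * i"
  proof -
   have "(i / W) powr s = (i / W) powr (s - 1) * (i / W)" using c by (metis powr_mult_base add.commute diff_add_cancel less_imp_le mult.commute powr_one powr_add)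
   then show ?thesis using W by simp
  qed
  ultimately have "s * ((i / W) powr (s - 1) * i) <= j + (s - 1) * ((i / W) powr (s - 1) * i)"
   by (metis mult.assoc)
  then have "(i / W) powr (s - 1) * i <= j" by (simp only: left_diff_distrib)
  moreover have "W powr (s - 1) * ((i / W) powr (s - 1) * i) = i powr s"
  proof -
   have "W powr (s - 1) * (i / W) powr (s - 1) = i powr (s - 1)"
    using i W by (simp add: powr_divide)
   moreover have "i powr (s - 1) * i = i powr s" using False i by (metis powr_add diff_add_cancel powr_one)
   ultimately show ?thesis by (metis mult.assoc)
  qed
  ultimately show ?thesis by (metis mult_left_mono powr_ge_zero)
 qed (use j in simp)
 then show "enn_powr ?I s <= ennreal (W powr (s - 1)) * ?J"
  using i j by (simp add: enn_powr_ennreal ennreal_mult[symmetric])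
qed

text \<open>Formulated for an arbitrary measure so that the spatial norm (over
  \<open>lborel\<close>) and the outer sequence norm (over \<open>count_space\<close>) obey the same
  Minkowski inequality.\<close>

definition lpn :: "'a measure => ereal => ('a => ennreal) => ennreal" where
 "lpn M p u = (if p = \<infinity> then esssup M u
   else enn_powr (\<integral>\<^sup>+x. enn_powr (u x) (real_of_ereal p) \<partial>M) (1 / real_of_ereal p))"

lemma ereal_ge_1_cases:
 assumes "1 <= (p::ereal)" obtains "p = \<infinity>" | r where "p = ereal r" "1 <= r"
 using assms by (cases p) auto

lemma lpn_real: "lpn M (ereal r) u = enn_powr (\<integral>\<^sup>+x. enn_powr (u x) r \<partial>M) (1 / r)"
 by (simp add: lpn_def)

lemma lpn_le_iff: 
 assumes "1 <= r"
 shows "lpn M (ereal r) u <= b \<longleftrightarrow> (\<integral>\<^sup>+x. enn_powr (u x) r \<partial>M) <= enn_powr b r"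
 using enn_powr_mono[of "lpn M (ereal r) u" b r] enn_powr_mono[of "\<integral>\<^sup>+x. enn_powr (u x) r \<partial>M" "enn_powr b r" "1/r"] assms
 by (auto simp: lpn_real)

lemma lpn_mono:
 assumes "1 <= p" "u \<in> borel_measurable M" "\<And>x. x \<in> space M ==> u x <= v x"
 shows "lpn M p u <= lpn M p v"
 using assms(1)
proof (cases rule: ereal_ge_1_cases)
 case 1
 then show ?thesis using assms by (auto simp: lpn_def intro: esssup_AE_mono)
next
 case (2 r)
 then show ?thesis using assms by (auto simp: lpn_real intro!: enn_powr_mono nn_integral_mono)
qed

lemma lpn_cmult_le:
 assumes "1 <= p" and [measurable]: "u \<in> borel_measurable M"
 shows "lpn M p (\<lambda>x. c * u x) <= c * lpn M p u"
 using assms(1)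
proof (cases rule: ereal_ge_1_cases)
 case 1
 have "AE x in M. c * u x <= c * esssup M u"
  using esssup_AE[of u M] by eventually_elim (auto intro: mult_left_mono)
 then show ?thesis using 1 by (auto simp: lpn_def intro!: esssup_I)
next
 case (2 r)
 then show ?thesis
  by (simp add: lpn_real enn_powr_mult nn_integral_cmult)
qed

text \<open>For a positive weight \<open>w\<close> dominating the norms of the slices, Jensen's inequality for the
 measure \<open>w \<cdot> N\<close> and Tonelli give Minkowski's inequality without any division of infinities.\<close>

lemma minkowski_weight:
 assumes "sigma_finite_measure M" "sigma_finite_measure N"
 assumes F[measurable]: "(\<lambda>(x,y). F x y) \<in> borel_measurable (M \<Otimes>\<^sub>M N)"
  and w[measurable]: "w \<in> borel_measurable N" and w0: "\<And>y. w y > (0::real)"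
  and r: "1 <= r"
  and b: "AE y in N. (\<integral>\<^sup>+x. enn_powr (F x y) r \<partial>M) <= ennreal (w y powr r)"
 shows "(\<integral>\<^sup>+x. enn_powr (\<integral>\<^sup>+y. F x y \<partial>N) r \<partial>M) <= enn_powr (\<integral>\<^sup>+y. ennreal (w y) \<partial>N) r"
proof (rule ennreal_le_of_finite)
 interpret M: sigma_finite_measure M by fact
 interpret N: sigma_finite_measure N by fact
 interpret P: pair_sigma_finite M N ..
 let ?W = "\<integral>\<^sup>+y. ennreal (w y) \<partial>N"
 assume "enn_powr ?W r < \<top>"
 then obtain W where W: "?W = ennreal W" "W \<ge> 0" by (cases ?W) auto
 define W1 where "W1 = W"
 let ?N = "density N (\<lambda>y. ennreal (w y))"
 have eN: "emeasure ?N (space ?N) = ennreal W"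
  using W(1) by (subst emeasure_density) auto
 have [measurable]: "x \<in> space M ==> (\<lambda>y. F x y) \<in> borel_measurable N" for x
  using measurable_compose_Pair1[OF _ F, of x] by simp
 have div: "ennreal (w y) * (F x y / ennreal (w y)) = F x y" for x y
  using w0[of y] by (metis ennreal_eq_0_iff ennreal_neq_top ennreal_times_divide linorder_not_le mult_divide_eq_ennreal mult.commute)
 let ?t1 = "\<integral>\<^sup>+x. enn_powr (\<integral>\<^sup>+y. F x y \<partial>N) r \<partial>M"
 show "?t1 <= enn_powr ?W r"
 proof (cases "W = 0")
  case True
  then have "AE y in N. ennreal (w y) = 0" using W by (subst nn_integral_0_iff_AE[symmetric]) auto
  \<comment> \<open>A positive weight with integral zero forces the measure \<open>N\<close> itself
    to be null.\<close>
  then have "AE y in N. False" by eventually_elim (metis w0 ennreal_eq_0_iff not_le)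
  then have "(\<integral>\<^sup>+y. F x y \<partial>N) = 0" if "x \<in> space M" for x
   using that by (subst nn_integral_0_iff_AE) auto
  then have "?t1 = (\<integral>\<^sup>+x. 0 \<partial>M)"
   by (intro nn_integral_cong) auto
  then show ?thesis by simp
 next
  case False
  then have W0: "W > 0" using W by simp
  have "?t1 \<le>
    (\<integral>\<^sup>+x. ennreal (W powr (r - 1)) * (\<integral>\<^sup>+y. enn_powr (F x y) r * ennreal (w y powr (1 - r)) \<partial>N) \<partial>M)"
  proof (rule nn_integral_mono)
   fix x assume x[measurable]: "x \<in> space M"
   have "(\<integral>\<^sup>+y. F x y \<partial>N) = (\<integral>\<^sup>+y. F x y / ennreal (w y) \<partial>?N)"
    by (subst nn_integral_density) (auto simp: div)
   also have "enn_powr ... r <= ennreal (W powr (r - 1)) * (\<integral>\<^sup>+y. enn_powr (F x y / ennreal (w y)) r \<partial>?N)"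
    by (rule jensen_powr) (use r W0 eN in auto)
   also have "(\<integral>\<^sup>+y. enn_powr (F x y / ennreal (w y)) r \<partial>?N) = (\<integral>\<^sup>+y. ennreal (w y) * enn_powr (F x y / ennreal (w y)) r \<partial>N)"
    by (subst nn_integral_density) auto
   also have "... = (\<integral>\<^sup>+y. enn_powr (F x y) r * ennreal (w y powr (1 - r)) \<partial>N)"
   proof (rule nn_integral_cong)
    fix y
    have "F x y / ennreal (w y) = F x y * ennreal (1 / w y)"
     using w0[of y] by (simp add: divide_ennreal_def inverse_ennreal divide_inverse)
    then have "ennreal (w y) * enn_powr (F x y / ennreal (w y)) r = enn_powr (F x y) r * (ennreal (w y) * ennreal ((1 / w y) powr r))"
     using w0[of y] by (simp add: enn_powr_mult enn_powr_ennreal mult_ac)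
    also have "ennreal (w y) * ennreal ((1 / w y) powr r) = ennreal (w y powr (1 - r))"
     using w0[of y] by (simp add: ennreal_mult[symmetric] powr_divide powr_diff)
    finally show "ennreal (w y) * enn_powr (F x y / ennreal (w y)) r = enn_powr (F x y) r * ennreal (w y powr (1 - r))" .
   qed
   finally show "enn_powr (\<integral>\<^sup>+y. F x y \<partial>N) r <= ennreal (W powr (r - 1)) * (\<integral>\<^sup>+y. enn_powr (F x y) r * ennreal (w y powr (1 - r)) \<partial>N)" .
  qed
  also have "... = ennreal (W powr (r - 1)) * (\<integral>\<^sup>+x. (\<integral>\<^sup>+y. enn_powr (F x y) r * ennreal (w y powr (1 - r)) \<partial>N) \<partial>M)"
   by (rule nn_integral_cmult) measurable
  also have "(\<integral>\<^sup>+x. (\<integral>\<^sup>+y. enn_powr (F x y) r * ennreal (w y powr (1 - r)) \<partial>N) \<partial>M) =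
    (\<integral>\<^sup>+y. (\<integral>\<^sup>+x. enn_powr (F x y) r * ennreal (w y powr (1 - r)) \<partial>M) \<partial>N)"
   by (rule P.Fubini'[symmetric]) measurable
  also have "... <= (\<integral>\<^sup>+y. ennreal (w y) \<partial>N)"
  proof (rule nn_integral_mono_AE)
   show "AE y in N. (\<integral>\<^sup>+x. enn_powr (F x y) r * ennreal (w y powr (1 - r)) \<partial>M) <= ennreal (w y)"
    using b AE_space
   proof eventually_elim
    case (elim y)
    have [measurable]: "(\<lambda>x. F x y) \<in> borel_measurable M"
     using measurable_compose[OF measurable_Pair2'[OF elim(2)] F] by simp
    have "(\<integral>\<^sup>+x. enn_powr (F x y) r * ennreal (w y powr (1 - r)) \<partial>M) = (\<integral>\<^sup>+x. enn_powr (F x y) r \<partial>M) * ennreal (w y powr (1 - r))"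
     by (rule nn_integral_multc) measurable
    also have "... <= ennreal (w y powr r) * ennreal (w y powr (1 - r))" by (intro mult_right_mono elim) auto
    also have "... = ennreal (w y)" using w0[of y] by (simp add: ennreal_mult[symmetric] powr_add[symmetric])
    finally show ?case .
   qed
  qed
  also have "ennreal (W powr (r - 1)) * (\<integral>\<^sup>+y. ennreal (w y) \<partial>N) = enn_powr ?W r"
  proof -
   have "W powr (r - 1) * W = W powr r" using W0 by (metis powr_add diff_add_cancel powr_one less_imp_le)
   then show ?thesis using W by (simp add: enn_powr_ennreal ennreal_mult[symmetric])
  qed
  finally show ?thesis by (simp add: mult_left_mono)
 qed
qed

text \<open>The bound \<open>a\<close> may vanish, whereas \<open>minkowski_weight\<close> requires
  a positive weight. So a small multiple of a positive integrable function, supplied by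
  sigma-finiteness, is added to it and then sent to 0. For p = \<infinity> one exchanges the two
  almost-everywhere quantifiers.\<close>

lemma minkowski:
 assumes M: "sigma_finite_measure M" and N: "sigma_finite_measure N"
 assumes F[measurable]: "(\<lambda>(x,y). F x y) \<in> borel_measurable (M \<Otimes>\<^sub>M N)"
  and a[measurable]: "a \<in> borel_measurable N"
  and p: "1 <= p"
  and b: "AE y in N. lpn M p (\<lambda>x. F x y) <= a y"
 shows "lpn M p (\<lambda>x. \<integral>\<^sup>+y. F x y \<partial>N) <= (\<integral>\<^sup>+y. a y \<partial>N)"
proof (rule ennreal_le_of_finite)
 interpret M: sigma_finite_measure M by fact
 interpret N: sigma_finite_measure N by fact
 interpret P: pair_sigma_finite M N ..
 let ?A = "\<integral>\<^sup>+y. a y \<partial>N"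
 assume fin: "?A < \<top>"
 let ?t1 = "\<lambda>x. \<integral>\<^sup>+y. F x y \<partial>N"
 show "lpn M p ?t1 <= ?A"
  using p
 proof (cases rule: ereal_ge_1_cases)
  case 1
  have "AE y in N. AE x in M. F x y <= a y"
   using b AE_space
  proof eventually_elim
   case (elim y)
   then have "AE x in M. F x y <= esssup M (\<lambda>x. F x y)"
    by (intro esssup_AE)
   moreover have "esssup M (\<lambda>x. F x y) <= a y" using elim(1) 1 by (simp add: lpn_def)
   ultimately show ?case by (auto elim: eventually_mono order_trans)
  qed
  then have "AE x in M. AE y in N. F x y <= a y"
   by (subst P.AE_commute) auto
  then have "AE x in M. (\<integral>\<^sup>+y. F x y \<partial>N) <= ?A"
   by eventually_elim (rule nn_integral_mono_AE)
  then show ?thesis using 1 by (auto simp: lpn_def intro!: esssup_I)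
 next
  case (2 r)
  obtain h where h: "h \<in> borel_measurable N" "integral\<^sup>N N h \<noteq> \<infinity>" "\<And>x. x \<in> space N ==> 0 < h x \<and> h x < \<infinity>"
   using N.Ex_finite_integrable_function by blast
  define v where "v y = (if y \<in> space N then enn2real (h y) else 1)" for y
  have v: "v y > 0" for y using h(3)[of y] by (auto simp: v_def enn2real_positive_iff)
  have [measurable]: "v \<in> borel_measurable N" using h(1) unfolding v_def by (subst measurable_cong[where g="\<lambda>y. enn2real (h y)"]) auto
  have "(\<integral>\<^sup>+y. ennreal (v y) \<partial>N) = integral\<^sup>N N h" using h(3)
   by (intro nn_integral_cong) (auto simp: v_def less_top)
  then obtain V where V: "(\<integral>\<^sup>+y. ennreal (v y) \<partial>N) = ennreal V" "V \<ge> 0" using h(2)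
   by (cases "integral\<^sup>N N h") auto
  have afin: "AE y in N. a y < \<top>" using nn_integral_PInf_AE[OF a] fin by (auto simp: less_top)
  show ?thesis
  proof (rule ennreal_le_epsilon)
   fix e :: real assume e: "e > 0"
   define \<epsilon> where "\<epsilon> = e / (V + 1)"
   have \<epsilon>: "\<epsilon> > 0" "\<epsilon> * V <= e" using e V by (auto simp: \<epsilon>_def field_simps)
   define w where "w y = enn2real (a y) + \<epsilon> * v y" for y
   have w: "w y > 0" for y using v[of y] \<epsilon> by (auto simp: w_def intro!: add_nonneg_pos)
   have [measurable]: "w \<in> borel_measurable N" unfolding w_def by measurable
   have "(\<integral>\<^sup>+x. enn_powr (\<integral>\<^sup>+y. F x y \<partial>N) r \<partial>M) <= enn_powr (\<integral>\<^sup>+y. ennreal (w y) \<partial>N) r"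
   proof (rule minkowski_weight[OF M N F _ w 2(2)])
    show "AE y in N. (\<integral>\<^sup>+x. enn_powr (F x y) r \<partial>M) <= ennreal (w y powr r)"
     using b afin
    proof eventually_elim
     case (elim y)
     have "(\<integral>\<^sup>+x. enn_powr (F x y) r \<partial>M) <= enn_powr (a y) r"
      using elim(1) 2 by (simp add: lpn_le_iff)
     also have "... <= enn_powr (ennreal (w y)) r"
      using elim(2) v[of y] \<epsilon> 2 by (cases "a y") (auto simp: w_def intro!: enn_powr_mono ennreal_leI)
     finally show ?case using w[of y] by (simp add: enn_powr_ennreal)
    qed
   qed measurable
   then have "lpn M p ?t1 <= (\<integral>\<^sup>+y. ennreal (w y) \<partial>N)" using 2 by (simp add: lpn_le_iff)
   also have "... = (\<integral>\<^sup>+y. ennreal (enn2real (a y)) + ennreal \<epsilon> * ennreal (v y) \<partial>N)"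
    using \<epsilon> v by (intro nn_integral_cong) (auto simp: w_def ennreal_mult less_imp_le)
   also have "... = (\<integral>\<^sup>+y. ennreal (enn2real (a y)) \<partial>N) + ennreal \<epsilon> * ennreal V"
    by (simp add: nn_integral_add nn_integral_cmult V)
   also have "(\<integral>\<^sup>+y. ennreal (enn2real (a y)) \<partial>N) = ?A"
    using afin by (intro nn_integral_cong_AE) (auto elim: eventually_mono simp: less_top)
   also have "?A + ennreal \<epsilon> * ennreal V <= ?A + ennreal e"
    using \<epsilon> V by (intro add_left_mono) (auto simp: ennreal_mult[symmetric] intro!: ennreal_leI)
   finally show "lpn M p ?t1 <= ?A + ennreal e" .
  qed
 qed
qed

section \<open>Norms of functions on Euclidean space and Young's inequality\<close>

abbreviation nrm :: "ereal => (real^'n::finite => complex) => ennreal" where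
 "nrm p g \<equiv> lpn lborel p (\<lambda>x. enorm (g x))"

lemma esssup_completion:
 fixes f :: "'a => ennreal"
 assumes [measurable]: "f \<in> borel_measurable M"
 shows "esssup (completion M) f = esssup M f"
proof -
 have "f \<in> borel_measurable (completion M)" using assms by (rule measurable_completion)
 then show ?thesis by (simp add: esssup_eq_AE AE_completion_iff)
qed

lemma Lp_norm_eq:
 assumes [measurable]: "g \<in> borelM"
 shows "Lp_norm p g = nrm p g"
 by (simp add: Lp_norm_def lpn_def nn_integral_completion enn_powr_ennreal esssup_completion)

lemma Lp_norm_cong_AE:
 assumes "AE x in lebesgue. g x = h x" "g \<in> borel_measurable lebesgue" "h \<in> borel_measurable lebesgue"
 shows "Lp_norm p g = Lp_norm p h"
proof -
 have 1: "esssup lebesgue (\<lambda>x. enorm (g x)) = esssup lebesgue (\<lambda>x. enorm (h x))"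
  using assms by (intro esssup_AE_cong) (auto elim: eventually_mono)
 have 2: "(\<integral>\<^sup>+x. ennreal (norm (g x) powr real_of_ereal p) \<partial>lebesgue) = (\<integral>\<^sup>+x. ennreal (norm (h x) powr real_of_ereal p) \<partial>lebesgue)"
  using assms by (intro nn_integral_cong_AE) (auto elim: eventually_mono)
 show ?thesis unfolding Lp_norm_def by (simp only: 1 2)
qed

lemma AE_lborel_shift:
 assumes [measurable]: "{x::'a::euclidean_space. P x} \<in> sets borel" and "AE x in lborel. P x"
 shows "AE x in lborel. P (x + t)"
proof -
 have "AE x in distr lborel borel ((+) t). P x" using assms(2) by (simp only: lborel_distr_plus)
 then have "AE x in lborel. P (t + x)" by (subst (asm) AE_distr_iff) auto
 then show ?thesis by (simp add: add.commute)
qed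

lemma lpn_shift:
 fixes u :: "'a::euclidean_space => ennreal"
 assumes p: "1 <= p" and [measurable]: "u \<in> borelM"
 shows "lpn lborel p (\<lambda>x. u (x + t)) <= lpn lborel p u"
 using p
proof (cases rule: ereal_ge_1_cases)
 case 1
 have "AE x in lborel. u x <= esssup lborel u" by (rule esssup_AE)
 then have "AE x in lborel. u (x + t) <= esssup lborel u" by (intro AE_lborel_shift[of "\<lambda>x. u x <= esssup lborel u"]) auto
 then show ?thesis using 1 by (auto simp: lpn_def intro!: esssup_I)
next
 case (2 r)
 have "(NBINT x. enn_powr (u (x + t)) r) = (NBINT x. enn_powr (u x) r)"
  by (rule nn_integral_shift(2)[of "\<lambda>x. enn_powr (u x) r"]) measurable
 then show ?thesis using 2 by (simp add: lpn_real)
qed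

lemma sigma_finite_lborel': "sigma_finite_measure (lborel :: 'a::euclidean_space measure)"
 by (rule sigma_finite_lborel)

text \<open>Young's inequality with an integrable kernel: Minkowski applied to the superposition of
  translates of \<open>g\<close>.\<close>

lemma nrm_cv:
 fixes g :: "real^'n::finite => complex"
 assumes p: "1 <= p" and [measurable]: "g \<in> borelM" "K \<in> borelM"
 shows "nrm p (cv K g) <= (NBINT z. enorm (K z)) * nrm p g"
proof -
 have "nrm p (cv K g) <= lpn lborel p (\<lambda>y. \<integral>\<^sup>+z. enorm (g (y + z)) * enorm (K z) \<partial>lborel)"
 proof (rule lpn_mono[OF p])
  fix y
  show "enorm (cv K g y) <= (NBINT z. enorm (g (y + z)) * enorm (K z))"
   unfolding cv_def by (rule order_trans[OF norm_integral_le]) (simp add: norm_mult ennreal_mult)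
 qed measurable
 also have "... <= (NBINT z. enorm (K z) * nrm p g)"
 proof (rule minkowski[OF sigma_finite_lborel' sigma_finite_lborel' _ _ p])
  show "AE z in lborel. lpn lborel p (\<lambda>y. enorm (g (y + z)) * enorm (K z)) <= enorm (K z) * nrm p g"
  proof (rule AE_I2)
   fix z
   have "lpn lborel p (\<lambda>y. enorm (K z) * enorm (g (y + z))) <= enorm (K z) * lpn lborel p (\<lambda>y. enorm (g (y + z)))"
    by (rule lpn_cmult_le[OF p]) measurable
   also have "... <= enorm (K z) * nrm p g"
    by (intro mult_left_mono lpn_shift[OF p, of "\<lambda>x. enorm (g x)"]) auto
   finally show "lpn lborel p (\<lambda>y. enorm (g (y + z)) * enorm (K z)) <= enorm (K z) * nrm p g"
    by (simp add: mult.commute)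
  qed
 qed measurable
 also have "... = (NBINT z. enorm (K z)) * nrm p g"
  by (rule nn_integral_multc) measurable
 finally show ?thesis .
qed

lemma nrm_sum:
 fixes g :: "'i => real^'n::finite => complex"
 assumes p: "1 <= p" and I: "finite I" and [measurable]: "\<And>i. i \<in> I ==> g i \<in> borelM"
 shows "nrm p (\<lambda>x. \<Sum>i\<in>I. g i x) <= (\<Sum>i\<in>I. nrm p (g i))"
proof -
 have "nrm p (\<lambda>x. \<Sum>i\<in>I. g i x) <= lpn lborel p (\<lambda>x. \<integral>\<^sup>+i. enorm (g i x) \<partial>count_space I)"
 proof (rule lpn_mono[OF p])
  fix x
  have "enorm (\<Sum>i\<in>I. g i x) <= ennreal (\<Sum>i\<in>I. norm (g i x))" by (intro ennreal_leI norm_sum)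
  also have "... = (\<Sum>i\<in>I. enorm (g i x))" by (simp add: sum_ennreal)
  finally show "enorm (\<Sum>i\<in>I. g i x) <= (\<integral>\<^sup>+i. enorm (g i x) \<partial>count_space I)"
   using I by (simp add: nn_integral_count_space_finite)
 qed measurable
 also have "... <= (\<integral>\<^sup>+i. nrm p (g i) \<partial>count_space I)"
 proof (rule minkowski[OF sigma_finite_lborel' sigma_finite_measure_count_space_finite[OF I] _ _ p])
  have "(\<lambda>(i, x). enorm (g i x)) \<in> borel_measurable (count_space I \<Otimes>\<^sub>M lborel)"
   by (rule measurable_pair_measure_countable1) (use I in \<open>auto intro: countable_finite\<close>)
  from measurable_compose[OF measurable_pair_swap' this]
  show "(\<lambda>(x, i). enorm (g i x)) \<in> borel_measurable (lborel \<Otimes>\<^sub>M count_space I)" by (simp add: case_prod_beta)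
 qed auto
 also have "... = (\<Sum>i\<in>I. nrm p (g i))" using I by (simp add: nn_integral_count_space_finite)
 finally show ?thesis .
qed

lemma nn_integral_wt: obtains W where "W > 0" "(NBINT z. ennreal (wt (z::real^'n::finite))) = ennreal W"
proof -
 have e: "(NBINT z. ennreal (wt (z::real^'n))) = ennreal (LBINT z. wt (z::real^'n))"
  by (rule nn_integral_eq_integral[OF integrable_wt]) auto
 have "(NBINT z. ennreal (wt (z::real^'n))) \<noteq> 0"
 proof
  assume "(NBINT z. ennreal (wt (z::real^'n))) = 0"
  then have "AE z in (lborel :: (real^'n) measure). ennreal (wt z) = 0" by (subst (asm) nn_integral_0_iff_AE) auto
  then have "AE z in (lborel :: (real^'n) measure). False" 
   by eventually_elim (metis wt_pos ennreal_eq_0_iff not_le)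
  then have "ae_filter (lborel :: (real^'n) measure) = bot" by (simp add: eventually_False)
  then show False by (simp add: ae_filter_eq_bot_iff)
 qed
 then have "(LBINT z. wt (z::real^'n)) > 0"
  using integral_nonneg_AE[of "wt :: real^'n => real" lborel] unfolding e by (simp add: less_le)
 then show ?thesis using e that by blast
qed

text \<open>For a kernel that reproduces \<open>g\<close> this is a Bernstein (Nikolskii)
  inequality. Jensen for the finite measure with density \<open>wt\<close> plays the part of
  Holder's inequality.\<close>

lemma cv_pointwise:
 assumes p: "1 <= p"
 shows "\<exists>D>0. \<forall>(g::real^'n::finite => complex) K y. g \<in> borelM \<and> K \<in> borelM \<and> (\<forall>z. norm (K z) <= C * wt z) -->
  enorm (cv K g y) <= ennreal D * nrm p g"
proof -
 obtain W where W: "W > 0" "(NBINT z. ennreal (wt (z::real^'n))) = ennreal W" by (rule nn_integral_wt)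
 define r where "r = (if p = \<infinity> then 0 else real_of_ereal p)"
 define D where "D = max C 1 * (if p = \<infinity> then W else W powr ((r - 1) / r))"
 have D: "D > 0" using W by (auto simp: D_def)
 have "enorm (cv K g y) <= ennreal D * nrm p g"
  if [measurable]: "g \<in> borelM" "K \<in> borelM" and K: "\<And>z. norm (K z) <= C * wt z" 
  for g :: "real^'n => complex" and K y
 proof -
  let ?t1 = "NBINT z. ennreal (wt z) * enorm (g (y + z))"
  have "enorm (cv K g y) <= (NBINT z. enorm (g (y + z) * K z))"
   unfolding cv_def by (rule norm_integral_le)
  also have "... <= (NBINT z. ennreal (max C 1) * (ennreal (wt z) * enorm (g (y + z))))"
  proof (intro nn_integral_mono)
   fix z
   have "norm (g (y + z) * K z) <= norm (g (y + z)) * (max C 1 * wt z)"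
    unfolding norm_mult by (intro mult_left_mono order_trans[OF K] mult_right_mono) auto
   then show "enorm (g (y + z) * K z) <= ennreal (max C 1) * (ennreal (wt z) * enorm (g (y + z)))"
    by (simp add: ennreal_mult[symmetric] mult_ac ennreal_leI)
  qed
  also have "... = ennreal (max C 1) * ?t1"
   by (rule nn_integral_cmult) measurable
  finally have 0: "enorm (cv K g y) <= ennreal (max C 1) * ?t1" .
  show ?thesis
   using p
  proof (cases rule: ereal_ge_1_cases)
   case 1
   have "AE z in lborel. enorm (g z) <= nrm p g" using 1 esssup_AE[of "\<lambda>x. enorm (g x)" lborel] by (simp add: lpn_def)
   then have "AE z in lborel. enorm (g (z + y)) <= nrm p g" by (intro AE_lborel_shift[of "\<lambda>z. enorm (g z) <= nrm p g"]) auto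
   then have "?t1 <= (NBINT z. ennreal (wt (z::real^'n)) * nrm p g)"
    by (intro nn_integral_mono_AE) (auto elim!: eventually_mono intro!: mult_left_mono simp: add.commute)
   also have "... = ennreal W * nrm p g" by (subst nn_integral_multc) (auto simp: W)
   finally have "enorm (cv K g y) <= ennreal (max C 1) * (ennreal W * nrm p g)"
    by (intro order_trans[OF 0] mult_left_mono) auto
   also have "... = ennreal D * nrm p g" using 1 W by (simp add: D_def ennreal_mult mult.assoc)
   finally show ?thesis .
  next
   case (2 r')
   then have r: "r' = r" "r \<ge> 1" "p = ereal r" by (auto simp: r_def)
   let ?N = "density lborel (\<lambda>z::real^'n. ennreal (wt z))"
   have "?t1 = (\<integral>\<^sup>+z. enorm (g (y + z)) \<partial>?N)"
    by (subst nn_integral_density) auto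
   also have "enn_powr ... r <= ennreal (W powr (r - 1)) * (\<integral>\<^sup>+z. enn_powr (enorm (g (y + z))) r \<partial>?N)"
    by (rule jensen_powr) (use r W in \<open>auto simp: emeasure_density\<close>)
   also have "(\<integral>\<^sup>+z. enn_powr (enorm (g (y + z))) r \<partial>?N) = (NBINT z. ennreal (wt z) * enn_powr (enorm (g (y + z))) r)"
    by (subst nn_integral_density) auto
   also have "... <= (NBINT z. 1 * enn_powr (enorm (g (y + z))) r)"
    by (intro nn_integral_mono mult_right_mono) auto
   also have "... = (NBINT z. enn_powr (enorm (g z)) r)"
    using nn_integral_shift(1)[of "\<lambda>z. enn_powr (enorm (g z)) r" y] by simp
   also have "... = enn_powr (nrm p g) r" using r by (simp add: lpn_real)
   finally have "enn_powr ?t1 r <= ennreal (W powr (r - 1)) * enn_powr (nrm p g) r"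
    by (simp add: mult_left_mono)
   then have "enn_powr (enn_powr ?t1 r) (1/r)
     <= enn_powr (ennreal (W powr (r - 1)) * enn_powr (nrm p g) r) (1/r)" using r by (intro enn_powr_mono) auto
   then have "?t1 <= ennreal (W powr ((r - 1)/r)) * nrm p g"
    using r by (simp add: enn_powr_mult enn_powr_ennreal powr_powr)
   then have "enorm (cv K g y) <= ennreal (max C 1) * (ennreal (W powr ((r - 1)/r)) * nrm p g)"
    by (intro order_trans[OF 0] mult_left_mono) auto
   also have "... = ennreal D * nrm p g" using r by (simp add: D_def ennreal_mult mult.assoc)
   finally show ?thesis .
  qed
 qed
 then show ?thesis using D by blast
qed

section \<open>The frequency-uniform decomposition\<close>

lemma schwartz_translate:
 fixes f :: "real^'n::finite => complex"
 assumes "f \<in> schwartz" shows "(\<lambda>x. f (x - a)) \<in> schwartz"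
proof (rule schwartz_coinduct[where P="{\<lambda>x. f (x - a) | f. f \<in> schwartz}"])
 show "(\<lambda>x. f (x - a)) \<in> {\<lambda>x. f (x - a) | f. f \<in> schwartz}" using assms by blast
 fix h assume "h \<in> {\<lambda>x. f (x - a) | f. f \<in> (schwartz :: (real^'n => complex) set)}"
 then obtain f where h: "h = (\<lambda>x. f (x - a))" "f \<in> schwartz" by blast
 have d: "(h has_derivative (\<lambda>y. frechet_derivative f (at (x - a)) y)) (at x)" for x
  unfolding h(1)
  by (rule has_derivative_compose[where g=f and f="\<lambda>x. x - a", OF _ schwartz_has_derivative[OF h(2)]])
    (auto intro!: derivative_eq_intros)
 show "h differentiable (at x)" for x using d differentiable_def by blast
 have "pd i h = (\<lambda>x. pd i f (x - a))" for i by (intro ext pd_eq d)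
 then show "pd i h \<in> {\<lambda>x. f (x - a) | f. f \<in> schwartz}" for i
  by (intro CollectI exI[of _ "pd i f"] conjI schwartz_pd h)
 show "rapid h" unfolding rapid_def
 proof
  fix N :: nat
  obtain C where C: "C > 0" "\<And>x. norm (f x) <= C * wt x ^ N" using schwartz_bound[OF h(2)] by blast
  have "norm (h x) <= (C * (2 ^ CARD('n) / wt a) ^ N) * wt x ^ N" for x
  proof -
   have "norm (h x) <= C * wt (x + (- a)) ^ N" using C(2)[of "x - a"] h(1) by simp
   also have "... <= C * (2 ^ CARD('n) * wt x / wt a) ^ N"
    using C(1) wt_add'[of x "-a"] by (intro mult_left_mono power_mono) auto
   finally show ?thesis by (simp add: power_mult_distrib power_divide mult_ac)
  qed
  then show "\<exists>C. \<forall>x. norm (h x) <= C * wt x ^ N" by blast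
 qed
qed

text \<open>Unfolding the transposed definitions puts \<sigma> onto the inverse transform of the
  test function; \<open>fourier_mult\<close> turns the product into a convolution, and Fubini moves
  that onto \<open>g\<close>. Distributional blocks of tame functions are thus functions.\<close>

lemma box_distr:
 fixes g :: "real^'n::finite => complex"
 assumes s: "(\<lambda>x. of_real (\<sigma> x)) \<in> schwartz" and g: "tame g" and p: "\<phi> \<in> schwartz"
 shows "distr_inv_fourier (distr_mult \<sigma> (distr_fourier (distr_of g))) \<phi> = distr_of (Op (\<lambda>x. of_real (\<sigma> x)) g) \<phi>"
proof -
 define s where "s = (\<lambda>x. cor (\<sigma> x))"
 have sS: "s \<in> schwartz" using s by (simp add: s_def)
 define \<psi> where "\<psi> = inv_fourier \<phi>"
 have \<psi>: "\<psi> = (\<lambda>x. fourier \<phi> (- x))" using inv_fourier_eq[OF p] by (simp add: \<psi>_def)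
 have \<psi>S: "\<psi> \<in> schwartz" unfolding \<psi> by (intro schwartz_reflect schwartz_fourier p)
 have F\<psi>: "fourier \<psi> = \<phi>" unfolding \<psi>
  by (intro ext) (simp add: fourier_reflect[OF schwartz_fourier[OF p]] fourier_inversion[OF p])
 have [measurable]: "g \<in> borelM" "\<phi> \<in> borelM" "fourier s \<in> borelM"
  using g p sS by (auto intro: tame_borel schwartz_borel schwartz_fourier)
 have [measurable]: "fourier (\<lambda>x. s x * \<psi> x) \<in> borelM"
  by (intro schwartz_borel schwartz_fourier schwartz_mult sS \<psi>S)
 obtain A where A: "A > 0" "\<And>x. norm (fourier s x) <= A * wt x ^ 1" using schwartz_bound[OF schwartz_fourier[OF sS]] by blast
 obtain B where B: "B > 0" "\<And>x. norm (\<phi> x) <= B * wt x ^ 2" using schwartz_bound[OF p] by blast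
 have "distr_inv_fourier (distr_mult \<sigma> (distr_fourier (distr_of g))) \<phi> = distr_of g (fourier (\<lambda>x. s x * \<psi> x))"
  by (simp add: distr_inv_fourier_def distr_mult_def distr_fourier_def \<psi>_def s_def)
 also have "... = (LBINT x. g x * fourier (\<lambda>x. s x * \<psi> x) x)"
  unfolding distr_of_def by (rule integral_completion) measurable
 also have "... = (LBINT x. LBINT y. g x * (\<phi> y * fourier s (x - y)))"
  unfolding fourier_mult[OF sS \<psi>S] F\<psi> by simp
 also have "... = (LBINT y. LBINT x. g x * (\<phi> y * fourier s (x - y)))"
 proof (rule integral_swap[where a="\<lambda>x. wt x * norm (g x)" and b="\<lambda>y. A * B * 2 ^ CARD('n) * wt y"])
  show "integrable lborel (\<lambda>x. wt x * norm (g x))" using g by (simp add: tame_def)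
  show "integrable lborel (\<lambda>z. A * B * 2 ^ CARD('n) * wt (z::real^'n))" by (intro integrable_mult_right integrable_wt)
  fix x y :: "real^'n"
  have "norm (fourier s (x - y)) <= A * (2 ^ CARD('n) * wt x / wt y)"
   using wt_add'[of x "-y"] A(1) mult_left_mono[OF wt_add'[of x "-y"], of A] A(2)[of "x - y"] by simp
  then have "norm (g x) * (norm (\<phi> y) * norm (fourier s (x - y))) <= norm (g x) * ((B * wt y ^ 2) * (A * (2 ^ CARD('n) * wt x / wt y)))"
   using A B by (intro mult_mono mult_left_mono) (auto intro!: mult_nonneg_nonneg)
  then show "norm (g x * (\<phi> y * fourier s (x - y))) <= (wt x * norm (g x)) * (A * B * 2 ^ CARD('n) * wt y)"
   by (simp add: norm_mult power2_eq_square mult_ac)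
 qed measurable
 also have "... = (LBINT y. Op s g y * \<phi> y)"
 proof (intro Bochner_Integration.integral_cong refl)
  fix y
  have "(LBINT x. g x * fourier s (x - y)) = Op s g y"
   using integral_shift(1)[of "\<lambda>x. g x * fourier s (x - y)" y] by (simp add: cv_def)
  moreover have "(\<lambda>x. g x * (\<phi> y * fourier s (x - y))) = (\<lambda>x. g x * fourier s (x - y) * \<phi> y)" by (simp add: mult_ac)
  ultimately show "(LBINT x. g x * (\<phi> y * fourier s (x - y))) = Op s g y * \<phi> y" by simp
 qed
 also have "... = distr_of (Op s g) \<phi>"
  unfolding distr_of_def by (rule integral_completion[symmetric]) measurable
 finally show ?thesis by (simp add: s_def)
qed

lemma completion_ex_borel_measurable_complex:
 fixes g :: "'a => complex"
 assumes "g \<in> borel_measurable (completion M)"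
 shows "\<exists>g'\<in>borel_measurable M. AE x in M. g x = g' x"
proof -
 obtain a where a: "a \<in> borel_measurable M" "AE x in M. Re (g x) = a x"
  using completion_ex_borel_measurable_real[of "\<lambda>x. Re (g x)" M] assms by auto
 obtain b where b: "b \<in> borel_measurable M" "AE x in M. Im (g x) = b x"
  using completion_ex_borel_measurable_real[of "\<lambda>x. Im (g x)" M] assms by auto
 have "AE x in M. g x = Complex (a x) (b x)"
  using a(2) b(2) by eventually_elim (simp add: complex_eq_iff)
 moreover have "(\<lambda>x. Complex (a x) (b x)) \<in> borel_measurable M"
  using a b unfolding Complex_eq by measurable
 ultimately show ?thesis by (rule bexI[where x="\<lambda>x. Complex (a x) (b x)"])
qed

lemma distr_Lp_norm_upper:
 assumes "h \<in> borelM" "\<And>\<phi>. \<phi> \<in> schwartz ==> u \<phi> = distr_of h \<phi>"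
 shows "distr_Lp_norm p u <= nrm p h"
proof -
 have "h \<in> borel_measurable lebesgue" using assms(1) by (intro measurable_completion) simp
 then have "distr_Lp_norm p u <= Lp_norm p h"
  unfolding distr_Lp_norm_def using assms(2) by (intro INF_lower) auto
 then show ?thesis by (simp add: Lp_norm_eq[OF assms(1)])
qed

text \<open>The distributional norm is an infimum over all representatives. Since
  \<open>Op t h = h\<close>, testing against translates of \<open>fourier t\<close> recovers every
  value of \<open>h\<close> from any representative \<open>k\<close>, and Young's inequality
  compares the norms.\<close>

lemma distr_Lp_norm_lower:
 fixes h :: "real^'n::finite => complex"
 assumes p: "1 <= p" and h[measurable]: "h \<in> borelM"
  and u: "\<And>\<phi>. \<phi> \<in> schwartz ==> u \<phi> = distr_of h \<phi>"
  and t: "t \<in> schwartz" and rep: "Op t h = h"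
 shows "nrm p h <= (NBINT z. enorm (fourier t z)) * distr_Lp_norm p u"
proof -
 let ?D = "\<integral>\<^sup>+z. enorm (fourier t z) \<partial>lborel"
 have [measurable]: "fourier t \<in> borelM" using t by (intro schwartz_borel schwartz_fourier)
 have D: "?D < \<top>" using schwartz_integrable[OF schwartz_fourier[OF t]] by (simp add: integrable_iff_bounded)
 have "nrm p h <= ?D * Lp_norm p k" 
  if k[measurable]: "k \<in> borel_measurable lebesgue" and ku: "\<And>\<phi>. \<phi> \<in> schwartz ==> u \<phi> = distr_of k \<phi>" for k
 proof -
  obtain k' where k'[measurable]: "k' \<in> borelM" "AE x in lborel. k x = k' x"
   using completion_ex_borel_measurable_complex[OF k] by auto
  have ae: "AE x in lebesgue. k x = k' x" using k'(2) by (rule AE_completion)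
  have k'l: "k' \<in> borel_measurable lebesgue" using k'(1) by (intro measurable_completion) simp
  have "h y = cv (fourier t) k' y" for y
  proof -
   define \<phi> where "\<phi> = (\<lambda>x. fourier t (x - y))"
   have \<phi>: "\<phi> \<in> schwartz" unfolding \<phi>_def by (intro schwartz_translate schwartz_fourier t)
   then have [measurable]: "\<phi> \<in> borelM" by (rule schwartz_borel)
   have "h y = Op t h y" by (simp add: rep)
   also have "... = (LBINT x. h x * \<phi> x)"
    unfolding cv_def \<phi>_def using integral_shift(1)[of "\<lambda>x. h x * fourier t (x - y)" y] by simp
   also have "... = distr_of h \<phi>" unfolding distr_of_def by (rule integral_completion[symmetric]) measurable
   also have "... = distr_of k \<phi>" using u[OF \<phi>] ku[OF \<phi>] by simp
   also have "... = distr_of k' \<phi>" unfolding distr_of_def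
   proof (rule integral_cong_AE)
    have [measurable]: "\<phi> \<in> borel_measurable lebesgue"
     by (intro measurable_completion) (simp add: \<open>\<phi> \<in> borelM\<close>)
    show "(\<lambda>x. k x * \<phi> x) \<in> borel_measurable lebesgue" "(\<lambda>x. k' x * \<phi> x) \<in> borel_measurable lebesgue"
     using k k'l by (auto intro: borel_measurable_times)
   qed (use ae in \<open>auto elim!: eventually_mono\<close>)
   also have "... = (LBINT x. k' x * \<phi> x)" unfolding distr_of_def by (rule integral_completion) measurable
   also have "... = cv (fourier t) k' y"
    unfolding cv_def \<phi>_def using integral_shift(1)[of "\<lambda>x. k' x * fourier t (x - y)" y] by simp
   finally show ?thesis .
  qed
  then have "h = cv (fourier t) k'" by blast
  then have "nrm p h <= ?D * nrm p k'" using nrm_cv[OF p, of k' "fourier t"] by simp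
  also have "nrm p k' = Lp_norm p k"
   using Lp_norm_cong_AE[OF ae k k'l] Lp_norm_eq[OF k'(1)] by simp
  finally show ?thesis .
 qed
 then have le: "nrm p h <= ?D * Lp_norm p k" 
  if "k \<in> {g \<in> borel_measurable lebesgue. \<forall>\<phi>\<in>schwartz. u \<phi> = distr_of g \<phi>}" for k using that by auto
 show ?thesis
 proof (cases "?D = 0")
  case True
  have "h \<in> borel_measurable lebesgue" using h by (intro measurable_completion) simp
  then have "nrm p h <= ?D * Lp_norm p h" using u by (intro le) auto
  then show ?thesis using True by simp
 next
  case False
  have "nrm p h / ?D <= distr_Lp_norm p u"
   unfolding distr_Lp_norm_def
   by (intro INF_greatest divide_le_posI_ennreal le) (use False in \<open>auto simp: zero_less_iff_neq_zero\<close>)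
  then have "?D * (nrm p h / ?D) <= ?D * distr_Lp_norm p u" by (intro mult_left_mono) auto
  moreover have "?D * (nrm p h / ?D) = nrm p h"
   using False D mult_divide_eq_ennreal[of ?D "nrm p h"] by (simp add: ennreal_times_divide mult.commute)
  ultimately show ?thesis by simp
 qed
qed

definition kv :: "int^'n => real^'n::finite" where "kv k = (\<chi> i. of_int (k $ i))"

lemma kv_nth [simp]: "kv k $ i = of_int (k $ i)" by (simp add: kv_def)
lemma kv_0 [simp]: "kv 0 = 0" by (simp add: vec_eq_iff)
lemma kv_diff: "kv (k - l) = kv k - kv l" by (simp add: vec_eq_iff)

lemma Basis_vec_range: "Basis = range (\<lambda>i. axis i (1::real) :: real^'n::finite)"
 by (auto simp: Basis_vec_def)

lemma infnorm_le_cart: "infnorm x <= r \<longleftrightarrow> (\<forall>i. \<bar>x $ i\<bar> <= r)" for x :: "real^'n::finite"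
 unfolding infnorm_Max Basis_vec_range by (subst Max_le_iff) (auto simp: inner_axis)

lemma infnorm_less_cart: "infnorm x < r \<longleftrightarrow> (\<forall>i. \<bar>x $ i\<bar> < r)" for x :: "real^'n::finite"
 unfolding infnorm_Max Basis_vec_range by (subst Max_less_iff) (auto simp: inner_axis)

lemma infnorm_lessD: "infnorm x < r ==> \<bar>x $ i\<bar> < r" for x :: "real^'n::finite"
 using infnorm_less_cart by blast

lemma infnorm_leD: "infnorm x <= r ==> \<bar>x $ i\<bar> <= r" for x :: "real^'n::finite"
 using infnorm_le_cart by blast

lemma finite_int_interval: "finite {m::int. \<bar>a - of_int m\<bar> < R}"
 and card_int_interval: "0 <= R ==> real (card {m::int. \<bar>a - of_int m\<bar> < R}) <= 2 * R + 1"
proof -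
 have sub: "{m::int. \<bar>a - of_int m\<bar> < R} \<subseteq> {\<lfloor>a - R\<rfloor> + 1..\<lceil>a + R\<rceil> - 1}"
 proof
  fix m :: int assume "m \<in> {m. \<bar>a - of_int m\<bar> < R}"
  then have "a - R < of_int m" "of_int m < a + R" by auto
  then show "m \<in> {\<lfloor>a - R\<rfloor> + 1..\<lceil>a + R\<rceil> - 1}" by (simp add: floor_less_iff less_ceiling_iff) linarith
 qed
 show "finite {m::int. \<bar>a - of_int m\<bar> < R}" using finite_subset[OF sub] by simp
 assume R: "0 <= R"
 have "real (card {m::int. \<bar>a - of_int m\<bar> < R}) <= real (card {\<lfloor>a - R\<rfloor> + 1..\<lceil>a + R\<rceil> - 1})"
  using card_mono[OF _ sub] by simp
 also have "... = real (nat (\<lceil>a + R\<rceil> - 1 - \<lfloor>a - R\<rfloor>))" by simp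
 also have "... <= 2 * R + 1"
  using R ceiling_correct[of "a + R"] floor_correct[of "a - R"] by linarith
 finally show "real (card {m::int. \<bar>a - of_int m\<bar> < R}) <= 2 * R + 1" .
qed

lemma finite_int_box: "finite {l::int^'n::finite. infnorm (x - kv l) < R}"
 and card_int_box: "0 <= R ==> real (card {l::int^'n::finite. infnorm (x - kv l) < R}) <= (2 * R + 1) ^ CARD('n)"
proof -
 let ?A = "\<lambda>i. {m::int. \<bar>x $ i - of_int m\<bar> < R}"
 let ?S = "{l::int^'n. infnorm (x - kv l) < R}"
 have sub: "vec_nth ` ?S \<subseteq> Pi\<^sub>E UNIV ?A" by (auto simp: infnorm_less_cart)
 have fP: "finite (Pi\<^sub>E UNIV ?A)" by (intro finite_PiE finite_int_interval) auto
 have inj: "inj_on vec_nth ?S" by (auto simp: inj_on_def vec_nth_inject)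
 show "finite ?S" using finite_subset[OF sub fP] finite_imageD[OF _ inj] by blast
 assume R: "0 <= R"
 have "real (card ?S) = real (card (vec_nth ` ?S))" using card_image[OF inj] by simp
 also have "... <= real (card (Pi\<^sub>E UNIV ?A))" using card_mono[OF fP sub] by simp
 also have "... = (\<Prod>i\<in>UNIV. real (card (?A i)))" by (simp add: card_PiE)
 also have "... <= (\<Prod>i\<in>(UNIV::'n set). 2 * R + 1)" by (intro prod_mono) (auto intro: card_int_interval R)
 also have "... = (2 * R + 1) ^ CARD('n)" by simp
 finally show "real (card ?S) <= (2 * R + 1) ^ CARD('n)" .
qed

text \<open>Turns the unordered sum in the modulation norm into an integral, so that it becomes an
  instance of \<open>lpn\<close>.\<close>

lemma sum_count_space:
 fixes f :: "'a::countable => ennreal"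
 shows "(\<Sum>\<^sub>\<infinity>k. f k) = (\<integral>\<^sup>+k. f k \<partial>count_space UNIV)"
proof (rule antisym)
 let ?t2 = "SUP F\<in>{F. finite F \<and> F \<subseteq> UNIV}. sum f F"
 have "infsum f UNIV = ?t2"
  by (rule nonneg_infsum_complete) auto
 note e = this
 let ?t1 = "\<integral>\<^sup>+k. f k \<partial>count_space UNIV"
 show "infsum f UNIV <= ?t1"
  unfolding e
 proof (intro SUP_least)
  fix F :: "'a set" assume "F \<in> {F. finite F \<and> F \<subseteq> UNIV}"
  then have F: "finite F" by simp
  have "sum f F = (\<integral>\<^sup>+k. f k * indicator F k \<partial>count_space UNIV)"
   using F by (subst nn_integral_count_space'[where A=F]) (auto simp: indicator_def)
  also have "... <= ?t1"
   by (intro nn_integral_mono) (auto simp: indicator_def)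
  finally show "sum f F <= ?t1" .
 qed
 let ?F = "\<lambda>n. {k::'a. to_nat k <= n}"
 have fF: "finite (?F n)" for n
  using finite_vimageI[of "{..n}" to_nat] by (simp add: vimage_def)
 have "?t1 = (\<integral>\<^sup>+k. (SUP n. f k * indicator (?F n) k) \<partial>count_space UNIV)"
 proof (intro nn_integral_cong antisym)
  fix k
  show "f k <= (SUP n. f k * indicator (?F n) k)"
   by (rule SUP_upper2[of "to_nat k"]) auto
  show "(SUP n. f k * indicator (?F n) k) <= f k"
   by (rule SUP_least) (auto simp: indicator_def)
 qed
 also have "... = (SUP n. \<integral>\<^sup>+k. f k * indicator (?F n) k \<partial>count_space UNIV)"
  by (rule nn_integral_monotone_convergence_SUP) (auto simp: incseq_def le_fun_def indicator_def)
 also have "... <= infsum f UNIV"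
  unfolding e
 proof (intro SUP_least)
  fix n
  have "(\<integral>\<^sup>+k. f k * indicator (?F n) k \<partial>count_space UNIV) = sum f (?F n)"
   using fF[of n] by (subst nn_integral_count_space'[where A="?F n"]) (auto simp: indicator_def)
  also have "... <= ?t2"
   by (rule SUP_upper) (simp add: fF)
  finally show "(\<integral>\<^sup>+k. f k * indicator (?F n) k \<partial>count_space UNIV) <= ?t2" .
 qed
 finally show "?t1 <= infsum f UNIV" .
qed

lemma esssup_count_space: "esssup (count_space UNIV) f = (SUP k. f k :: ennreal)"
proof -
 have "esssup (count_space UNIV) f = Inf {z. \<forall>k. f k <= z}"
  by (subst esssup_eq_AE) (auto simp: AE_count_space)
 also have "... = (SUP k. f k)"
  by (intro antisym Inf_lower Inf_greatest) (auto intro: SUP_upper SUP_least)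
 finally show ?thesis .
qed

lemma modulation_norm_eq:
 "modulation_norm \<eta> p q u = lpn (count_space UNIV) q (\<lambda>k. distr_Lp_norm p (box_op \<eta> k u))"
 by (simp add: modulation_norm_def lpn_def esssup_count_space sum_count_space)

section \<open>Windows and blocks as operators on functions\<close>

locale window =
 fixes \<eta> :: "real^'n::finite => real"
 assumes win: "modulation_window \<eta>"
begin

lemma eta_smooth: "smooth \<eta>" and eta_ge: "0 <= \<eta> \<xi>" and eta_le: "\<eta> \<xi> <= 1"
 and eta_1: "infnorm \<xi> <= 1/2 ==> \<eta> \<xi> = 1" and eta_0: "\<not> infnorm \<xi> < 3/4 ==> \<eta> \<xi> = 0"
 using win unfolding modulation_window_def by (auto simp: not_less)

lemma translate_eq: "translate_window \<eta> k \<xi> = \<eta> (\<xi> - kv k)"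
 by (simp add: translate_window_def kv_def)

definition den :: "real^'n => real" where "den \<xi> = (\<Sum>\<^sub>\<infinity>l. \<eta> (\<xi> - kv l))"

lemma sigma_eq: "sigma_window \<eta> k \<xi> = \<eta> (\<xi> - kv k) / den \<xi>"
 by (simp add: sigma_window_def translate_eq den_def)

lemma den_eq:
 assumes "finite L" "\<And>l. infnorm (\<xi> - kv l) < 3/4 ==> l \<in> L"
 shows "den \<xi> = (\<Sum>l\<in>L. \<eta> (\<xi> - kv l))"
proof -
 have "den \<xi> = infsum (\<lambda>l. \<eta> (\<xi> - kv l)) L"
  unfolding den_def by (rule infsum_cong_neutral) (use assms(2) eta_0 in auto)
 then show ?thesis using assms(1) by simp
qed

lemma den_shift: "den (\<xi> - kv k) = den \<xi>"
proof -
 have "bij (\<lambda>l. l + k)" by (rule bij_betwI[of _ _ _ "\<lambda>l. l - k"]) auto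
 then have "(\<Sum>\<^sub>\<infinity>l. \<eta> (\<xi> - kv (l + k))) = (\<Sum>\<^sub>\<infinity>l. \<eta> (\<xi> - kv l))"
  by (rule infsum_reindex_bij_betw[of "\<lambda>l. l + k" UNIV UNIV "\<lambda>l. \<eta> (\<xi> - kv l)"])
 moreover have "\<xi> - kv (l + k) = \<xi> - kv k - kv l" for l by (simp add: vec_eq_iff)
 ultimately show ?thesis by (simp add: den_def)
qed

lemma den_ge_1: "den \<xi> \<ge> 1"
proof -
 let ?L = "{l. infnorm (\<xi> - kv l) < 3/4}"
 \<comment> \<open>Rounding every coordinate finds a lattice point whose window has its plateau over
   \<open>\<xi>\<close>.\<close>
 let ?l = "(\<chi> i. round (\<xi> $ i)) :: int^'n"
 have r: "infnorm (\<xi> - kv ?l) <= 1/2"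
  unfolding infnorm_le_cart using of_int_round_abs_le[where 'a=real] by (auto simp: abs_minus_commute)
 have "1 = \<eta> (\<xi> - kv ?l)" using eta_1[OF r] by simp
 also have "... <= (\<Sum>l\<in>?L. \<eta> (\<xi> - kv l))"
 proof (rule member_le_sum)
  show "?l \<in> ?L" using r by (intro CollectI) linarith
 qed (rule eta_ge finite_int_box)+
 also have "... = den \<xi>" by (rule den_eq[symmetric, OF finite_int_box]) simp
 finally show ?thesis .
qed

definition sg :: "int^'n => real^'n => complex" where "sg k \<xi> = of_real (sigma_window \<eta> k \<xi>)"

lemma sg_translate: "sg k = (\<lambda>\<xi>. sg 0 (\<xi> - kv k))"
 by (intro ext) (simp add: sg_def sigma_eq den_shift)

lemma sigma_ge: "0 <= sigma_window \<eta> k \<xi>" 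
 using den_ge_1[of \<xi>] eta_ge by (simp add: sigma_eq)

lemma sg_0: "\<not> infnorm (\<xi> - kv k) < 3/4 ==> sg k \<xi> = 0"
 by (simp add: sg_def sigma_eq eta_0)

text \<open>Within distance 1/4 of \<open>kv k\<close> no other window is active: a point that is
  also within 3/4 of \<open>kv l\<close> forces all coordinates of k and l to differ by less than
  1.\<close>

lemma sigma_1: assumes k: "infnorm (\<xi> - kv k) <= 1/4" shows "sigma_window \<eta> k \<xi> = 1"
proof -
 have "l \<in> {k}" if l: "infnorm (\<xi> - kv l) < 3/4" for l
 proof -
  have "l $ i = k $ i" for i
  proof -
   have "\<bar>\<xi> $ i - of_int (l $ i)\<bar> < 3/4" "\<bar>\<xi> $ i - of_int (k $ i)\<bar> <= 1/4"
    using infnorm_leD[OF k, of i] infnorm_lessD[OF l, of i] by (simp_all only: vector_minus_component kv_nth)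
   then have "\<bar>real_of_int (l $ i) - real_of_int (k $ i)\<bar> < 1" by linarith
   then have "real_of_int \<bar>l $ i - k $ i\<bar> < 1" by simp
   then show ?thesis by linarith
  qed
  then show ?thesis by (simp add: vec_eq_iff)
 qed
 then have "den \<xi> = (\<Sum>l\<in>{k}. \<eta> (\<xi> - kv l))" by (intro den_eq) auto
 moreover have "\<eta> (\<xi> - kv k) = 1" using k by (intro eta_1) simp
 ultimately show ?thesis by (simp add: sigma_eq)
qed

lemma sg_partition:
 assumes "finite L" "\<And>l. infnorm (\<xi> - kv l) < 3/4 ==> l \<in> L"
 shows "(\<Sum>l\<in>L. sg l \<xi>) = 1"
proof -
 have "(\<Sum>l\<in>L. sigma_window \<eta> l \<xi>) = (\<Sum>l\<in>L. \<eta> (\<xi> - kv l)) / den \<xi>"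
  by (simp add: sigma_eq sum_divide_distrib)
 also have "... = 1" using den_eq[OF assms] den_ge_1[of \<xi>] by simp
 finally show ?thesis by (simp add: sg_def flip: of_real_sum)
qed

lemma norm_gt_infnorm: "norm (\<xi>::real^'n) > real CARD('n) ==> \<not> infnorm \<xi> < 3/4"
proof
 assume a: "norm \<xi> > real CARD('n)" and "infnorm \<xi> < 3/4"
 then have "\<bar>\<xi> $ i\<bar> <= 1" for i using infnorm_lessD[of \<xi> "3/4" i] by linarith
 then have "(\<Sum>i\<in>UNIV. \<bar>\<xi> $ i\<bar>) <= (\<Sum>i\<in>(UNIV::'n set). 1)" by (intro sum_mono)
 then show False using norm_le_l1_cart[of \<xi>] a by simp
qed

lemma eta_schwartz: "(\<lambda>x. cor (\<eta> x)) \<in> schwartz"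
 by (rule schwartz_compact_support[OF eta_smooth, of "real CARD('n)"]) (use norm_gt_infnorm eta_0 in blast)

text \<open>The infinite sum in the denominator is replaced by a globally smooth function that agrees with
 it on the support of the numerator and is bounded below by 1 everywhere.\<close>

lemma sg_0_schwartz: "sg 0 \<in> schwartz"
proof -
 define L where "L = {l::int^'n. infnorm (0 - kv l) < 3/2}"
 have fL: "finite L" unfolding L_def by (rule finite_int_box)
 have L_iff: "l \<in> L \<longleftrightarrow> (\<forall>i. \<bar>l $ i\<bar> <= 1)" for l
 proof -
  have "real_of_int \<bar>l $ i\<bar> < 3/2 \<longleftrightarrow> \<bar>l $ i\<bar> <= 1" for i by linarith
  then show ?thesis unfolding L_def mem_Collect_eq infnorm_less_cart by simp
 qed
 \<comment> \<open>The correction 1 - \<eta>(\<xi>/2) vanishes for |\<xi>| <= 1 in the maximum norm,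
   hence on the support of \<eta>, and equals 1 for |\<xi>| >= 3/2. In between, one of the finitely
   many translates in \<open>L\<close> already has the value 1.\<close>
 define D where "D \<xi> = (\<Sum>l\<in>L. \<eta> (1 *\<^sub>R \<xi> + (- kv l))) + (1 + (-1) * \<eta> ((1/2) *\<^sub>R \<xi> + 0))" for \<xi>
 have sD: "smooth D" unfolding D_def
  by (intro smooth_add smooth_sum smooth_cmult smooth_const smooth_affine eta_smooth)
 have D1: "D \<xi> \<ge> 1" for \<xi>
 proof (cases "infnorm \<xi> <= 3/2")
  case True
  \<comment> \<open>Rounding a coordinate equal to 3/2 or -3/2 may give 2 or -2, outside
    \<open>L\<close>. Clamping to the range from -1 to 1 repairs this and keeps the distance at most
    1/2.\<close>
  let ?l = "(\<chi> i. max (-1) (min 1 (round (\<xi> $ i)))) :: int^'n"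
  have "?l \<in> L" unfolding L_iff by (auto simp: abs_le_iff min_def max_def)
  have "infnorm (\<xi> - kv ?l) <= 1/2" unfolding infnorm_le_cart
  proof
   fix i
   have a: "\<bar>\<xi> $ i\<bar> <= 3/2" by (rule infnorm_leD[OF True])
   have b: "\<bar>of_int (round (\<xi> $ i)) - \<xi> $ i\<bar> <= 1/2" by (rule of_int_round_abs_le)
   then have "\<bar>round (\<xi> $ i)\<bar> <= 2" using a by linarith
   then consider "round (\<xi> $ i) = 2" | "round (\<xi> $ i) = -2" | "\<bar>round (\<xi> $ i)\<bar> <= 1" by linarith
   then have "\<bar>\<xi> $ i - of_int (max (-1) (min 1 (round (\<xi> $ i))))\<bar> <= 1/2"
   proof cases
    case 1
    then have "of_int (round (\<xi> $ i)) = (2::real)" by simp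
    then show ?thesis using a b by (simp add: 1)
   next
    case 2
    then have "of_int (round (\<xi> $ i)) = (-2::real)" by simp
    then show ?thesis using a b by (simp add: 2)
   next
    case 3
    then have "max (-1) (min 1 (round (\<xi> $ i))) = round (\<xi> $ i)" by linarith
    then show ?thesis using b by (simp add: abs_minus_commute)
   qed
   then show "\<bar>(\<xi> - kv ?l) $ i\<bar> <= 1/2" by simp
  qed
  then have "1 = \<eta> (\<xi> - kv ?l)" by (simp add: eta_1)
  also have "... <= (\<Sum>l\<in>L. \<eta> (\<xi> - kv l))"
   by (rule member_le_sum) (use \<open>?l \<in> L\<close> eta_ge fL in auto)
  finally show ?thesis using eta_le[of "(1/2) *\<^sub>R \<xi>"] by (simp add: D_def)
 next
  case False
  have "\<not> infnorm ((1/2) *\<^sub>R \<xi>) < 3/4" using False by (simp add: infnorm_mul)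
  then have "\<eta> ((1/2) *\<^sub>R \<xi>) = 0" by (rule eta_0)
  then show ?thesis using eta_ge by (simp add: D_def sum_nonneg)
 qed
 have eq: "sigma_window \<eta> 0 \<xi> = \<eta> \<xi> * inverse (D \<xi>)" for \<xi>
 proof (cases "infnorm \<xi> < 3/4")
  case True
  have "den \<xi> = (\<Sum>l\<in>L. \<eta> (\<xi> - kv l))"
  proof (rule den_eq[OF fL])
   fix l assume "infnorm (\<xi> - kv l) < 3/4"
   then have a: "\<bar>\<xi> $ i - of_int (l $ i)\<bar> < 3/4" "\<bar>\<xi> $ i\<bar> < 3/4" for i
    using infnorm_lessD[OF True, of i] infnorm_lessD[of "\<xi> - kv l" "3/4" i] by (simp_all only: vector_minus_component kv_nth)
   have "real_of_int \<bar>l $ i\<bar> < real_of_int 2" for i using a[of i] unfolding of_int_abs by linarith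
   then have "\<bar>l $ i\<bar> < 2" for i unfolding of_int_less_iff .
   then have "\<bar>l $ i\<bar> <= 1" for i using \<open>\<And>i. \<bar>l $ i\<bar> < 2\<close>[of i] by linarith
   then show "l \<in> L" unfolding L_iff by blast
  qed
  moreover have "\<eta> ((1/2) *\<^sub>R \<xi>) = 1" using True by (intro eta_1) (simp add: infnorm_mul)
  ultimately have "D \<xi> = den \<xi>" by (simp add: D_def)
  then show ?thesis by (simp add: sigma_eq divide_inverse)
 qed (simp add: sigma_eq eta_0)
 have "D \<xi> \<noteq> 0" for \<xi> using D1[of \<xi>] by linarith
 then have "smooth (\<lambda>\<xi>. \<eta> \<xi> * inverse (D \<xi>))"
  by (intro smooth_mult eta_smooth smooth_inverse sD)
 then have "(\<lambda>\<xi>. cor (\<eta> \<xi> * inverse (D \<xi>))) \<in> schwartz"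
  by (rule schwartz_compact_support[of _ "real CARD('n)"]) (use norm_gt_infnorm eta_0 in auto)
 then show ?thesis unfolding sg_def eq .
qed

lemma sg_schwartz: "sg k \<in> schwartz"
 unfolding sg_translate[of k] by (intro schwartz_translate sg_0_schwartz)

abbreviation B :: "int^'n => (real^'n => complex) => real^'n => complex" where "B k \<equiv> Op (sg k)"

text \<open>A wider window, equal to 1 on the support of \<open>sg k\<close>. Each block is
  therefore reproduced by a kernel whose modulus does not depend on k.\<close>

definition tt :: "int^'n => real^'n => complex" where "tt k \<xi> = of_real (\<eta> ((1/2) *\<^sub>R (\<xi> - kv k)))"

lemma tt_translate: "tt k = (\<lambda>\<xi>. tt 0 (\<xi> - kv k))"
 by (intro ext) (simp add: tt_def)

lemma tt_schwartz: "tt k \<in> schwartz"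
 unfolding tt_translate[of k]
 using schwartz_translate[OF schwartz_dilate[OF eta_schwartz, of "1/2"], of "kv k"] by (simp add: tt_def)

lemma sg_tt: "sg k \<xi> * tt k \<xi> = sg k \<xi>"
proof (cases "infnorm (\<xi> - kv k) < 3/4")
 case True
 then have "\<eta> ((1/2) *\<^sub>R (\<xi> - kv k)) = 1" by (intro eta_1) (simp add: infnorm_mul)
 then show ?thesis by (simp add: tt_def)
qed (simp add: sg_0)

lemma fourier_sg: "fourier (sg k) z = ee (kv k \<bullet> z) * fourier (sg 0) z"
 unfolding sg_translate[of k] by (rule fourier_translate) (intro schwartz_borel sg_0_schwartz)

lemma fourier_tt: "fourier (tt k) z = ee (kv k \<bullet> z) * fourier (tt 0) z"
 unfolding tt_translate[of k] by (rule fourier_translate) (intro schwartz_borel tt_schwartz)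

lemma B_tt: "tame g ==> Op (tt k) (B k g) = B k g"
 by (simp add: Op_Op tt_schwartz sg_schwartz sg_tt)

lemma B_borel: "tame g ==> B k g \<in> borelM"
 by (intro tame_borel tame_cv fourier_wbound sg_schwartz)

lemma box_B: "tame g ==> \<phi> \<in> schwartz ==> box_op \<eta> k (distr_of g) \<phi> = distr_of (B k g) \<phi>"
 unfolding box_op_def sg_def using box_distr[of "sigma_window \<eta> k" g \<phi>] sg_schwartz[of k] 
 by (simp add: sg_def[abs_def])

definition Ct :: ennreal where "Ct = (NBINT z. enorm (fourier (tt 0) z))"

lemma Ct_finite: "Ct < \<top>"
 using schwartz_integrable[OF schwartz_fourier[OF tt_schwartz]] by (simp add: Ct_def integrable_iff_bounded)

lemma box_upper: "tame g ==> distr_Lp_norm p (box_op \<eta> k (distr_of g)) <= nrm p (B k g)"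
 by (intro distr_Lp_norm_upper B_borel box_B)

lemma box_lower:
 assumes "1 <= p" "tame g" shows "nrm p (B k g) <= Ct * distr_Lp_norm p (box_op \<eta> k (distr_of g))"
proof -
 have "Ct = (NBINT z. enorm (fourier (tt k) z))"
  unfolding fourier_tt[of k] Ct_def by (simp add: norm_mult)
 then show ?thesis
  using distr_Lp_norm_lower[OF assms(1) B_borel[OF assms(2)] box_B[OF assms(2)] tt_schwartz B_tt[OF assms(2)]] by simp
qed

text \<open>The modulation norm evaluated on the functions representing the blocks. On tame
  functions it agrees with the distributional norm up to the factor \<open>Ct\<close>, by
  \<open>mnorm_upper\<close> and \<open>mnorm_lower\<close>, and it is the norm used from here
  on.\<close>

definition mnorm :: "ereal => ereal => (real^'n => complex) => ennreal" where
 "mnorm p q g = lpn (count_space UNIV) q (\<lambda>k. nrm p (B k g))"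

lemma mnorm_upper:
 assumes "1 <= q" "tame g" shows "modulation_norm \<eta> p q (distr_of g) <= mnorm p q g"
 unfolding modulation_norm_eq mnorm_def using assms by (intro lpn_mono box_upper) auto

lemma mnorm_lower:
 assumes "1 <= p" "1 <= q" "tame g" shows "mnorm p q g <= Ct * modulation_norm \<eta> p q (distr_of g)"
proof -
 have "mnorm p q g <= lpn (count_space UNIV) q (\<lambda>k. Ct * distr_Lp_norm p (box_op \<eta> k (distr_of g)))"
  unfolding mnorm_def using assms by (intro lpn_mono box_lower) auto
 also have "... <= Ct * modulation_norm \<eta> p q (distr_of g)"
  unfolding modulation_norm_eq using assms by (intro lpn_cmult_le) auto
 finally show ?thesis .
qed

end

section \<open>A Bessel inequality and the analysis estimates\<close>

lemma gauss_le_wt2: "gauss x <= wt (x::real^'n::finite) ^ 2"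
proof -
 have "gauss x = (\<Prod>i\<in>(UNIV::'n set). exp (- pi * (x$i)^2))"
  by (simp add: gauss_def norm_vec_def L2_set_def sum_nonneg sum_distrib_left flip: exp_sum)
 also have "... <= (\<Prod>i\<in>(UNIV::'n set). inverse (1 + (x$i)^2) ^ 2)"
 proof (intro prod_mono conjI)
  fix i
  have "(1 + (x$i)^2)^2 <= (exp ((x$i)^2))^2" by (intro power_mono exp_ge_add_one_self) auto
  also have "... = exp (2 * (x$i)^2)" by (simp add: power2_eq_square exp_add[symmetric])
  also have "... <= exp (pi * (x$i)^2)" using pi_gt3 by (intro iffD2[OF exp_le_cancel_iff] mult_right_mono) auto
  finally have "inverse (exp (pi * (x$i)^2)) <= inverse ((1 + (x$i)^2)^2)"
   by (intro le_imp_inverse_le zero_less_power add_pos_nonneg) auto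
  then show "exp (- pi * (x$i)^2) <= inverse (1 + (x$i)^2) ^ 2" by (simp add: exp_minus power_inverse)
 qed auto
 also have "... = wt x ^ 2" by (simp add: wt_def prod_power_distrib)
 finally show ?thesis .
qed

lemma wbound_of_real:
 assumes [measurable]: "f \<in> borelM" and "\<And>x. \<bar>f x\<bar> <= C * wt x ^ N" "C > 0"
 shows "wbound N (\<lambda>x. cor (f x))"
 unfolding wbound_def using assms by auto

text \<open>Each sample is compared with the integral of \<open>wt\<close> over a unit cube attached
  to it, and these cubes are disjoint. One factor 2^n comes from the lower bound of
  \<open>wt\<close> on the unit cube, the other from \<open>wt_lower\<close>.\<close>

lemma sum_wt_lattice_le:
 fixes x :: "real^'n::finite"
 assumes K: "finite K"
 shows "(\<Sum>k\<in>K. wt (x - kv k)) <= 4 ^ CARD('n) * (LBINT z. wt (z::real^'n))"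
proof -
 let ?n = "CARD('n)"
 define Q where "Q = box (0::real^'n) (\<chi> i. 1)"
 have Qi: "u \<in> Q \<longleftrightarrow> (\<forall>i. 0 < u $ i \<and> u $ i < 1)" for u by (simp add: Q_def mem_box_cart)
 have [measurable]: "Q \<in> sets borel" by (simp add: Q_def)
 have mQ: "emeasure lborel Q = 1" unfolding Q_def
 proof (subst emeasure_lborel_box)
  show "ennreal (\<Prod>b\<in>Basis. ((\<chi> i. 1) - (0::real^'n)) \<bullet> b) = 1"
   unfolding prod_Basis_vec by (simp add: inner_axis)
 qed (auto simp: Basis_vec_def inner_axis)
 have wQ: "wt u \<ge> 1 / 2 ^ ?n" if "u \<in> Q" for u
 proof -
  have "(\<Prod>i\<in>(UNIV::'n set). 1 / 2) <= (\<Prod>i\<in>UNIV. inverse (1 + (u$i)^2))"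
  proof (intro prod_mono conjI)
   fix i
   have "(u$i)^2 <= 1" using that Qi by (simp add: abs_square_le_1 less_imp_le abs_le_iff)
   then show "1 / 2 <= inverse (1 + (u$i)^2)" by (simp add: divide_simps add_pos_nonneg)
  qed simp
  then show ?thesis by (simp add: wt_def power_one_over)
 qed
 have 1: "ennreal (wt (x - kv k)) <= ennreal (4 ^ ?n) * (NBINT v. ennreal (wt v) * indicator Q (v - (x - kv k)))" for k
 proof -
  have "ennreal (wt (x - kv k)) = ennreal (wt (x - kv k)) * emeasure lborel Q" by (simp add: mQ)
  also have "... = (NBINT u. ennreal (wt (x - kv k)) * indicator Q u)"
   by (subst nn_integral_cmult_indicator) auto
  also have "... <= (NBINT u. ennreal (4 ^ ?n) * (ennreal (wt ((x - kv k) + u)) * indicator Q u))"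
  proof (intro nn_integral_mono)
   fix u
   show "ennreal (wt (x - kv k)) * indicator Q u <= ennreal (4 ^ ?n) * (ennreal (wt ((x - kv k) + u)) * indicator Q u)"
   proof (cases "u \<in> Q")
    case True
    have "wt (x - kv k) * (1 / 2 ^ ?n) <= wt (x - kv k) * wt u" using wQ[OF True] by (intro mult_left_mono) auto
    also have "... <= 2 ^ ?n * wt ((x - kv k) + u)" by (rule wt_lower)
    finally have "wt (x - kv k) <= 2 ^ ?n * 2 ^ ?n * wt ((x - kv k) + u)" by (simp add: field_simps)
    also have "2 ^ ?n * 2 ^ ?n = (4::real) ^ ?n" by (simp flip: power_mult_distrib)
    finally show ?thesis using True by (simp add: ennreal_mult[symmetric] ennreal_leI)
   qed simp
  qed
  also have "... = ennreal (4 ^ ?n) * (NBINT u. ennreal (wt ((x - kv k) + u)) * indicator Q u)"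
   by (rule nn_integral_cmult) measurable
  also have "(NBINT u. ennreal (wt ((x - kv k) + u)) * indicator Q u) = (NBINT v. ennreal (wt v) * indicator Q (v - (x - kv k)))"
   using nn_integral_shift(1)[of "\<lambda>v. ennreal (wt v) * indicator Q (v - (x - kv k))" "x - kv k"] by simp
  finally show ?thesis .
 qed
 have "ennreal (\<Sum>k\<in>K. wt (x - kv k)) = (\<Sum>k\<in>K. ennreal (wt (x - kv k)))" by (simp add: sum_ennreal)
 also have "... <= (\<Sum>k\<in>K. ennreal (4 ^ ?n) * (NBINT v. ennreal (wt v) * indicator Q (v - (x - kv k))))"
  by (intro sum_mono 1)
 also have "... = ennreal (4 ^ ?n) * (NBINT v. (\<Sum>k\<in>K. ennreal (wt v) * indicator Q (v - (x - kv k))))"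
  by (subst nn_integral_sum) (auto simp: sum_distrib_left)
 also have "... <= ennreal (4 ^ ?n) * (NBINT v. ennreal (wt (v::real^'n)))"
 proof (intro mult_left_mono nn_integral_mono)
  fix v
  have "k = l" if "v - (x - kv k) \<in> Q" "v - (x - kv l) \<in> Q" for k l
  proof -
   have "k $ i = l $ i" for i
   proof -
    have "0 < v $ i - x $ i + of_int (k $ i)" "v $ i - x $ i + of_int (k $ i) < 1"
     "0 < v $ i - x $ i + of_int (l $ i)" "v $ i - x $ i + of_int (l $ i) < 1"
     using that unfolding Qi by (auto simp: algebra_simps) 
    then have "real_of_int (k $ i) - real_of_int (l $ i) < 1" "real_of_int (l $ i) - real_of_int (k $ i) < 1" by linarith+
    then show ?thesis by linarith
   qed
   then show ?thesis by (simp add: vec_eq_iff)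
  qed
  then have "card {k \<in> K. v - (x - kv k) \<in> Q} <= 1"
   using K by (intro card_le_Suc0_iff_eq[THEN iffD2, unfolded One_nat_def[symmetric]]) auto
  then have "of_nat (card {k \<in> K. v - (x - kv k) \<in> Q}) <= (of_nat 1 :: ennreal)" by (rule of_nat_mono)
  moreover have "(\<Sum>k\<in>K. indicator Q (v - (x - kv k)) :: ennreal) = (\<Sum>k\<in>{k \<in> K. v - (x - kv k) \<in> Q}. 1)"
   by (rule sum.mono_neutral_cong_right) (use K in \<open>auto simp: indicator_def\<close>)
  ultimately have "(\<Sum>k\<in>K. indicator Q (v - (x - kv k)) :: ennreal) <= 1" by simp
  then have "ennreal (wt v) * (\<Sum>k\<in>K. indicator Q (v - (x - kv k))) <= ennreal (wt v) * 1"
   by (intro mult_left_mono) auto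
  then show "(\<Sum>k\<in>K. ennreal (wt v) * indicator Q (v - (x - kv k))) <= ennreal (wt v)"
   by (simp add: sum_distrib_left)
 qed auto
 also have "... = ennreal (4 ^ ?n * (LBINT z. wt (z::real^'n)))"
  by (simp add: nn_integral_eq_integral integrable_wt ennreal_mult integral_nonneg_AE)
 finally show ?thesis
  by (subst (asm) ennreal_le_iff) (auto intro!: mult_nonneg_nonneg integral_nonneg_AE)
qed

text \<open>A weight comparable to \<^const>\<open>wt\<close> from below whose Fourier transform is dominated by
 \<^const>\<open>wt\<close>, so that the exponentials are almost orthogonal with respect to it.\<close>

lemma bessel_weight:
 obtains W c A where "c > 0" "A > 0" "integrable lborel W" "\<And>z::real^'n::finite. c * wt z <= W z"
  "\<And>\<xi>. norm (LBINT z. of_real (W z) * ee (z \<bullet> \<xi>)) <= A * wt (\<xi>::real^'n)"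
proof -
 define A where "A = (LBINT z. wt (z::real^'n))"
 have A: "A > 0"
 proof -
  obtain W' where "W' > 0" "(NBINT z. ennreal (wt (z::real^'n))) = ennreal W'" by (rule nn_integral_wt)
  then show ?thesis using nn_integral_eq_integral[OF integrable_wt[where 'n='n]] by (simp add: A_def)
 qed
 \<comment> \<open>Convolution with the Gaussian multiplies the transforms: that of
   \<open>wt\<close> is bounded by its integral \<open>A\<close>, and that of the Gaussian supplies
   the decay.\<close>
 define W where "W z = (LBINT u. wt (z + u) * gauss (u::real^'n))" for z
 have ig: "integrable lborel (\<lambda>u::real^'n. wt u * gauss u)"
  by (rule Bochner_Integration.integrable_bound[OF integrable_gauss[where 'n='n]])
    (auto simp: abs_mult mult_le_cancel_right1 less_imp_le intro!: mult_left_le_one_le)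
 define c where "c = (LBINT u. wt u * gauss (u::real^'n)) / 2 ^ CARD('n)"
 have "(LBINT u. wt u * gauss (u::real^'n)) \<noteq> 0"
 proof
  assume "(LBINT u. wt u * gauss (u::real^'n)) = 0"
  then have "AE u in (lborel :: (real^'n) measure). wt u * gauss u = 0"
   using integral_nonneg_eq_0_iff_AE[OF ig] by (auto simp: less_imp_le)
  then have "AE u in (lborel :: (real^'n) measure). gauss u = 0" by eventually_elim simp
  then have "(LBINT u. gauss (u::real^'n)) = (LINT u|(lborel :: (real^'n) measure). 0)" by (intro integral_cong_AE) auto
  then show False by (simp add: integral_gauss)
 qed
 moreover have "(LBINT u. wt u * gauss (u::real^'n)) \<ge> 0" by (intro integral_nonneg_AE) (auto simp: less_imp_le)
 ultimately have c: "c > 0" by (simp add: c_def)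
 have is1: "integrable lborel (\<lambda>u::real^'n. wt (z + u) * gauss u)" for z
  by (rule Bochner_Integration.integrable_bound[OF integrable_gauss[where 'n='n]])
    (auto simp: abs_mult less_imp_le intro!: mult_left_le_one_le)
 have lower: "c * wt z <= W z" for z
 proof -
  have "c * wt z = (LBINT u. (wt z / 2 ^ CARD('n)) * (wt u * gauss (u::real^'n)))" by (simp add: c_def)
  also have "... <= W z" unfolding W_def
  proof (rule integral_mono[OF integrable_mult_right[OF ig] is1])
   fix u :: "real^'n"
   have "wt z * wt u / 2 ^ CARD('n) <= wt (z + u)" using wt_lower[of z u] by (simp add: field_simps)
   from mult_right_mono[OF this, of "gauss u"] show "(wt z / 2 ^ CARD('n)) * (wt u * gauss u) <= wt (z + u) * gauss u"
    by (simp add: less_imp_le)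
  qed
  finally show ?thesis .
 qed
 have ww: "wbound 1 (\<lambda>x::real^'n. cor (wt x))" by (rule wbound_of_real[where C=1]) auto
 have wg: "wbound 2 (\<lambda>x::real^'n. cor (gauss x))"
  by (rule wbound_of_real[where C=1]) (auto simp: less_imp_le gauss_le_wt2)
 have Wcv: "cor (W z) = cv (\<lambda>x. of_real (gauss x)) (\<lambda>x. of_real (wt x)) z" for z
  by (simp add: W_def cv_def flip: of_real_mult)
 have iW: "integrable lborel W"
  using wbound_integrable[OF wbound_cv[OF ww wg]] unfolding Wcv[symmetric] by (simp only: complex_of_real_integrable_eq)
 have F: "norm (LBINT z. of_real (W z) * ee (z \<bullet> \<xi>)) <= A * wt \<xi>" for \<xi> :: "real^'n"
 proof -
  have "(LBINT z. of_real (W z) * ee (z \<bullet> \<xi>)) = (LBINT z. LBINT u. of_real (wt (z + u) * gauss u) * ee (z \<bullet> \<xi>))"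
   by (simp only: W_def integral_complex_of_real[symmetric] integral_mult_left_zero)
  also have "... = (LBINT z. LBINT v. of_real (wt v * gauss (v - z)) * ee (z \<bullet> \<xi>))"
  proof (rule Bochner_Integration.integral_cong[OF refl])
   fix z
   show "(LBINT u. cor (wt (z + u) * gauss u) * ee (z \<bullet> \<xi>)) = (LBINT v. of_real (wt v * gauss (v - z)) * ee (z \<bullet> \<xi>))"
    using integral_shift(1)[of "\<lambda>v. cor (wt v * gauss (v - z)) * ee (z \<bullet> \<xi>)" z] by simp
  qed
  also have "... = (LBINT v. LBINT z. of_real (wt v * gauss (v - z)) * ee (z \<bullet> \<xi>))"
  proof -
   have "integrable (lborel \<Otimes>\<^sub>M lborel) (\<lambda>(v, z). cor (wt v * gauss (v - z)) * ee (z \<bullet> \<xi>))"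
   proof (rule lborel_pair.Fubini_integrable)
    have "integrable lborel (\<lambda>v. A' * wt (v::real^'n))" for A' by (intro integrable_mult_right integrable_wt)
    moreover have "(LBINT z. norm (case (v, z) of (v, z) => cor (wt v * gauss (v - z)) * ee (z \<bullet> \<xi>))) = 1 * wt v" for v
     using integral_shift(3)[of "gauss :: real^'n => real" v] by (simp add: norm_mult abs_mult less_imp_le integral_gauss)
    ultimately show "integrable lborel (\<lambda>v. LBINT z. norm (case (v, z) of (v, z) => cor (wt v * gauss (v - z)) * ee (z \<bullet> \<xi>)))"
     by presburger
    have "integrable lborel (\<lambda>z. cor (wt v * gauss (v - z)) * ee (z \<bullet> \<xi>))" for v
     using integrable_shift(3)[OF integrable_gauss[where 'n='n], of v]
     by (intro integrable_times_ee integrable_of_real integrable_mult_right)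
    then show "AE v in lborel. integrable lborel (\<lambda>z. case (v, z) of (v, z) => cor (wt v * gauss (v - z)) * ee (z \<bullet> \<xi>))" by simp
   qed measurable
   from lborel_pair.Fubini_integral[OF this] show ?thesis by simp
  qed
  also have "... = (LBINT v. of_real (wt v) * (ee (v \<bullet> \<xi>) * of_real (gauss \<xi>)))"
  proof (intro Bochner_Integration.integral_cong refl)
   fix v :: "real^'n"
   have "(LBINT z. of_real (wt v * gauss (v - z)) * ee (z \<bullet> \<xi>)) = (LBINT u. of_real (wt v * gauss u) * ee ((v - u) \<bullet> \<xi>))"
    using integral_shift(3)[of "\<lambda>z. cor (wt v * gauss (v - z)) * ee (z \<bullet> \<xi>)" v] by simp
   also have "... = (LBINT u. of_real (wt v) * ee (v \<bullet> \<xi>) * (of_real (gauss u) * ee (u \<bullet> (- \<xi>))))"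
    by (intro Bochner_Integration.integral_cong refl) (simp add: inner_diff_left ee_add[of "v \<bullet> \<xi>" "- (_ \<bullet> \<xi>)", simplified])
   also have "... = of_real (wt v) * ee (v \<bullet> \<xi>) * (LBINT u. of_real (gauss u) * ee (u \<bullet> (- \<xi>)))"
    by (rule integral_mult_right_zero)
   also have "... = of_real (wt v) * (ee (v \<bullet> \<xi>) * of_real (gauss \<xi>))" by (subst gauss_fourier(2)) simp
   finally show "(LBINT z. of_real (wt v * gauss (v - z)) * ee (z \<bullet> \<xi>)) = of_real (wt v) * (ee (v \<bullet> \<xi>) * of_real (gauss \<xi>))" .
  qed
  also have "norm ... <= (LBINT v. wt (v::real^'n) * gauss \<xi>)"
   by (rule order_trans[OF integral_norm_bound]) (simp add: norm_mult less_imp_le)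
  also have "... = A * gauss \<xi>" by (simp add: A_def)
  also have "... <= A * wt \<xi>"
   using A by (intro mult_left_mono order_trans[OF gauss_le_wt2 wt_power_le1]) auto
  finally show ?thesis .
 qed
 show ?thesis by (rule that[OF c A iW lower F])
qed

text \<open>By duality the square sum S is the integral of \<open>G\<close> against the
  trigonometric polynomial with coefficients conjugate to those of \<open>G\<close>. A Schur test
  bounds the weighted square norm of this polynomial by a multiple of S, and Cauchy-Schwarz in
  additive form absorbs S/2.\<close>

lemma bessel:
 "\<exists>C>0. \<forall>K (G::real^'n::finite => complex). finite K --> G \<in> borelM -->
   ennreal (\<Sum>k\<in>K. norm (LBINT z. G z * ee (kv k \<bullet> z)) ^ 2) <= ennreal C * (NBINT z. ennreal (norm (G z) ^ 2 / wt z))"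
proof -
 obtain W c A where W: "c > 0" "A > 0" "integrable lborel W" "\<And>z::real^'n. c * wt z <= W z"
  "\<And>\<xi>. norm (LBINT z. of_real (W z) * ee (z \<bullet> \<xi>)) <= A * wt (\<xi>::real^'n)" by (rule bessel_weight, rule that)
 define L where "L = 4 ^ CARD('n) * (LBINT z. wt (z::real^'n)) + 1"
 have L: "L > 0" unfolding L_def by (intro add_nonneg_pos mult_nonneg_nonneg integral_nonneg_AE) auto
 have W0: "W z > 0" for z using W(4)[of z] mult_pos_pos[OF W(1) wt_pos[of z]] by linarith
 have [measurable]: "W \<in> borelM" using W(3) by auto
 define C where "C = A * L / c"
 have C: "C > 0" using W L by (simp add: C_def)
 have "ennreal (\<Sum>k\<in>K. norm (LBINT z. G z * ee (kv k \<bullet> z)) ^ 2) <= ennreal C * (NBINT z. ennreal (norm (G z) ^ 2 / wt z))"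
  if K: "finite K" and [measurable]: "G \<in> borelM" for K and G :: "real^'n => complex"
 proof (rule ennreal_le_of_finite)
  assume "ennreal C * (NBINT z. ennreal (norm (G z) ^ 2 / wt z)) < \<top>"
  then have fin: "(NBINT z. ennreal (norm (G z) ^ 2 / wt z)) < \<top>" using C by (auto simp: ennreal_mult_less_top)
  then have iQ: "integrable lborel (\<lambda>z. norm (G z) ^ 2 / wt z)" by (simp add: integrable_iff_bounded)
  define Q where "Q = (LBINT z. norm (G z) ^ 2 / wt z)"
  have eQ: "(NBINT z. ennreal (norm (G z) ^ 2 / wt z)) = ennreal Q"
   unfolding Q_def by (rule nn_integral_eq_integral[OF iQ]) auto
  have iG: "integrable lborel G"
  proof (rule Bochner_Integration.integrable_bound[OF Bochner_Integration.integrable_add[OF iQ integrable_wt]])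
   have "norm (G z) <= norm (G z) ^ 2 / wt z + wt z" for z
   proof -
    have "0 <= (norm (G z) - wt z)^2 + norm (G z) * wt z" by (auto intro!: add_nonneg_nonneg mult_nonneg_nonneg)
    then have "norm (G z) * wt z <= norm (G z) ^ 2 + wt z ^ 2" by (simp add: power2_diff mult.commute)
    then show ?thesis by (simp add: field_simps power2_eq_square)
   qed
   then show "AE z in lborel. norm (G z) <= norm (norm (G z) ^ 2 / wt z + wt z)"
    by (intro AE_I2) (auto intro: order_trans[OF _ abs_ge_self])
  qed measurable
  define a where "a k = (LBINT z. G z * ee (kv k \<bullet> z))" for k
  define S where "S = (\<Sum>k\<in>K. norm (a k) ^ 2)"
  \<comment> \<open>The extremal polynomial: pairing it with \<open>G\<close> gives exactly the
    square sum.\<close>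
  define P where "P z = (\<Sum>k\<in>K. cnj (a k) * ee (kv k \<bullet> z))" for z :: "real^'n"
  have [measurable]: "P \<in> borelM" unfolding P_def by measurable
  have Pb: "norm (P z) <= (\<Sum>k\<in>K. norm (a k))" for z
   unfolding P_def by (rule order_trans[OF norm_sum]) (simp add: norm_mult)
  have ie: "integrable lborel (\<lambda>z. G z * ee (kv k \<bullet> z))" for k
   using integrable_times_ee[OF iG, of "kv k"] by (simp add: inner_commute)
  have "cor S = (\<Sum>k\<in>K. a k * cnj (a k))"
   by (simp add: S_def complex_norm_square del: of_real_power)
  also have "... = (\<Sum>k\<in>K. LBINT z. (G z * ee (kv k \<bullet> z)) * cnj (a k))"
   by (simp add: a_def)
  also have "... = (LBINT z. (\<Sum>k\<in>K. (G z * ee (kv k \<bullet> z)) * cnj (a k)))"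
   by (rule Bochner_Integration.integral_sum[symmetric]) (intro integrable_mult_left ie)
  also have "... = (LBINT z. G z * P z)"
   by (simp add: P_def sum_distrib_left mult_ac)
  finally have SG: "cor S = (LBINT z. G z * P z)" .
  have S0: "S \<ge> 0" by (simp add: S_def sum_nonneg)
  have iPW: "integrable lborel (\<lambda>z. norm (P z) ^ 2 * W z)"
  proof (rule Bochner_Integration.integrable_bound[OF integrable_mult_right[OF W(3), of "(\<Sum>k\<in>K. norm (a k)) ^ 2"]])
   show "AE z in lborel. norm (norm (P z) ^ 2 * W z) <= norm ((\<Sum>k\<in>K. norm (a k)) ^ 2 * W z)"
    using W0 Pb by (intro AE_I2) (auto simp: abs_mult less_imp_le sum_nonneg intro!: mult_right_mono power_mono)
  qed measurable
  have PW: "(LBINT z. norm (P z) ^ 2 * W z) <= A * L * S"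
  proof -
   have iWe: "integrable lborel (\<lambda>z. of_real (W z) * ee (z \<bullet> \<xi>))" for \<xi>
    using W(3) by (intro integrable_times_ee integrable_of_real)
   have "cor (LBINT z. norm (P z) ^ 2 * W z) = (LBINT z. (P z * cnj (P z)) * of_real (W z))"
    by (simp only: integral_complex_of_real[symmetric] of_real_mult complex_norm_square)
   also have "(\<lambda>z. (P z * cnj (P z)) * of_real (W z)) =
     (\<lambda>z. \<Sum>k\<in>K. \<Sum>l\<in>K. (cnj (a k) * a l) * (of_real (W z) * ee (z \<bullet> (kv k - kv l))))"
   proof
    fix z :: "real^'n"
    have "ee (z \<bullet> (kv k - kv l)) = ee (kv k \<bullet> z) * ee (- (kv l \<bullet> z))" for k l
     by (simp add: inner_diff_right inner_commute flip: ee_add)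
    note e = this
    have c: "cnj (P z) = (\<Sum>l\<in>K. a l * ee (- (kv l \<bullet> z)))" by (simp add: P_def cnj_ee)
    show "(P z * cnj (P z)) * of_real (W z) = (\<Sum>k\<in>K. \<Sum>l\<in>K. (cnj (a k) * a l) * (of_real (W z) * ee (z \<bullet> (kv k - kv l))))"
     unfolding c unfolding P_def sum_product sum_distrib_right
     by (intro sum.cong refl) (simp add: e mult_ac sum_distrib_left)
   qed
   also have "(LBINT z. (\<Sum>k\<in>K. \<Sum>l\<in>K. (cnj (a k) * a l) * (of_real (W z) * ee (z \<bullet> (kv k - kv l))))) =
    (\<Sum>k\<in>K. \<Sum>l\<in>K. (cnj (a k) * a l) * (LBINT z. of_real (W z) * ee (z \<bullet> (kv k - kv l))))"
    by (subst Bochner_Integration.integral_sum, intro Bochner_Integration.integrable_sum integrable_mult_right iWe,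
      subst Bochner_Integration.integral_sum, intro integrable_mult_right iWe) simp
   finally have eq: "cor (LBINT z. norm (P z) ^ 2 * W z) = (\<Sum>k\<in>K. \<Sum>l\<in>K. (cnj (a k) * a l) * (LBINT z. of_real (W z) * ee (z \<bullet> (kv k - kv l))))" .
   have "(LBINT z. norm (P z) ^ 2 * W z) <= norm (cor (LBINT z. norm (P z) ^ 2 * W z))" by simp
   also have "... <= (\<Sum>k\<in>K. \<Sum>l\<in>K. (norm (a k) * norm (a l)) * (A * wt (kv k - kv l)))"
    unfolding eq by (intro order_trans[OF norm_sum] sum_mono) (auto simp: norm_mult intro!: mult_left_mono W(5))
   \<comment> \<open>Schur's test: after symmetrising the products, every row of the matrix
     \<open>wt (kv k - kv l)\<close> has sum at most \<open>L\<close>.\<close>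
   also have "... <= (\<Sum>k\<in>K. \<Sum>l\<in>K. ((norm (a k) ^ 2 + norm (a l) ^ 2) / 2) * (A * wt (kv k - kv l)))"
   proof (intro sum_mono mult_right_mono)
    fix k l
    show "norm (a k) * norm (a l) <= (norm (a k) ^ 2 + norm (a l) ^ 2) / 2"
     using zero_le_power2[of "norm (a k) - norm (a l)"] by (simp add: power2_diff)
   qed (use W in auto)
   also have "... = (\<Sum>k\<in>K. \<Sum>l\<in>K. norm (a k) ^ 2 / 2 * A * wt (kv k - kv l)) + (\<Sum>k\<in>K. \<Sum>l\<in>K. norm (a l) ^ 2 / 2 * A * wt (kv k - kv l))"
    by (simp add: sum.distrib[symmetric] algebra_simps add_divide_distrib)
   also have "(\<Sum>k\<in>K. \<Sum>l\<in>K. norm (a l) ^ 2 / 2 * A * wt (kv k - kv l)) = (\<Sum>k\<in>K. \<Sum>l\<in>K. norm (a k) ^ 2 / 2 * A * wt (kv k - kv l))"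
    by (subst sum.swap) (simp add: wt_diff_commute)
   also have "(\<Sum>k\<in>K. \<Sum>l\<in>K. norm (a k) ^ 2 / 2 * A * wt (kv k - kv l)) <= (\<Sum>k\<in>K. norm (a k) ^ 2 / 2 * A * L)"
   proof (intro sum_mono)
    fix k
    have "(\<Sum>l\<in>K. wt (kv k - kv l)) <= L" using sum_wt_lattice_le[OF K, of "kv k"] by (simp add: L_def)
    then have "norm (a k) ^ 2 / 2 * A * (\<Sum>l\<in>K. wt (kv k - kv l)) <= norm (a k) ^ 2 / 2 * A * L"
     using W by (intro mult_left_mono) auto
    then show "(\<Sum>l\<in>K. norm (a k) ^ 2 / 2 * A * wt (kv k - kv l)) <= norm (a k) ^ 2 / 2 * A * L"
     by (simp add: sum_distrib_left)
   qed
   also have "(\<Sum>k\<in>K. norm (a k) ^ 2 / 2 * A * L) = A * L * S / 2"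
    by (simp add: S_def sum_distrib_left sum_divide_distrib mult_ac)
   finally show ?thesis by simp
  qed
  \<comment> \<open>With this parameter the polynomial part of the arithmetic-geometric inequality
    is at most S/2.\<close>
  define t where "t = A * L"
  have t: "t > 0" using W L by (simp add: t_def)
  have "S <= norm (cor S)" by simp
  also have "... <= (LBINT z. t / (2 * c) * (norm (G z) ^ 2 / wt z) + 1 / (2 * t) * (norm (P z) ^ 2 * W z))"
   unfolding SG
  proof (rule Bochner_Integration.integral_norm_bound_integral)
   show "integrable lborel (\<lambda>z. t / (2 * c) * (norm (G z) ^ 2 / wt z) + 1 / (2 * t) * (norm (P z) ^ 2 * W z))"
    by (intro Bochner_Integration.integrable_add integrable_mult_right iQ iPW)
   show "integrable lborel (\<lambda>z. G z * P z)"
    by (rule Bochner_Integration.integrable_bound[OF integrable_mult_right[OF integrable_norm[OF iG], of "\<Sum>k\<in>K. norm (a k)"]])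
      (use Pb in \<open>auto simp: norm_mult abs_mult sum_nonneg mult.commute intro!: AE_I2 mult_left_mono\<close>)
   fix z
   have "norm (G z) * norm (P z) <= t / 2 * (norm (G z) ^ 2 / W z) + 1 / (2 * t) * (norm (P z) ^ 2 * W z)"
   proof -
    have "0 <= (t * norm (G z) - norm (P z) * W z) ^ 2 / (2 * t * W z)" using t W0[of z] by simp
    also have "... = t / 2 * (norm (G z) ^ 2 / W z) + 1 / (2 * t) * (norm (P z) ^ 2 * W z) - norm (G z) * norm (P z)"
     using t W0[of z] by (simp add: power2_diff field_simps power2_eq_square)
    finally show ?thesis by simp
   qed
   moreover have "norm (G z) ^ 2 / W z <= norm (G z) ^ 2 / (c * wt z)"
    using W(4)[of z] W0[of z] W(1) by (intro divide_left_mono) auto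
   then have "t / 2 * (norm (G z) ^ 2 / W z) <= t / 2 * (norm (G z) ^ 2 / (c * wt z))" using t by (intro mult_left_mono) auto
   ultimately show "norm (G z * P z) <= t / (2 * c) * (norm (G z) ^ 2 / wt z) + 1 / (2 * t) * (norm (P z) ^ 2 * W z)"
    by (simp add: norm_mult mult_ac)
  qed
  also have "... = t / (2 * c) * Q + 1 / (2 * t) * (LBINT z. norm (P z) ^ 2 * W z)"
   unfolding Q_def
   by (subst Bochner_Integration.integral_add[OF integrable_mult_right[OF iQ] integrable_mult_right[OF iPW]])
     (simp only: integral_mult_right_zero)
  also have "... <= t / (2 * c) * Q + 1 / (2 * t) * (A * L * S)"
   using PW t by (intro add_left_mono mult_left_mono) auto
  also have "1 / (2 * t) * (A * L * S) = S / 2" using W L by (simp add: t_def)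
  finally have "S <= C * Q" by (simp add: C_def t_def)
  moreover have "Q \<ge> 0" unfolding Q_def by (intro integral_nonneg_AE) auto
  ultimately show "ennreal (\<Sum>k\<in>K. norm (LBINT z. G z * ee (kv k \<bullet> z)) ^ 2) <= ennreal C * (NBINT z. ennreal (norm (G z) ^ 2 / wt z))"
   unfolding eQ S_def a_def using C by (simp add: ennreal_mult[symmetric] ennreal_leI)
 qed
 then show ?thesis using C by blast
qed

text \<open>The r-th power of \<open>nrm\<close>; it adds up over disjoint sets and over blocks, so
  roots are postponed to the very end.\<close>

definition Ip :: "real => (real^'n::finite => complex) => ennreal" where
 "Ip r g = (NBINT x. enn_powr (enorm (g x)) r)"

lemma Ip_nrm: "1 <= r ==> Ip r g = enn_powr (nrm (ereal r) g) r"
 by (simp add: Ip_def lpn_real)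

lemma nrm_Ip: "nrm (ereal r) g = enn_powr (Ip r g) (1 / r)"
 by (simp add: Ip_def lpn_real)

text \<open>All blocks come from one kernel by modulation. At a fixed x their values are Fourier
  integrals of the single function h(x + z) \<kappa>(z) sampled on the lattice, which is what
  Bessel's inequality controls.\<close>

abbreviation mod_cv :: "(real^'n::finite => complex) => int^'n => (real^'n => complex) => real^'n => complex" where
 "mod_cv \<kappa> k \<equiv> cv (\<lambda>z. ee (kv k \<bullet> z) * \<kappa> z)"

lemma sum_powr_le: "(\<Sum>k\<in>K. a k powr s) <= (\<Sum>k\<in>K. a k) powr s" if "1 <= s" "\<And>k. k \<in> K ==> 0 <= a k" for a :: "'b => real"
proof (cases "finite K")
 case True
 let ?S = "\<Sum>k\<in>K. a k"
 have S: "?S \<ge> 0" using that by (simp add: sum_nonneg)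
 have le: "a k <= ?S" if "k \<in> K" for k using that \<open>\<And>k. k \<in> K ==> 0 <= a k\<close> True by (intro member_le_sum) auto
 have "(\<Sum>k\<in>K. a k powr s) <= (\<Sum>k\<in>K. a k * ?S powr (s - 1))"
 proof (rule sum_mono)
  fix k assume k: "k \<in> K"
  show "a k powr s <= a k * ?S powr (s - 1)"
  proof (cases "a k = 0")
   case False
   then have "a k powr s = a k * a k powr (s - 1)" using that(2)[OF k] by (simp add: powr_mult_base)
   also have "... <= a k * ?S powr (s - 1)" using that k le by (intro mult_left_mono powr_mono2) auto
   finally show ?thesis .
  qed (use S in simp)
 qed
 also have "... = ?S * ?S powr (s - 1)" by (simp add: sum_distrib_right)
 also have "... = ?S powr s" using S by (cases "?S = 0") (simp_all add: powr_mult_base)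
 finally show ?thesis .
qed auto

lemma sum_powr_jensen:
 fixes a :: "'b => real"
 assumes K: "finite K" "card K > 0" and s: "1 <= s" and a: "\<And>k. k \<in> K ==> 0 <= a k"
 shows "(\<Sum>k\<in>K. a k) powr s <= real (card K) powr (s - 1) * (\<Sum>k\<in>K. a k powr s)"
proof -
 have "enn_powr (\<integral>\<^sup>+k. ennreal (a k) \<partial>count_space K) s <= ennreal (real (card K) powr (s - 1)) * (\<integral>\<^sup>+k. enn_powr (ennreal (a k)) s \<partial>count_space K)"
  by (rule jensen_powr) (use K s in \<open>auto simp: ennreal_of_nat_eq_real_of_nat\<close>)
 moreover have "(\<integral>\<^sup>+k. ennreal (a k) \<partial>count_space K) = ennreal (\<Sum>k\<in>K. a k)"
  using K a by (simp add: nn_integral_count_space_finite sum_ennreal)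
 moreover have "(\<integral>\<^sup>+k. enn_powr (ennreal (a k)) s \<partial>count_space K) = ennreal (\<Sum>k\<in>K. a k powr s)"
  using K a by (simp add: nn_integral_count_space_finite enn_powr_ennreal sum_ennreal)
 ultimately show ?thesis using a
  by (simp add: enn_powr_ennreal sum_nonneg ennreal_mult[symmetric])
qed

lemma sum_powr_le_card:
 fixes a :: "'b => real"
 assumes K: "finite K" and s: "0 < s" "s <= 1" and a: "\<And>k. k \<in> K ==> 0 <= a k"
 shows "(\<Sum>k\<in>K. a k powr s) <= real (card K) powr (1 - s) * (\<Sum>k\<in>K. a k) powr s"
proof (cases "card K > 0")
 case True
 have "(\<Sum>k\<in>K. a k powr s) = ((\<Sum>k\<in>K. a k powr s) powr (1/s)) powr s"
  using s by (simp add: powr_powr sum_nonneg)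
 also have "... <= (real (card K) powr (1/s - 1) * (\<Sum>k\<in>K. (a k powr s) powr (1/s))) powr s"
  using s K True by (intro powr_mono2 sum_powr_jensen) (auto simp: field_simps)
 also have "(\<Sum>k\<in>K. (a k powr s) powr (1/s)) = (\<Sum>k\<in>K. a k)"
  using s a by (intro sum.cong refl) (simp add: powr_powr)
 also have "(real (card K) powr (1/s - 1) * (\<Sum>k\<in>K. a k)) powr s = real (card K) powr (1 - s) * (\<Sum>k\<in>K. a k) powr s"
  using s a by (simp add: powr_mult sum_nonneg powr_powr algebra_simps)
 finally show ?thesis .
qed (use K in auto)

text \<open>Squaring the kernel bound produces four powers of \<open>wt\<close> and the weight in
  \<open>bessel\<close> consumes one, whence the exponent 3.\<close>

lemma bessel_mod_cv:
 assumes \<kappa>: "wbound 2 \<kappa>"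
 shows "\<exists>C>0. \<forall>K (h::real^'n::finite => complex) x. finite K --> h \<in> borelM -->
   ennreal (\<Sum>k\<in>K. norm (mod_cv \<kappa> k h x) ^ 2) <= ennreal C * (NBINT z. ennreal (norm (h (x + z)) ^ 2 * wt z ^ 3))"
proof -
 obtain A where A: "A > 0" "\<And>x. norm (\<kappa> x) <= A * wt x ^ 2" using \<kappa> wboundE by blast
 have [measurable]: "\<kappa> \<in> borelM" using \<kappa> by (rule wbound_borel)
 obtain C where C: "C > 0" "\<And>K (G::real^'n => complex). finite K ==> G \<in> borelM ==>
   ennreal (\<Sum>k\<in>K. norm (LBINT z. G z * ee (kv k \<bullet> z)) ^ 2) <= ennreal C * (NBINT z. ennreal (norm (G z) ^ 2 / wt z))"
  using bessel[where 'n='n] by auto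
 have "ennreal (\<Sum>k\<in>K. norm (mod_cv \<kappa> k h x) ^ 2) <= ennreal (C * A^2) * (NBINT z. ennreal (norm (h (x + z)) ^ 2 * wt z ^ 3))"
  if K: "finite K" and [measurable]: "h \<in> borelM" for K and h :: "real^'n => complex" and x
 proof -
  have "mod_cv \<kappa> k h x = (LBINT z. (h (x + z) * \<kappa> z) * ee (kv k \<bullet> z))" for k
   by (simp add: cv_def mult_ac)
  then have "ennreal (\<Sum>k\<in>K. norm (mod_cv \<kappa> k h x) ^ 2) <= ennreal C * (NBINT z. ennreal (norm (h (x + z) * \<kappa> z) ^ 2 / wt z))"
   using C(2)[OF K, of "\<lambda>z. h (x + z) * \<kappa> z"] by simp
  also have "... <= ennreal C * (NBINT z. ennreal (A^2) * ennreal (norm (h (x + z)) ^ 2 * wt z ^ 3))"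
  proof (intro mult_left_mono nn_integral_mono)
   fix z
   have "norm (\<kappa> z) ^ 2 <= (A * wt z ^ 2) ^ 2" using A by (intro power_mono) auto
   then have "norm (\<kappa> z) ^ 2 / wt z <= A ^ 2 * wt z ^ 3"
    by (simp add: field_simps power_mult_distrib flip: power_mult power_Suc2) (simp add: eval_nat_numeral mult_ac)
   then have "norm (h (x + z)) ^ 2 * (norm (\<kappa> z) ^ 2 / wt z) <= norm (h (x + z)) ^ 2 * (A ^ 2 * wt z ^ 3)"
    by (intro mult_left_mono) auto
   then show "ennreal (norm (h (x + z) * \<kappa> z) ^ 2 / wt z) <= ennreal (A^2) * ennreal (norm (h (x + z)) ^ 2 * wt z ^ 3)"
    by (simp add: ennreal_mult[symmetric] norm_mult power_mult_distrib mult_ac ennreal_leI)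
  qed auto
  also have "... = ennreal (C * A^2) * (NBINT z. ennreal (norm (h (x + z)) ^ 2 * wt z ^ 3))"
   using C(1) by (subst nn_integral_cmult) (auto simp: ennreal_mult mult.assoc)
  finally show ?thesis .
 qed
 moreover have "C * A^2 > 0" using A C by simp
 ultimately show ?thesis by blast
qed

lemma jensen_wt:
 "\<exists>C>0. \<forall>F::real^'n::finite => ennreal. F \<in> borelM -->
   enn_powr (NBINT z. F z * ennreal (wt z)) s <= ennreal C * (NBINT z. enn_powr (F z) s * ennreal (wt z))"
 if s: "1 <= s"
proof -
 obtain W where W: "W > 0" "(NBINT z. ennreal (wt (z::real^'n))) = ennreal W" by (rule nn_integral_wt)
 let ?N = "density lborel (\<lambda>z::real^'n. ennreal (wt z))"
 have "enn_powr (NBINT z. F z * ennreal (wt z)) s <= ennreal (W powr (s - 1)) * (NBINT z. enn_powr (F z) s * ennreal (wt z))"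
  if [measurable]: "F \<in> borelM" for F :: "real^'n => ennreal"
 proof -
  have "enn_powr (\<integral>\<^sup>+z. F z \<partial>?N) s <= ennreal (W powr (s - 1)) * (\<integral>\<^sup>+z. enn_powr (F z) s \<partial>?N)"
   by (rule jensen_powr) (use s W in \<open>auto simp: emeasure_density\<close>)
  then show ?thesis by (simp add: nn_integral_density mult.commute)
 qed
 then show ?thesis using W by (intro exI[of _ "W powr (s - 1)"]) auto
qed

lemma wt_conv_integral:
 fixes g :: "real^'n::finite => complex"
 assumes [measurable]: "g \<in> borelM"
 shows "(NBINT x. (NBINT z. enn_powr (enorm (g (x + z))) r * ennreal (wt z))) =
  Ip r g * (NBINT z. ennreal (wt (z::real^'n)))"
proof -
 have "(NBINT x. (NBINT z. enn_powr (enorm (g (x + z))) r * ennreal (wt z))) =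
  (NBINT z. (NBINT x. enn_powr (enorm (g (x + z))) r * ennreal (wt z)))"
  by (rule lborel_pair.Fubini'[symmetric]) measurable
 also have "... = (NBINT z. Ip r g * ennreal (wt (z::real^'n)))"
 proof (intro nn_integral_cong)
  fix z :: "real^'n"
  have "(NBINT x. enn_powr (enorm (g (x + z))) r * ennreal (wt z)) = (NBINT x. enn_powr (enorm (g (x + z))) r) * ennreal (wt z)"
   by (rule nn_integral_multc) measurable
  also have "(NBINT x. enn_powr (enorm (g (x + z))) r) = Ip r g"
   unfolding Ip_def by (rule nn_integral_shift(2)[of "\<lambda>x. enn_powr (enorm (g x)) r"]) measurable
  finally show "(NBINT x. enn_powr (enorm (g (x + z))) r * ennreal (wt z)) = Ip r g * ennreal (wt z)" .
 qed
 also have "... = Ip r g * (NBINT z. ennreal (wt (z::real^'n)))" by (rule nn_integral_cmult) measurable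
 finally show ?thesis .
qed

lemma enn_powr_norm: "enn_powr (enorm x) r = ennreal (norm x powr r)"
 by (simp add: enn_powr_ennreal)

text \<open>For r >= 2 the l^r sum over the frequencies is dominated by the l^2 sum. Bessel at each
  x, Jensen with exponent r/2 and integration over x then give a bound independent of the number of
  frequencies.\<close>

lemma analysis_ge_2:
 fixes \<kappa> :: "real^'n::finite => complex"
 assumes \<kappa>: "wbound 2 \<kappa>" and r: "2 <= r"
 shows "\<exists>C>0. \<forall>K h. finite K --> h \<in> borelM --> (\<Sum>k\<in>K. Ip r (mod_cv \<kappa> k h)) <= ennreal C * Ip r h"
proof -
 have [measurable]: "\<kappa> \<in> borelM" using \<kappa> by (rule wbound_borel)
 obtain B where B: "B > 0" "\<And>K (h::real^'n => complex) x. finite K ==> h \<in> borelM ==>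
   ennreal (\<Sum>k\<in>K. norm (mod_cv \<kappa> k h x) ^ 2) <= ennreal B * (NBINT z. ennreal (norm (h (x + z)) ^ 2 * wt z ^ 3))"
  using bessel_mod_cv[OF \<kappa>] by auto
 define s where "s = r / 2"
 have s: "1 <= s" using r by (simp add: s_def)
 obtain J where J: "J > 0" "\<And>F::real^'n => ennreal. F \<in> borelM ==>
   enn_powr (NBINT z. F z * ennreal (wt z)) s <= ennreal J * (NBINT z. enn_powr (F z) s * ennreal (wt z))"
  using jensen_wt[OF s, where 'n='n] by auto
 obtain W where W: "W > 0" "(NBINT z. ennreal (wt (z::real^'n))) = ennreal W" by (rule nn_integral_wt)
 define C where "C = B powr s * J * W"
 have "(\<Sum>k\<in>K. Ip r (mod_cv \<kappa> k h)) <= ennreal C * Ip r h"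
  if K: "finite K" and [measurable]: "h \<in> borelM" for K and h :: "real^'n => complex"
 proof -
  have "(\<Sum>k\<in>K. Ip r (mod_cv \<kappa> k h)) = (NBINT x. (\<Sum>k\<in>K. enn_powr (enorm (mod_cv \<kappa> k h x)) r))"
   unfolding Ip_def by (rule nn_integral_sum[symmetric]) measurable
  also have "... <= (NBINT x. ennreal (B powr s * J) * (NBINT z. enn_powr (enorm (h (x + z))) r * ennreal (wt z)))"
  proof (rule nn_integral_mono)
   fix x
   have "(\<Sum>k\<in>K. enn_powr (enorm (mod_cv \<kappa> k h x)) r) = ennreal (\<Sum>k\<in>K. (norm (mod_cv \<kappa> k h x) ^ 2) powr s)"
    by (simp add: enn_powr_norm sum_ennreal s_def powr_powr flip: powr_numeral)
   also have "... <= ennreal ((\<Sum>k\<in>K. norm (mod_cv \<kappa> k h x) ^ 2) powr s)"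
    by (intro ennreal_leI sum_powr_le s) auto
   also have "... = enn_powr (ennreal (\<Sum>k\<in>K. norm (mod_cv \<kappa> k h x) ^ 2)) s"
    by (simp add: enn_powr_ennreal sum_nonneg)
   also have "... <= enn_powr (ennreal B * (NBINT z. ennreal (norm (h (x + z)) ^ 2 * wt z ^ 3))) s"
    using s by (intro enn_powr_mono B K) auto
   also have "... <= enn_powr (ennreal B * (NBINT z. ennreal (norm (h (x + z)) ^ 2) * ennreal (wt z))) s"
   proof (intro enn_powr_mono mult_left_mono nn_integral_mono)
    fix z
    have "norm (h (x + z)) ^ 2 * wt z ^ 3 <= norm (h (x + z)) ^ 2 * wt z"
     by (intro mult_left_mono wt_power_le1) auto
    then show "ennreal (norm (h (x + z)) ^ 2 * wt z ^ 3) <= ennreal (norm (h (x + z)) ^ 2) * ennreal (wt z)"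
     by (simp add: ennreal_mult[symmetric] ennreal_leI)
   qed (use s in auto)
   also have "... = ennreal (B powr s) * enn_powr (NBINT z. ennreal (norm (h (x + z)) ^ 2) * ennreal (wt z)) s"
    using B by (simp add: enn_powr_mult enn_powr_ennreal)
   also have "... <= ennreal (B powr s) * (ennreal J * (NBINT z. enn_powr (ennreal (norm (h (x + z)) ^ 2)) s * ennreal (wt z)))"
    by (intro mult_left_mono J) auto
   also have "... = ennreal (B powr s * J) * (NBINT z. enn_powr (enorm (h (x + z))) r * ennreal (wt z))"
   proof -
    have "enn_powr (ennreal (norm (h (x + z)) ^ 2)) s = enn_powr (enorm (h (x + z))) r" for z
     by (simp add: enn_powr_ennreal s_def powr_powr flip: powr_numeral)
    then show ?thesis using J(1) by (simp add: ennreal_mult mult.assoc)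
   qed
   finally show "(\<Sum>k\<in>K. enn_powr (enorm (mod_cv \<kappa> k h x)) r) \<le>
    ennreal (B powr s * J) * (NBINT z. enn_powr (enorm (h (x + z))) r * ennreal (wt z))" .
  qed
  also have "... = ennreal (B powr s * J) * (Ip r h * ennreal W)"
   by (subst nn_integral_cmult) (auto simp: wt_conv_integral W)
  also have "... = ennreal C * Ip r h" using B J W by (simp add: C_def ennreal_mult mult_ac)
  finally show ?thesis .
 qed
 moreover have "C > 0" using B J W by (simp add: C_def)
 ultimately show ?thesis by blast
qed

lemma enn_interpolate: "0 <= s ==> s <= 1 ==> enn_powr a (1 - s) * enn_powr b s <= a + b"
proof -
 assume s: "0 <= s" "s <= 1"
 let ?m = "max a b"
 have "enn_powr a (1 - s) * enn_powr b s <= enn_powr ?m (1 - s) * enn_powr ?m s"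
  using s by (intro mult_mono enn_powr_mono) auto
 also have "... = ?m"
  by (cases ?m) (auto simp: enn_powr_ennreal ennreal_mult[symmetric] powr_add[symmetric] ennreal_top_mult simp del: max_def)
 also have "?m <= a + b" by (simp add: max_def add_increasing add_increasing2)
 finally show ?thesis .
qed

text \<open>For exponents below 2 the analysis operators lose a power of the number of frequencies and
 gain from local constancy of \<open>h\<close>, expressed by the domination hypothesis on \<open>h\<close>.\<close>

lemma analysis_lt_2:
 fixes \<kappa> :: "real^'n::finite => complex"
 assumes \<kappa>: "wbound 2 \<kappa>" and r: "1 <= r" "r < 2"
 shows "\<exists>C>0. \<forall>K h g M. finite K --> h \<in> borelM --> g \<in> borelM --> M > 0 -->
  (\<forall>z. enn_powr (enorm (h z)) r <= ennreal M * (NBINT u. enn_powr (enorm (g (z + u))) r * ennreal (wt u))) -->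
  (\<Sum>k\<in>K. Ip r (mod_cv \<kappa> k h)) <= ennreal (C * (real (card K) * M) powr (1 - r / 2)) * (Ip r g + Ip r h)"
proof -
 have [measurable]: "\<kappa> \<in> borelM" using \<kappa> by (rule wbound_borel)
 obtain B where B: "B > 0" "\<And>K (h::real^'n => complex) x. finite K ==> h \<in> borelM ==>
   ennreal (\<Sum>k\<in>K. norm (mod_cv \<kappa> k h x) ^ 2) <= ennreal B * (NBINT z. ennreal (norm (h (x + z)) ^ 2 * wt z ^ 3))"
  using bessel_mod_cv[OF \<kappa>] by auto
 define s where "s = r / 2"
 have s: "0 < s" "s < 1" using r by (auto simp: s_def)
 \<comment> \<open>Chosen so that r + r e = 2: the square of |h| splits into |h|^r, which is
   integrated, and the e-th power of |h|^r, which the domination hypothesis bounds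
   pointwise.\<close>
 define e where "e = (2 - r) / r"
 have e: "0 < e" "e <= 1" "e * s = 1 - s" "r + r * e = 2" using r by (auto simp: e_def s_def field_simps)
 obtain W where W: "W > 0" "(NBINT z. ennreal (wt (z::real^'n))) = ennreal W" by (rule nn_integral_wt)
 let ?n = "CARD('n)"
 define C where "C = B powr s * (2 ^ ?n) powr (1 - s) * W"
 have "(\<Sum>k\<in>K. Ip r (mod_cv \<kappa> k h)) <= ennreal (C * (real (card K) * M) powr (1 - r / 2)) * (Ip r g + Ip r h)"
  if K: "finite K" and [measurable]: "h \<in> borelM" "g \<in> borelM" and M: "M > 0"
   and dom: "\<And>z. enn_powr (enorm (h z)) r <= ennreal M * (NBINT u. enn_powr (enorm (g (z + u))) r * ennreal (wt u))"
  for K M and h g :: "real^'n => complex"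
 proof -
  define G where "G x = (NBINT u. enn_powr (enorm (g (x + u))) r * ennreal (wt u))" for x
  define H where "H x = (NBINT u. enn_powr (enorm (h (x + u))) r * ennreal (wt u))" for x
  have [measurable]: "G \<in> borelM" "H \<in> borelM" unfolding G_def H_def by measurable
  have iG: "(NBINT x. G x) = Ip r g * ennreal W" unfolding G_def by (subst wt_conv_integral) (auto simp: W)
  have iH: "(NBINT x. H x) = Ip r h * ennreal W" unfolding H_def by (subst wt_conv_integral) (auto simp: W)
  have Gshift: "G (x + z) * ennreal (wt z) <= ennreal (2 ^ ?n) * G x" for x z
  proof -
   have "G (x + z) = (NBINT v. enn_powr (enorm (g (x + v))) r * ennreal (wt (v - z)))"
    unfolding G_def using nn_integral_shift(1)[of "\<lambda>v. enn_powr (enorm (g (x + v))) r * ennreal (wt (v - z))" z]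
    by (simp add: add.assoc)
   then have "G (x + z) * ennreal (wt z) = (NBINT v. enn_powr (enorm (g (x + v))) r * ennreal (wt (v - z)) * ennreal (wt z))"
    by (simp add: nn_integral_multc)
   also have "... <= (NBINT v. ennreal (2 ^ ?n) * (enn_powr (enorm (g (x + v))) r * ennreal (wt v)))"
   proof (intro nn_integral_mono)
    fix v
    have "wt (v - z) * wt z <= 2 ^ ?n * wt v" using wt_add[of v "- z"] by simp
    then have "ennreal (wt (v - z)) * ennreal (wt z) <= ennreal (2 ^ ?n) * ennreal (wt v)"
     by (simp add: ennreal_mult[symmetric] ennreal_leI)
    from mult_left_mono[OF this, of "enn_powr (enorm (g (x + v))) r"]
    show "enn_powr (enorm (g (x + v))) r * ennreal (wt (v - z)) * ennreal (wt z) <= ennreal (2 ^ ?n) * (enn_powr (enorm (g (x + v))) r * ennreal (wt v))"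
     by (simp add: mult_ac)
   qed
   also have "... = ennreal (2 ^ ?n) * G x" unfolding G_def by (rule nn_integral_cmult) measurable
   finally show ?thesis .
  qed
  have h2: "ennreal (norm (h (x + z)) ^ 2 * wt z ^ 3) <= enn_powr (ennreal (M * 2 ^ ?n) * G x) e * (enn_powr (enorm (h (x + z))) r * ennreal (wt z))" for x z
  proof -
   have "ennreal (norm (h (x + z)) ^ 2) = enn_powr (enorm (h (x + z))) r * enn_powr (enn_powr (enorm (h (x + z))) r) e"
    using e(4) by (simp add: enn_powr_powr enn_powr_ennreal ennreal_mult[symmetric] powr_add[symmetric] powr_powr)
   also have "... <= enn_powr (enorm (h (x + z))) r * enn_powr (ennreal M * G (x + z)) e"
    using e dom[of "x + z"] unfolding G_def by (intro mult_left_mono enn_powr_mono) auto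
   finally have 1: "ennreal (norm (h (x + z)) ^ 2) <= enn_powr (enorm (h (x + z))) r * enn_powr (ennreal M * G (x + z)) e" .
   have "wt z <= wt z powr e" using powr_mono'[of e 1 "wt z"] e by simp
   then have "ennreal (wt z) <= enn_powr (ennreal (wt z)) e" by (simp add: enn_powr_ennreal ennreal_leI)
   then have "enn_powr (ennreal M * G (x + z)) e * ennreal (wt z) <= enn_powr (ennreal M * G (x + z)) e * enn_powr (ennreal (wt z)) e"
    by (intro mult_left_mono) auto
   also have "... = enn_powr (ennreal M * (G (x + z) * ennreal (wt z))) e" by (simp add: enn_powr_mult mult_ac)
   also have "... <= enn_powr (ennreal M * (ennreal (2 ^ ?n) * G x)) e"
    using e by (intro enn_powr_mono mult_left_mono Gshift) auto
   also have "... = enn_powr (ennreal (M * 2 ^ ?n) * G x) e" using M by (simp add: ennreal_mult mult.assoc)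
   finally have 2: "enn_powr (ennreal M * G (x + z)) e * ennreal (wt z) <= enn_powr (ennreal (M * 2 ^ ?n) * G x) e" .
   \<comment> \<open>Of the two powers kept, one pays for moving the local average \<open>G\<close>
     from x + z to x, the other is the weight inside \<open>H\<close>.\<close>
   have "wt z ^ 3 <= wt z ^ 2" by (rule wt_power_le) simp
   then have "ennreal (norm (h (x + z)) ^ 2 * wt z ^ 3) <= ennreal (norm (h (x + z)) ^ 2) * (ennreal (wt z) * ennreal (wt z))"
    by (simp add: ennreal_mult[symmetric] ennreal_leI mult_left_mono power2_eq_square)
   also have "... <= (enn_powr (enorm (h (x + z))) r * enn_powr (ennreal M * G (x + z)) e) * (ennreal (wt z) * ennreal (wt z))"
    by (intro mult_right_mono 1) auto
   also have "... = (enn_powr (ennreal M * G (x + z)) e * ennreal (wt z)) * (enn_powr (enorm (h (x + z))) r * ennreal (wt z))"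
    by (simp add: mult_ac)
   also have "... <= enn_powr (ennreal (M * 2 ^ ?n) * G x) e * (enn_powr (enorm (h (x + z))) r * ennreal (wt z))"
    by (intro mult_right_mono 2) auto
   finally show ?thesis .
  qed
  let ?t1 = "B powr s * (M * 2 ^ ?n) powr (1 - s)"
  define c where "c = real (card K) powr (1 - s) * ?t1"
  have c0: "c \<ge> 0" by (simp add: c_def)
  have pt: "(\<Sum>k\<in>K. enn_powr (enorm (mod_cv \<kappa> k h x)) r) <= ennreal c * (G x + H x)" for x
  proof -
   let ?t2 = "\<Sum>k\<in>K. norm (mod_cv \<kappa> k h x) ^ 2"
   have "(\<Sum>k\<in>K. enn_powr (enorm (mod_cv \<kappa> k h x)) r) = ennreal (\<Sum>k\<in>K. (norm (mod_cv \<kappa> k h x) ^ 2) powr s)"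
    by (simp add: enn_powr_norm sum_ennreal s_def powr_powr flip: powr_numeral)
   also have "... <= ennreal (real (card K) powr (1 - s) * ?t2 powr s)"
    by (intro ennreal_leI sum_powr_le_card K) (use s in auto)
   also have "... = ennreal (real (card K) powr (1 - s)) * enn_powr (ennreal ?t2) s"
    by (simp add: enn_powr_ennreal sum_nonneg ennreal_mult)
   also have "enn_powr (ennreal ?t2) s <= enn_powr (ennreal B * (NBINT z. ennreal (norm (h (x + z)) ^ 2 * wt z ^ 3))) s"
    using s by (intro enn_powr_mono B K) auto
   also have "... <= enn_powr (ennreal B * (NBINT z. enn_powr (ennreal (M * 2 ^ ?n) * G x) e * (enn_powr (enorm (h (x + z))) r * ennreal (wt z)))) s"
    using s by (intro enn_powr_mono mult_left_mono nn_integral_mono h2) auto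
   also have "(NBINT z. enn_powr (ennreal (M * 2 ^ ?n) * G x) e * (enn_powr (enorm (h (x + z))) r * ennreal (wt z))) = enn_powr (ennreal (M * 2 ^ ?n) * G x) e * H x"
    unfolding H_def by (rule nn_integral_cmult) measurable
   also have "enn_powr (ennreal B * (enn_powr (ennreal (M * 2 ^ ?n) * G x) e * H x)) s = ennreal ?t1 * (enn_powr (G x) (1 - s) * enn_powr (H x) s)"
   proof -
    have "enn_powr (enn_powr (ennreal (M * 2 ^ ?n) * G x) e) s = ennreal ((M * 2 ^ ?n) powr (1 - s)) * enn_powr (G x) (1 - s)"
    proof -
     have "enn_powr (enn_powr (ennreal (M * 2 ^ ?n) * G x) e) s = enn_powr (ennreal (M * 2 ^ ?n) * G x) (1 - s)"
      by (simp only: enn_powr_powr e(3))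
     also have "... = ennreal ((M * 2 ^ ?n) powr (1 - s)) * enn_powr (G x) (1 - s)"
      by (subst enn_powr_mult, subst enn_powr_ennreal) (use M in auto)
     finally show ?thesis .
    qed
    moreover have "ennreal ?t1 = ennreal (B powr s) * ennreal ((M * 2 ^ ?n) powr (1 - s))"
     by (rule ennreal_mult) auto
    moreover have "enn_powr (ennreal B) s = ennreal (B powr s)" using B(1) by (simp add: enn_powr_ennreal)
    ultimately show ?thesis by (simp only: enn_powr_mult mult_ac)
   qed
   also have "... <= ennreal ?t1 * (G x + H x)"
    using s by (intro mult_left_mono enn_interpolate) auto
   finally show ?thesis by (simp add: mult_left_mono c_def ennreal_mult mult.assoc)
  qed
  have "(\<Sum>k\<in>K. Ip r (mod_cv \<kappa> k h)) = (NBINT x. (\<Sum>k\<in>K. enn_powr (enorm (mod_cv \<kappa> k h x)) r))"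
   unfolding Ip_def by (rule nn_integral_sum[symmetric]) measurable
  also have "... <= (NBINT x. ennreal c * (G x + H x))" by (intro nn_integral_mono pt)
  also have "... = ennreal c * (ennreal W * (Ip r g + Ip r h))"
   by (simp add: nn_integral_cmult nn_integral_add iG iH distrib_left distrib_right mult.commute)
  also have "... = ennreal (c * W) * (Ip r g + Ip r h)" using c0 W by (simp add: ennreal_mult mult.assoc)
  also have "c * W = C * (real (card K) * M) powr (1 - r / 2)"
   using M by (simp add: c_def C_def s_def powr_mult mult_ac)
  finally show ?thesis .
 qed
 moreover have "C > 0" using B W by (simp add: C_def)
 ultimately show ?thesis by blast
qed

section \<open>Dilations\<close>

abbreviation dil :: "real => (real^'n::finite => complex) => real^'n => complex" where
 "dil c f \<equiv> (\<lambda>x. f (c *\<^sub>R x))"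

lemma Op_fourier:
 assumes "m \<in> schwartz" "\<kappa> \<in> schwartz"
 shows "Op m (fourier \<kappa>) = fourier (\<lambda>\<xi>. m (- \<xi>) * \<kappa> \<xi>)"
proof
 fix y
 have [measurable]: "fourier m \<in> borelM" "fourier \<kappa> \<in> borelM"
  using assms schwartz_fourier schwartz_borel by blast+
 have "fourier (\<lambda>\<xi>. m (- \<xi>) * \<kappa> \<xi>) y = (LBINT x. fourier \<kappa> x * fourier (\<lambda>\<xi>. m (- \<xi>)) (y - x))"
  by (rule fourier_mult[OF schwartz_reflect[OF assms(1)] assms(2)])
 also have "... = (LBINT x. fourier \<kappa> x * fourier m (x - y))"
  by (simp add: fourier_reflect[OF assms(1)])
 also have "... = Op m (fourier \<kappa>) y"
  using integral_shift(1)[of "\<lambda>x. fourier \<kappa> x * fourier m (x - y)" y] by (simp add: cv_def)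
 finally show "Op m (fourier \<kappa>) y = fourier (\<lambda>\<xi>. m (- \<xi>) * \<kappa> \<xi>) y" by simp
qed

lemma schwartz_fourier_image: assumes "f \<in> schwartz" obtains \<kappa> where "\<kappa> \<in> schwartz" "f = fourier \<kappa>"
proof (rule that)
 show "(\<lambda>x. fourier f (- x)) \<in> schwartz" by (intro schwartz_reflect schwartz_fourier assms)
 show "f = fourier (\<lambda>x. fourier f (- x))"
  by (intro ext) (simp add: fourier_reflect[OF schwartz_fourier[OF assms]] fourier_inversion[OF assms])
qed

lemma Op_schwartz: assumes "m \<in> schwartz" "f \<in> schwartz" shows "Op m f \<in> schwartz"
proof -
 obtain \<kappa> where "\<kappa> \<in> schwartz" "f = fourier \<kappa>" using schwartz_fourier_image[OF assms(2)] .
 then show ?thesis by (simp add: Op_fourier assms schwartz_fourier schwartz_mult schwartz_reflect)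
qed

lemma Ip_dil:
 fixes g :: "real^'n::finite => complex"
 assumes [measurable]: "g \<in> borelM" and c: "c > 0"
 shows "Ip r (dil c g) = ennreal (inverse (c ^ CARD('n))) * Ip r g"
proof -
 have "Ip r g = ennreal (c ^ CARD('n)) * Ip r (dil c g)"
  unfolding Ip_def using nn_integral_affine[of "\<lambda>x. enn_powr (enorm (g x)) r" c 0] c by simp
 then have "ennreal (inverse (c ^ CARD('n))) * Ip r g = (ennreal (inverse (c ^ CARD('n))) * ennreal (c ^ CARD('n))) * Ip r (dil c g)"
  by (simp add: mult.assoc)
 also have "... = Ip r (dil c g)" using c by (simp add: ennreal_mult[symmetric])
 finally show ?thesis by simp
qed

lemma Ip_cv:
 fixes g :: "real^'n::finite => complex"
 assumes r: "1 <= r" and "g \<in> borelM" "K \<in> borelM"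
 shows "Ip r (cv K g) <= enn_powr (NBINT z. enorm (K z)) r * Ip r g"
proof -
 have "enn_powr (nrm (ereal r) (cv K g)) r <= enn_powr ((NBINT z. enorm (K z)) * nrm (ereal r) g) r"
  using r assms by (intro enn_powr_mono nrm_cv) auto
 then show ?thesis using r by (simp add: enn_powr_mult Ip_nrm)
qed

lemma Ip_finite:
 fixes g :: "real^'n::finite => complex"
 assumes r: "1 <= r" and g: "wbound 1 g" shows "Ip r g < \<top>"
proof -
 obtain C where C: "C > 0" "\<And>x. norm (g x) <= C * wt x ^ 1" using g wboundE by blast
 obtain W where W: "W > 0" "(NBINT z. ennreal (wt (z::real^'n))) = ennreal W" by (rule nn_integral_wt)
 have "Ip r g <= (NBINT x. ennreal (C powr r) * ennreal (wt (x::real^'n)))"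
  unfolding Ip_def
 proof (intro nn_integral_mono)
  fix x
  have "norm (g x) powr r <= (C * wt x) powr r" using r C by (intro powr_mono2) auto
  also have "... = C powr r * wt x powr r" using C by (simp add: powr_mult)
  also have "... <= C powr r * wt x" using powr_mono'[of 1 r "wt x"] r by (intro mult_left_mono) auto
  finally show "enn_powr (enorm (g x)) r <= ennreal (C powr r) * ennreal (wt x)"
   by (simp add: enn_powr_norm ennreal_mult[symmetric] ennreal_leI)
 qed
 also have "... = ennreal (C powr r) * ennreal W" by (simp add: nn_integral_cmult W)
 also have "... < \<top>" by (simp add: ennreal_mult_less_top)
 finally show ?thesis .
qed

text \<open>A function reproduced by a kernel of unit width becomes, after dilation by \<open>c\<close>, locally
 constant at scale \<open>1/c\<close>.\<close>

lemma dil_dominated: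
 assumes r: "1 <= r" and A: "A > 0"
 shows "\<exists>M>0. \<forall>c (u :: real^'n::finite => complex) K. 1 <= c --> u \<in> borelM --> K \<in> borelM -->
  (\<forall>z. norm (K z) <= A * wt z) --> cv K u = u -->
  (\<forall>z. enn_powr (enorm (dil c u z)) r <= ennreal (M * c ^ CARD('n)) * (NBINT v. enn_powr (enorm (dil c u (z + v))) r * ennreal (wt v)))"
proof -
 obtain J where J: "J > 0" "\<And>F::real^'n => ennreal. F \<in> borelM ==>
   enn_powr (NBINT z. F z * ennreal (wt z)) r <= ennreal J * (NBINT z. enn_powr (F z) r * ennreal (wt z))"
  using jensen_wt[OF r, where 'n='n] by auto
 let ?n = "CARD('n)"
 define M where "M = A powr r * J"
 have "enn_powr (enorm (dil c u z)) r <= ennreal (M * c ^ ?n) * (NBINT v. enn_powr (enorm (dil c u (z + v))) r * ennreal (wt v))"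
  if c: "1 <= c" and [measurable]: "u \<in> borelM" "K \<in> borelM" 
  and K: "\<And>z. norm (K z) <= A * wt z" and rep: "cv K u = u" for c K z and u :: "real^'n => complex"
 proof -
  have c0: "c > 0" using c by simp
  let ?t1 = "NBINT v. enorm (u (c *\<^sub>R z + v)) * ennreal (wt v)"
  have "enorm (u (c *\<^sub>R z)) = enorm (cv K u (c *\<^sub>R z))" by (simp add: rep)
  also have "... <= (NBINT v. enorm (u (c *\<^sub>R z + v) * K v))" unfolding cv_def by (rule norm_integral_le)
  also have "... <= (NBINT v. ennreal A * (enorm (u (c *\<^sub>R z + v)) * ennreal (wt v)))"
  proof (intro nn_integral_mono)
   fix v
   have "norm (u (c *\<^sub>R z + v)) * norm (K v) <= norm (u (c *\<^sub>R z + v)) * (A * wt v)" by (intro mult_left_mono K) auto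
   then show "enorm (u (c *\<^sub>R z + v) * K v) <= ennreal A * (enorm (u (c *\<^sub>R z + v)) * ennreal (wt v))"
    using A by (simp add: norm_mult ennreal_mult[symmetric] mult_ac ennreal_leI)
  qed
  also have "... = ennreal A * ?t1" by (rule nn_integral_cmult) measurable
  finally have "enn_powr (enorm (u (c *\<^sub>R z))) r <= enn_powr (ennreal A * ?t1) r"
   using r by (intro enn_powr_mono) auto
  also have "... = ennreal (A powr r) * enn_powr ?t1 r"
   using A by (simp add: enn_powr_mult enn_powr_ennreal)
  also have "... <= ennreal (A powr r) * (ennreal J * (NBINT v. enn_powr (enorm (u (c *\<^sub>R z + v))) r * ennreal (wt v)))"
   by (intro mult_left_mono J) auto
  also have "(NBINT v. enn_powr (enorm (u (c *\<^sub>R z + v))) r * ennreal (wt v)) =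
    ennreal (c ^ ?n) * (NBINT v. enn_powr (enorm (u (c *\<^sub>R z + c *\<^sub>R v))) r * ennreal (wt (c *\<^sub>R v)))"
   using nn_integral_affine[of "\<lambda>v. enn_powr (enorm (u (c *\<^sub>R z + v))) r * ennreal (wt v)" c 0] c0 by simp
  also have "(NBINT v. enn_powr (enorm (u (c *\<^sub>R z + c *\<^sub>R v))) r * ennreal (wt (c *\<^sub>R v))) \<le>
    (NBINT v. enn_powr (enorm (dil c u (z + v))) r * ennreal (wt v))"
   using c by (intro nn_integral_mono) (auto simp: scaleR_add_right intro!: mult_left_mono ennreal_leI wt_scale_le)
  finally show ?thesis using A J c0 by (simp add: M_def ennreal_mult mult.assoc mult_left_mono)
 qed
 moreover have "M > 0" using A J by (simp add: M_def)
 ultimately show ?thesis by blast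
qed

text \<open>Put N = c^n. Undoing the dilation gives 1/N. For r < 2 both the number of frequencies
  and the constant of local domination are O(N), and the power 1 - r/2 of their product is N^(2 -
  r).\<close>

lemma dil_analysis:
 fixes \<kappa> :: "real^'n::finite => complex"
 assumes \<kappa>: "wbound 2 \<kappa>" and r: "1 <= r" and A: "A > 0" "L > 0"
 shows "\<exists>C>0. \<forall>c K u K'. 1 <= c --> finite K --> real (card K) <= L * c ^ CARD('n) --> u \<in> borelM -->
  K' \<in> borelM --> (\<forall>z. norm (K' z) <= A * wt z) --> cv K' u = u -->
  (\<Sum>k\<in>K. Ip r (mod_cv \<kappa> k (dil c u))) <= ennreal (C * inverse (c ^ CARD('n)) * (c ^ CARD('n)) powr (max 0 (2 - r))) * Ip r u"
proof (cases "2 <= r")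
 case True
 then obtain C where C: "C > 0" "\<And>K h. finite K ==> h \<in> borelM ==> (\<Sum>k\<in>K. Ip r (mod_cv \<kappa> k h)) <= ennreal C * Ip r h"
  using analysis_ge_2[OF \<kappa>] by blast
 show ?thesis
 proof (intro exI[of _ C] conjI allI impI)
  fix c :: real and K :: "(int^'n) set" and u :: "real^'n => complex"
  assume c: "1 <= c" and K: "finite K" and u[measurable]: "u \<in> borelM"
  have "(\<Sum>k\<in>K. Ip r (mod_cv \<kappa> k (dil c u))) <= ennreal C * Ip r (dil c u)" by (rule C(2)[OF K]) measurable
  also have "... = ennreal (C * inverse (c ^ CARD('n)) * (c ^ CARD('n)) powr (max 0 (2 - r))) * Ip r u"
   using c True C(1) by (subst Ip_dil) (auto simp: ennreal_mult mult.assoc max_absorb1)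
  finally show "(\<Sum>k\<in>K. Ip r (mod_cv \<kappa> k (dil c u))) <= ennreal (C * inverse (c ^ CARD('n)) * (c ^ CARD('n)) powr (max 0 (2 - r))) * Ip r u" .
 qed (rule C)
next
 case False
 then have r2: "r < 2" by simp
 obtain C where C: "C > 0" "\<And>K h g M. finite K ==> h \<in> borelM ==> g \<in> borelM ==> M > 0 ==>
  (\<And>z. enn_powr (enorm (h z)) r <= ennreal M * (NBINT u. enn_powr (enorm (g (z + u))) r * ennreal (wt u))) ==>
  (\<Sum>k\<in>K. Ip r (mod_cv \<kappa> k h)) <= ennreal (C * (real (card K) * M) powr (1 - r / 2)) * (Ip r g + Ip r h)"
  using analysis_lt_2[OF \<kappa> r r2] by auto
 obtain M where M: "M > 0" "\<And>c (u :: real^'n => complex) K z. 1 <= c ==> u \<in> borelM ==> K \<in> borelM ==>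
  (\<forall>z. norm (K z) <= A * wt z) ==> cv K u = u ==>
  enn_powr (enorm (dil c u z)) r <= ennreal (M * c ^ CARD('n)) * (NBINT v. enn_powr (enorm (dil c u (z + v))) r * ennreal (wt v))"
  using dil_dominated[OF r A(1), where 'n='n] by auto
 define D where "D = 2 * C * (L * M) powr (1 - r / 2)"
 show ?thesis
 proof (intro exI[of _ D] conjI allI impI)
  show "D > 0" using C M A by (simp add: D_def)
  fix c :: real and K :: "(int^'n) set" and u K' :: "real^'n => complex"
  assume c: "1 <= c" and K: "finite K" "real (card K) <= L * c ^ CARD('n)" and u[measurable]: "u \<in> borelM"
   and K': "K' \<in> borelM" "\<forall>z. norm (K' z) <= A * wt z" "cv K' u = u"
  let ?N = "c ^ CARD('n)"
  have N: "?N > 0" using c by simp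
  let ?t1 = "(L * M) powr (1 - r / 2) * ?N powr (2 - r)"
  have "(\<Sum>k\<in>K. Ip r (mod_cv \<kappa> k (dil c u))) <= ennreal (C * (real (card K) * (M * ?N)) powr (1 - r / 2)) * (Ip r (dil c u) + Ip r (dil c u))"
   by (rule C(2)[OF K(1) _ _ _ M(2)[OF c u K']]) (use M N in auto)
  also have "... <= ennreal (C * ?t1) * (Ip r (dil c u) + Ip r (dil c u))"
  proof (intro mult_right_mono ennreal_leI mult_left_mono)
   have "(real (card K) * (M * ?N)) powr (1 - r / 2) <= ((L * ?N) * (M * ?N)) powr (1 - r / 2)"
    using K M N r2 by (intro powr_mono2 mult_right_mono) auto
   also have "(L * ?N) * (M * ?N) = (L * M) * (?N powr 2)" using N by (simp add: power2_eq_square)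
   also have "((L * M) * (?N powr 2)) powr (1 - r / 2) = (L * M) powr (1 - r / 2) * ?N powr (2 - r)"
    using A M N by (simp add: powr_mult powr_powr algebra_simps del: powr_numeral)
   finally show "(real (card K) * (M * ?N)) powr (1 - r / 2) <= (L * M) powr (1 - r / 2) * ?N powr (2 - r)" .
  qed (use C in auto)
  also have "Ip r (dil c u) + Ip r (dil c u) = ennreal 2 * (ennreal (inverse ?N) * Ip r u)"
   using c by (subst (1 2) Ip_dil) (auto simp: mult_2[symmetric])
  also have "ennreal (C * ?t1) * (ennreal 2 * (ennreal (inverse ?N) * Ip r u)) =
   ennreal (D * inverse ?N * ?N powr (max 0 (2 - r))) * Ip r u"
  proof -
   have m: "max 0 (2 - r) = 2 - r" using r2 by simp
   have "ennreal (C * ?t1) * (ennreal 2 * (ennreal (inverse ?N) * Ip r u)) =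
    (ennreal (C * ?t1) * ennreal 2 * ennreal (inverse ?N)) * Ip r u"
    by (simp only: mult.assoc)
   also have "ennreal (C * ?t1) * ennreal 2 * ennreal (inverse ?N) =
    ennreal (C * ?t1 * 2 * inverse ?N)"
    using C N by (simp only: ennreal_mult[symmetric] mult_nonneg_nonneg less_imp_le powr_ge_zero zero_le_numeral inverse_nonnegative_iff_nonnegative)
   also have "C * ?t1 * 2 * inverse ?N = D * inverse ?N * ?N powr (max 0 (2 - r))"
    unfolding m D_def by (simp only: mult_ac)
   finally show ?thesis .
  qed
  finally show "(\<Sum>k\<in>K. Ip r (mod_cv \<kappa> k (dil c u))) <= ennreal (D * inverse ?N * ?N powr (max 0 (2 - r))) * Ip r u" .
 qed
qed

text \<open>The free scale \<open>e\<close> will be tuned so that one of the two terms can be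
  absorbed.\<close>

lemma young_enn:
 assumes r: "1 < r" and r': "r' = r / (r - 1)" and e: "e > (0::real)" and ab: "a \<ge> 0" "b \<ge> 0"
 shows "a * b <= e powr (- r) * a powr r + e powr r' * b powr r'"
proof -
 have r'1: "r' > 1" "1 / r + 1 / r' = 1" using r by (auto simp: r' field_simps)
 have "a * b = (a / e) * (e * b)" using e by simp
 also have "... <= (a / e) powr r / r + (e * b) powr r' / r'"
  by (rule Youngs_inequality) (use r r'1 e ab in auto)
 also have "... <= (a / e) powr r / 1 + (e * b) powr r' / 1"
  using r r'1 by (intro add_mono divide_left_mono) auto
 also have "... = e powr (- r) * a powr r + e powr r' * b powr r'"
  using e ab by (simp add: powr_divide powr_mult powr_minus_divide mult.commute)
 finally show ?thesis .
qed

lemma wbound0_cv: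
 fixes g :: "real^'n::finite => complex"
 assumes g: "wbound 0 g" and K: "wbound 2 K"
 shows "wbound 0 (cv K g)"
proof -
 have [measurable]: "g \<in> borelM" "K \<in> borelM" using g K by (auto intro: wbound_borel)
 obtain C where C: "C > 0" "\<And>x. norm (g x) <= C * wt x ^ 0" using g wboundE by blast
 have iK: "integrable lborel K" by (rule wbound_integrable[OF K]) simp
 have "norm (cv K g y) <= (C * (LBINT z. norm (K z)) + 1) * wt y ^ 0" for y
 proof -
  have "norm (cv K g y) <= (LBINT z. C * norm (K z))"
   unfolding cv_def
  proof (rule Bochner_Integration.integral_norm_bound_integral)
   show "integrable lborel (\<lambda>z. g (y + z) * K z)" by (rule cv_integrable[OF wbound_tame[OF g] K]) simp
   show "integrable lborel (\<lambda>z. C * norm (K z))" using iK by (intro integrable_mult_right integrable_norm)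
   fix z
   show "norm (g (y + z) * K z) <= C * norm (K z)"
    unfolding norm_mult using C(2)[of "y + z"] by (intro mult_right_mono) auto
  qed
  then show ?thesis by simp
 qed
 moreover have "C * (LBINT z. norm (K z)) + 1 > 0"
  using C by (intro add_nonneg_pos mult_nonneg_nonneg integral_nonneg_AE) auto
 ultimately show ?thesis unfolding wbound_def by (auto intro!: exI[of _ "C * (LBINT z. norm (K z)) + 1"])
qed

lemma Ip_1_sum:
 assumes "finite I" "\<And>i. i \<in> I ==> g i \<in> borelM"
 shows "Ip 1 (\<lambda>x. \<Sum>i\<in>I. g i x) <= (\<Sum>i\<in>I. Ip 1 (g i))"
 using nrm_sum[of "ereal 1" I g] assms by (simp add: nrm_Ip)

section \<open>Dilated blocks: analysis and synthesis\<close>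

context window
begin

text \<open>\<open>dil c\<close> multiplies frequencies by c, so window k pulls back to centre
  \<open>kv k\<close> / c and radius 3/(4c). Listed are the windows, of radius 3/4, that it can
  meet.\<close>

definition Lk :: "real => int^'n => (int^'n) set" where
 "Lk c k = {l. infnorm ((1 / c) *\<^sub>R kv k - kv l) < 3/4 * (1 + 1 / c)}"

lemma finite_Lk: "finite (Lk c k)" unfolding Lk_def by (rule finite_int_box)

lemma card_Lk: assumes "c > 0" shows "real (card (Lk c k)) <= (3/2 * (1 + 1 / c) + 1) ^ CARD('n)"
proof -
 have "real (card (Lk c k)) <= (2 * (3/4 * (1 + 1 / c)) + 1) ^ CARD('n)"
  unfolding Lk_def using assms by (intro card_int_box) simp
 moreover have "2 * (3/4 * (1 + 1 / c)) = 3/2 * (1 + 1 / c)" by simp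
 ultimately show ?thesis by (simp only:)
qed

lemma card_Lk_inverse:
 assumes c: "c > 0" and K: "\<And>k. k \<in> K ==> l \<in> Lk c k"
 shows "finite K" "real (card K) <= (3/2 * (1 + c) + 1) ^ CARD('n)"
proof -
 let ?S = "{k. infnorm (c *\<^sub>R kv l - kv k) < 3/4 * (1 + c)}"
 have sub: "K \<subseteq> ?S"
 proof
  fix k assume "k \<in> K"
  then have "infnorm ((1 / c) *\<^sub>R kv k - kv l) < 3/4 * (1 + 1 / c)" using K by (simp add: Lk_def)
  then have "c * infnorm ((1 / c) *\<^sub>R kv k - kv l) < c * (3/4 * (1 + 1 / c))" using c by simp
  moreover have "c * infnorm ((1 / c) *\<^sub>R kv k - kv l) = infnorm (c *\<^sub>R ((1 / c) *\<^sub>R kv k - kv l))"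
   using c by (simp add: infnorm_mul)
  moreover have "c *\<^sub>R ((1 / c) *\<^sub>R kv k - kv l) = - (c *\<^sub>R kv l - kv k)" using c by (simp add: scaleR_diff_right)
  ultimately have "infnorm (- (c *\<^sub>R kv l - kv k)) < c * (3/4 * (1 + 1 / c))" by (simp only:)
  moreover have "c * (3/4 * (1 + 1 / c)) = 3/4 * (1 + c)" using c by (simp add: field_simps)
  ultimately show "k \<in> ?S" unfolding infnorm_neg by (simp only: mem_Collect_eq)
 qed
 show "finite K" using finite_subset[OF sub finite_int_box] .
 have "real (card K) <= real (card ?S)" using card_mono[OF finite_int_box sub] by simp
 also have "... <= (2 * (3/4 * (1 + c)) + 1) ^ CARD('n)" using c by (intro card_int_box) simp
 also have "2 * (3/4 * (1 + c)) = 3/2 * (1 + c)" by simp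
 finally show "real (card K) <= (3/2 * (1 + c) + 1) ^ CARD('n)" .
qed

text \<open>On the support of the pulled-back symbol the windows indexed by \<open>Lk c k\<close>
  form a partition of unity, so they may be inserted before the dilation.\<close>

lemma B_dil:
 assumes f: "f \<in> schwartz" and c: "c > 0"
 shows "B k (dil c f) y = (\<Sum>l\<in>Lk c k. B k (dil c (B l f)) y)"
proof -
 have [measurable]: "f \<in> borelM" using f by (rule schwartz_borel)
 define m where "m \<xi> = sg k (c *\<^sub>R \<xi>)" for \<xi>
 have mS: "m \<in> schwartz" unfolding m_def using c by (intro schwartz_dilate sg_schwartz) auto
 have "m \<xi> = (\<Sum>l\<in>Lk c k. sg l \<xi> * m \<xi>)" for \<xi>
 proof (cases "infnorm (c *\<^sub>R \<xi> - kv k) < 3/4")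
  case True
  have "(\<Sum>l\<in>Lk c k. sg l \<xi>) = 1"
  proof (rule sg_partition[OF finite_Lk])
   fix l assume l: "infnorm (\<xi> - kv l) < 3/4"
   let ?t1 = "(1 / c) *\<^sub>R kv k - \<xi>"
   have "c *\<^sub>R ?t1 = - (c *\<^sub>R \<xi> - kv k)" using c by (simp add: scaleR_diff_right)
   then have "c * infnorm ?t1 < 3/4"
    using True c infnorm_mul[of c "(1 / c) *\<^sub>R kv k - \<xi>"] infnorm_neg[of "c *\<^sub>R \<xi> - kv k"] by simp
   then have "infnorm ?t1 < 3/4 * (1 / c)" using c by (simp add: field_simps)
   moreover have "infnorm ((1 / c) *\<^sub>R kv k - kv l) <= infnorm ?t1 + infnorm (\<xi> - kv l)"
    using infnorm_triangle[of "(1 / c) *\<^sub>R kv k - \<xi>" "\<xi> - kv l"] by simp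
   ultimately show "l \<in> Lk c k" using l unfolding Lk_def by (simp add: distrib_left)
  qed
  then show ?thesis by (simp add: sum_distrib_right[symmetric])
 qed (simp add: m_def sg_0)
 then have m_eq: "m = (\<lambda>\<xi>. \<Sum>l\<in>Lk c k. sg l \<xi> * m \<xi>)" by blast
 have "B k (dil c f) y = Op m f (c *\<^sub>R y)"
  unfolding m_def using c by (intro Op_dilate sg_schwartz) auto
 also have "... = Op (\<lambda>\<xi>. \<Sum>l\<in>Lk c k. sg l \<xi> * m \<xi>) f (c *\<^sub>R y)" by (simp only: m_eq[symmetric])
 also have "... = (\<Sum>l\<in>Lk c k. Op (\<lambda>\<xi>. sg l \<xi> * m \<xi>) f (c *\<^sub>R y))"
  by (intro Op_sum finite_Lk schwartz_mult sg_schwartz mS schwartz_tame f)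
 also have "... = (\<Sum>l\<in>Lk c k. B k (dil c (B l f)) y)"
 proof (intro sum.cong refl)
  fix l
  have "Op (\<lambda>\<xi>. sg l \<xi> * m \<xi>) f = Op m (B l f)" by (intro Op_Op[symmetric] schwartz_tame f mS sg_schwartz)
  moreover have "B k (dil c (B l f)) y = Op m (B l f) (c *\<^sub>R y)"
   unfolding m_def using c by (intro Op_dilate sg_schwartz B_borel schwartz_tame f) auto
  ultimately show "Op (\<lambda>\<xi>. sg l \<xi> * m \<xi>) f (c *\<^sub>R y) = B k (dil c (B l f)) y" by simp
 qed
 finally show ?thesis .
qed

lemma B_mod_cv: "B k = mod_cv (fourier (sg 0)) k"
proof -
 have "fourier (sg k) = (\<lambda>z. ee (kv k \<bullet> z) * fourier (sg 0) z)" by (intro ext fourier_sg)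
 then show ?thesis by simp
qed

lemma tt_bound: obtains A where "A > 0" "\<And>l z. norm (fourier (tt l) z) <= A * wt z"
proof -
 obtain A where A: "A > 0" "\<And>z. norm (fourier (tt 0) z) <= A * wt z ^ 1"
  using schwartz_bound[OF schwartz_fourier[OF tt_schwartz]] by blast
 have e: "norm (fourier (tt l) z) = norm (fourier (tt 0) z)" for l z by (subst fourier_tt) (simp add: norm_mult)
 have "norm (fourier (tt l) z) <= A * wt z" for l z unfolding e[of l] using A(2)[of z] by simp
 then show ?thesis using A(1) by (intro that[of A])
qed

text \<open>For c >= 1 a dilated block meets at most (4c)^n blocks, and the kernel of
  \<open>tt l\<close> provides the reproducing property that \<open>dil_analysis\<close>
  requires.\<close>

lemma B_dil_analysis:
 assumes r: "1 <= r"
 shows "\<exists>C>0. \<forall>c K f l. 1 <= c --> f \<in> schwartz --> (\<forall>k\<in>K. l \<in> Lk c k) -->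
  (\<Sum>k\<in>K. Ip r (B k (dil c (B l f)))) <= ennreal (C * inverse (c ^ CARD('n)) * (c ^ CARD('n)) powr (max 0 (2 - r))) * Ip r (B l f)"
proof -
 obtain A where A: "A > 0" "\<And>l z. norm (fourier (tt l) z) <= A * wt z" by (rule tt_bound, rule that)
 have w: "wbound 2 (fourier (sg 0))" by (intro fourier_wbound sg_schwartz)
 obtain C where C: "C > 0" "\<And>c K u K'. 1 <= c ==> finite K ==> real (card K) <= 4 ^ CARD('n) * c ^ CARD('n) ==> u \<in> borelM ==>
  K' \<in> borelM ==> (\<forall>z. norm (K' z) <= A * wt z) ==> cv K' u = u ==>
  (\<Sum>k\<in>K. Ip r (mod_cv (fourier (sg 0)) k (dil c u))) <= ennreal (C * inverse (c ^ CARD('n)) * (c ^ CARD('n)) powr (max 0 (2 - r))) * Ip r u"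
  using dil_analysis[OF w r A(1), of "4 ^ CARD('n)"] by auto
 show ?thesis
 proof (intro exI[of _ C] conjI allI impI)
  fix c :: real and K l and f :: "real^'n => complex" assume c: "1 <= c" and f: "f \<in> schwartz" and K: "\<forall>k\<in>K. l \<in> Lk c k"
  have "real (card K) <= (3/2 * (1 + c) + 1) ^ CARD('n)" "finite K"
   using card_Lk_inverse[of c K l] c K by auto
  moreover have "(3/2 * (1 + c) + 1) ^ CARD('n) <= (4 * c) ^ CARD('n)"
  proof (rule power_mono)
   show "3/2 * (1 + c) + 1 <= 4 * c" using c by (simp add: field_simps)
   show "0 <= 3/2 * (1 + c) + 1" using c by simp
  qed
  ultimately have "real (card K) <= 4 ^ CARD('n) * c ^ CARD('n)" "finite K" by (auto simp: power_mult_distrib)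
  then show "(\<Sum>k\<in>K. Ip r (B k (dil c (B l f)))) <= ennreal (C * inverse (c ^ CARD('n)) * (c ^ CARD('n)) powr (max 0 (2 - r))) * Ip r (B l f)"
   unfolding B_mod_cv[of k for k] 
   using C(2)[OF c, of K "B l f" "fourier (tt l)"] A(2) B_tt[OF schwartz_tame[OF f], of l]
   by (simp add: B_mod_cv[symmetric] B_borel schwartz_tame f schwartz_borel schwartz_fourier tt_schwartz)
 qed (rule C)
qed

text \<open>The dual of \<open>B_dil_analysis\<close>: for b >= 1 many blocks l collapse into a
  single block k. The sum F is paired with its extremal function; transposing the block and the
  dilation turns the pairing into an analysis sum at the conjugate exponent r', and Young's
  inequality absorbs half of the r-th power of F. For r = 1 the triangle inequality already gives
  the bound.\<close>

lemma B_dil_synthesis: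
 assumes r: "1 <= r" and La: "La > 0"
 shows "\<exists>C>0. \<forall>b L k f. 1 <= b --> finite L --> real (card L) <= La * b ^ CARD('n) --> f \<in> schwartz -->
  Ip r (\<lambda>x. \<Sum>l\<in>L. B k (dil (1 / b) (B l f)) x) <= ennreal (C * (b ^ CARD('n)) powr (1 + max 0 (r - 2))) * (\<Sum>l\<in>L. Ip r (B l f))"
proof (cases "r = 1")
 case True
 define D where "D = (NBINT z. enorm (fourier (sg 0) z))"
 have Dk: "(NBINT z. enorm (fourier (sg k) z)) = D" for k
  unfolding fourier_sg[of k] D_def by (simp add: norm_mult)
 have "D < \<top>" using schwartz_integrable[OF schwartz_fourier[OF sg_schwartz]] by (simp add: D_def integrable_iff_bounded)
 then obtain d where d: "D = ennreal d" "d \<ge> 0" by (cases D) auto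
 show ?thesis
 proof (intro exI[of _ "d + 1"] conjI allI impI)
  fix b k and L :: "(int^'n) set" and f :: "real^'n => complex" assume b: "1 <= (b::real)" and L: "finite L" and f: "f \<in> schwartz"
  have g: "dil (1 / b) (B l f) \<in> borelM" for l
   using b by (intro schwartz_borel schwartz_dilate Op_schwartz sg_schwartz f) auto
  have "Ip 1 (\<lambda>x. \<Sum>l\<in>L. B k (dil (1 / b) (B l f)) x) <= (\<Sum>l\<in>L. Ip 1 (B k (dil (1 / b) (B l f))))"
   using b by (intro Ip_1_sum L schwartz_borel Op_schwartz schwartz_dilate sg_schwartz f) auto
  also have "... <= (\<Sum>l\<in>L. enn_powr D 1 * Ip 1 (dil (1 / b) (B l f)))"
   unfolding Dk[of k, symmetric] by (intro sum_mono Ip_cv g schwartz_borel schwartz_fourier sg_schwartz) simp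
  also have "... = (\<Sum>l\<in>L. (D * ennreal (b ^ CARD('n))) * Ip 1 (B l f))"
   using b by (intro sum.cong refl, subst Ip_dil) (auto simp: mult.assoc power_one_over intro!: B_borel schwartz_tame f)
  also have "... = (D * ennreal (b ^ CARD('n))) * (\<Sum>l\<in>L. Ip 1 (B l f))" by (simp add: sum_distrib_left)
  also have "... <= ennreal ((d + 1) * (b ^ CARD('n)) powr (1 + max 0 (r - 2))) * (\<Sum>l\<in>L. Ip 1 (B l f))"
   using b d True by (intro mult_right_mono) (auto simp: ennreal_mult[symmetric] intro!: ennreal_leI mult_right_mono)
  finally show "Ip r (\<lambda>x. \<Sum>l\<in>L. B k (dil (1 / b) (B l f)) x) <= ennreal ((d + 1) * (b ^ CARD('n)) powr (1 + max 0 (r - 2))) * (\<Sum>l\<in>L. Ip r (B l f))"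
   unfolding True .
 qed (use d in auto)
next
 case False
 then have r1: "1 < r" using r by simp
 define r' where "r' = r / (r - 1)"
 have r': "1 < r'" "(r - 1) * r' = r" using r1 by (auto simp: r'_def field_simps)
 define \<kappa> where "\<kappa> z = fourier (tt 0) (- z)" for z
 have \<kappa>: "wbound 2 \<kappa>" unfolding \<kappa>_def[abs_def] by (intro wbound_reflect fourier_wbound tt_schwartz)
 obtain A where A: "A > 0" "\<And>l z. norm (fourier (tt l) z) <= A * wt z" by (rule tt_bound, rule that)
 obtain C1 where C1: "C1 > 0" "\<And>c K u K'. 1 <= c ==> finite K ==> real (card K) <= La * c ^ CARD('n) ==> u \<in> borelM ==>
  K' \<in> borelM ==> (\<forall>z. norm (K' z) <= A * wt z) ==> cv K' u = u ==>
  (\<Sum>k\<in>K. Ip r' (mod_cv \<kappa> k (dil c u))) <= ennreal (C1 * inverse (c ^ CARD('n)) * (c ^ CARD('n)) powr (max 0 (2 - r'))) * Ip r' u"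
  using dil_analysis[OF \<kappa> less_imp_le[OF r'(1)] A(1) La] by auto
 define D where "D = (NBINT z. enorm (fourier (sg 0) z))"
 have "D < \<top>" using schwartz_integrable[OF schwartz_fourier[OF sg_schwartz]] by (simp add: D_def integrable_iff_bounded)
 then have "enn_powr D r' < \<top>" by simp
 then obtain d where d: "enn_powr D r' = ennreal d" "d \<ge> 0" by (cases "enn_powr D r'") auto
 define C2 where "C2 = C1 * (d + 1)"
 have C2: "C2 > 0" using C1 d by (simp add: C2_def)
 define m where "m = max 0 (2 - r')"
 \<comment> \<open>The loss 2 - r' at the conjugate exponent, raised to the power r - 1, is the loss
   r - 2 of the claim, because (r - 1) r' = r.\<close>
 have m: "m * (r - 1) = max 0 (r - 2)"
 proof -
  have "m * (r - 1) = max (0 * (r - 1)) ((2 - r') * (r - 1))"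
   unfolding m_def using r1 by (intro max_mult_distrib_right[THEN trans]) auto
  also have "(2 - r') * (r - 1) = r - 2" using r'(2) by (simp add: algebra_simps)
  finally show ?thesis by simp
 qed
 show ?thesis
 proof (intro exI[of _ "2 * (2 * C2) powr (r - 1)"] conjI allI impI)
  show "2 * (2 * C2) powr (r - 1) > 0" using C2 by simp
  fix b :: real and k and L :: "(int^'n) set" and f :: "real^'n => complex" assume b: "1 <= b" and L: "finite L" "real (card L) <= La * b ^ CARD('n)" and f: "f \<in> schwartz"
  define N where "N = b ^ CARD('n)"
  have N: "N > 0" using b by (simp add: N_def)
  define g where "g l = B l f" for l
  have gS: "g l \<in> schwartz" for l unfolding g_def by (intro Op_schwartz sg_schwartz f)
  have dgS: "dil (1 / b) (g l) \<in> schwartz" for l using b by (intro schwartz_dilate gS) auto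
  define G where "G l = B k (dil (1 / b) (g l))" for l
  have GS: "G l \<in> schwartz" for l unfolding G_def by (intro Op_schwartz sg_schwartz dgS)
  define F where "F x = (\<Sum>l\<in>L. G l x)" for x
  have FS: "F \<in> schwartz" unfolding F_def by (intro schwartz_sum GS)
  have [measurable]: "F \<in> borelM" "g l \<in> borelM" "G l \<in> borelM" for l
   using FS gS GS by (auto intro: schwartz_borel)
  \<comment> \<open>The extremal function: its product with \<open>F\<close> is |F|^r and its r'-th
    power is |F|^r as well.\<close>
  define \<phi> where "\<phi> x = cnj (F x) * of_real (norm (F x) powr (r - 2))" for x
  have [measurable]: "cnj \<in> borelM" by (intro borel_measurable_continuous_onI continuous_intros)
  have [measurable]: "\<phi> \<in> borelM" unfolding \<phi>_def by measurable
  have n\<phi>: "norm (\<phi> x) = norm (F x) powr (r - 1)" for x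
   by (cases "F x = 0") (auto simp: \<phi>_def norm_mult powr_mult_base)
  have F\<phi>: "F x * \<phi> x = of_real (norm (F x) powr r)" for x
  proof (cases "F x = 0")
   case False
   have "F x * \<phi> x = of_real (norm (F x) ^ 2 * norm (F x) powr (r - 2))"
    unfolding \<phi>_def of_real_mult complex_norm_square by (simp only: mult.assoc)
   also have "norm (F x) ^ 2 * norm (F x) powr (r - 2) = norm (F x) powr r"
    using False by (simp add: powr_add[symmetric] flip: powr_numeral)
   finally show ?thesis .
  qed simp
  obtain B0 where B0: "B0 > 0" "\<And>x. norm (F x) <= B0 * wt x ^ 0" using schwartz_bound[OF FS] by blast
  have w\<phi>: "wbound 0 \<phi>" unfolding wbound_def
  proof (intro conjI exI[of _ "B0 powr (r - 1)"] allI)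
   fix x show "norm (\<phi> x) <= B0 powr (r - 1) * wt x ^ 0"
    unfolding n\<phi> using B0(2)[of x] r1 by (simp add: powr_mono2)
  qed (use B0 in auto)
  \<comment> \<open>Transposition reflects kernels and hence symbols.\<close>
  define m' where "m' \<xi> = sg k (- \<xi>)" for \<xi>
  have m'S: "m' \<in> schwartz" unfolding m'_def by (intro schwartz_reflect sg_schwartz)
  define u where "u = Op m' \<phi>"
  have Fm': "fourier m' = (\<lambda>z. fourier (sg k) (- z))"
   unfolding m'_def by (intro ext fourier_reflect sg_schwartz)
  have wu: "wbound 0 u" unfolding u_def by (intro wbound0_cv w\<phi> fourier_wbound m'S)
  have [measurable]: "u \<in> borelM" using wu by (rule wbound_borel)
  define K' where "K' z = fourier (tt k) (- z)" for z
  have K'b: "norm (K' z) <= A * wt z" for z using A(2)[of k "- z"] by (simp add: K'_def)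
  have [measurable]: "K' \<in> borelM"
   using wbound_borel[OF wbound_reflect[OF fourier_wbound[OF tt_schwartz], of 0 k]] unfolding K'_def .
  have repu: "cv K' u = u"
  proof -
   define n' where "n' \<xi> = tt k (- \<xi>)" for \<xi>
   have n'S: "n' \<in> schwartz" unfolding n'_def by (intro schwartz_reflect tt_schwartz)
   have "fourier n' = K'" unfolding n'_def K'_def by (intro ext fourier_reflect tt_schwartz)
   moreover have "Op n' (Op m' \<phi>) = Op (\<lambda>\<xi>. m' \<xi> * n' \<xi>) \<phi>" by (intro Op_Op wbound_tame w\<phi> m'S n'S)
   moreover have "(\<lambda>\<xi>. m' \<xi> * n' \<xi>) = m'" by (intro ext) (simp add: m'_def n'_def sg_tt)
   ultimately show ?thesis by (simp add: u_def)
  qed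
  \<comment> \<open>The inverse dilation, which the change of variables in \<open>tr\<close> moves
    onto the dual function.\<close>
  define v where "v = dil b u"
  have wv: "wbound 0 v"
  proof -
   obtain Cu where Cu: "Cu > 0" "\<And>x. norm (u x) <= Cu * wt x ^ 0" using wu wboundE by blast
   then show ?thesis unfolding wbound_def v_def by auto
  qed
  have [measurable]: "v \<in> borelM" using wv by (rule wbound_borel)
  define \<psi> where "\<psi> l = mod_cv \<kappa> (- l) v" for l
  have [measurable]: "\<kappa> \<in> borelM" using \<kappa> by (rule wbound_borel)
  have [measurable]: "\<psi> l \<in> borelM" for l unfolding \<psi>_def by measurable
  have tr: "(LBINT x. G l x * \<phi> x) = N *\<^sub>R (LBINT x. g l x * \<psi> l x)" for l
  proof -
   have "(LBINT x. G l x * \<phi> x) = (LBINT x. dil (1 / b) (g l) x * cv (\<lambda>z. fourier (sg k) (- z)) \<phi> x)"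
    unfolding G_def by (intro cv_transpose schwartz_wbound dgS fourier_wbound sg_schwartz wbound_tame w\<phi>)
   also have "... = (LBINT x. g l ((1 / b) *\<^sub>R x) * u x)" by (simp add: u_def Fm')
   also have "... = \<bar>b\<bar> ^ DIM(real^'n) *\<^sub>R (LBINT x. g l ((1 / b) *\<^sub>R (0 + b *\<^sub>R x)) * u (0 + b *\<^sub>R x))"
    by (rule integral_affine) (use b in auto)
   \<comment> \<open>The wider window at l is inserted for free, since it reproduces
     \<open>g l\<close>; transposing it produces the frequency -l on the dual side.\<close>
   also have "... = N *\<^sub>R (LBINT x. cv (fourier (tt l)) (g l) x * v x)"
    using b B_tt[OF schwartz_tame[OF f], of l] by (simp add: v_def N_def g_def)
   also have "(LBINT x. cv (fourier (tt l)) (g l) x * v x) = (LBINT x. g l x * cv (\<lambda>z. fourier (tt l) (- z)) v x)"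
    by (intro cv_transpose schwartz_wbound gS fourier_wbound tt_schwartz wbound_tame wv)
   also have "cv (\<lambda>z. fourier (tt l) (- z)) v = \<psi> l"
   proof -
    have "kv (- l) \<bullet> z = kv l \<bullet> (- z)" for z using kv_diff[of 0 l] by simp
    then have "(\<lambda>z. fourier (tt l) (- z)) = (\<lambda>z. ee (kv (- l) \<bullet> z) * \<kappa> z)"
     by (intro ext) (simp only: fourier_tt[of l] \<kappa>_def)
    then show ?thesis by (simp add: \<psi>_def)
   qed
   finally show ?thesis .
  qed
  let ?Y = "Ip r F" and ?X = "\<Sum>l\<in>L. Ip r (g l)"
  \<comment> \<open>Finiteness is what permits the absorption of half of this quantity at the
    end.\<close>
  have Yfin: "?Y < \<top>" by (intro Ip_finite schwartz_wbound FS r)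
  \<comment> \<open>Tuned so that the dual term, after the factor N from the change of variables,
    becomes exactly half of \<open>Ip r F\<close>.\<close>
  define e where "e = (1 / (2 * C2 * N powr m)) powr (1 / r')"
  have e: "e > 0" "e powr r' = 1 / (2 * C2 * N powr m)" using C2 N r' by (auto simp: e_def powr_powr)
  have er: "e powr (- r) = (2 * C2) powr (r - 1) * N powr (max 0 (r - 2))"
  proof -
   have "r' * (- (r - 1)) = - r" using r'(2) by (simp add: algebra_simps)
   then have "e powr (- r) = (e powr r') powr (- (r - 1))" unfolding powr_powr by (simp only:)
   also have "... = (2 * C2 * N powr m) powr (r - 1)"
   proof -
    have "(1 / q) powr (- a) = q powr a" if "q > 0" for q a :: real
     using that by (simp add: powr_minus powr_divide)
    then show ?thesis unfolding e(2) using C2 N by (simp del: minus_diff_eq)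
   qed
   also have "... = (2 * C2) powr (r - 1) * N powr (max 0 (r - 2))"
    using C2 N by (simp add: powr_mult powr_powr m)
   finally show ?thesis .
  qed
  have iF: "integrable lborel (\<lambda>x. norm (F x) powr r)"
   using Yfin unfolding Ip_def enn_powr_norm by (simp add: integrable_iff_bounded)
  have iG: "integrable lborel (\<lambda>x. G l x * \<phi> x)" for l
  proof -
   obtain Cp where Cp: "Cp > 0" "\<And>x. norm (\<phi> x) <= Cp * wt x ^ 0" using w\<phi> wboundE by blast
   show ?thesis
    by (rule Bochner_Integration.integrable_bound[OF integrable_mult_left[OF integrable_norm[OF schwartz_integrable[OF GS[of l]]], of Cp]])
      (use Cp in \<open>auto simp: norm_mult intro!: AE_I2 mult_left_mono\<close>)
  qed
  have Y1: "?Y = enorm (LBINT x. F x * \<phi> x)"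
  proof -
   have "?Y = ennreal (LBINT x. norm (F x) powr r)"
    unfolding Ip_def enn_powr_norm by (rule nn_integral_eq_integral[OF iF]) auto
   moreover have "(LBINT x. F x * \<phi> x) = of_real (LBINT x. norm (F x) powr r)"
    unfolding F\<phi> by (rule integral_complex_of_real)
   moreover have "(LBINT x. norm (F x) powr r) \<ge> 0" by (intro integral_nonneg_AE) auto
   ultimately show ?thesis by simp
  qed
  let ?t1 = "ennreal (e powr (- r)) * ?X"
  let ?t2 = "C2 * inverse N * N powr m"
  have "(LBINT x. F x * \<phi> x) = (\<Sum>l\<in>L. LBINT x. G l x * \<phi> x)"
   unfolding F_def sum_distrib_right by (rule Bochner_Integration.integral_sum) (rule iG)
  also have "... = (\<Sum>l\<in>L. N *\<^sub>R (LBINT x. g l x * \<psi> l x))" by (simp only: tr)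
  finally have "?Y <= ennreal (\<Sum>l\<in>L. N * norm (LBINT x. g l x * \<psi> l x))"
   unfolding Y1 using N by (intro ennreal_leI) (auto intro!: order_trans[OF norm_sum] sum_mono)
  also have "... = (\<Sum>l\<in>L. ennreal N * enorm (LBINT x. g l x * \<psi> l x))"
   using N by (simp add: sum_ennreal[symmetric] ennreal_mult)
  also have "... <= (\<Sum>l\<in>L. ennreal N * (ennreal (e powr (- r)) * Ip r (g l) + ennreal (e powr r') * Ip r' (\<psi> l)))"
  proof (intro sum_mono mult_left_mono)
   fix l
   have "enorm (LBINT x. g l x * \<psi> l x) <= (NBINT x. enorm (g l x * \<psi> l x))"
    by (rule norm_integral_le)
   also have "... <= (NBINT x. ennreal (e powr (- r)) * enn_powr (enorm (g l x)) r + ennreal (e powr r') * enn_powr (enorm (\<psi> l x)) r')"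
   proof (intro nn_integral_mono)
    fix x
    have "norm (g l x) * norm (\<psi> l x) <= e powr (- r) * norm (g l x) powr r + e powr r' * norm (\<psi> l x) powr r'"
     by (rule young_enn[OF r1 r'_def e(1)]) auto
    then show "enorm (g l x * \<psi> l x) <= ennreal (e powr (- r)) * enn_powr (enorm (g l x)) r + ennreal (e powr r') * enn_powr (enorm (\<psi> l x)) r'"
     by (simp add: enn_powr_norm norm_mult ennreal_mult[symmetric] ennreal_plus[symmetric] ennreal_leI del: ennreal_plus)
   qed
   also have "... = ennreal (e powr (- r)) * Ip r (g l) + ennreal (e powr r') * Ip r' (\<psi> l)"
    unfolding Ip_def by (simp add: nn_integral_add nn_integral_cmult)
   finally show "enorm (LBINT x. g l x * \<psi> l x) <= ennreal (e powr (- r)) * Ip r (g l) + ennreal (e powr r') * Ip r' (\<psi> l)" .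
  qed auto
  also have "... = ennreal N * ?t1 + ennreal N * (ennreal (e powr r') * (\<Sum>l\<in>L. Ip r' (\<psi> l)))"
   by (simp add: sum_distrib_left[symmetric] sum.distrib distrib_left)
  also have "(\<Sum>l\<in>L. Ip r' (\<psi> l)) <= ennreal ?t2 * ?Y"
  proof -
   have "(\<Sum>l\<in>L. Ip r' (\<psi> l)) = (\<Sum>k\<in>uminus ` L. Ip r' (mod_cv \<kappa> k v))"
    by (subst sum.reindex) (auto simp: \<psi>_def)
   also have "... <= ennreal (C1 * inverse N * N powr m) * Ip r' u"
    unfolding v_def N_def m_def
    by (rule C1(2)[OF b, where K'=K']) (use L K'b repu in \<open>auto simp: card_image\<close>)
   also have "Ip r' u <= ennreal d * Ip r' \<phi>"
   proof -
    have "(NBINT z. enorm (fourier m' z)) = D"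
     unfolding Fm' D_def fourier_sg[of k]
     using nn_integral_shift(3)[of "\<lambda>z. enorm (fourier (sg 0) z)" 0] schwartz_borel[OF schwartz_fourier[OF sg_schwartz[of 0]]]
     by (simp add: norm_mult)
    then show ?thesis using Ip_cv[of r' \<phi> "fourier m'"] r' m'S d
     by (simp add: u_def schwartz_borel schwartz_fourier)
   qed
   also have "Ip r' \<phi> = ?Y"
    unfolding Ip_def n\<phi> by (simp add: enn_powr_ennreal powr_powr r'(2))
   also have "ennreal (C1 * inverse N * N powr m) * (ennreal d * ?Y) = ennreal (C1 * inverse N * N powr m * d) * ?Y"
    using C1 N d by (simp add: ennreal_mult mult.assoc)
   also have "... <= ennreal ?t2 * ?Y"
    using C1 N d by (intro mult_right_mono ennreal_leI) (auto simp: C2_def algebra_simps)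
   finally show ?thesis by (simp add: mult_left_mono)
  qed
  also have "ennreal N * (ennreal (e powr r') * (ennreal ?t2 * ?Y)) = ennreal (1/2) * ?Y"
  proof -
   have "ennreal N * (ennreal (e powr r') * (ennreal ?t2 * ?Y)) = ennreal (N * (e powr r' * ?t2)) * ?Y"
    using N C2 by (simp only: ennreal_mult mult.assoc mult_nonneg_nonneg powr_ge_zero less_imp_le inverse_nonnegative_iff_nonnegative)
   also have "N * (e powr r' * ?t2) = 1/2" unfolding e(2) using N C2 by (simp add: field_simps)
   finally show ?thesis .
  qed
  finally have main: "?Y <= ennreal N * ?t1 + ennreal (1/2) * ?Y"
   by (simp add: add_left_mono mult_left_mono)
  have "?Y <= ennreal 2 * (ennreal N * ?t1)"
  proof (rule ennreal_le_of_finite)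
   assume "ennreal 2 * (ennreal N * ?t1) < \<top>"
   then obtain a where a: "ennreal N * ?t1 = ennreal a" "a \<ge> 0"
    by (cases "ennreal N * ?t1") (auto simp: ennreal_mult_top)
   obtain y where y: "?Y = ennreal y" "y \<ge> 0" using Yfin by (cases ?Y) auto
   have "ennreal (a + 1/2 * y) = ennreal a + ennreal (1/2 * y)" by (rule ennreal_plus) (use a y in auto)
   moreover have "ennreal (1/2 * y) = ennreal (1/2) * ennreal y" by (rule ennreal_mult) (use y in auto)
   ultimately have "ennreal y <= ennreal (a + 1/2 * y)" using main unfolding a y(1) by (simp only:)
   then have "y <= 2 * a" using a y by (subst (asm) ennreal_le_iff) auto
   then show "?Y <= ennreal 2 * (ennreal N * ?t1)"
    unfolding a y(1) using a by (simp add: ennreal_mult[symmetric] ennreal_leI del: ennreal_numeral)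
  qed
  also have "... = ennreal (2 * (N * e powr (- r))) * ?X"
   using N by (simp only: ennreal_mult mult.assoc mult_nonneg_nonneg powr_ge_zero less_imp_le zero_le_numeral)
  also have "2 * (N * e powr (- r)) = 2 * (2 * C2) powr (r - 1) * N powr (1 + max 0 (r - 2))"
   unfolding er using N by (simp add: powr_add)
  finally show "Ip r (\<lambda>x. \<Sum>l\<in>L. B k (dil (1 / b) (B l f)) x) <= ennreal (2 * (2 * C2) powr (r - 1) * (b ^ CARD('n)) powr (1 + max 0 (r - 2))) * (\<Sum>l\<in>L. Ip r (B l f))"
   by (simp add: F_def[abs_def] G_def g_def N_def)
 qed
qed

end

section \<open>Summation over interacting blocks\<close>

lemma sum_powr_ge:
 fixes a :: "'b => real"
 assumes s: "0 < s" "s <= 1" and a: "\<And>k. k \<in> K ==> 0 <= a k"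
 shows "(\<Sum>k\<in>K. a k) powr s <= (\<Sum>k\<in>K. a k powr s)"
proof -
 have "(\<Sum>k\<in>K. a k) = (\<Sum>k\<in>K. (a k powr s) powr (1 / s))"
  using s a by (intro sum.cong refl) (simp add: powr_powr)
 also have "... <= (\<Sum>k\<in>K. a k powr s) powr (1 / s)"
  using s by (intro sum_powr_le) auto
 finally have "(\<Sum>k\<in>K. a k) powr s <= ((\<Sum>k\<in>K. a k powr s) powr (1 / s)) powr s"
  using s a by (intro powr_mono2 sum_nonneg) auto
 then show ?thesis using s by (simp add: powr_powr sum_nonneg)
qed

lemma sum_powr_jensen':
 fixes a :: "'b => real"
 assumes K: "finite K" "real (card K) <= L" and s: "1 <= s" and a: "\<And>k. k \<in> K ==> 0 <= a k"
 shows "(\<Sum>k\<in>K. a k) powr s <= L powr (s - 1) * (\<Sum>k\<in>K. a k powr s)"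
proof (cases "card K > 0")
 case True
 have "(\<Sum>k\<in>K. a k) powr s <= real (card K) powr (s - 1) * (\<Sum>k\<in>K. a k powr s)"
  using K True s a by (intro sum_powr_jensen) auto
 also have "... <= L powr (s - 1) * (\<Sum>k\<in>K. a k powr s)"
  using K s by (intro mult_right_mono powr_mono2 sum_nonneg) auto
 finally show ?thesis .
qed (use K in auto)

text \<open>A sum over a sparse incidence relation, later with s = q/p. For s <= 1 the power passes
  inside each row for free and Holder on the columns costs \<open>Ka powr (1 - s)\<close>; for s >=
  1 Jensen on the rows costs \<open>La powr (s - 1)\<close> and the columns are free.\<close>

lemma sparse_powr_sum:
 fixes c :: "'k => 'l => real"
 assumes K: "finite K" and fL: "\<And>k. finite (L k)" and s: "0 < s" and c0: "\<And>k l. 0 <= c k l" and u0: "\<And>l. 0 <= u l"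
  and V: "\<And>k. k \<in> K ==> 0 <= V k \<and> V k <= P * (\<Sum>l\<in>L k. c k l)" and P: "0 <= P" and M: "0 <= M"
  and La: "\<And>k. real (card (L k)) <= La" and Ka: "\<And>l. real (card {k \<in> K. l \<in> L k}) <= Ka"
  and col: "\<And>l. (\<Sum>k | k \<in> K \<and> l \<in> L k. c k l) <= M * u l"
 shows "(\<Sum>k\<in>K. V k powr s) <= (P * M) powr s * (if s <= 1 then Ka powr (1 - s) else La powr (s - 1)) * (\<Sum>l\<in>(\<Union>k\<in>K. L k). u l powr s)"
proof -
 let ?U = "\<Union>k\<in>K. L k"
 have fU: "finite ?U" using K fL by auto
 have swap: "(\<Sum>k\<in>K. \<Sum>l\<in>L k. c k l powr s) = (\<Sum>l\<in>?U. \<Sum>k | k \<in> K \<and> l \<in> L k. c k l powr s)"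
 proof -
  have "(\<Sum>k\<in>K. \<Sum>l\<in>L k. c k l powr s) = (\<Sum>k\<in>K. \<Sum>l | l \<in> ?U \<and> l \<in> L k. c k l powr s)"
   by (intro sum.cong refl) auto
  also have "... = (\<Sum>l\<in>?U. \<Sum>k | k \<in> K \<and> l \<in> L k. c k l powr s)" by (rule sum.swap_restrict[OF K fU])
  finally show ?thesis .
 qed
 have V': "(\<Sum>k\<in>K. V k powr s) <= (\<Sum>k\<in>K. P powr s * (\<Sum>l\<in>L k. c k l) powr s)"
 proof (rule sum_mono)
  fix k assume "k \<in> K"
  then have "V k powr s <= (P * (\<Sum>l\<in>L k. c k l)) powr s" using V s by (intro powr_mono2) auto
  then show "V k powr s <= P powr s * (\<Sum>l\<in>L k. c k l) powr s" using P c0 by (simp add: powr_mult sum_nonneg)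
 qed
 show ?thesis
 proof (cases "s <= 1")
  case True
  have "(\<Sum>k\<in>K. V k powr s) <= (\<Sum>k\<in>K. P powr s * (\<Sum>l\<in>L k. c k l powr s))"
   using True s c0 by (intro order_trans[OF V'] sum_mono mult_left_mono sum_powr_ge) auto
  also have "... = P powr s * (\<Sum>l\<in>?U. \<Sum>k | k \<in> K \<and> l \<in> L k. c k l powr s)"
   by (simp add: sum_distrib_left[symmetric] swap)
  also have "... <= P powr s * (\<Sum>l\<in>?U. Ka powr (1 - s) * (M powr s * u l powr s))"
  proof (intro mult_left_mono sum_mono)
   fix l
   have "(\<Sum>k | k \<in> K \<and> l \<in> L k. c k l powr s) <= real (card {k\<in>K. l \<in> L k}) powr (1 - s) * (\<Sum>k | k \<in> K \<and> l \<in> L k. c k l) powr s"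
    using K s True c0 by (intro sum_powr_le_card) auto
   also have "... <= Ka powr (1 - s) * (M * u l) powr s"
    using Ka col s True c0 by (intro mult_mono powr_mono2 sum_nonneg) auto
   finally show "(\<Sum>k | k \<in> K \<and> l \<in> L k. c k l powr s) <= Ka powr (1 - s) * (M powr s * u l powr s)"
    using M u0 by (simp add: powr_mult)
  qed auto
  also have "... = (P * M) powr s * Ka powr (1 - s) * (\<Sum>l\<in>?U. u l powr s)"
   using P M by (simp add: powr_mult sum_distrib_left mult_ac)
  finally show ?thesis using True by simp
 next
  case False
  have "(\<Sum>k\<in>K. V k powr s) <= (\<Sum>k\<in>K. P powr s * (La powr (s - 1) * (\<Sum>l\<in>L k. c k l powr s)))"
   using False c0 by (intro order_trans[OF V'] sum_mono mult_left_mono sum_powr_jensen' fL La) auto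
  also have "... = P powr s * La powr (s - 1) * (\<Sum>l\<in>?U. \<Sum>k | k \<in> K \<and> l \<in> L k. c k l powr s)"
   by (simp add: sum_distrib_left[symmetric] swap mult.assoc)
  also have "... <= P powr s * La powr (s - 1) * (\<Sum>l\<in>?U. M powr s * u l powr s)"
  proof (intro mult_left_mono sum_mono)
   fix l
   have "(\<Sum>k | k \<in> K \<and> l \<in> L k. c k l powr s) <= (\<Sum>k | k \<in> K \<and> l \<in> L k. c k l) powr s"
    using False c0 by (intro sum_powr_le) auto
   also have "... <= (M * u l) powr s" using col s c0 by (intro powr_mono2 sum_nonneg) auto
   finally show "(\<Sum>k | k \<in> K \<and> l \<in> L k. c k l powr s) <= M powr s * u l powr s" using M u0 by (simp add: powr_mult)
  qed auto
  also have "... = (P * M) powr s * La powr (s - 1) * (\<Sum>l\<in>?U. u l powr s)"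
   using P M by (simp add: powr_mult sum_distrib_left mult_ac)
  finally show ?thesis using False by simp
 qed
qed

lemma Ip_sum:
 fixes g :: "'i => real^'n::finite => complex"
 assumes L: "finite L" "real (card L) <= La" and r: "1 <= r" and [measurable]: "\<And>l. l \<in> L ==> g l \<in> borelM"
 shows "Ip r (\<lambda>x. \<Sum>l\<in>L. g l x) <= ennreal (La powr (r - 1)) * (\<Sum>l\<in>L. Ip r (g l))"
proof -
 have "Ip r (\<lambda>x. \<Sum>l\<in>L. g l x) <= (NBINT x. ennreal (La powr (r - 1)) * (\<Sum>l\<in>L. enn_powr (enorm (g l x)) r))"
  unfolding Ip_def
 proof (intro nn_integral_mono)
  fix x
  have "norm (\<Sum>l\<in>L. g l x) powr r <= (\<Sum>l\<in>L. norm (g l x)) powr r" using r by (intro powr_mono2 norm_sum) auto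
  also have "... <= La powr (r - 1) * (\<Sum>l\<in>L. norm (g l x) powr r)" using r L by (intro sum_powr_jensen') auto
  finally show "enn_powr (enorm (\<Sum>l\<in>L. g l x)) r <= ennreal (La powr (r - 1)) * (\<Sum>l\<in>L. enn_powr (enorm (g l x)) r)"
   by (simp add: enn_powr_norm sum_ennreal ennreal_mult[symmetric] ennreal_leI sum_nonneg)
 qed
 also have "... = ennreal (La powr (r - 1)) * (\<Sum>l\<in>L. Ip r (g l))"
  unfolding Ip_def by (simp add: nn_integral_cmult nn_integral_sum)
 finally show ?thesis .
qed

lemma nn_integral_count_space_le:
 fixes f :: "'a::countable => ennreal"
 assumes "\<And>K. finite K ==> (\<Sum>k\<in>K. f k) <= b"
 shows "(\<integral>\<^sup>+k. f k \<partial>count_space UNIV) <= b"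
 unfolding sum_count_space[symmetric] by (subst nonneg_infsum_complete) (auto intro: SUP_least assms)

lemma sum_le_nn_integral_count_space:
 fixes f :: "'a::countable => ennreal"
 assumes "finite K"
 shows "(\<Sum>k\<in>K. f k) <= (\<integral>\<^sup>+k. f k \<partial>count_space UNIV)"
 unfolding sum_count_space[symmetric] by (subst nonneg_infsum_complete) (auto intro: SUP_upper assms)

context window
begin

lemma Ip_real:
 assumes "f \<in> schwartz" "1 <= r" shows "Ip r f = ennreal (enn2real (Ip r f))"
 using Ip_finite[OF assms(2) schwartz_wbound[OF assms(1)]] by simp

text \<open>With N = t^n, rows are bounded and columns have size O(1/N) for t <= 1, and the opposite
  for t >= 1. Under \<open>reg\<close> the sparse sum is lossy only in the range of t in which the
  analysis or synthesis bound is; there the exponents combine to w - 1, and elsewhere they give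
  w/r.\<close>

lemma B_dil_sum:
 assumes r: "1 <= r" and w: "1 <= w" and reg: "r <= 2 \<and> w <= r \<or> 2 <= r \<and> r <= w"
 shows "\<exists>C>0. \<forall>t f K. 0 < t --> f \<in> schwartz --> finite K -->
  (\<exists>L. finite L \<and> (\<Sum>k\<in>K. enn_powr (Ip r (B k (dil (1 / t) f))) (w / r)) \<le>
   ennreal (C * max ((t ^ CARD('n)) powr (w / r)) ((t ^ CARD('n)) powr (w - 1))) * (\<Sum>l\<in>L. enn_powr (Ip r (B l f)) (w / r)))"
proof -
 let ?n = "CARD('n)"
 define s where "s = w / r"
 have s: "0 < s" "s * r = w" using r w by (auto simp: s_def)
 have reg': "r <= 2 \<and> s <= 1 \<or> 2 <= r \<and> 1 <= s" using reg r by (auto simp: s_def)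
 obtain C1 where C1: "C1 > 0" "\<And>c K f l. 1 <= c ==> f \<in> schwartz ==> (\<forall>k\<in>K. l \<in> Lk c k) ==>
  (\<Sum>k\<in>K. Ip r (B k (dil c (B l f)))) <= ennreal (C1 * inverse (c ^ ?n) * (c ^ ?n) powr (max 0 (2 - r))) * Ip r (B l f)"
  using B_dil_analysis[OF r] by auto
 obtain C2 where C2: "C2 > 0" "\<And>b L k f. 1 <= b ==> finite L ==> real (card L) <= 4 ^ ?n * b ^ ?n ==> f \<in> schwartz ==>
  Ip r (\<lambda>x. \<Sum>l\<in>L. B k (dil (1 / b) (B l f)) x) <= ennreal (C2 * (b ^ ?n) powr (1 + max 0 (r - 2))) * (\<Sum>l\<in>L. Ip r (B l f))"
  using B_dil_synthesis[OF r, of "4 ^ ?n"] by auto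
 define F where "F = (4::real) ^ ?n"
 have F: "F \<ge> 1" by (simp add: F_def)
 let ?t3 = "F powr (1 - s) + F powr (s - 1)"
 define D1 where "D1 = (F powr (r - 1) * C1) powr s * ?t3"
 define D2 where "D2 = (C2 * F) powr s * ?t3"
 have main: "\<exists>L. finite L \<and> (\<Sum>k\<in>K. enn_powr (Ip r (B k (dil (1 / t) f))) s) \<le>
   ennreal ((D1 + D2) * max ((t ^ ?n) powr s) ((t ^ ?n) powr (w - 1))) * (\<Sum>l\<in>L. enn_powr (Ip r (B l f)) s)"
  if t: "0 < t" and f: "f \<in> schwartz" and K: "finite K" for t f K
 proof -
  let ?c = "1 / t"
  have c: "?c > 0" using t by simp
  define V where "V k = enn2real (Ip r (B k (dil ?c f)))" for k
  define u where "u l = enn2real (Ip r (B l f))" for l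
  have Bf: "B l f \<in> schwartz" for l by (intro Op_schwartz sg_schwartz f)
  have df: "dil ?c g \<in> schwartz" if "g \<in> schwartz" for g :: "real^'n => complex" using that t by (intro schwartz_dilate) auto
  have Ve: "Ip r (B k (dil ?c f)) = ennreal (V k)" for k unfolding V_def by (intro Ip_real r Op_schwartz sg_schwartz df f)
  have ue: "Ip r (B l f) = ennreal (u l)" for l unfolding u_def by (intro Ip_real r Bf)
  have V0: "V k \<ge> 0" and u0: "u l \<ge> 0" for k l by (auto simp: V_def u_def)
  let ?U = "\<Union>k\<in>K. Lk ?c k"
  have fU: "finite ?U" using K finite_Lk by auto
  let ?N = "t ^ ?n"
  have N: "?N > 0" using t by simp
  have cN: "?c ^ ?n = inverse ?N" by (simp add: divide_inverse power_inverse)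
  let ?t4 = "\<Sum>l\<in>?U. u l powr s"
  let ?t5 = "\<Sum>k\<in>K. V k powr s"
  have "\<exists>D\<in>{D1, D2}. ?t5 <= D * max (?N powr s) (?N powr (w - 1)) * ?t4"
  proof (cases "t <= 1")
   case True
   have c1: "1 <= ?c" using True t by simp
   define cc where "cc k l = enn2real (Ip r (B k (dil ?c (B l f))))" for k l
   have cce: "Ip r (B k (dil ?c (B l f))) = ennreal (cc k l)" for k l unfolding cc_def by (intro Ip_real r Op_schwartz sg_schwartz df Bf)
   have cc0: "cc k l \<ge> 0" for k l by (simp add: cc_def)
   define M where "M = C1 * ?N * (inverse ?N) powr (max 0 (2 - r))"
   have M: "M \<ge> 0" using C1 N by (simp add: M_def)
   have cL: "real (card (Lk ?c k)) <= F" for k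
   proof -
    have "real (card (Lk ?c k)) <= (3/2 * (1 + 1 / ?c) + 1) ^ ?n" by (rule card_Lk[OF c])
    also have "... <= 4 ^ ?n" using True t by (intro power_mono) (auto simp: field_simps)
    finally show ?thesis by (simp add: F_def)
   qed
   let ?t2 = "if s <= 1 then (F * inverse ?N) powr (1 - s) else F powr (s - 1)"
   have "?t5 <= (F powr (r - 1) * M) powr s * ?t2 * ?t4"
   proof (rule sparse_powr_sum[OF K finite_Lk s(1) cc0 u0 _ _ M cL])
    fix k
    have "ennreal (V k) = Ip r (\<lambda>x. \<Sum>l\<in>Lk ?c k. B k (dil ?c (B l f)) x)"
     unfolding Ve[symmetric] B_dil[OF f c, of k, abs_def] ..
    also have "... <= ennreal (F powr (r - 1)) * (\<Sum>l\<in>Lk ?c k. Ip r (B k (dil ?c (B l f))))"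
     by (intro Ip_sum finite_Lk cL r schwartz_borel Op_schwartz sg_schwartz df f)
    also have "... = ennreal (F powr (r - 1) * (\<Sum>l\<in>Lk ?c k. cc k l))"
     unfolding cce using cc0 by (simp add: sum_ennreal ennreal_mult sum_nonneg)
    finally show "0 <= V k \<and> V k <= F powr (r - 1) * (\<Sum>l\<in>Lk ?c k. cc k l)"
     using V0 cc0 by (auto simp: sum_nonneg ennreal_le_iff)
   next
    fix l
    have "real (card {k \<in> K. l \<in> Lk ?c k}) <= (3/2 * (1 + ?c) + 1) ^ ?n" by (rule card_Lk_inverse(2)[OF c, of _ l]) auto
    also have "... <= (4 * ?c) ^ ?n" using c1 by (intro power_mono) (auto simp: field_simps)
    finally show "real (card {k \<in> K. l \<in> Lk ?c k}) <= F * inverse ?N" unfolding power_mult_distrib cN F_def .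
    have "ennreal (\<Sum>k | k \<in> K \<and> l \<in> Lk ?c k. cc k l) = (\<Sum>k | k \<in> K \<and> l \<in> Lk ?c k. Ip r (B k (dil ?c (B l f))))"
     unfolding cce using cc0 by (simp add: sum_ennreal)
    also have "... <= ennreal (C1 * inverse (?c ^ ?n) * (?c ^ ?n) powr (max 0 (2 - r))) * Ip r (B l f)"
     by (intro C1(2) c1 f) auto
    also have "... = ennreal (M * u l)" unfolding ue cN using C1 N u0 by (simp add: M_def ennreal_mult[symmetric])
    finally show "(\<Sum>k | k \<in> K \<and> l \<in> Lk ?c k. cc k l) <= M * u l" using M u0 by (simp add: ennreal_le_iff)
   qed simp
   also have "(F powr (r - 1) * M) powr s * ?t2 <= D1 * max (?N powr s) (?N powr (w - 1))"
   proof -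
    have e: "(F powr (r - 1) * M) powr s = (F powr (r - 1) * C1) powr s * (?N powr s * ?N powr (- (max 0 (2 - r) * s)))"
     using C1 N F by (simp add: M_def powr_mult powr_powr powr_minus inverse_powr)
    have "?N powr s * ?N powr (- (max 0 (2 - r) * s)) * ?t2
     <= ?t3 * max (?N powr s) (?N powr (w - 1))"
    proof (cases "r <= 2 \<and> s <= 1")
     case True
     have m: "max 0 (2 - r) = 2 - r" using True by simp
     have "(F * inverse ?N) powr (1 - s) = F powr (1 - s) * inverse ?N powr (1 - s)" by (rule powr_mult)
     also have "inverse ?N powr (1 - s) = ?N powr (- (1 - s))" using N by (simp only: powr_minus inverse_powr less_imp_le)
     finally have "?N powr s * ?N powr (- (max 0 (2 - r) * s)) * (F * inverse ?N) powr (1 - s) =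
      F powr (1 - s) * (?N powr s * (?N powr (- ((2 - r) * s)) * ?N powr (- (1 - s))))"
      unfolding m by (simp only: mult_ac)
     also have "... = F powr (1 - s) * ?N powr (s + (- ((2 - r) * s) + - (1 - s)))" by (simp only: powr_add)
     \<comment> \<open>Dilation gain, Bessel loss and column loss together; the identity is s r =
       w.\<close>
     also have "s + (- ((2 - r) * s) + - (1 - s)) = w - 1" using s by (simp add: algebra_simps)
     finally have "?N powr s * ?N powr (- (max 0 (2 - r) * s)) * (F * inverse ?N) powr (1 - s) = F powr (1 - s) * ?N powr (w - 1)" .
     also have "... <= ?t3 * max (?N powr s) (?N powr (w - 1))" by (intro mult_mono) (auto simp: le_max_iff_disj)
     finally show ?thesis using True by simp
    next
     case False
     then have rs: "2 <= r" "1 <= s" using reg' by auto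
     have "?t2 = F powr (s - 1)" using rs F N t by auto
     moreover have "?N powr s * ?N powr (- (max 0 (2 - r) * s)) = ?N powr s" using rs N by (simp add: max_def)
     moreover have "?N powr s * F powr (s - 1) <= max (?N powr s) (?N powr (w - 1)) * ?t3" by (intro mult_mono) (auto simp: le_max_iff_disj)
     ultimately show ?thesis by (simp only: mult.commute)
    qed
    then have "(F powr (r - 1) * C1) powr s * (?N powr s * ?N powr (- (max 0 (2 - r) * s)) * ?t2)
     <= (F powr (r - 1) * C1) powr s * (?t3 * max (?N powr s) (?N powr (w - 1)))"
     by (intro mult_left_mono) auto
    then show ?thesis unfolding e D1_def by (simp only: mult.assoc)
   qed
   finally have "?t5 <= D1 * max (?N powr s) (?N powr (w - 1)) * ?t4"
    by (simp add: mult_right_mono sum_nonneg)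
   then show ?thesis by blast
  next
   case False
   then have t1: "1 <= t" by simp
   define P where "P = C2 * ?N powr (1 + max 0 (r - 2))"
   have P: "P \<ge> 0" using C2 by (simp add: P_def)
   have F0: "0 <= F" using F by simp
   have cL: "real (card (Lk ?c k)) <= F * ?N" for k
   proof -
    have "real (card (Lk ?c k)) <= (3/2 * (1 + 1 / ?c) + 1) ^ ?n" by (rule card_Lk[OF c])
    also have "... <= (4 * t) ^ ?n" using t1 by (intro power_mono) (auto simp: field_simps)
    finally show ?thesis by (simp add: F_def power_mult_distrib)
   qed
   have cK: "real (card {k \<in> K. l \<in> Lk ?c k}) <= F" for l
   proof -
    have "real (card {k \<in> K. l \<in> Lk ?c k}) <= (3/2 * (1 + ?c) + 1) ^ ?n" by (rule card_Lk_inverse(2)[OF c, of _ l]) auto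
    also have "... <= 4 ^ ?n" using t1 by (intro power_mono) (auto simp: field_simps)
    finally show ?thesis by (simp add: F_def)
   qed
   let ?t1 = "if s <= 1 then F powr (1 - s) else (F * ?N) powr (s - 1)"
   have "?t5 <= (P * F) powr s * ?t1 * ?t4"
   proof (rule sparse_powr_sum[where c="\<lambda>k l. u l", OF K finite_Lk s(1) u0 u0 _ P F0 cL cK])
    fix k
    have "ennreal (V k) = Ip r (\<lambda>x. \<Sum>l\<in>Lk ?c k. B k (dil ?c (B l f)) x)"
     unfolding Ve[symmetric] B_dil[OF f c, of k, abs_def] ..
    also have "... <= ennreal P * (\<Sum>l\<in>Lk ?c k. Ip r (B l f))"
     unfolding P_def using cL by (intro C2(2) t1 finite_Lk f) (simp add: F_def)
    also have "... = ennreal (P * (\<Sum>l\<in>Lk ?c k. u l))"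
     unfolding ue using u0 P by (simp add: sum_ennreal ennreal_mult sum_nonneg)
    finally show "0 <= V k \<and> V k <= P * (\<Sum>l\<in>Lk ?c k. u l)"
     using V0 u0 P by (auto simp: sum_nonneg ennreal_le_iff)
   next
    fix l
    have "(\<Sum>k | k \<in> K \<and> l \<in> Lk ?c k. u l) = real (card {k \<in> K. l \<in> Lk ?c k}) * u l" by simp
    also have "... <= F * u l" by (intro mult_right_mono cK u0)
    finally show "(\<Sum>k | k \<in> K \<and> l \<in> Lk ?c k. u l) <= F * u l" .
   qed
   also have "(P * F) powr s * ?t1 <= D2 * max (?N powr s) (?N powr (w - 1))"
   proof -
    let ?t6 = "(1 + max 0 (r - 2)) * s"
    have e: "(P * F) powr s = (C2 * F) powr s * ?N powr ?t6"
     using C2 N F by (simp add: P_def powr_mult powr_powr)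
    have "?N powr ?t6 * ?t1
     <= ?t3 * max (?N powr s) (?N powr (w - 1))"
    proof (cases "r <= 2 \<and> s <= 1")
     case True
     then have "?N powr ?t6 * ?t1 = F powr (1 - s) * ?N powr s"
      by (simp add: max_absorb1 mult.commute)
     also have "... <= ?t3 * max (?N powr s) (?N powr (w - 1))" by (intro mult_mono) (auto simp: le_max_iff_disj)
     finally show ?thesis .
    next
     case False
     then have rs: "2 <= r" "1 <= s" using reg' by auto
     have "?t1 = F powr (s - 1) * ?N powr (s - 1)"
      using rs F N t by (auto simp: powr_mult)
     moreover have "?N powr ?t6 * ?N powr (s - 1) = ?N powr (w - 1)"
     proof -
      \<comment> \<open>The same balance for t >= 1: synthesis loss plus row loss, again by s r =
        w.\<close>
      have "(1 + max 0 (r - 2)) * s + (s - 1) = w - 1" using rs s(2) by (simp add: algebra_simps max_def)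
      then show ?thesis by (simp only: powr_add[symmetric])
     qed
     moreover have "F powr (s - 1) * ?N powr (w - 1) <= ?t3 * max (?N powr s) (?N powr (w - 1))" by (intro mult_mono) (auto simp: le_max_iff_disj)
     ultimately show ?thesis by (simp only: mult.left_commute[of "?N powr ?t6"])
    qed
    then have "(C2 * F) powr s * (?N powr ?t6 * ?t1)
     <= (C2 * F) powr s * (?t3 * max (?N powr s) (?N powr (w - 1)))"
     by (intro mult_left_mono) auto
    then show ?thesis unfolding e D2_def by (simp only: mult.assoc)
   qed
   finally have "?t5 <= D2 * max (?N powr s) (?N powr (w - 1)) * ?t4"
    by (simp add: mult_right_mono sum_nonneg)
   then show ?thesis by blast
  qed
  then obtain D where D: "D \<in> {D1, D2}" "?t5 <= D * max (?N powr s) (?N powr (w - 1)) * ?t4" by blast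
  have D0: "D1 \<ge> 0" "D2 \<ge> 0" by (auto simp: D1_def D2_def)
  have "D * max (?N powr s) (?N powr (w - 1)) * ?t4 <= (D1 + D2) * max (?N powr s) (?N powr (w - 1)) * ?t4"
   using D(1) D0 by (intro mult_right_mono sum_nonneg) (auto simp: le_max_iff_disj)
  with D(2) have "?t5 <= (D1 + D2) * max (?N powr s) (?N powr (w - 1)) * ?t4" by linarith
  then have "ennreal ?t5 <= ennreal ((D1 + D2) * max (?N powr s) (?N powr (w - 1)) * ?t4)" by (rule ennreal_leI)
  also have "... = ennreal ((D1 + D2) * max (?N powr s) (?N powr (w - 1))) * ennreal ?t4"
   using D0 by (intro ennreal_mult mult_nonneg_nonneg sum_nonneg) (auto simp: le_max_iff_disj)
  finally have "(\<Sum>k\<in>K. enn_powr (Ip r (B k (dil ?c f))) s) <= ennreal ((D1 + D2) * max (?N powr s) (?N powr (w - 1))) * (\<Sum>l\<in>?U. enn_powr (Ip r (B l f)) s)"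
   unfolding Ve ue using V0 u0 by (simp add: enn_powr_ennreal sum_ennreal)
  then show ?thesis using fU by blast
 qed
 have "D1 + D2 > 0" using C1 C2 F by (auto simp: D1_def D2_def intro!: add_pos_pos mult_pos_pos)
 then show ?thesis using main unfolding s_def by (intro exI[of _ "D1 + D2"]) blast
qed

end

section \<open>Dilation bounds in modulation norm for all exponents\<close>

definition einv :: "ereal => real" where "einv p = (if p = \<infinity> then 0 else 1 / real_of_ereal p)"

lemma cv_sup:
 fixes g :: "real^'n::finite => complex"
 assumes [measurable]: "g \<in> borelM" "K \<in> borelM"
 shows "enorm (cv K g y) <= (NBINT z. enorm (K z)) * nrm \<infinity> g"
proof -
 have "AE z in lborel. enorm (g z) <= nrm \<infinity> g" using esssup_AE[of "\<lambda>x. enorm (g x)" lborel] by (simp add: lpn_def)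
 then have ae: "AE z in lborel. enorm (g (z + y)) <= nrm \<infinity> g" by (intro AE_lborel_shift[of "\<lambda>z. enorm (g z) <= nrm \<infinity> g"]) auto
 have "enorm (cv K g y) <= (NBINT z. enorm (g (y + z) * K z))"
  unfolding cv_def by (rule norm_integral_le)
 also have "... <= (NBINT z. enorm (K z) * nrm \<infinity> g)"
 proof (rule nn_integral_mono_AE)
  show "AE z in lborel. enorm (g (y + z) * K z) <= enorm (K z) * nrm \<infinity> g"
   using ae
  proof eventually_elim
   case (elim z)
   have "enorm (g (y + z) * K z) = enorm (K z) * enorm (g (z + y))"
    by (simp add: norm_mult ennreal_mult mult.commute add.commute)
   also have "... <= enorm (K z) * nrm \<infinity> g" using elim by (intro mult_left_mono) auto
   finally show ?case .
  qed
 qed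
 also have "... = (NBINT z. enorm (K z)) * nrm \<infinity> g" by (rule nn_integral_multc) measurable
 finally show ?thesis .
qed

lemma nrm_infI: "(\<And>x. enorm (g x) <= b) ==> g \<in> borelM ==> nrm \<infinity> g <= b"
 by (auto simp: lpn_def intro!: esssup_I)

context window
begin

lemma mnorm_inf: "mnorm p \<infinity> g = (SUP k. nrm p (B k g))"
 by (simp add: mnorm_def lpn_def esssup_count_space)

lemma mnorm_fin: "mnorm (ereal r) (ereal w) g = enn_powr (\<integral>\<^sup>+k. enn_powr (Ip r (B k g)) (w / r) \<partial>count_space UNIV) (1 / w)"
 by (simp add: mnorm_def lpn_real[of "count_space UNIV"] nrm_Ip enn_powr_powr)

lemma powr_power_n: "t > 0 ==> (t ^ CARD('n)) powr a = t powr (real CARD('n) * a)" for t :: real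
 by (simp add: powr_powr flip: powr_realpow)

text \<open>\<open>B_dil_sum\<close> bounds every finite partial sum by the full series for
  \<open>f\<close>; the supremum over finite sets and the w-th root then give the norm, with the
  maximum of two powers replaced by their sum.\<close>

lemma dil_mnorm_fin:
 assumes r: "1 <= r" and w: "1 <= w" and reg: "r <= 2 \<and> w <= r \<or> 2 <= r \<and> r <= w"
 shows "\<exists>C>0. \<forall>t f. 0 < t --> f \<in> schwartz --> mnorm (ereal r) (ereal w) (dil (1 / t) f) \<le>
  ennreal (C * (t powr (CARD('n) * (1 / r)) + t powr (CARD('n) * (1 - 1 / w)))) * mnorm (ereal r) (ereal w) f"
proof -
 let ?n = "CARD('n)"
 obtain C where C: "C > 0" "\<And>t f K. 0 < t ==> f \<in> schwartz ==> finite K ==>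
  (\<exists>L. finite L \<and> (\<Sum>k\<in>K. enn_powr (Ip r (B k (dil (1 / t) f))) (w / r)) \<le>
   ennreal (C * max ((t ^ ?n) powr (w / r)) ((t ^ ?n) powr (w - 1))) * (\<Sum>l\<in>L. enn_powr (Ip r (B l f)) (w / r)))"
  using B_dil_sum[OF assms] by auto
 have "mnorm (ereal r) (ereal w) (dil (1 / t) f) \<le>
  ennreal (C powr (1 / w) * (t powr (?n * (1 / r)) + t powr (?n * (1 - 1 / w)))) * mnorm (ereal r) (ereal w) f"
  if t: "0 < t" and f: "f \<in> schwartz" for t f
 proof -
  define m where "m = max ((t ^ ?n) powr (w / r)) ((t ^ ?n) powr (w - 1))"
  have m0: "m \<ge> 0" by (simp add: m_def le_max_iff_disj)
  let ?X = "\<integral>\<^sup>+k. enn_powr (Ip r (B k f)) (w / r) \<partial>count_space UNIV"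
  have "(\<integral>\<^sup>+k. enn_powr (Ip r (B k (dil (1 / t) f))) (w / r) \<partial>count_space UNIV) <= ennreal (C * m) * ?X"
  proof (rule nn_integral_count_space_le)
   fix K :: "(int^'n) set" assume "finite K"
   then obtain L where L: "finite L" "(\<Sum>k\<in>K. enn_powr (Ip r (B k (dil (1 / t) f))) (w / r)) <= ennreal (C * m) * (\<Sum>l\<in>L. enn_powr (Ip r (B l f)) (w / r))"
    using C(2)[OF t f] unfolding m_def by blast
   note L(2)
   also have "ennreal (C * m) * (\<Sum>l\<in>L. enn_powr (Ip r (B l f)) (w / r)) <= ennreal (C * m) * ?X"
    by (intro mult_left_mono sum_le_nn_integral_count_space L) auto
   finally show "(\<Sum>k\<in>K. enn_powr (Ip r (B k (dil (1 / t) f))) (w / r)) <= ennreal (C * m) * ?X" .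
  qed
  then have "mnorm (ereal r) (ereal w) (dil (1 / t) f) <= enn_powr (ennreal (C * m) * ?X) (1 / w)"
   unfolding mnorm_fin using w by (intro enn_powr_mono) auto
  also have "... = ennreal ((C * m) powr (1 / w)) * mnorm (ereal r) (ereal w) f"
   unfolding mnorm_fin using C(1) m0 by (simp add: enn_powr_mult enn_powr_ennreal)
  also have "... <= ennreal (C powr (1 / w) * (t powr (?n * (1 / r)) + t powr (?n * (1 - 1 / w)))) * mnorm (ereal r) (ereal w) f"
  proof (intro mult_right_mono ennreal_leI)
   have "m powr (1 / w) <= ((t ^ ?n) powr (w / r)) powr (1 / w) + ((t ^ ?n) powr (w - 1)) powr (1 / w)"
    unfolding m_def max_def by auto
   also have "... = t powr (?n * (1 / r)) + t powr (?n * (1 - 1 / w))"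
   proof -
    have "w / r * (1 / w) = 1 / r" "(w - 1) * (1 / w) = 1 - 1 / w" using w by (auto simp: field_simps)
    then show ?thesis unfolding powr_powr[of "t ^ ?n"] using powr_power_n[OF t] by (simp only:)
   qed
   finally have "m powr (1 / w) <= t powr (?n * (1 / r)) + t powr (?n * (1 - 1 / w))" .
   then show "(C * m) powr (1 / w) <= C powr (1 / w) * (t powr (?n * (1 / r)) + t powr (?n * (1 - 1 / w)))"
    using C(1) m0 by (simp add: powr_mult mult_left_mono)
  qed auto
  finally show ?thesis .
 qed
 moreover have "C powr (1 / w) > 0" using C by simp
 ultimately show ?thesis by blast
qed

text \<open>With a supremum outside, a row sum is at most the number of its terms times that
  supremum: boundedly many for t <= 1 and O(N) for t >= 1. In the latter case N^(1 + (r - 2)) * N =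
  N^r yields t^n after the root.\<close>

lemma dil_mnorm_inf:
 assumes r: "2 <= r"
 shows "\<exists>C>0. \<forall>t f. 0 < t --> f \<in> schwartz --> mnorm (ereal r) \<infinity> (dil (1 / t) f) \<le>
  ennreal (C * (t powr (CARD('n) * (1 / r)) + t powr CARD('n))) * mnorm (ereal r) \<infinity> f"
proof -
 let ?n = "CARD('n)"
 have r1: "1 <= r" using r by simp
 obtain C1 where C1: "C1 > 0" "\<And>c K f l. 1 <= c ==> f \<in> schwartz ==> (\<forall>k\<in>K. l \<in> Lk c k) ==>
  (\<Sum>k\<in>K. Ip r (B k (dil c (B l f)))) <= ennreal (C1 * inverse (c ^ ?n) * (c ^ ?n) powr (max 0 (2 - r))) * Ip r (B l f)"
  using B_dil_analysis[OF r1] by auto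
 obtain C2 where C2: "C2 > 0" "\<And>b L k f. 1 <= b ==> finite L ==> real (card L) <= 4 ^ ?n * b ^ ?n ==> f \<in> schwartz ==>
  Ip r (\<lambda>x. \<Sum>l\<in>L. B k (dil (1 / b) (B l f)) x) <= ennreal (C2 * (b ^ ?n) powr (1 + max 0 (r - 2))) * (\<Sum>l\<in>L. Ip r (B l f))"
  using B_dil_synthesis[OF r1, of "4 ^ ?n"] by auto
 define F where "F = (4::real) ^ ?n"
 have F: "F \<ge> 1" by (simp add: F_def)
 define D where "D = (F powr (r - 1) * F * C1) + (C2 * F)"
 have D: "D > 0" using F C1 C2 by (auto simp: D_def intro!: add_pos_pos mult_pos_pos)
 have "mnorm (ereal r) \<infinity> (dil (1 / t) f) <= ennreal (D powr (1 / r) * (t powr (?n * (1 / r)) + t powr ?n)) * mnorm (ereal r) \<infinity> f"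
  if t: "0 < t" and f: "f \<in> schwartz" for t f
  unfolding mnorm_inf[of _ "dil (1 / t) f"]
 proof (intro SUP_least)
  fix k
  let ?c = "1 / t" and ?N = "t ^ ?n" and ?S = "mnorm (ereal r) \<infinity> f"
  have c: "?c > 0" and N: "?N > 0" using t by auto
  have cN: "?c ^ ?n = inverse ?N" by (simp add: divide_inverse power_inverse)
  have Sl: "Ip r (B l f) <= enn_powr ?S r" for l
   unfolding Ip_nrm[OF r1] mnorm_inf using r1 by (intro enn_powr_mono SUP_upper) auto
  have sumS: "(\<Sum>l\<in>L. Ip r (B l f)) <= ennreal (real (card L)) * enn_powr ?S r" for L
   using sum_mono[of L "\<lambda>l. Ip r (B l f)" "\<lambda>l. enn_powr ?S r"] Sl by (simp add: ennreal_of_nat_eq_real_of_nat)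
  have Bf: "B l f \<in> schwartz" for l by (intro Op_schwartz sg_schwartz f)
  have df: "dil ?c g \<in> schwartz" if "g \<in> schwartz" for g :: "real^'n => complex" using that t by (intro schwartz_dilate) auto
  have "Ip r (B k (dil ?c f)) <= ennreal (D * max ?N (?N powr r)) * enn_powr ?S r"
  proof (cases "t <= 1")
   case True
   have c1: "1 <= ?c" using True t by simp
   have cL: "real (card (Lk ?c k)) <= F"
   proof -
    have "real (card (Lk ?c k)) <= (3/2 * (1 + 1 / ?c) + 1) ^ ?n" by (rule card_Lk[OF c])
    also have "... <= 4 ^ ?n" using True t by (intro power_mono) (auto simp: field_simps)
    finally show ?thesis by (simp add: F_def)
   qed
   have "Ip r (B k (dil ?c f)) = Ip r (\<lambda>x. \<Sum>l\<in>Lk ?c k. B k (dil ?c (B l f)) x)"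
    unfolding B_dil[OF f c, of k, abs_def] ..
   also have "... <= ennreal (F powr (r - 1)) * (\<Sum>l\<in>Lk ?c k. Ip r (B k (dil ?c (B l f))))"
    by (intro Ip_sum finite_Lk cL r1 schwartz_borel Op_schwartz sg_schwartz df f)
   also have "... <= ennreal (F powr (r - 1)) * (\<Sum>l\<in>Lk ?c k. ennreal (C1 * ?N) * Ip r (B l f))"
   proof (intro mult_left_mono sum_mono)
    fix l assume "l \<in> Lk ?c k"
    then show "Ip r (B k (dil ?c (B l f))) <= ennreal (C1 * ?N) * Ip r (B l f)"
     using C1(2)[OF c1 f, of "{k}" l] r N t unfolding cN by (simp add: max_absorb1)
   qed auto
   also have "... = ennreal (F powr (r - 1) * (C1 * ?N)) * (\<Sum>l\<in>Lk ?c k. Ip r (B l f))"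
    using C1 N by (simp add: sum_distrib_left ennreal_mult mult.assoc)
   also have "... <= ennreal (F powr (r - 1) * (C1 * ?N)) * (ennreal F * enn_powr ?S r)"
    by (intro mult_left_mono order_trans[OF sumS] mult_right_mono ennreal_leI cL) auto
   also have "... = ennreal (F powr (r - 1) * (C1 * ?N) * F) * enn_powr ?S r"
    using C1 N F by (simp only: ennreal_mult mult.assoc mult_nonneg_nonneg powr_ge_zero less_imp_le) 
   also have "... <= ennreal (D * max ?N (?N powr r)) * enn_powr ?S r"
   proof (intro mult_right_mono ennreal_leI)
    have "F powr (r - 1) * (C1 * ?N) * F = (F powr (r - 1) * F * C1) * ?N" by (simp only: mult_ac)
    also have "... <= D * max ?N (?N powr r)" using F C1 C2 N by (intro mult_mono) (auto simp: D_def)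
    finally show "F powr (r - 1) * (C1 * ?N) * F <= D * max ?N (?N powr r)" .
   qed auto
   finally show ?thesis .
  next
   case False
   then have t1: "1 <= t" by simp
   have cL: "real (card (Lk ?c k)) <= F * ?N"
   proof -
    have "real (card (Lk ?c k)) <= (3/2 * (1 + 1 / ?c) + 1) ^ ?n" by (rule card_Lk[OF c])
    also have "... <= (4 * t) ^ ?n" using t1 by (intro power_mono) (auto simp: field_simps)
    finally show ?thesis by (simp add: F_def power_mult_distrib)
   qed
   have "Ip r (B k (dil ?c f)) = Ip r (\<lambda>x. \<Sum>l\<in>Lk ?c k. B k (dil ?c (B l f)) x)"
    unfolding B_dil[OF f c, of k, abs_def] ..
   also have "... <= ennreal (C2 * ?N powr (1 + max 0 (r - 2))) * (\<Sum>l\<in>Lk ?c k. Ip r (B l f))"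
    using cL by (intro C2(2) t1 finite_Lk f) (simp add: F_def)
   also have "... <= ennreal (C2 * ?N powr (1 + max 0 (r - 2))) * (ennreal (F * ?N) * enn_powr ?S r)"
    by (intro mult_left_mono order_trans[OF sumS] mult_right_mono ennreal_leI cL) auto
   also have "... = ennreal (C2 * ?N powr (1 + max 0 (r - 2)) * (F * ?N)) * enn_powr ?S r"
    using C2 N F by (subst ennreal_mult) (auto simp: mult.assoc)
   also have "... <= ennreal (D * max ?N (?N powr r)) * enn_powr ?S r"
   proof (intro mult_right_mono ennreal_leI)
    have "?N powr (1 + max 0 (r - 2)) * ?N = ?N powr r"
    proof -
     have "1 + max 0 (r - 2) + 1 = r" using r by simp
     then show ?thesis using N by (metis powr_add powr_one less_imp_le)
    qed
    then have "C2 * ?N powr (1 + max 0 (r - 2)) * (F * ?N) = (C2 * F) * ?N powr r" by (simp only: mult_ac)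
    also have "... <= D * max ?N (?N powr r)" using F C1 C2 N by (intro mult_mono) (auto simp: D_def)
    finally show "C2 * ?N powr (1 + max 0 (r - 2)) * (F * ?N) <= D * max ?N (?N powr r)" .
   qed auto
   finally show ?thesis .
  qed
  then have "nrm (ereal r) (B k (dil ?c f)) <= enn_powr (ennreal (D * max ?N (?N powr r)) * enn_powr ?S r) (1 / r)"
   unfolding nrm_Ip using r by (intro enn_powr_mono) auto
  also have "... = ennreal ((D * max ?N (?N powr r)) powr (1 / r)) * ?S"
   using D N r by (simp add: enn_powr_mult enn_powr_ennreal le_max_iff_disj)
  also have "... <= ennreal (D powr (1 / r) * (t powr (?n * (1 / r)) + t powr ?n)) * ?S"
  proof (intro mult_right_mono ennreal_leI)
   have "(max ?N (?N powr r)) powr (1 / r) <= ?N powr (1 / r) + (?N powr r) powr (1 / r)"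
    unfolding max_def by auto
   also have "... = t powr (?n * (1 / r)) + t powr ?n"
    using powr_power_n[OF t, of "1 / r"] powr_power_n[OF t, of 1] r by (simp add: powr_powr)
   finally show "(D * max ?N (?N powr r)) powr (1 / r) <= D powr (1 / r) * (t powr (?n * (1 / r)) + t powr ?n)"
    using D N by (simp add: powr_mult mult_left_mono)
  qed auto
  finally show "nrm (ereal r) (B k (dil ?c f)) <= ennreal (D powr (1 / r) * (t powr (?n * (1 / r)) + t powr ?n)) * ?S" .
 qed
 moreover have "D powr (1 / r) > 0" using D by simp
 ultimately show ?thesis by blast
qed

text \<open>Each dilated block is bounded by the supremum of the blocks of \<open>f\<close>, so one
  only counts the blocks that contribute.\<close>

lemma dil_mnorm_inf_inf:
 "\<exists>C>0. \<forall>t f. 0 < t --> f \<in> schwartz --> mnorm \<infinity> \<infinity> (dil (1 / t) f) \<le>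
  ennreal (C * (1 + t powr CARD('n))) * mnorm \<infinity> \<infinity> f"
proof -
 let ?n = "CARD('n)"
 define D where "D = (NBINT z. enorm (fourier (sg 0) z))"
 have Dk: "(NBINT z. enorm (fourier (sg k) z)) = D" for k
  unfolding fourier_sg[of k] D_def by (simp add: norm_mult)
 have Ctl: "(NBINT z. enorm (fourier (tt l) z)) = Ct" for l
  unfolding fourier_tt[of l] Ct_def by (simp add: norm_mult)
 have "D < \<top>" using schwartz_integrable[OF schwartz_fourier[OF sg_schwartz]] by (simp add: D_def integrable_iff_bounded)
 then have "D * Ct < \<top>" using Ct_finite by (simp add: ennreal_mult_less_top)
 then obtain d where d: "D * Ct = ennreal d" "d \<ge> 0" by (cases "D * Ct") auto
 have "mnorm \<infinity> \<infinity> (dil (1 / t) f) <= ennreal (4 ^ ?n * (d + 1) * (1 + t powr ?n)) * mnorm \<infinity> \<infinity> f"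
  if t: "0 < t" and f: "f \<in> schwartz" for t f
  unfolding mnorm_inf[of _ "dil (1 / t) f"]
 proof (intro SUP_least)
  fix k
  let ?c = "1 / t" and ?S = "mnorm \<infinity> \<infinity> f"
  have c: "?c > 0" using t by simp
  have Bf: "B l f \<in> schwartz" for l by (intro Op_schwartz sg_schwartz f)
  have df: "dil ?c g \<in> schwartz" if "g \<in> schwartz" for g :: "real^'n => complex" using that t by (intro schwartz_dilate) auto
  have 1: "enorm (B l f x) <= Ct * ?S" for l x
  proof -
   have "enorm (B l f x) = enorm (Op (tt l) (B l f) x)" by (simp add: B_tt schwartz_tame f)
   also have "... <= Ct * nrm \<infinity> (B l f)"
    unfolding Ctl[of l, symmetric] by (intro cv_sup schwartz_borel Bf schwartz_fourier tt_schwartz)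
   also have "... <= Ct * ?S" unfolding mnorm_inf by (intro mult_left_mono SUP_upper) auto
   finally show ?thesis .
  qed
  have 2: "enorm (B k (dil ?c (B l f)) x) <= D * (Ct * ?S)" for l x
  proof -
   have "enorm (B k (dil ?c (B l f)) x) <= D * nrm \<infinity> (dil ?c (B l f))"
    unfolding Dk[of k, symmetric] by (intro cv_sup schwartz_borel df Bf schwartz_fourier sg_schwartz)
   also have "... <= D * (Ct * ?S)"
    by (intro mult_left_mono nrm_infI 1 schwartz_borel df Bf) auto
   finally show ?thesis .
  qed
  show "nrm \<infinity> (B k (dil ?c f)) <= ennreal (4 ^ ?n * (d + 1) * (1 + t powr ?n)) * ?S"
  proof (rule nrm_infI)
   show "B k (dil ?c f) \<in> borelM" by (intro schwartz_borel Op_schwartz sg_schwartz df f)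
   fix x
   have cL: "real (card (Lk ?c k)) <= 4 ^ ?n * (1 + t powr ?n)"
   proof -
    have "real (card (Lk ?c k)) <= (3/2 * (1 + 1 / ?c) + 1) ^ ?n" by (rule card_Lk[OF c])
    also have "... <= (4 * max 1 t) ^ ?n" using t by (intro power_mono) (auto simp: max_def field_simps)
    also have "... = 4 ^ ?n * (max 1 t) ^ ?n" by (simp add: power_mult_distrib)
    also have "(max 1 t) ^ ?n <= 1 + t powr ?n" using t by (auto simp: max_def powr_realpow)
    finally show ?thesis by simp
   qed
   have "enorm (B k (dil ?c f) x) <= ennreal (\<Sum>l\<in>Lk ?c k. norm (B k (dil ?c (B l f)) x))"
    unfolding B_dil[OF f c, of k x] by (intro ennreal_leI norm_sum)
   also have "... = (\<Sum>l\<in>Lk ?c k. enorm (B k (dil ?c (B l f)) x))" by (simp add: sum_ennreal)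
   also have "... <= (\<Sum>l\<in>Lk ?c k. D * (Ct * ?S))" by (intro sum_mono 2)
   also have "... = ennreal (real (card (Lk ?c k))) * (ennreal d * ?S)"
    by (simp add: d(1)[symmetric] mult.assoc ennreal_of_nat_eq_real_of_nat)
   also have "... <= ennreal (4 ^ ?n * (1 + t powr ?n)) * (ennreal (d + 1) * ?S)"
    using d by (intro mult_mono ennreal_leI cL) auto
   also have "... = ennreal (4 ^ ?n * (d + 1) * (1 + t powr ?n)) * ?S"
    using d by (simp add: ennreal_mult mult_ac)
   finally show "enorm (B k (dil ?c f) x) <= ennreal (4 ^ ?n * (d + 1) * (1 + t powr ?n)) * ?S" .
  qed
 qed
 moreover have "4 ^ ?n * (d + 1) > 0" using d by simp
 ultimately show ?thesis by blast
qed

lemma dil_mnorm: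
 assumes p: "1 <= p" and q: "1 <= q" and reg: "p <= 2 \<and> q <= p \<or> 2 <= p \<and> p <= q"
 shows "\<exists>C>0. \<forall>t f. 0 < t --> f \<in> schwartz --> mnorm p q (dil (1 / t) f) \<le>
  ennreal (C * (t powr (CARD('n) * einv p) + t powr (CARD('n) * (1 - einv q)))) * mnorm p q f"
 using p
proof (cases rule: ereal_ge_1_cases)
 case 1
 then have "q = \<infinity>" using reg by auto
 show ?thesis
  using dil_mnorm_inf_inf by (simp add: 1 \<open>q = \<infinity>\<close> einv_def)
next
 case (2 r)
 note pr = this
 from q show ?thesis
 proof (cases rule: ereal_ge_1_cases)
  case 1
  then have "2 <= r" using reg pr by auto
  from dil_mnorm_inf[OF this] show ?thesis by (simp add: pr 1 einv_def)
 next
  case (2 w)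
  have "r <= 2 \<and> w <= r \<or> 2 <= r \<and> r <= w" using reg unfolding pr 2 by (simp add: numeral_eq_ereal)
  from dil_mnorm_fin[OF pr(2) 2(2) this] show ?thesis by (simp add: pr 2 einv_def)
 qed
qed

end

section \<open>Hausdorff operators\<close>

text \<open>The kernel is Borel here; the theorem itself passes from a Lebesgue measurable kernel to
  an almost everywhere equal Borel one.\<close>

locale hausdorff = window \<eta> for \<eta> :: "real^'n::finite => real" +
 fixes \<Phi> :: "real^'n => real"
 assumes Phi_borel [measurable]: "\<Phi> \<in> borelM"
  and Phi_ge: "\<Phi> y \<ge> 0"
  and near_0: "(\<integral>\<^sup>+y\<in>ball 0 1. ennreal (norm y ^ CARD('n) * \<Phi> y) \<partial>lborel) < \<infinity>"
  and far: "(\<integral>\<^sup>+y\<in>- ball 0 1. ennreal (\<Phi> y) \<partial>lborel) < \<infinity>"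
begin

abbreviation HH :: "(real^'n => complex) => real^'n => complex" where
 "HH f x \<equiv> LBINT y. of_real (\<Phi> y) * dil (1 / norm y) f x"

lemma hausdorff_op_eq:
 assumes "f \<in> schwartz" shows "hausdorff_op \<Phi> f x = HH f x"
proof -
 have [measurable]: "f \<in> borelM" by (rule schwartz_borel[OF assms])
 show ?thesis unfolding hausdorff_op_def
  by (subst integral_completion) (simp_all add: divide_inverse)
qed

lemma AE_nonzero: "AE y in lborel. norm (y::real^'n) > 0"
 using AE_lborel_singleton[of "0::real^'n"] by eventually_elim auto

lemma min_finite: "(NBINT y. ennreal (min 1 (norm y ^ CARD('n)) * \<Phi> y)) < \<infinity>"
proof -
 have "(NBINT y. ennreal (min 1 (norm y ^ CARD('n)) * \<Phi> y))
  <= (NBINT y. ennreal (norm y ^ CARD('n) * \<Phi> y) * indicator (ball 0 1) y + ennreal (\<Phi> y) * indicator (- ball 0 1) y)"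
 proof (rule nn_integral_mono)
  fix y :: "real^'n"
  show "ennreal (min 1 (norm y ^ CARD('n)) * \<Phi> y) <= ennreal (norm y ^ CARD('n) * \<Phi> y) * indicator (ball 0 1) y + ennreal (\<Phi> y) * indicator (- ball 0 1) y"
   using Phi_ge[of y] power_le_one[of "norm y" "CARD('n)"] by (cases "norm y < 1") (auto intro!: ennreal_leI mult_right_mono mult_left_le_one_le simp: min_def)
 qed
 also have "... = (\<integral>\<^sup>+y\<in>ball 0 1. ennreal (norm y ^ CARD('n) * \<Phi> y) \<partial>lborel) + (\<integral>\<^sup>+y\<in>- ball 0 1. ennreal (\<Phi> y) \<partial>lborel)"
  by (intro nn_integral_add borel_measurable_times_ennreal borel_measurable_indicator) (simp_all, measurable)
 also have "... < \<infinity>" using near_0 far by (simp add: ennreal_add_less_top)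
 finally show ?thesis .
qed

text \<open>The bound 1 uses that \<open>f\<close> is bounded, the bound t^n that it is integrable.
  Their minimum is the weight under which the two integrability conditions on \<Phi> combine in
  \<open>min_finite\<close>.\<close>

lemma dil_wt:
 assumes f: "f \<in> schwartz"
 shows "\<exists>M>0. \<forall>t>0. (NBINT z. ennreal (norm (dil (1 / t) f z) * wt (z::real^'n))) <= ennreal (M * min 1 (t ^ CARD('n)))"
proof -
 have [measurable]: "f \<in> borelM" by (rule schwartz_borel[OF f])
 obtain W where W: "W > 0" "(NBINT z. ennreal (wt (z::real^'n))) = ennreal W" by (rule nn_integral_wt)
 obtain S where S: "S > 0" "\<And>x. norm (f x) <= S" using wboundE[OF schwartz_wbound[OF f, of 0]] by auto
 have "integrable lborel f" by (rule schwartz_integrable[OF f])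
 then have "(NBINT z. enorm (f z)) < \<infinity>" by (simp add: integrable_iff_bounded)
 then obtain I where I: "I \<ge> 0" "(NBINT z. enorm (f z)) = ennreal I"
  by (cases "\<integral>\<^sup>+z. enorm (f z) \<partial>lborel") auto
 have "(NBINT z. ennreal (norm (dil (1 / t) f z) * wt z)) <= ennreal ((S * W + I) * min 1 (t ^ CARD('n)))" if t: "t > 0" for t
 proof -
  let ?t1 = "NBINT z. ennreal (norm (dil (1 / t) f z) * wt z)"
  have "?t1 <= (NBINT z. ennreal S * ennreal (wt (z::real^'n)))"
   using S by (intro nn_integral_mono) (auto simp: ennreal_mult[symmetric] intro!: ennreal_leI mult_right_mono)
  also have "... = ennreal (S * W)" using W S by (simp add: nn_integral_cmult ennreal_mult)
  finally have 1: "?t1 <= ennreal (S * W)" .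
  have "?t1 <= (NBINT z. enorm (dil (1 / t) f z))"
   by (intro nn_integral_mono ennreal_leI) (simp add: mult_left_le)
  also have "... = ennreal (t ^ CARD('n)) * (NBINT z. enorm (f z))"
   using t by (subst nn_integral_affine[of _ t 0]) simp_all
  also have "... = ennreal (I * t ^ CARD('n))" using I t by (simp add: ennreal_mult[symmetric] mult.commute)
  finally have 2: "?t1 <= ennreal (I * t ^ CARD('n))" .
  have "?t1 <= ennreal (min (S * W) (I * t ^ CARD('n)))"
   using 1 2 by (simp add: min_def)
  also have "min (S * W) (I * t ^ CARD('n)) <= (S * W + I) * min 1 (t ^ CARD('n))"
   using S W I t by (auto simp: min_def algebra_simps intro: order_trans add_increasing)
  finally show ?thesis by (simp add: ennreal_leI)
 qed
 moreover have "S * W + I > 0" using S W I by (simp add: add_pos_nonneg)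
 ultimately show ?thesis by blast
qed

text \<open>Absolute convergence of the double integral against any function bounded by
  \<open>wt\<close>; it justifies every interchange of \<open>HH\<close> with a convolution.\<close>

lemma HH_joint:
 assumes f: "f \<in> schwartz" and [measurable]: "V \<in> borelM" and V: "\<And>z. norm (V z :: complex) <= A * wt z"
 shows "integrable (lborel \<Otimes>\<^sub>M lborel) (\<lambda>(y,z::real^'n). of_real (\<Phi> y) * dil (1 / norm y) f z * V z)"
proof (rule integrableI_bounded)
 have [measurable]: "f \<in> borelM" by (rule schwartz_borel[OF f])
 show m: "(\<lambda>(y,z). of_real (\<Phi> y) * dil (1 / norm y) f z * V z) \<in> borel_measurable (lborel \<Otimes>\<^sub>M lborel)"
  by measurable
 obtain M where M: "M > 0" "\<And>t. t > 0 ==> (NBINT z. ennreal (norm (dil (1 / t) f z) * wt (z::real^'n))) <= ennreal (M * min 1 (t ^ CARD('n)))"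
  using dil_wt[OF f] by auto
 have "norm (V 0) <= A" using V[of 0] by simp
 then have A: "A \<ge> 0" using norm_ge_zero order_trans by blast
 have "(\<integral>\<^sup>+x. enorm (case x of (y,z) => of_real (\<Phi> y) * dil (1 / norm y) f z * V z) \<partial>(lborel \<Otimes>\<^sub>M lborel))
   = (NBINT y. \<integral>\<^sup>+z. enorm (of_real (\<Phi> y) * dil (1 / norm y) f z * V z) \<partial>lborel)"
  using m by (subst lborel.nn_integral_fst[symmetric]) auto
 also have "... <= (NBINT y. ennreal (A * M) * ennreal (min 1 (norm y ^ CARD('n)) * \<Phi> y))"
 proof (rule nn_integral_mono_AE)
  show "AE y in lborel. (NBINT z. enorm (of_real (\<Phi> y) * dil (1 / norm y) f z * V z))
   <= ennreal (A * M) * ennreal (min 1 (norm y ^ CARD('n)) * \<Phi> y)"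
   using AE_nonzero
  proof eventually_elim
   case (elim y)
   have "(NBINT z. enorm (of_real (\<Phi> y) * dil (1 / norm y) f z * V z))
    <= (NBINT z. ennreal (\<Phi> y * A) * ennreal (norm (dil (1 / norm y) f z) * wt z))"
   proof (rule nn_integral_mono)
    fix z
    have "norm (of_real (\<Phi> y) * dil (1 / norm y) f z * V z) <= \<Phi> y * norm (dil (1 / norm y) f z) * (A * wt z)"
     unfolding norm_mult using V[of z] Phi_ge[of y] by (intro mult_mono) auto
    then show "enorm (of_real (\<Phi> y) * dil (1 / norm y) f z * V z) <= ennreal (\<Phi> y * A) * ennreal (norm (dil (1 / norm y) f z) * wt z)"
     using Phi_ge[of y] A by (simp add: ennreal_mult[symmetric] mult_ac)
   qed
   also have "... = ennreal (\<Phi> y * A) * (NBINT z. ennreal (norm (dil (1 / norm y) f z) * wt z))"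
    by (rule nn_integral_cmult) measurable
   also have "... <= ennreal (\<Phi> y * A) * ennreal (M * min 1 (norm y ^ CARD('n)))"
    by (intro mult_left_mono M(2) elim) auto
   also have "... = ennreal (A * M) * ennreal (min 1 (norm y ^ CARD('n)) * \<Phi> y)"
    using Phi_ge[of y] A M(1) by (simp add: ennreal_mult[symmetric] mult_ac)
   finally show ?case .
  qed
 qed
 also have "... = ennreal (A * M) * (NBINT y. ennreal (min 1 (norm y ^ CARD('n)) * \<Phi> y))"
  by (rule nn_integral_cmult) measurable
 also have "... < \<infinity>" using min_finite by (simp add: ennreal_mult_less_top)
 finally show "(\<integral>\<^sup>+x. enorm (case x of (y,z) => of_real (\<Phi> y) * dil (1 / norm y) f z * V z) \<partial>(lborel \<Otimes>\<^sub>M lborel)) < \<infinity>" .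
qed

lemma HH_borel: "f \<in> schwartz ==> HH f \<in> borelM"
proof -
 assume "f \<in> schwartz"
 then have [measurable]: "f \<in> borelM" by (rule schwartz_borel)
 show ?thesis by measurable
qed

lemma HH_swap:
 assumes f: "f \<in> schwartz" and V: "V \<in> borelM" "\<And>z. norm (V z :: complex) <= A * wt z"
 shows "integrable lborel (\<lambda>z. HH f z * V z)"
  "(LBINT z. HH f z * V z) = (LBINT y. of_real (\<Phi> y) * (LBINT (z::real^'n). dil (1 / norm y) f z * V z))"
  "integrable lborel (\<lambda>y. of_real (\<Phi> y) * (LBINT (z::real^'n). dil (1 / norm y) f z * V z))"
proof -
 note i = HH_joint[OF f V]
 have e: "HH f z * V z = (LBINT y. of_real (\<Phi> y) * dil (1 / norm y) f z * V z)" for z by simp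
 have e': "of_real (\<Phi> y) * (LBINT (z::real^'n). dil (1 / norm y) f z * V z) = (LBINT z. of_real (\<Phi> y) * dil (1 / norm y) f z * V z)" for y
  by (simp add: mult.assoc)
 show "integrable lborel (\<lambda>z. HH f z * V z)" unfolding e by (rule lborel_pair.integrable_snd[OF i])
 show "integrable lborel (\<lambda>y. of_real (\<Phi> y) * (LBINT (z::real^'n). dil (1 / norm y) f z * V z))"
  unfolding e' by (rule lborel_pair.integrable_fst[OF i])
 show "(LBINT z. HH f z * V z) = (LBINT y. of_real (\<Phi> y) * (LBINT (z::real^'n). dil (1 / norm y) f z * V z))"
  unfolding e e' by (rule lborel_pair.Fubini_integral[OF i])
qed

lemma HH_tame: assumes f: "f \<in> schwartz" shows "tame (HH f)"
proof -
 have "integrable lborel (\<lambda>z. HH f z * of_real (wt z))" by (rule HH_swap(1)[OF f, where A=1]) auto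
 then have "integrable lborel (\<lambda>z. norm (HH f z * of_real (wt z)))" by (rule integrable_norm)
 then show ?thesis using HH_borel[OF f] by (simp add: tame_def norm_mult mult.commute)
qed

lemma cv_HH:
 assumes f: "f \<in> schwartz" and K: "wbound 1 K"
 shows "cv K (HH f) x = (LBINT y. of_real (\<Phi> y) * cv K (dil (1 / norm y) f) x)"
  "integrable lborel (\<lambda>y. of_real (\<Phi> y) * cv K (dil (1 / norm y) f) x)"
proof -
 note [measurable] = schwartz_borel[OF f] wbound_borel[OF K] HH_borel[OF f]
 obtain C where C: "C > 0" "\<And>x. norm (K x) <= C * wt x" using wboundE[OF K] by auto
 have V: "norm (K (z - x)) <= C * (2 ^ CARD('n) / wt x) * wt z" for z
 proof -
  have "wt (z + - x) <= 2 ^ CARD('n) * wt z / wt (- x)" by (rule wt_add')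
  then have "C * wt (z + - x) <= C * (2 ^ CARD('n) * wt z / wt x)" using C by (intro mult_left_mono) auto
  with C(2)[of "z - x"] show ?thesis by simp
 qed
 have e: "cv K g x = (LBINT z. g z * K (z - x))" if [measurable]: "g \<in> borelM" for g
  unfolding cv_def using integral_shift(1)[of "\<lambda>z. g z * K (z - x)" x] by simp
 have d: "dil (1 / norm y) f \<in> borelM" for y :: "real^'n" by measurable
 have m: "(\<lambda>z. K (z - x)) \<in> borelM" by measurable
 show "cv K (HH f) x = (LBINT y. of_real (\<Phi> y) * cv K (dil (1 / norm y) f) x)"
  unfolding e[OF HH_borel[OF f]] e[OF d] by (rule HH_swap(2)[OF f m V])
 show "integrable lborel (\<lambda>y. of_real (\<Phi> y) * cv K (dil (1 / norm y) f) x)"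
  unfolding e[OF d] by (rule HH_swap(3)[OF f m V])
qed

text \<open>Minkowski in L^p for each block and then in l^q over the blocks. The intermediate bound
  must be measurable in y: for finite p the block norms are given by integrals, and for p =
  \<infinity>, where q = \<infinity> too, the majorant \<open>A\<close> serves for all blocks at
  once.\<close>

lemma mnorm_HH_le:
 assumes f: "f \<in> schwartz" and p: "1 <= p" and q: "1 <= q" and pq: "p = \<infinity> ==> q = \<infinity>"
  and A[measurable]: "A \<in> borelM"
  and le: "\<And>y. norm y > 0 ==> ennreal (\<Phi> y) * mnorm p q (dil (1 / norm y) f) <= A y"
 shows "mnorm p q (HH f) <= (NBINT y. A y)"
proof -
 note [measurable] = schwartz_borel[OF f] schwartz_borel[OF schwartz_fourier[OF sg_schwartz]]
 define F where "F k x y = ennreal (\<Phi> y) * enorm (B k (dil (1 / norm y) f) x)" for k and x y :: "real^'n"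
 have Fm: "(\<lambda>(x,y). F k x y) \<in> borel_measurable (lborel \<Otimes>\<^sub>M lborel)" for k
  unfolding F_def cv_def by measurable
 have dm: "B k (dil c f) \<in> borelM" for k c by measurable
 have BF: "enorm (B k (HH f) x) <= (NBINT y. F k x y)" for k x
  unfolding cv_HH(1)[OF f fourier_wbound[OF sg_schwartz]]
  by (rule order_trans[OF norm_integral_le]) (simp add: F_def norm_mult ennreal_mult Phi_ge)
 have BHm: "B k (HH f) \<in> borelM" for k by (intro B_borel HH_tame f)
 have Fl: "lpn lborel p (\<lambda>x. F k x y) <= ennreal (\<Phi> y) * nrm p (B k (dil (1 / norm y) f))" for k y
  unfolding F_def using dm by (intro lpn_cmult_le p) auto
 have nF: "nrm p (B k (HH f)) <= (NBINT y. a y)"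
  if "a \<in> borelM" "AE y in lborel. ennreal (\<Phi> y) * nrm p (B k (dil (1 / norm y) f)) <= a y" for k a
 proof -
  have "nrm p (B k (HH f)) <= lpn lborel p (\<lambda>x. \<integral>\<^sup>+y. F k x y \<partial>lborel)"
   using BHm BF by (intro lpn_mono p) auto
  also have "... <= (NBINT y. a y)"
  proof (rule minkowski[OF sigma_finite_lborel' sigma_finite_lborel' Fm _ p])
   show "AE y in lborel. lpn lborel p (\<lambda>x. F k x y) <= a y"
    using that(2) by eventually_elim (rule order_trans[OF Fl])
  qed (use that in auto)
  finally show ?thesis .
 qed
 show ?thesis
 proof (cases "p = \<infinity>")
  case True
  have "nrm p (B k (HH f)) <= (NBINT y. A y)" for k
  proof (rule nF)
   show "AE y in lborel. ennreal (\<Phi> y) * nrm p (B k (dil (1 / norm y) f)) <= A y"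
    using AE_nonzero
   proof eventually_elim
    case (elim y)
    have "ennreal (\<Phi> y) * nrm p (B k (dil (1 / norm y) f)) <= ennreal (\<Phi> y) * mnorm p q (dil (1 / norm y) f)"
     unfolding pq[OF True] mnorm_inf by (intro mult_left_mono SUP_upper) auto
    also have "... <= A y" by (rule le[OF elim])
    finally show ?case .
   qed
  qed simp
  then show ?thesis unfolding pq[OF True] mnorm_inf by (intro SUP_least)
 next
  case False
  then obtain r where r: "p = ereal r" "1 <= r" using ereal_ge_1_cases[OF p] by blast
  define a where "a k y = ennreal (\<Phi> y) * nrm p (B k (dil (1 / norm y) f))" for k and y :: "real^'n"
  have am [measurable]: "a k \<in> borelM" for k
   unfolding a_def r lpn_real cv_def by measurable
  have "mnorm p q (HH f) <= lpn (count_space UNIV) q (\<lambda>k. \<integral>\<^sup>+y. a k y \<partial>lborel)"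
   unfolding mnorm_def by (intro lpn_mono q nF am) (auto simp: a_def)
  also have "... <= (NBINT y. A y)"
  proof (rule minkowski[OF _ sigma_finite_lborel' _ _ q])
   show "sigma_finite_measure (count_space (UNIV :: (int^'n) set))" by (rule sigma_finite_measure_count_space_countable) simp
   have "(\<lambda>x. a (fst x) (snd x)) \<in> borel_measurable (count_space UNIV \<Otimes>\<^sub>M lborel)"
    by (rule measurable_compose_countable[where f="\<lambda>k x. a k (snd x)" and g=fst]) auto
   then show "(\<lambda>(k,y). a k y) \<in> borel_measurable (count_space UNIV \<Otimes>\<^sub>M lborel)"
    by (simp add: case_prod_beta')
   show "AE y in lborel. lpn (count_space UNIV) q (\<lambda>k. a k y) <= A y"
    using AE_nonzero
   proof eventually_elim
    case (elim y)
    have "lpn (count_space UNIV) q (\<lambda>k. a k y) <= ennreal (\<Phi> y) * mnorm p q (dil (1 / norm y) f)"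
     unfolding a_def mnorm_def by (intro lpn_cmult_le q) auto
    also have "... <= A y" by (rule le[OF elim])
    finally show ?case .
   qed
  qed simp
  finally show ?thesis .
 qed
qed

lemma sufficiency:
 assumes p: "1 <= p" and q: "1 <= q" and reg: "p <= 2 \<and> q <= p \<or> 2 <= p \<and> p <= q"
  and fin: "(NBINT y. ennreal ((norm y powr (CARD('n) * einv p) + norm y powr (CARD('n) * (1 - einv q))) * \<Phi> y)) < \<infinity>"
 shows "\<exists>C\<ge>0. \<forall>f\<in>schwartz. mnorm p q (HH f) <= ennreal C * mnorm p q f"
proof -
 let ?w = "\<lambda>y::real^'n. norm y powr (CARD('n) * einv p) + norm y powr (CARD('n) * (1 - einv q))"
 obtain C where C: "C > 0" "\<And>t f. 0 < t ==> f \<in> schwartz ==> mnorm p q (dil (1 / t) f) \<le>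
  ennreal (C * (t powr (CARD('n) * einv p) + t powr (CARD('n) * (1 - einv q)))) * mnorm p q f"
  using dil_mnorm[OF p q reg] by auto
 obtain I where I: "I \<ge> 0" "(NBINT y. ennreal (?w y * \<Phi> y)) = ennreal I"
  using fin by (cases "\<integral>\<^sup>+y. ennreal (?w y * \<Phi> y) \<partial>lborel") auto
 have "mnorm p q (HH f) <= ennreal (C * I) * mnorm p q f" if f: "f \<in> schwartz" for f
 proof -
  have "mnorm p q (HH f) <= (NBINT y. ennreal (?w y * \<Phi> y) * (ennreal C * mnorm p q f))"
  proof (rule mnorm_HH_le[OF f p q])
   show "p = \<infinity> ==> q = \<infinity>" using reg by auto
   fix y :: "real^'n" assume y: "norm y > 0"
   have "ennreal (\<Phi> y) * mnorm p q (dil (1 / norm y) f) <= ennreal (\<Phi> y) * (ennreal (C * ?w y) * mnorm p q f)"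
    by (intro mult_left_mono C(2) y f) auto
   also have "... = ennreal (?w y * \<Phi> y) * (ennreal C * mnorm p q f)"
    using C(1) Phi_ge[of y] by (simp add: ennreal_mult mult_ac)
   finally show "ennreal (\<Phi> y) * mnorm p q (dil (1 / norm y) f) <= ennreal (?w y * \<Phi> y) * (ennreal C * mnorm p q f)" .
  qed measurable
  also have "... = ennreal I * (ennreal C * mnorm p q f)" unfolding I(2)[symmetric] by (rule nn_integral_multc) measurable
  also have "... = ennreal (C * I) * mnorm p q f" using I C by (simp add: ennreal_mult mult_ac)
  finally show ?thesis .
 qed
 moreover have "C * I \<ge> 0" using C I by simp
 ultimately show ?thesis by blast
qed

text \<open>Passing between the distributional and the functional norm costs one factor
  \<open>Ct\<close> in each direction.\<close>

lemma bounded_iff: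
 assumes p: "1 <= p" and q: "1 <= q"
 shows "bounded_on_modulation \<eta> p q (hausdorff_op \<Phi>) \<longleftrightarrow> (\<exists>C\<ge>0. \<forall>f\<in>schwartz. mnorm p q (HH f) <= ennreal C * mnorm p q f)"
proof -
 obtain c where c: "c \<ge> 0" "Ct = ennreal c" using Ct_finite by (cases Ct) auto
 have e: "hausdorff_op \<Phi> f = HH f" if "f \<in> schwartz" for f using hausdorff_op_eq[OF that] by auto
 show ?thesis
 proof
  assume "bounded_on_modulation \<eta> p q (hausdorff_op \<Phi>)"
  then obtain C where C: "C \<ge> 0" "\<And>f. f \<in> schwartz ==> modulation_norm \<eta> p q (distr_of (HH f)) <= ennreal C * modulation_norm \<eta> p q (distr_of f)"
   unfolding bounded_on_modulation_def using e by auto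
  have "mnorm p q (HH f) <= ennreal (c * C) * mnorm p q f" if f: "f \<in> schwartz" for f
  proof -
   have "mnorm p q (HH f) <= Ct * modulation_norm \<eta> p q (distr_of (HH f))" by (intro mnorm_lower p q HH_tame f)
   also have "... <= Ct * (ennreal C * mnorm p q f)"
    by (intro mult_left_mono order_trans[OF C(2)[OF f]] mnorm_upper q schwartz_tame f) auto
   finally show ?thesis using c C(1) by (simp add: ennreal_mult mult.assoc)
  qed
  then show "\<exists>C\<ge>0. \<forall>f\<in>schwartz. mnorm p q (HH f) <= ennreal C * mnorm p q f"
   using c C(1) by (intro exI[of _ "c * C"]) auto
 next
  assume "\<exists>C\<ge>0. \<forall>f\<in>schwartz. mnorm p q (HH f) <= ennreal C * mnorm p q f"
  then obtain C where C: "C \<ge> 0" "\<And>f. f \<in> schwartz ==> mnorm p q (HH f) <= ennreal C * mnorm p q f" by auto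
  have "modulation_norm \<eta> p q (distr_of (HH f)) <= ennreal (C * c) * modulation_norm \<eta> p q (distr_of f)" if f: "f \<in> schwartz" for f
  proof -
   have "modulation_norm \<eta> p q (distr_of (HH f)) <= mnorm p q (HH f)" by (intro mnorm_upper q HH_tame f)
   also have "... <= ennreal C * mnorm p q f" by (rule C(2)[OF f])
   also have "... <= ennreal C * (Ct * modulation_norm \<eta> p q (distr_of f))" by (intro mult_left_mono mnorm_lower p q schwartz_tame f) auto
   finally show ?thesis using c C(1) by (simp add: ennreal_mult mult.assoc)
  qed
  then show "bounded_on_modulation \<eta> p q (hausdorff_op \<Phi>)"
   unfolding bounded_on_modulation_def using e c C(1) by (intro exI[of _ "C * c"]) auto
 qed
qed

end

section \<open>Test functions\<close>

lemma geometric_min_sum: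
 fixes u v :: "nat => real"
 assumes \<rho>: "0 < \<rho>" "\<rho> < 1" and u0: "\<And>j. 0 <= u j" and v0: "\<And>j. 0 <= v j"
  and u: "\<And>j. u (Suc j) <= \<rho> * u j" and v: "\<And>j. v j <= \<rho> * v (Suc j)"
  and M: "\<And>j. j < J ==> min (u j) (v j) <= M" "0 <= M"
 shows "(\<Sum>j<J. min (u j) (v j)) <= 2 / (1 - \<rho>) * M"
proof -
 have ud: "u (Suc j) <= u j" for j using u[of j] mult_right_mono[of \<rho> 1 "u j"] u0[of j] \<rho> by simp
 have vi: "v j <= v (Suc j)" for j using v[of j] mult_right_mono[of \<rho> 1 "v (Suc j)"] v0[of "Suc j"] \<rho> by simp
 have um: "i <= j ==> u j <= u i" for i j using ud by (rule lift_Suc_antimono_le)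
 have vm: "i <= j ==> v i <= v j" for i j using vi by (rule lift_Suc_mono_le)
 have su: "(1 - \<rho>) * (\<Sum>j<l. u (m + j)) <= u m" for l m
 proof -
  have "(1 - \<rho>) * (\<Sum>j<l. u (m + j)) + u (m + l) <= u m"
  proof (induction l)
   case (Suc l)
   then show ?case using u[of "m + l"] by (simp add: algebra_simps)
  qed simp
  then show ?thesis using u0[of "m + l"] by linarith
 qed
 have sv: "(1 - \<rho>) * (\<Sum>j<Suc l. v j) <= v l" for l
 proof (induction l)
  case 0
  then show ?case using v0[of 0] \<rho> by (simp add: algebra_simps)
 next
  case (Suc l)
  then show ?case using v[of l] by (simp add: algebra_simps)
 qed
 \<comment> \<open>The first crossing index; the value \<open>J\<close> when there is none before
   \<open>J\<close> leaves the second part of the sum empty.\<close>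
 define m where "m = (if \<exists>j<J. u j <= v j then LEAST j. u j <= v j else J)"
 have mJ: "m <= J"
 proof (cases "\<exists>j<J. u j <= v j")
  case True
  then obtain j where "j < J" "u j <= v j" by blast
  then have "(LEAST j. u j <= v j) <= j" by (intro Least_le)
  then show ?thesis using \<open>j < J\<close> True by (simp add: m_def)
 qed (simp add: m_def del: not_ex)
 have before: "min (u j) (v j) = v j" if "j < m" for j
 proof -
  have "\<not> u j <= v j"
  proof
   assume "u j <= v j"
   moreover have "j < J" using that mJ by simp
   ultimately show False using that not_less_Least[of j "\<lambda>j. u j <= v j"] by (auto simp: m_def split: if_splits)
  qed
  then show ?thesis by simp
 qed
 have after: "min (u (m + j)) (v (m + j)) = u (m + j)" if "m < J" for j
 proof -
  have ex: "\<exists>j<J. u j <= v j" using that by (auto simp: m_def split: if_splits)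
  then have "u m <= v m" unfolding m_def by (auto intro: LeastI)
  then show ?thesis using um[of m "m + j"] vm[of m "m + j"] by simp
 qed
 let ?t1 = "\<Sum>j<J - m. min (u (m + j)) (v (m + j))"
 have "(1 - \<rho>) * (\<Sum>j<m. min (u j) (v j)) <= M"
 proof (cases m)
  case (Suc l)
  have "(1 - \<rho>) * (\<Sum>j<m. min (u j) (v j)) = (1 - \<rho>) * (\<Sum>j<Suc l. v j)" using before unfolding Suc by simp
  also have "... <= v l" by (rule sv)
  also have "v l <= M" using M(1)[of l] before[of l] mJ Suc by simp
  finally show ?thesis .
 qed (use M in simp)
 moreover have "(1 - \<rho>) * ?t1 <= M"
 proof (cases "m < J")
  case True
  have "(1 - \<rho>) * ?t1 = (1 - \<rho>) * (\<Sum>j<J - m. u (m + j))" using after[OF True] by simp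
  also have "... <= u m" by (rule su)
  also have "u m <= M" using M(1)[OF True] after[OF True, of 0] by simp
  finally show ?thesis .
 qed (use M in simp)
 moreover have "(\<Sum>j<J. min (u j) (v j)) = (\<Sum>j<m. min (u j) (v j)) + ?t1"
 proof -
  have "(\<Sum>j<m + l. f j) = (\<Sum>j<m. f j) + (\<Sum>j<l. f (m + j))" for l and f :: "nat => real"
   by (induction l) auto
  from this[where l="J - m"] mJ show ?thesis by simp
 qed
 ultimately have "(1 - \<rho>) * (\<Sum>j<J. min (u j) (v j)) <= 2 * M" by (simp add: distrib_left)
 then show ?thesis using \<rho> by (simp add: field_simps)
qed

text \<open>The summands increase geometrically up to the crossing point of \<open>u\<close> and \<open>v\<close> and decrease
 geometrically after it, so the sum is comparable to its largest term.\<close>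

lemma geometric_min_powr:
 fixes u v :: "nat => real"
 assumes \<rho>: "0 < \<rho>" "\<rho> < 1" and u0: "\<And>j. 0 <= u j" and v0: "\<And>j. 0 <= v j"
  and u: "\<And>j. u (Suc j) <= \<rho> * u j" and v: "\<And>j. v j <= \<rho> * v (Suc j)" and r: "0 < r"
 shows "(\<Sum>j<J. min (u j) (v j)) powr r <= (2 / (1 - \<rho>)) powr r * (\<Sum>j<J. min (u j) (v j) powr r)"
proof (cases "J = 0")
 case False
 let ?a = "\<lambda>j. min (u j) (v j)"
 define M where "M = Max (?a ` {..<J})"
 have "M \<in> ?a ` {..<J}" unfolding M_def using False by (intro Max_in) auto
 then obtain i where i: "i < J" "M = ?a i" by auto
 have M0: "M \<ge> 0" using u0 v0 i by simp
 have "(\<Sum>j<J. ?a j) <= 2 / (1 - \<rho>) * M"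
 proof (rule geometric_min_sum[where u=u and v=v])
  show "?a j <= M" if "j < J" for j using that by (auto simp: M_def)
 qed (use \<rho> u0 v0 u v M0 in auto)
 then have "(\<Sum>j<J. ?a j) powr r <= (2 / (1 - \<rho>) * M) powr r"
  using u0 v0 r by (intro powr_mono2 sum_nonneg) auto
 also have "... = (2 / (1 - \<rho>)) powr r * ?a i powr r" unfolding i(2)[symmetric] using \<rho> M0 by (intro powr_mult)
 also have "... <= (2 / (1 - \<rho>)) powr r * (\<Sum>j<J. ?a j powr r)"
  using i by (intro mult_left_mono member_le_sum) auto
 finally show ?thesis .
qed (use r in simp)

lemma integral_ge_cball:
 fixes h :: "real^'n::finite => real"
 assumes h: "integrable lborel h" "\<And>z. 0 <= h z" and a: "\<And>z. norm (z - v) <= r ==> a <= h z" "0 <= a" and r: "0 <= r"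
 shows "a * (unit_ball_vol (real CARD('n)) * r ^ CARD('n)) <= (LBINT z. h z)"
proof -
 have "a * (unit_ball_vol (real CARD('n)) * r ^ CARD('n)) = (LBINT z. indicator (cball v r) z *\<^sub>R a)"
  using content_cball[OF r, of v] by simp
 also have "... <= (LBINT z. h z)"
  using h a by (intro integral_mono integrable_scaleR_left integrable_real_indicator) (auto simp: indicator_def dist_norm norm_minus_commute emeasure_lborel_cball_finite simp flip: infinity_ennreal_def)
 finally show ?thesis .
qed

text \<open>One term suffices. Let m be the least scale with |z|/t <= r0 2^m: there \<theta> is at
  least c0, and by minimality 2^m is at most a constant times |z|/t, so the weight 2^(-mE) has the
  right size.\<close>

lemma dyadic_sum_lower:
 fixes \<theta> :: "real^'n::finite => real"
 assumes \<theta>: "\<And>x. 0 <= \<theta> x" "\<And>x. norm x <= r0 ==> c0 <= \<theta> x" and r0: "0 < r0" "r0 <= 1" and c0: "0 < c0" and B: "1 <= B" and E: "0 <= E"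
 shows "\<exists>c>0. \<forall>d::nat. \<exists>N. \<forall>J i t (z::real^'n). N <= i --> i + N <= J --> 1 / 2 ^ d <= t --> t <= 2 ^ d -->
  2 ^ i / 2 <= norm z --> norm z <= B * 2 ^ i -->
  c * (t powr E * 2 powr (- (real i * E))) <= (\<Sum>j<J. 2 powr (- (real j * E)) * \<theta> ((1 / 2 ^ j) *\<^sub>R ((1 / t) *\<^sub>R z)))"
proof -
 define c where "c = c0 * (2 * B / r0) powr (- E)"
 have c: "c > 0" using c0 B r0 by (simp add: c_def)
 have "\<exists>N. \<forall>J i t (z::real^'n). N <= i --> i + N <= J --> 1 / 2 ^ d <= t --> t <= 2 ^ d -->
  2 ^ i / 2 <= norm z --> norm z <= B * 2 ^ i -->
  c * (t powr E * 2 powr (- (real i * E))) <= (\<Sum>j<J. 2 powr (- (real j * E)) * \<theta> ((1 / 2 ^ j) *\<^sub>R ((1 / t) *\<^sub>R z)))" for d :: nat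
 proof -
  obtain N0 where N0: "B * 2 ^ d / r0 < 2 ^ N0" using real_arch_pow[of 2 "B * 2 ^ d / r0"] by auto
  \<comment> \<open>The first margin forces m < J. The second makes |z| exceed t, so that m is
    positive and minimality can be used at m - 1.\<close>
  define N where "N = Suc N0 + (d + 2)"
  have "c * (t powr E * 2 powr (- (real i * E))) <= (\<Sum>j<J. 2 powr (- (real j * E)) * \<theta> ((1 / 2 ^ j) *\<^sub>R ((1 / t) *\<^sub>R z)))"
   if i: "N <= i" "i + N <= J" and t: "1 / 2 ^ d <= t" "t <= 2 ^ d" and z: "2 ^ i / 2 <= norm z" "norm z <= B * 2 ^ i"
   for J i t and z :: "real^'n"
  proof -
   have t0: "t > 0" using t(1) by (rule less_le_trans[rotated]) simp
   define w where "w = norm z / t"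
   obtain m0 where "w / r0 < 2 ^ m0" using real_arch_pow[of 2 "w / r0"] by auto
   then have m0: "w <= r0 * 2 ^ m0" using r0 by (simp add: field_simps)
   define m where "m = (LEAST m. w <= r0 * 2 ^ m)"
   have m: "w <= r0 * 2 ^ m" unfolding m_def by (rule LeastI[of "\<lambda>m. w <= r0 * 2 ^ m", OF m0])
   have "1 / t <= 2 ^ d" using t(1) t0 by (simp add: field_simps)
   then have "w <= B * 2 ^ i * 2 ^ d" unfolding w_def divide_inverse using z(2) t0 B by (intro mult_mono) (auto simp: divide_inverse)
   also have "... <= r0 * 2 ^ (i + N0)" using N0 r0 by (simp add: field_simps power_add)
   finally have "m <= i + N0" unfolding m_def by (rule Least_le)
   then have mJ: "m < J" using i by (simp add: N_def)
   have "w > 1"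
   proof -
    have "(2::real) ^ (d + 2) <= 2 ^ i" using i by (intro power_increasing) (auto simp: N_def)
    then have "2 * 2 ^ d <= norm z" using z(1) by (simp add: power_add)
    moreover have "(0::real) < 2 ^ d" by simp
    ultimately have "t < norm z" using t(2) by linarith
    then show ?thesis using t0 by (simp add: w_def)
   qed
   then have "m \<noteq> 0" using m r0 by (intro notI) simp
   then obtain m' where m': "m = Suc m'" by (cases m) auto
   have "\<not> w <= r0 * 2 ^ m'" using not_less_Least[of m' "\<lambda>m. w <= r0 * 2 ^ m"] m' by (simp add: m_def)
   then have mw: "2 ^ m <= 2 * w / r0" using r0 unfolding m' by (simp add: field_simps)
   have "2 * w / r0 <= 2 * B / r0 * 2 ^ i / t" using z(2) r0 t0 by (simp add: w_def field_simps)
   with mw have mi: "2 ^ m <= 2 * B / r0 * 2 ^ i / t" by simp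
   have "c * (t powr E * 2 powr (- (real i * E))) = c0 * (2 * B / r0 * 2 ^ i / t) powr (- E)"
   proof -
    have "(2 * B / r0 * 2 ^ i / t) powr (- E) = (2 * B / r0) powr (- E) * ((2 ^ i) powr (- E) * (1 / t) powr (- E))"
     using B r0 t0 by (simp add: powr_mult[symmetric] mult.assoc)
    moreover have "(1 / t) powr (- E) = t powr E" using t0 by (simp add: powr_minus powr_divide inverse_eq_divide)
    moreover have "(2 ^ i) powr (- E) = 2 powr (- (real i * E))" by (simp add: powr_powr flip: powr_realpow)
    ultimately show ?thesis by (simp add: c_def mult_ac)
   qed
   also have "... <= c0 * (2 ^ m) powr (- E)" using mi c0 E by (intro mult_left_mono powr_mono2') auto
   also have "(2 ^ m) powr (- E) = (2::real) powr (- (real m * E))" by (simp add: powr_powr flip: powr_realpow)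
   also have "c0 * 2 powr (- (real m * E)) <= 2 powr (- (real m * E)) * \<theta> ((1 / 2 ^ m) *\<^sub>R ((1 / t) *\<^sub>R z))"
    unfolding mult.commute[of c0] using m t0 by (intro mult_left_mono \<theta>(2)) (auto simp: w_def field_simps)
   also have "... <= (\<Sum>j<J. 2 powr (- (real j * E)) * \<theta> ((1 / 2 ^ j) *\<^sub>R ((1 / t) *\<^sub>R z)))"
    using mJ \<theta>(1) by (intro member_le_sum[of m]) auto
   finally show ?thesis .
  qed
  then show ?thesis by (intro exI[of _ N]) blast
 qed
 then show ?thesis using c by blast
qed

section \<open>Test profiles and band-limited functions\<close>

context window
begin

text \<open>\<open>\<kappa>\<close> is the autocorrelation of a dilated window and \<open>\<theta>\<close> the square of the modulus of the window's
 Fourier transform.\<close>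

lemma profile:
 obtains \<theta> \<kappa> :: "real^'n => real" and c r0 :: real
 where "0 < c" "0 < r0" "r0 <= 1/4" "(\<lambda>x. cor (\<theta> x)) \<in> schwartz" "(\<lambda>x. cor (\<kappa> x)) \<in> schwartz"
  "\<And>x. 0 <= \<theta> x" "\<And>x. 0 <= \<kappa> x" "fourier (\<lambda>x. cor (\<kappa> x)) = (\<lambda>x. cor (\<theta> x))"
  "\<And>x. \<not> infnorm x < 3/16 ==> \<kappa> x = 0" "\<And>x. norm x <= r0 ==> c <= \<theta> x" "\<And>x. norm x <= r0 ==> c <= \<kappa> x"
proof -
 \<comment> \<open>The factor 8 confines the support to radius 3/32, hence that of the
   autocorrelation to 3/16, inside the plateau of radius 1/4 on which the zeroth window equals
   1.\<close>
 define \<rho> where "\<rho> x = \<eta> (8 *\<^sub>R x)" for x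
 define r where "r x = cor (\<rho> x)" for x
 have rS: "r \<in> schwartz" unfolding r_def \<rho>_def by (rule schwartz_dilate[OF eta_schwartz]) simp
 have \<rho>0: "0 <= \<rho> x" for x unfolding \<rho>_def by (rule eta_ge)
 have \<rho>1: "\<rho> x = 1" if "norm x <= 1/16" for x
  unfolding \<rho>_def using that infnorm_le_norm[of x] by (intro eta_1) (simp add: infnorm_mul)
 have \<rho>z: "\<rho> x = 0" if "\<not> infnorm x < 3/32" for x
  unfolding \<rho>_def using that by (intro eta_0) (simp add: infnorm_mul)
 define R where "R = fourier r"
 have RS: "R \<in> schwartz" unfolding R_def by (rule schwartz_fourier[OF rS])
 note [measurable] = schwartz_borel[OF rS]
 have Rcnj: "cnj (R x) = R (- x)" for x
  unfolding R_def fourier_lborel[OF schwartz_borel[OF rS]] by (subst Bochner_Integration.integral_cnj[symmetric]) (simp add: cnj_ee r_def)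
 have R': "R (- x) = fourier (\<lambda>x. r (- x)) x" for x unfolding R_def by (rule fourier_reflect[OF rS, symmetric])
 define \<theta> where "\<theta> x = norm (R x) ^ 2" for x
 \<comment> \<open>The window is real, so conjugating its transform reflects it. This exhibits the
   squared modulus as a product of Schwartz functions and, by \<open>fourier_mult\<close>, its
   transform as an autocorrelation.\<close>
 have \<theta>R: "cor (\<theta> x) = R x * R (- x)" for x
  unfolding \<theta>_def using complex_norm_square[of "R x"] by (simp add: Rcnj del: of_real_power)
 let ?t1 = "\<lambda>x. cor (\<theta> x)"
 have \<theta>S: "?t1 \<in> schwartz" unfolding \<theta>R by (intro schwartz_mult schwartz_reflect RS)
 define \<kappa> where "\<kappa> x = (LBINT y. \<rho> y * \<rho> (y - x))" for x
 have \<kappa>: "fourier ?t1 x = cor (\<kappa> x)" for x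
 proof -
  have "fourier ?t1 x = (LBINT y. fourier (fourier (\<lambda>x. r (- x))) y * fourier R (x - y))"
   unfolding \<theta>R R' by (rule fourier_mult[OF RS schwartz_fourier[OF schwartz_reflect[OF rS]]])
  also have "... = (LBINT y. cor (\<rho> y * \<rho> (y - x)))"
   unfolding R_def fourier_inversion[OF schwartz_reflect[OF rS]] fourier_inversion[OF rS] by (simp add: r_def)
  also have "... = cor (\<kappa> x)" unfolding \<kappa>_def by (rule integral_complex_of_real)
  finally show ?thesis .
 qed
 let ?t2 = "\<lambda>x. cor (\<kappa> x)"
 have \<kappa>S: "?t2 \<in> schwartz" unfolding \<kappa>[symmetric] by (rule schwartz_fourier[OF \<theta>S])
 have "fourier ?t2 x = cor (\<theta> x)" for x
 proof -
  have "fourier ?t2 x = cor (\<theta> (- x))"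
   unfolding \<kappa>[symmetric] by (rule fourier_inversion[OF \<theta>S])
  also have "\<theta> (- x) = \<theta> x" unfolding \<theta>_def Rcnj[symmetric] by simp
  finally show ?thesis .
 qed
 then have F: "fourier ?t2 = ?t1" by (rule ext)
 let ?V = "\<lambda>s. unit_ball_vol (real CARD('n)) * s ^ CARD('n)"
 have V: "?V s > 0" if "s > 0" for s using that by (simp add: unit_ball_vol_pos)
 have \<kappa>z: "\<kappa> x = 0" if x: "\<not> infnorm x < 3/16" for x
 proof -
  have z: "\<rho> y * \<rho> (y - x) = 0" for y
  proof (rule ccontr)
   assume "\<rho> y * \<rho> (y - x) \<noteq> 0"
   then have "infnorm y < 3/32" "infnorm (y - x) < 3/32" using \<rho>z by auto
   moreover have "infnorm x <= infnorm y + infnorm (y - x)"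
    using infnorm_triangle[of y "x - y"] by (simp add: infnorm_sub)
   ultimately show False using x by linarith
  qed
  show ?thesis unfolding \<kappa>_def z by simp
 qed
 have \<kappa>l: "?V (1/32) <= \<kappa> x" if x: "norm x <= 1/32" for x
 proof -
  have "(\<lambda>y. r y * r (y - x)) \<in> schwartz" by (intro schwartz_mult schwartz_translate rS)
  from schwartz_integrable[OF this] have "integrable lborel (\<lambda>y. cor (\<rho> y * \<rho> (y - x)))" by (simp add: r_def)
  then have i: "integrable lborel (\<lambda>y. \<rho> y * \<rho> (y - x))" by (simp only: complex_of_real_integrable_eq)
  have "1 * ?V (1/32) <= \<kappa> x" unfolding \<kappa>_def
  proof (rule integral_ge_cball[OF i, where v=0])
   fix z :: "real^'n" assume "norm (z - 0) <= 1/32"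
   then have z: "norm z <= 1/16" "norm (z - x) <= 1/16" using x norm_triangle_ineq4[of z x] by auto
   show "1 <= \<rho> z * \<rho> (z - x)" unfolding \<rho>1[OF z(1)] \<rho>1[OF z(2)] by simp
  qed (auto simp: \<rho>0)
  then show ?thesis by simp
 qed
 have "\<theta> 0 > 0"
 proof -
  have "integrable lborel (\<lambda>y. cor (\<rho> y))" using schwartz_integrable[OF rS] by (simp add: r_def[abs_def])
  then have i: "integrable lborel \<rho>" by (simp only: complex_of_real_integrable_eq)
  have "1 * ?V (1/16) <= (LBINT y. \<rho> y)"
   by (rule integral_ge_cball[OF i, where v=0]) (auto simp: \<rho>0 \<rho>1)
  moreover have "?V (1/16) > 0" by (rule V) simp
  ultimately have "(LBINT y. \<rho> y) > 0" by linarith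
  moreover have "R 0 = cor (LBINT y. \<rho> y)"
   unfolding R_def fourier_lborel[OF schwartz_borel[OF rS]] by (simp add: r_def)
  ultimately show ?thesis by (simp add: \<theta>_def)
 qed
 moreover have "continuous_on UNIV \<theta>" unfolding \<theta>_def
  by (intro continuous_intros smooth_continuous schwartz_smooth RS)
 ultimately obtain \<delta> where \<delta>: "\<delta> > 0" "\<And>x. dist x 0 < \<delta> ==> dist (\<theta> x) (\<theta> 0) < \<theta> 0 / 2"
  unfolding continuous_on_iff by (metis UNIV_I half_gt_zero)
 define r0 where "r0 = min (\<delta> / 2) (1/32)"
 define c where "c = min (\<theta> 0 / 2) (?V (1/32))"
 have "c <= \<theta> x" if "norm x <= r0" for x
 proof -
  have "dist (\<theta> x) (\<theta> 0) < \<theta> 0 / 2" using that \<delta>(1) by (intro \<delta>(2)) (simp add: r0_def)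
  then show ?thesis unfolding c_def dist_real_def by linarith
 qed
 moreover have "c <= \<kappa> x" if "norm x <= r0" for x using \<kappa>l[of x] that by (simp add: c_def r0_def)
 moreover have "\<kappa> x \<ge> 0" for x unfolding \<kappa>_def by (intro integral_nonneg_AE) (auto simp: \<rho>0)
 moreover have "c > 0" unfolding c_def using \<open>\<theta> 0 > 0\<close> V[of "1/32"] by simp
 moreover have "r0 > 0" "r0 <= 1/4" using \<delta>(1) by (auto simp: r0_def)
 moreover have "\<theta> x \<ge> 0" for x by (simp add: \<theta>_def)
 ultimately show ?thesis using that[OF _ _ _ \<theta>S \<kappa>S _ _ F \<kappa>z] by blast
qed

lemma nrm_le_mnorm:
 assumes q: "1 <= q" shows "nrm p (B k g) <= mnorm p q g"
 using q
proof (cases rule: ereal_ge_1_cases)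
 case 1
 show ?thesis unfolding 1 mnorm_inf by (intro SUP_upper) auto
next
 case (2 w)
 have "enn_powr (nrm p (B k g)) w <= (\<integral>\<^sup>+k. enn_powr (nrm p (B k g)) w \<partial>count_space UNIV)"
  using sum_le_nn_integral_count_space[of "{k}" "\<lambda>k. enn_powr (nrm p (B k g)) w"] by simp
 then have "enn_powr (enn_powr (nrm p (B k g)) w) (1 / w) <= mnorm p q g"
  unfolding mnorm_def 2 lpn_real using 2 by (intro enn_powr_mono) auto
 then show ?thesis using 2 by simp
qed

text \<open>A spectrum within 3/16 of the origin lies in the plateau of window 0 and misses all
  other windows, because 1 - 3/16 > 3/4.\<close>

lemma mnorm_band_limited:
 assumes q: "1 <= q" and K: "K \<in> schwartz" "\<And>\<xi>. \<not> infnorm \<xi> < 3/16 ==> K \<xi> = 0"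
 shows "mnorm p q (fourier K) <= nrm p (fourier K)"
proof -
 have B0: "B 0 (fourier K) = fourier K"
  unfolding Op_fourier[OF sg_schwartz K(1)]
 proof (rule arg_cong[of _ _ fourier], rule ext)
  fix \<xi> show "sg 0 (- \<xi>) * K \<xi> = K \<xi>"
   using K(2)[of \<xi>] sigma_1[of "- \<xi>" 0] by (cases "infnorm \<xi> < 3/16") (auto simp: sg_def infnorm_neg)
 qed
 have Bk: "B k (fourier K) = (\<lambda>_. 0)" if k: "k \<noteq> 0" for k
 proof -
  obtain i where "k $ i \<noteq> 0" using k by (auto simp: vec_eq_iff)
  then have "\<bar>real_of_int (k $ i)\<bar> \<ge> 1" by linarith
  then have k1: "infnorm (kv k) \<ge> 1" using infnorm_lessD[of "kv k" 1 i] by fastforce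
  have z: "sg k (- \<xi>) * K \<xi> = 0" for \<xi>
  proof (cases "infnorm \<xi> < 3/16")
   case True
   have "infnorm (kv k) <= infnorm (- \<xi> - kv k) + infnorm \<xi>"
    using infnorm_triangle[of "\<xi> + kv k" "- \<xi>"] infnorm_neg[of "\<xi> + kv k"] infnorm_neg[of \<xi>] by simp
   then have "\<not> infnorm (- \<xi> - kv k) < 3/4" using True k1 by linarith
   then show ?thesis by (simp add: sg_0)
  qed (simp add: K(2))
  show ?thesis unfolding Op_fourier[OF sg_schwartz K(1)] z by (simp add: fourier_def[abs_def])
 qed
 have n0: "nrm p (\<lambda>_::real^'n. 0) = 0"
  using nrm_infI[of "\<lambda>_::real^'n. 0" 0] by (cases "p = \<infinity>") (auto simp: lpn_def)
 have e: "nrm p (B k (fourier K)) = nrm p (fourier K) * indicator {0} k" for k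
  using B0 Bk n0 by (cases "k = 0") (auto simp: indicator_def)
 from q show ?thesis
 proof (cases rule: ereal_ge_1_cases)
  case 1
  show ?thesis unfolding 1 mnorm_inf e by (intro SUP_least) (auto simp: indicator_def)
 next
  case (2 w)
  have "(\<integral>\<^sup>+k. enn_powr (nrm p (B k (fourier K))) w \<partial>count_space UNIV) = (\<integral>\<^sup>+k. enn_powr (nrm p (fourier K)) w * indicator {0} k \<partial>count_space (UNIV :: (int^'n) set))"
   unfolding e by (intro nn_integral_cong) (auto simp: indicator_def)
  also have "... = enn_powr (nrm p (fourier K)) w" by (subst nn_integral_cmult_indicator) auto
  finally show ?thesis unfolding mnorm_def 2 lpn_real using 2 by simp
 qed
qed

end

section \<open>Dyadic superpositions with critical weights\<close>

definition dyadic_sum :: "(real^'n::finite => real) => real => nat set => real^'n => real" where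
 "dyadic_sum \<theta> E I x = (\<Sum>j\<in>I. 2 powr (- (real j * E)) * \<theta> ((1 / 2 ^ j) *\<^sub>R x))"

lemma schwartz_dyadic_sum:
 assumes "(\<lambda>x. cor (\<theta> x)) \<in> schwartz"
 shows "(\<lambda>x. cor (dyadic_sum \<theta> E I x)) \<in> schwartz"
 unfolding dyadic_sum_def of_real_sum of_real_mult
 by (intro schwartz_sum schwartz_cmult schwartz_dilate[OF assms]) simp

lemma dyadic_sum_nonneg: "(\<And>x. 0 <= \<theta> x) ==> 0 <= dyadic_sum \<theta> E I x"
 unfolding dyadic_sum_def by (intro sum_nonneg) simp

text \<open>Isotropic decay of order 2n is dominated by the product weight, whose dilates have
  explicit integrals.\<close>

lemma dyadic_min_le_wt:
 fixes x :: "real^'n::finite"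
 shows "min 1 ((2 ^ j / (1 + norm x)) ^ (2 * CARD('n))) <= 4 ^ CARD('n) * wt ((1 / 2 ^ j) *\<^sub>R x)"
proof -
 define w where "w = (1 + norm x) / 2 ^ j"
 have w: "w > 0" by (simp add: w_def add_pos_nonneg)
 let ?t1 = "(1 / 2 ^ j) *\<^sub>R x"
 have wx: "norm ?t1 <= w" by (simp add: w_def divide_right_mono)
 have 1: "(inverse ((1 + w)^2)) ^ CARD('n) <= wt ?t1"
 proof -
  have "(\<Prod>i\<in>(UNIV::'n set). inverse ((1 + w)^2)) <= wt ?t1"
   unfolding wt_def
  proof (intro prod_mono conjI le_imp_inverse_le)
   fix i :: 'n
   have "((?t1 $ i))\<^sup>2 <= w\<^sup>2"
    using order_trans[OF component_le_norm_cart wx] w by (metis abs_le_square_iff abs_of_pos)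
   then show "1 + (?t1 $ i)\<^sup>2 <= (1 + w)\<^sup>2" using w by (simp add: power2_sum)
  qed (auto simp: add_pos_nonneg)
  then show ?thesis by simp
 qed
 have e: "(2 ^ j / (1 + norm x)) ^ (2 * CARD('n)) = (inverse (w^2)) ^ CARD('n)"
  by (simp add: w_def power_mult power_divide divide_inverse power_inverse power_mult_distrib)
 have "min 1 ((inverse (w^2)) ^ CARD('n)) <= (4 * inverse ((1 + w)^2)) ^ CARD('n)"
 proof (cases "w <= 1")
  case True
  then have "(1 + w)^2 <= 2^2" using w by (intro power_mono) auto
  then have "1 <= 4 * inverse ((1 + w)^2)" using w by (simp add: field_simps)
  then have "1 <= (4 * inverse ((1 + w)^2)) ^ CARD('n)" by (rule one_le_power)
  then show ?thesis by (rule min.coboundedI1)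
 next
  case False
  then have "(1 + w)^2 <= (2 * w)^2" by (intro power_mono) auto
  then have "inverse (w^2) <= 4 * inverse ((1 + w)^2)" using w by (simp add: field_simps power_mult_distrib)
  then have "(inverse (w^2)) ^ CARD('n) <= (4 * inverse ((1 + w)^2)) ^ CARD('n)" by (intro power_mono) auto
  then show ?thesis by (rule min.coboundedI2)
 qed
 also have "... = 4 ^ CARD('n) * (inverse ((1 + w)^2)) ^ CARD('n)" by (simp add: power_mult_distrib)
 also have "... <= 4 ^ CARD('n) * wt ?t1" using 1 by simp
 finally show ?thesis unfolding e .
qed

text \<open>Isotropic decay, so that a dyadic sum at x is controlled by the single number 1 +
  |x|.\<close>

lemma schwartz_decay:
 fixes f :: "real^'n::finite => complex"
 assumes "f \<in> schwartz"
 shows "\<exists>C>0. \<forall>x. norm (f x) <= C * inverse ((1 + norm x) ^ (2 * CARD('n)))"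
proof -
 obtain C where C: "C > 0" "\<And>x. norm (f x) <= C * wt x ^ CARD('n)"
  using wboundE[OF schwartz_wbound[OF assms, of "CARD('n)"]] by auto
 let ?M = "2 * real CARD('n) + 2"
 have le: "wt x * (1 + norm x)^2 <= ?M" for x :: "real^'n"
 proof -
  have "(1 + norm x)^2 <= 2 + 2 * norm x ^ 2" using sum_squares_bound[of 1 "norm x"] by (simp add: power2_sum)
  then have "wt x * (1 + norm x)^2 <= wt x * (2 + 2 * norm x ^ 2)" by (intro mult_left_mono) auto
  also have "... = 2 * wt x + 2 * (wt x * norm x ^ 2)" by (simp add: algebra_simps)
  also have "... <= ?M" using wt_le_norm[of x] wt_le_1[of x] by linarith
  finally show ?thesis .
 qed
 have "norm (f x) <= (C * ?M ^ CARD('n)) * inverse ((1 + norm x) ^ (2 * CARD('n)))" for x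
 proof -
  have p: "1 + norm x > 0" by (simp add: add_pos_nonneg)
  have "wt x ^ CARD('n) * (1 + norm x) ^ (2 * CARD('n)) = (wt x * (1 + norm x)^2) ^ CARD('n)"
   by (simp add: power_mult power_mult_distrib)
  also have "... <= ?M ^ CARD('n)" by (intro power_mono le) auto
  finally have "wt x ^ CARD('n) <= ?M ^ CARD('n) * inverse ((1 + norm x) ^ (2 * CARD('n)))"
   using p by (simp add: field_simps)
  then show ?thesis using C(2)[of x] C(1) by (smt (verit) mult.assoc mult_left_mono)
 qed
 moreover have "C * ?M ^ CARD('n) > 0" using C by simp
 ultimately show ?thesis by blast
qed

lemma powr_nat_2: "(2::real) powr (- (real j * E)) = (2 powr (- E)) ^ j"
 by (simp add: powr_powr powr_realpow[symmetric] mult.commute)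

text \<open>The weight 2^(-jn/r) gives all summands the same r-norm. At a fixed x the terms are
  bounded by a sequence that rises and then falls geometrically, so the r-th power of the sum is
  comparable to the sum of r-th powers, and each of these integrates to the same constant.\<close>

lemma dyadic_sum_Ip:
 fixes \<theta> :: "real^'n::finite => real"
 assumes \<theta>S: "(\<lambda>x. cor (\<theta> x)) \<in> schwartz" and \<theta>: "\<And>x. 0 <= \<theta> x" and r: "1 <= r"
 shows "\<exists>K>0. \<forall>J. Ip r (\<lambda>x. cor (dyadic_sum \<theta> (CARD('n) / r) {..<J} x)) <= ennreal (K * J)"
proof -
 let ?n = "CARD('n)"
 let ?E = "?n / r"
 have E: "0 < ?E" "?E <= ?n" using r by (auto simp: field_simps)
 have [measurable]: "\<theta> \<in> borelM"
  using measurable_compose[OF schwartz_borel[OF \<theta>S] borel_measurable_Re] by simp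
 obtain C where C: "C > 0" "\<And>x. \<theta> x <= C * inverse ((1 + norm x) ^ (2 * ?n))"
  using schwartz_decay[OF \<theta>S] \<theta> by auto
 obtain W where W: "W > 0" "(NBINT z. ennreal (wt (z::real^'n))) = ennreal W" by (rule nn_integral_wt)
 define \<rho> :: real where "\<rho> = 2 powr (- ?E)"
 have \<rho>: "0 < \<rho>" "\<rho> < 1" using E powr_less_mono[of "- ?E" 0 2] by (auto simp: \<rho>_def)
 \<comment> \<open>Geometric growth before the crossing: one step in j gains 4^n from the decay and
   loses one factor \<rho>, which leaves at least 1/\<rho> because n/r <= n.\<close>
 have \<rho>4: "1 <= \<rho> * \<rho> * 4 ^ ?n"
 proof -
  have "\<rho> * \<rho> * 4 ^ ?n = 2 powr (- ?E) * 2 powr (- ?E) * 2 powr (2 * real ?n)"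
   using powr_realpow[of 2 "2 * ?n"] by (simp add: \<rho>_def power_mult)
  also have "... = 2 powr (2 * real ?n - 2 * ?E)" by (simp add: powr_add[symmetric])
  also have "... \<ge> 1" using E by (intro ge_one_powr_ge_zero) auto
  finally show ?thesis .
 qed
 define D where "D = C powr r * ((2 / (1 - \<rho>)) powr r * 4 ^ ?n)"
 have D: "D > 0" using C \<rho> by (simp add: D_def)
 have pt: "dyadic_sum \<theta> ?E {..<J} x powr r <= D * (\<Sum>j<J. inverse ((2 ^ j) ^ ?n) * wt ((1 / 2 ^ j) *\<^sub>R x))" for J and x :: "real^'n"
 proof -
  define s where "s = 1 + norm x"
  have s: "s > 0" by (simp add: s_def add_pos_nonneg)
  define v where "v j = \<rho> ^ j * (2 ^ j / s) ^ (2 * ?n)" for j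
  have v0: "0 <= v j" for j using \<rho> s by (simp add: v_def)
  have v: "v j <= \<rho> * v (Suc j)" for j
  proof -
   have "(2 ^ Suc j / s) ^ (2 * ?n) = (2 * (2 ^ j / s)) ^ (2 * ?n)" by simp
   also have "... = 2 ^ (2 * ?n) * (2 ^ j / s) ^ (2 * ?n)" by (rule power_mult_distrib)
   also have "2 ^ (2 * ?n) = (4::real) ^ ?n" by (simp add: power_mult)
   finally have "\<rho> * v (Suc j) = (\<rho> * \<rho> * 4 ^ ?n) * v j" by (simp only: v_def power_Suc mult_ac)
   then show ?thesis using mult_right_mono[OF \<rho>4 v0[of j]] by (simp only: mult_1_left)
  qed
  have minv: "min (\<rho> ^ j) (v j) = \<rho> ^ j * min 1 ((2 ^ j / s) ^ (2 * ?n))" for j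
   using \<rho> by (simp add: v_def min_mult_distrib_left)
  have "\<theta> ((1 / 2 ^ j) *\<^sub>R x) <= C * min 1 ((2 ^ j / s) ^ (2 * ?n))" for j
  proof -
   define a where "a = 1 + norm ((1 / 2 ^ j) *\<^sub>R x)"
   have a1: "1 <= a" by (simp add: a_def)
   have "s <= 2 ^ j * a" by (simp add: s_def a_def algebra_simps)
   then have "inverse a <= 2 ^ j / s" using s a1 by (simp add: field_simps)
   then have "inverse a ^ (2 * ?n) <= (2 ^ j / s) ^ (2 * ?n)" using a1 by (intro power_mono) auto
   moreover have "inverse a ^ (2 * ?n) <= 1" using a1 by (intro power_le_one) (auto simp: inverse_le_1_iff)
   ultimately have "inverse (a ^ (2 * ?n)) <= min 1 ((2 ^ j / s) ^ (2 * ?n))" by (simp only: power_inverse min.bounded_iff simp_thms)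
   then have "C * inverse (a ^ (2 * ?n)) <= C * min 1 ((2 ^ j / s) ^ (2 * ?n))" using C(1) by (intro mult_left_mono) auto
   with C(2)[of "(1 / 2 ^ j) *\<^sub>R x"] show ?thesis unfolding a_def by (rule order_trans)
  qed
  then have "dyadic_sum \<theta> ?E {..<J} x <= (\<Sum>j<J. \<rho> ^ j * (C * min 1 ((2 ^ j / s) ^ (2 * ?n))))"
   unfolding dyadic_sum_def powr_nat_2 \<rho>_def[symmetric] using \<rho> by (intro sum_mono mult_left_mono) auto
  also have "... = C * (\<Sum>j<J. min (\<rho> ^ j) (v j))" unfolding minv sum_distrib_left by (intro sum.cong) auto
  finally have "dyadic_sum \<theta> ?E {..<J} x powr r <= (C * (\<Sum>j<J. min (\<rho> ^ j) (v j))) powr r"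
   using r dyadic_sum_nonneg[OF \<theta>] by (intro powr_mono2) auto
  also have "... = C powr r * (\<Sum>j<J. min (\<rho> ^ j) (v j)) powr r"
   using C \<rho> v0 by (intro powr_mult)
  also have "... <= C powr r * ((2 / (1 - \<rho>)) powr r * (\<Sum>j<J. min (\<rho> ^ j) (v j) powr r))"
  proof (intro mult_left_mono geometric_min_powr)
   show "0 < r" using r by simp
  qed (use \<rho> v0 v in auto)
  also have "... <= C powr r * ((2 / (1 - \<rho>)) powr r * (\<Sum>j<J. inverse ((2 ^ j) ^ ?n) * (4 ^ ?n * wt ((1 / 2 ^ j) *\<^sub>R x))))"
  proof (intro mult_left_mono sum_mono)
   fix j
   let ?m = "min 1 ((2 ^ j / s) ^ (2 * ?n))"
   have m: "0 <= ?m" "?m <= 1" using s by auto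
   have "?m powr r <= ?m powr 1" using m r by (intro powr_mono')
   also have "... = ?m" using m(1) by (rule powr_one)
   also have "?m <= 4 ^ ?n * wt ((1 / 2 ^ j) *\<^sub>R x)" unfolding s_def by (rule dyadic_min_le_wt)
   finally have mr: "?m powr r <= 4 ^ ?n * wt ((1 / 2 ^ j) *\<^sub>R x)" .
   have "(\<rho> ^ j) powr r = 2 powr (- (real j * ?E) * r)" unfolding \<rho>_def powr_nat_2[symmetric] by (rule powr_powr)
   also have "- (real j * ?E) * r = - real (j * ?n)" using r by simp
   also have "2 powr (- real (j * ?n)) = inverse ((2 ^ j) ^ ?n)"
    by (simp only: powr_minus powr_realpow zero_less_numeral power_mult)
   finally have pr: "(\<rho> ^ j) powr r = inverse ((2 ^ j) ^ ?n)" .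
   show "min (\<rho> ^ j) (v j) powr r <= inverse ((2 ^ j) ^ ?n) * (4 ^ ?n * wt ((1 / 2 ^ j) *\<^sub>R x))"
    unfolding minv powr_mult pr using mr by (intro mult_left_mono) auto
  qed auto
  also have "... = D * (\<Sum>j<J. inverse ((2 ^ j) ^ ?n) * wt ((1 / 2 ^ j) *\<^sub>R x))"
   by (simp add: D_def sum_distrib_left mult_ac)
  finally show ?thesis .
 qed
 have "Ip r (\<lambda>x. cor (dyadic_sum \<theta> ?E {..<J} x)) <= ennreal (D * W * J)" for J
 proof -
  have "Ip r (\<lambda>x. cor (dyadic_sum \<theta> ?E {..<J} x))
   <= (NBINT x. ennreal D * (\<Sum>j<J. ennreal (inverse ((2 ^ j) ^ ?n)) * ennreal (wt ((1 / 2 ^ j) *\<^sub>R (x::real^'n)))))"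
   unfolding Ip_def enn_powr_norm
  proof (rule nn_integral_mono)
   fix x :: "real^'n"
   let ?t1 = "cor (dyadic_sum \<theta> ?E {..<J} x)"
   have "norm ?t1 powr r <= D * (\<Sum>j<J. inverse ((2 ^ j) ^ ?n) * wt ((1 / 2 ^ j) *\<^sub>R x))"
    using pt[of J x] dyadic_sum_nonneg[of \<theta> ?E "{..<J}" x] \<theta> by simp
   then have "ennreal (norm ?t1 powr r) <= ennreal (D * (\<Sum>j<J. inverse ((2 ^ j) ^ ?n) * wt ((1 / 2 ^ j) *\<^sub>R x)))"
    by (rule ennreal_leI)
   also have "... = ennreal D * (\<Sum>j<J. ennreal (inverse ((2 ^ j) ^ ?n)) * ennreal (wt ((1 / 2 ^ j) *\<^sub>R x)))"
    using D by (simp add: ennreal_mult sum_nonneg flip: sum_ennreal)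
   finally show "ennreal (norm ?t1 powr r) <= ennreal D * (\<Sum>j<J. ennreal (inverse ((2 ^ j) ^ ?n)) * ennreal (wt ((1 / 2 ^ j) *\<^sub>R x)))" .
  qed
  also have "... = ennreal D * (NBINT x. (\<Sum>j<J. ennreal (inverse ((2 ^ j) ^ ?n)) * ennreal (wt ((1 / 2 ^ j) *\<^sub>R (x::real^'n)))))"
   by (rule nn_integral_cmult) measurable
  also have "(NBINT x. (\<Sum>j<J. ennreal (inverse ((2 ^ j) ^ ?n)) * ennreal (wt ((1 / 2 ^ j) *\<^sub>R (x::real^'n)))))
   = (\<Sum>j<J. \<integral>\<^sup>+x. ennreal (inverse ((2 ^ j) ^ ?n)) * ennreal (wt ((1 / 2 ^ j) *\<^sub>R (x::real^'n))) \<partial>lborel)"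
   by (rule nn_integral_sum) measurable
  also have "... = (\<Sum>j<J. ennreal W)"
  proof (rule sum.cong[OF refl])
   fix j
   have "(NBINT x. ennreal (inverse ((2 ^ j) ^ ?n)) * ennreal (wt ((1 / 2 ^ j) *\<^sub>R (x::real^'n))))
    = ennreal (inverse ((2 ^ j) ^ ?n)) * (NBINT x. ennreal (wt ((1 / 2 ^ j) *\<^sub>R (x::real^'n))))"
    by (rule nn_integral_cmult) measurable
   also have "(NBINT x. ennreal (wt ((1 / 2 ^ j) *\<^sub>R (x::real^'n)))) = ennreal ((2 ^ j) ^ ?n) * ennreal W"
    using W(2) by (subst nn_integral_affine[of _ "2 ^ j" 0]) simp_all
   also have "ennreal (inverse ((2 ^ j) ^ ?n)) * (ennreal ((2 ^ j) ^ ?n) * ennreal W) = ennreal (inverse ((2 ^ j) ^ ?n) * ((2 ^ j) ^ ?n * W))"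
    using W(1) by (simp only: ennreal_mult less_imp_le mult_nonneg_nonneg zero_le_power inverse_nonnegative_iff_nonnegative zero_le_numeral)
   also have "inverse ((2 ^ j) ^ ?n) * ((2 ^ j) ^ ?n * W) = W" by simp
   finally show "(NBINT x. ennreal (inverse ((2 ^ j) ^ ?n)) * ennreal (wt ((1 / 2 ^ j) *\<^sub>R (x::real^'n)))) = ennreal W" .
  qed
  also have "ennreal D * (\<Sum>j<J. ennreal W) = ennreal (D * W * J)"
   using D W by (simp add: ennreal_mult mult_ac ennreal_of_nat_eq_real_of_nat)
  finally show ?thesis .
 qed
 moreover have "D * W > 0" using D W by simp
 ultimately show ?thesis by blast
qed

section \<open>Truncated integrals of the kernel and their growth\<close>

context hausdorff
begin

text \<open>The truncation keeps y within a fixed number of dyadic scales, so that only boundedly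
  many shells are lost in the tests; \<open>mass_bounded\<close> removes it by monotone
  convergence.\<close>

definition mass :: "real => nat => ennreal" where
 "mass \<alpha> d = (NBINT y. ennreal (norm y powr \<alpha> * \<Phi> y) * indicator {y. 1 / 2 ^ d <= norm y \<and> norm y <= 2 ^ d} y)"

lemma mass_bounded:
 assumes "\<And>d. mass \<alpha> d <= b" shows "(NBINT y. ennreal (norm y powr \<alpha> * \<Phi> y)) <= b"
proof -
 let ?f = "\<lambda>(d::nat) (y::real^'n). ennreal (norm y powr \<alpha> * \<Phi> y) * indicator {y. 1 / 2 ^ d <= norm y \<and> norm y <= 2 ^ d} y"
 have "(NBINT y. ennreal (norm y powr \<alpha> * \<Phi> y)) <= (NBINT y. (SUP d. ?f d y))"
 proof (rule nn_integral_mono)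
  fix y :: "real^'n"
  show "ennreal (norm y powr \<alpha> * \<Phi> y) <= (SUP d. ?f d y)"
  proof (cases "y = 0")
   case False
   obtain d1 d2 where d: "norm y < 2 ^ d1" "1 / norm y < 2 ^ d2"
    using real_arch_pow[of 2 "norm y"] real_arch_pow[of 2 "1 / norm y"] by auto
   have "norm y <= 2 ^ (d1 + d2)" using d(1) power_increasing[of d1 "d1 + d2" "2::real"] by linarith
   moreover have "1 / norm y <= 2 ^ (d1 + d2)" using d(2) power_increasing[of d2 "d1 + d2" "2::real"] by linarith
   then have "1 / 2 ^ (d1 + d2) <= norm y" using False by (simp add: field_simps)
   ultimately have "?f (d1 + d2) y = ennreal (norm y powr \<alpha> * \<Phi> y)" by simp
   moreover have "?f (d1 + d2) y <= (SUP d. ?f d y)" by (rule SUP_upper) simp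
   ultimately show ?thesis by (simp only:)
  qed simp
 qed
 also have "... = (SUP d. mass \<alpha> d)" unfolding mass_def
 proof (rule nn_integral_monotone_convergence_SUP)
  show "incseq ?f"
  proof (intro incseq_SucI le_funI)
   fix d and y :: "real^'n"
   have "(1::real) / 2 ^ Suc d <= 1 / 2 ^ d" "(2::real) ^ d <= 2 ^ Suc d" by (auto simp: field_simps)
   then have "1 / 2 ^ d <= norm y ==> 1 / 2 ^ Suc d <= norm y" "norm y <= 2 ^ d ==> norm y <= 2 ^ Suc d" by linarith+
   then show "?f d y <= ?f (Suc d) y" by (intro mult_left_mono) (auto simp: indicator_def simp del: power_Suc)
  qed
 qed measurable
 also have "... <= b" by (intro SUP_least assms)
 finally show ?thesis .
qed

text \<open>The integrand has nonnegative real part, so nothing is cancelled by restricting to the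
  truncated range and then passing to the modulus.\<close>

lemma mass_le:
 assumes i: "integrable lborel (\<lambda>y. cor (\<Phi> y) * w y)"
  and w0: "\<And>y. norm y > 0 ==> 0 <= Re (w y)"
  and w1: "\<And>y. 1 / 2 ^ d <= norm y ==> norm y <= 2 ^ d ==> c * norm y powr \<alpha> <= Re (w y)" and c: "0 <= c"
 shows "ennreal c * mass \<alpha> d <= enorm (LBINT y. cor (\<Phi> y) * w y)"
proof -
 have iR: "integrable lborel (\<lambda>y. \<Phi> y * Re (w y))" using integrable_Re[OF i] by simp
 have "ennreal c * mass \<alpha> d = (NBINT y. ennreal c * (ennreal (norm y powr \<alpha> * \<Phi> y) * indicator {y. 1 / 2 ^ d <= norm y \<and> norm y <= 2 ^ d} y))"
  unfolding mass_def by (rule nn_integral_cmult[symmetric]) measurable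
 also have "... <= (NBINT y. ennreal (\<Phi> y * Re (w y)))"
 proof (rule nn_integral_mono)
  fix y
  have "c * (norm y powr \<alpha> * \<Phi> y) <= \<Phi> y * Re (w y)" if "1 / 2 ^ d <= norm y" "norm y <= 2 ^ d"
   using mult_left_mono[OF w1[OF that] Phi_ge[of y]] by (simp add: mult_ac)
  then show "ennreal c * (ennreal (norm y powr \<alpha> * \<Phi> y) * indicator {y. 1 / 2 ^ d <= norm y \<and> norm y <= 2 ^ d} y) <= ennreal (\<Phi> y * Re (w y))"
   using c Phi_ge[of y] by (auto simp: indicator_def ennreal_mult[symmetric] intro!: ennreal_leI)
 qed
 also have "... = ennreal (LBINT y. \<Phi> y * Re (w y))"
 proof (rule nn_integral_eq_integral[OF iR])
  show "AE y in lborel. 0 <= \<Phi> y * Re (w y)" using AE_nonzero by eventually_elim (simp add: w0 Phi_ge)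
 qed
 also have "(LBINT y. \<Phi> y * Re (w y)) = Re (LBINT y. cor (\<Phi> y) * w y)"
  using integral_Re[OF i] by simp
 also have "ennreal ... <= enorm (LBINT y. cor (\<Phi> y) * w y)"
  by (intro ennreal_leI complex_Re_le_cmod)
 finally show ?thesis .
qed

text \<open>A per-shell bound summed over J - 2N shells is compared with an O(J) upper bound. As J
  may be taken large relative to N, the resulting bound does not depend on d.\<close>

lemma mass_growth:
 assumes c: "0 < c" and r: "1 <= r" and K: "0 <= K"
  and "\<And>d. \<exists>N. \<forall>J. ennreal (real (card {N..<J - N})) * enn_powr (ennreal c * mass \<alpha> d) r <= ennreal (K * real J)"
 shows "(NBINT y. ennreal (norm y powr \<alpha> * \<Phi> y)) < \<infinity>"
proof -
 have "mass \<alpha> d <= ennreal ((2 * K) powr (1 / r) / c)" for d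
 proof -
  obtain N where N: "\<And>J. ennreal (real (card {N..<J - N})) * enn_powr (ennreal c * mass \<alpha> d) r <= ennreal (K * real J)"
   using assms(4) by blast
  let ?X = "ennreal c * mass \<alpha> d"
  \<comment> \<open>J = 4N + 2 leaves 2N + 2 shells, more than half of J.\<close>
  have "ennreal (real (2 * N + 2)) * enn_powr ?X r <= ennreal (K * real (4 * N + 2))"
   using N[of "4 * N + 2"] by (simp add: algebra_simps)
  also have "... <= ennreal (real (2 * N + 2) * (2 * K))" using K by (intro ennreal_leI) (simp add: algebra_simps)
  also have "... = ennreal (real (2 * N + 2)) * ennreal (2 * K)" using K by (intro ennreal_mult) auto
  finally have "enn_powr ?X r <= ennreal (2 * K)"
   by (subst (asm) ennreal_mult_le_mult_iff) (auto simp: ennreal_eq_0_iff)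
  then have "enn_powr (enn_powr ?X r) (1 / r) <= enn_powr (ennreal (2 * K)) (1 / r)" using r by (intro enn_powr_mono) auto
  then have "?X <= ennreal ((2 * K) powr (1 / r))" using r K by (simp add: enn_powr_ennreal)
  also have "... = ennreal c * ennreal ((2 * K) powr (1 / r) / c)" using c by (simp add: ennreal_mult[symmetric])
  finally show ?thesis using c by (subst (asm) ennreal_mult_le_mult_iff) (auto simp: ennreal_eq_0_iff)
 qed
 from mass_bounded[OF this] show ?thesis using ennreal_less_top order_le_less_trans infinity_ennreal_def by metis
qed

end

text \<open>Cubes in the positive orthant in place of annuli: their volume is exactly 2^(in), the
  lattice analogue has exactly that many points, and any one coordinate determines i.\<close>

definition dyadic_box :: "nat => (real^'n::finite) set" where
 "dyadic_box i = box (\<chi> l. 2 ^ i) (\<chi> l. 2 ^ Suc i)"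

definition dyadic_lattice_box :: "nat => (int^'n::finite) set" where
 "dyadic_lattice_box i = {k. \<forall>l. k $ l \<in> {2 ^ i..<2 ^ Suc i}}"

lemma norm_coordinate_bounds:
 fixes x :: "real^'n::finite"
 assumes "\<And>l. a <= x $ l" "\<And>l. x $ l <= b" "0 <= a"
 shows "a <= norm x" "norm x <= real CARD('n) * b"
proof -
 fix l :: 'n
 show "a <= norm x" using component_le_norm_cart[of x l] assms(1)[of l] by linarith
next
 have "norm x <= (\<Sum>l\<in>UNIV. \<bar>x $ l\<bar>)" by (rule norm_le_l1_cart)
 also have "... <= (\<Sum>l\<in>(UNIV::'n set). b)"
 proof (rule sum_mono)
  fix l show "\<bar>x $ l\<bar> <= b" using assms(1)[of l] assms(2)[of l] assms(3) by simp
 qed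
 finally show "norm x <= real CARD('n) * b" by simp
qed

lemma emeasure_dyadic_box: "emeasure lborel (dyadic_box i :: (real^'n::finite) set) = ennreal ((2 ^ i) ^ CARD('n))"
proof -
 have "((\<chi> l. 2 ^ Suc i) - (\<chi> l. 2 ^ i) :: real^'n) \<bullet> b = 2 ^ i" if "b \<in> Basis" for b
  using that by (auto simp: Basis_vec_range inner_axis)
 moreover have "(\<chi> l. 2 ^ i :: real^'n) \<bullet> b <= (\<chi> l. 2 ^ Suc i) \<bullet> b" if "b \<in> Basis" for b
  using that by (auto simp: Basis_vec_range inner_axis)
 ultimately show ?thesis unfolding dyadic_box_def by (subst emeasure_lborel_box) auto
qed

lemma card_dyadic_lattice_box:
 "finite (dyadic_lattice_box i :: (int^'n::finite) set)" "card (dyadic_lattice_box i :: (int^'n::finite) set) = (2 ^ i) ^ CARD('n)"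
proof -
 let ?A = "{2 ^ i..<2 ^ Suc i} :: int set"
 let ?S = "dyadic_lattice_box i :: (int^'n) set"
 have inj: "inj_on vec_nth ?S" by (auto simp: inj_on_def vec_nth_inject)
 have im: "vec_nth ` ?S = Pi\<^sub>E UNIV (\<lambda>_. ?A)"
 proof (intro equalityI subsetI)
  fix f :: "'n => int" assume "f \<in> Pi\<^sub>E UNIV (\<lambda>_. ?A)"
  then have "vec_lambda f \<in> ?S" by (auto simp: dyadic_lattice_box_def)
  then have "vec_nth (vec_lambda f) \<in> vec_nth ` ?S" by (rule imageI)
  then show "f \<in> vec_nth ` ?S" by (simp add: vec_lambda_inverse)
 qed (auto simp: dyadic_lattice_box_def)
 have "finite (vec_nth ` ?S)" unfolding im by (intro finite_PiE) auto
 then show "finite ?S" using finite_imageD inj by blast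
 have cA: "card ?A = 2 ^ i" by (simp add: nat_power_eq)
 have "card ?S = card (vec_nth ` ?S)" using card_image[OF inj] by simp
 also have "... = (2 ^ i) ^ CARD('n)" unfolding im by (subst card_PiE) (simp_all only: cA prod_constant finite)
 finally show "card ?S = (2 ^ i) ^ CARD('n)" .
qed

lemma dyadic_unique:
 fixes x :: real
 assumes "2 ^ i <= x" "x < 2 ^ Suc i" "2 ^ j <= x" "x < 2 ^ Suc j" shows "i = j"
proof -
 have "(2::real) ^ i < 2 ^ Suc j" "(2::real) ^ j < 2 ^ Suc i" using assms by linarith+
 then have "i < Suc j" "j < Suc i" using power_less_imp_less_exp[of "2::real"] by (metis one_less_numeral_iff semiring_norm(76))+
 then show ?thesis by simp
qed

lemma (in window) sigma_near: "norm (\<xi> + kv k) <= 1/4 ==> sigma_window \<eta> k (- \<xi>) = 1"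
 using infnorm_le_norm[of "\<xi> + kv k"] infnorm_neg[of "\<xi> + kv k"] by (intro sigma_1) simp

section \<open>Tests with spectrum in block 0: the weight with exponent n/p\<close>

locale hausdorff_test = hausdorff \<eta> \<Phi> for \<eta> \<Phi> :: "real^'n::finite => real" +
 fixes p q :: ereal and \<theta> \<kappa> :: "real^'n => real" and c r0 bv Cb :: real
 assumes p: "1 <= p" and q: "1 <= q" and Cb: "0 <= Cb"
  and bd: "\<And>f. f \<in> schwartz ==> mnorm p q (HH f) <= ennreal Cb * mnorm p q f"
  and c: "0 < c" and r0: "0 < r0" "r0 <= 1/4"
  and bv: "bv = unit_ball_vol (real CARD('n)) * r0 ^ CARD('n)"
  and theta_S: "(\<lambda>x. cor (\<theta> x)) \<in> schwartz" and kappa_S: "(\<lambda>x. cor (\<kappa> x)) \<in> schwartz"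
  and theta_ge: "\<And>x. 0 <= \<theta> x" and kappa_ge: "\<And>x. 0 <= \<kappa> x"
  and fourier_kappa: "fourier (\<lambda>x. cor (\<kappa> x)) = (\<lambda>x. cor (\<theta> x))"
  and kappa_0: "\<And>x. \<not> infnorm x < 3/16 ==> \<kappa> x = 0"
  and theta_c: "\<And>x. norm x <= r0 ==> c <= \<theta> x" and kappa_c: "\<And>x. norm x <= r0 ==> c <= \<kappa> x"
begin

lemma bv_pos: "0 < bv" using r0 by (simp add: bv)

abbreviation fI :: "real => nat set => real^'n => complex" where
 "fI E I \<equiv> (\<lambda>x. cor (dyadic_sum \<theta> E I x))"

lemma fI_schwartz: "fI E I \<in> schwartz" by (rule schwartz_dyadic_sum[OF theta_S])

text \<open>The dilate of \<theta> by 2^j has spectrum \<kappa>(2^j \<xi>) up to a factor, which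
  shrinks towards 0 as j grows; all scales stay in block 0.\<close>

lemma mnorm_fI: assumes "finite I" shows "mnorm p q (fI E I) <= nrm p (fI E I)"
proof -
 let ?k = "\<lambda>x. cor (\<kappa> x)"
 define K where "K \<xi> = (\<Sum>j\<in>I. of_real (2 powr (- (real j * E)) * (2 ^ j) ^ CARD('n)) * ?k ((2 ^ j) *\<^sub>R \<xi>))" for \<xi>
 have dS: "(\<lambda>\<xi>. ?k ((2 ^ j) *\<^sub>R \<xi>)) \<in> schwartz" for j :: nat by (rule schwartz_dilate[OF kappa_S]) simp
 have KS: "K \<in> schwartz" unfolding K_def by (intro schwartz_sum schwartz_cmult dS)
 have "fourier K x = fI E I x" for x
 proof -
  have "fourier K x = (\<Sum>j\<in>I. fourier (\<lambda>\<xi>. of_real (2 powr (- (real j * E)) * (2 ^ j) ^ CARD('n)) * ?k ((2 ^ j) *\<^sub>R \<xi>)) x)"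
   unfolding K_def by (intro fourier_sum assms schwartz_cmult dS)
  also have "... = (\<Sum>j\<in>I. cor (2 powr (- (real j * E)) * \<theta> ((1 / 2 ^ j) *\<^sub>R x)))"
  proof (rule sum.cong[OF refl])
   fix j
   have "fourier (\<lambda>\<xi>. ?k ((2 ^ j) *\<^sub>R \<xi>)) x = fourier ?k (x /\<^sub>R 2 ^ j) /\<^sub>R \<bar>2 ^ j\<bar> ^ CARD('n)"
    by (rule fourier_dilate[OF schwartz_borel[OF kappa_S]]) simp
   also have "... = cor (\<theta> ((1 / 2 ^ j) *\<^sub>R x) / (2 ^ j) ^ CARD('n))"
    unfolding fourier_kappa by (simp add: divide_inverse scaleR_conv_of_real[where 'a=complex] mult.commute)
   finally have e: "fourier (\<lambda>\<xi>. ?k ((2 ^ j) *\<^sub>R \<xi>)) x = cor (\<theta> ((1 / 2 ^ j) *\<^sub>R x) / (2 ^ j) ^ CARD('n))" .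
   show "fourier (\<lambda>\<xi>. of_real (2 powr (- (real j * E)) * (2 ^ j) ^ CARD('n)) * ?k ((2 ^ j) *\<^sub>R \<xi>)) x = cor (2 powr (- (real j * E)) * \<theta> ((1 / 2 ^ j) *\<^sub>R x))"
    unfolding fourier_cmult[OF schwartz_borel[OF dS]] e by (simp add: field_simps)
  qed
  finally show ?thesis by (simp add: dyadic_sum_def)
 qed
 then have e: "fourier K = fI E I" by (rule ext)
 have "mnorm p q (fourier K) <= nrm p (fourier K)"
 proof (rule mnorm_band_limited[OF q KS])
  fix \<xi> :: "real^'n" assume x: "\<not> infnorm \<xi> < 3/16"
  have "\<kappa> ((2 ^ j) *\<^sub>R \<xi>) = 0" for j :: nat
  proof (rule kappa_0)
   have "1 * infnorm \<xi> <= 2 ^ j * infnorm \<xi>" by (intro mult_right_mono infnorm_pos_le) simp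
   then have "infnorm \<xi> <= infnorm ((2 ^ j) *\<^sub>R \<xi>)" by (simp add: infnorm_mul)
   then show "\<not> infnorm ((2 ^ j) *\<^sub>R \<xi>) < 3/16" using x by linarith
  qed
  then show "K \<xi> = 0" by (simp add: K_def)
 qed
 then show ?thesis unfolding e .
qed

definition T :: ennreal where "T = (NBINT z. enorm (cor (\<theta> z)))"

lemma T_finite: "T < \<infinity>"
 using schwartz_integrable[OF theta_S] unfolding T_def integrable_iff_bounded by blast

text \<open>The multiplier \<kappa> has the nonnegative kernel \<theta>, which allows lower bounds
  at points; since \<kappa> lives on the plateau of window 0, its output is still controlled by
  block 0.\<close>

lemma Op_kappa_B:
 assumes "f \<in> schwartz"
 shows "Op (\<lambda>x. cor (\<kappa> x)) (HH f) = cv (\<lambda>x. cor (\<theta> x)) (B 0 (HH f))"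
proof -
 have "(\<lambda>\<xi>. sg 0 \<xi> * cor (\<kappa> \<xi>)) = (\<lambda>x. cor (\<kappa> x))"
 proof
  fix \<xi> show "sg 0 \<xi> * cor (\<kappa> \<xi>) = cor (\<kappa> \<xi>)"
   using kappa_0[of \<xi>] sigma_1[of \<xi> 0] by (cases "infnorm \<xi> < 3/16") (auto simp: sg_def)
 qed
 moreover have "Op (\<lambda>x. cor (\<kappa> x)) (B 0 (HH f)) = Op (\<lambda>\<xi>. sg 0 \<xi> * cor (\<kappa> \<xi>)) (HH f)"
  by (rule Op_Op[OF HH_tame[OF assms] kappa_S sg_schwartz])
 ultimately show ?thesis unfolding fourier_kappa by (simp only: fourier_kappa)
qed

lemma nrm_B_fI: "finite I ==> nrm p (B 0 (HH (fI E I))) <= ennreal Cb * nrm p (fI E I)"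
 using order_trans[OF nrm_le_mnorm[OF q] order_trans[OF bd[OF fI_schwartz] mult_left_mono[OF mnorm_fI]]] by simp

text \<open>Kernel, dyadic sum and \<Phi> are all nonnegative, so z may be restricted to a ball
  around x and y to the truncated range.\<close>

lemma type_I_point:
 assumes a: "0 <= a"
  and le: "\<And>(y::real^'n) z. 1 / 2 ^ d <= norm y ==> norm y <= 2 ^ d ==> norm (z - x) <= r0 ==> a * norm y powr E' <= dyadic_sum \<theta> E I ((1 / norm y) *\<^sub>R z)"
 shows "ennreal (c * bv * a) * mass E' d <= enorm (Op (\<lambda>x. cor (\<kappa> x)) (HH (fI E I)) x)"
 unfolding fourier_kappa cv_HH(1)[OF fI_schwartz schwartz_wbound[OF theta_S]]
proof (rule mass_le[OF cv_HH(2)[OF fI_schwartz schwartz_wbound[OF theta_S]]])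
 let ?S = "dyadic_sum \<theta> E I"
 have S0: "0 <= ?S z" for z by (rule dyadic_sum_nonneg[of \<theta>, OF theta_ge])
 let ?t1 = "\<lambda>x. cor (\<theta> x)"
 have e: "cv ?t1 (dil (1 / norm y) (fI E I)) x = cor (LBINT z. ?S ((1 / norm y) *\<^sub>R (x + z)) * \<theta> z)" for y :: "real^'n"
  unfolding cv_def of_real_mult[symmetric] by (rule integral_complex_of_real)
 show "0 <= Re (cv ?t1 (dil (1 / norm y) (fI E I)) x)" for y :: "real^'n"
  unfolding e by (simp add: S0 theta_ge)
 show "0 <= c * bv * a" using c bv_pos a by simp
 fix y :: "real^'n" assume y: "1 / 2 ^ d <= norm y" "norm y <= 2 ^ d"
 have "(0::real) < 1 / 2 ^ d" by simp
 then have y0: "norm y > 0" using y(1) by linarith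
 have "(\<lambda>x. fI E I ((1 / norm y) *\<^sub>R x)) \<in> schwartz" using y0 by (intro schwartz_dilate[OF fI_schwartz]) auto
 then have "integrable lborel (\<lambda>z. fI E I ((1 / norm y) *\<^sub>R (x + z)) * cor (\<theta> z))"
  by (intro cv_integrable[where g="\<lambda>x. fI E I ((1 / norm y) *\<^sub>R x)" and N=1] schwartz_tame schwartz_wbound theta_S) auto
 then have i: "integrable lborel (\<lambda>z. ?S ((1 / norm y) *\<^sub>R (x + z)) * \<theta> z)"
  unfolding of_real_mult[symmetric] by (simp only: complex_of_real_integrable_eq)
 have "(a * norm y powr E' * c) * (unit_ball_vol (real CARD('n)) * r0 ^ CARD('n)) <= (LBINT z. ?S ((1 / norm y) *\<^sub>R (x + z)) * \<theta> z)"
 proof (rule integral_ge_cball[OF i, where v=0])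
  fix z :: "real^'n" assume "norm (z - 0) <= r0"
  then show "a * norm y powr E' * c <= ?S ((1 / norm y) *\<^sub>R (x + z)) * \<theta> z"
   using a c S0 by (intro mult_mono le[OF y] theta_c) auto
 qed (use a c r0 S0 theta_ge in auto)
 then show "c * bv * a * norm y powr E' <= Re (cv ?t1 (dil (1 / norm y) (fI E I)) x)"
  unfolding e bv by (simp add: mult_ac)
qed

lemma dyadic_ball:
 fixes x z :: "real^'n"
 assumes x: "2 ^ i <= norm x" "norm x <= real CARD('n) * 2 ^ Suc i" and z: "norm (z - x) <= 1/4"
 shows "2 ^ i / 2 <= norm z" "norm z <= (4 * real CARD('n)) * 2 ^ i"
proof -
 have p2: "(1::real) <= 2 ^ i" by simp
 have "norm x <= norm z + norm (z - x)" using norm_triangle_ineq4[of z "z - x"] by simp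
 then show "2 ^ i / 2 <= norm z" using x(1) z p2 by linarith
 have "norm z <= norm x + norm (z - x)" using norm_triangle_ineq[of x "z - x"] by simp
 moreover have "1 <= real CARD('n) * 2 ^ i" using mult_mono[of 1 "real CARD('n)" 1 "2 ^ i"] p2 by (simp add: Suc_leI)
 moreover have "norm x <= 2 * (real CARD('n) * 2 ^ i)" using x(2) by simp
 ultimately have "norm z <= 4 * (real CARD('n) * 2 ^ i)" using z by linarith
 then show "norm z <= (4 * real CARD('n)) * 2 ^ i" by simp
qed

lemma powr_dyadic: "r \<noteq> 0 ==> (2 powr (- (real i * (real CARD('n) / r)))) powr r = inverse ((2 ^ i) ^ CARD('n))"
proof -
 assume r: "r \<noteq> 0"
 have "(2 powr (- (real i * (real CARD('n) / r)))) powr r = 2 powr (- real (i * CARD('n)))"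
  using r by (simp add: powr_powr)
 also have "... = inverse ((2 ^ i) ^ CARD('n))" by (simp only: powr_minus powr_realpow zero_less_numeral power_mult)
 finally show ?thesis .
qed

text \<open>On the i-th dyadic box the p-th power of the smoothed image is at least a constant times
  2^(-in), which the volume of the box cancels: every box contributes the same amount. Boundedness
  of the operator limits the total to O(J).\<close>

lemma type_I_fin:
 assumes pr: "p = ereal r"
 shows "(NBINT y. ennreal (norm y powr (CARD('n) * einv p) * \<Phi> y)) < \<infinity>"
proof -
 let ?n = "CARD('n)"
 have r: "1 <= r" using p pr by simp
 let ?E = "real ?n / r"
 have E: "?E \<ge> 0" using r by simp
 have "1 <= ?n" by (simp add: Suc_leI)
 then have B1: "1 <= 4 * real ?n" by linarith
 have r01: "r0 <= 1" using r0 by linarith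
 have "\<exists>c>0. \<forall>d. \<exists>N. \<forall>J i t (z::real^'n). N <= i --> i + N <= J --> 1 / 2 ^ d <= t --> t <= 2 ^ d -->
  2 ^ i / 2 <= norm z --> norm z <= (4 * real ?n) * 2 ^ i -->
  c * (t powr ?E * 2 powr (- (real i * ?E))) <= (\<Sum>j<J. 2 powr (- (real j * ?E)) * \<theta> ((1 / 2 ^ j) *\<^sub>R ((1 / t) *\<^sub>R z)))"
  by (rule dyadic_sum_lower[where \<theta>=\<theta> and ?r0.0=r0 and ?c0.0=c and B="4 * real ?n" and E="?E"]) (fact theta_ge theta_c r0(1) r01 c B1 E)+
 then obtain c2 where c2: "c2 > 0" "\<forall>d. \<exists>N. \<forall>J i t (z::real^'n). N <= i --> i + N <= J --> 1 / 2 ^ d <= t --> t <= 2 ^ d -->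
  2 ^ i / 2 <= norm z --> norm z <= (4 * real ?n) * 2 ^ i -->
  c2 * (t powr ?E * 2 powr (- (real i * ?E))) <= (\<Sum>j<J. 2 powr (- (real j * ?E)) * \<theta> ((1 / 2 ^ j) *\<^sub>R ((1 / t) *\<^sub>R z)))"
  by - (elim exE conjE, rule that)
 obtain K1 where K1: "K1 > 0" "\<And>J. Ip r (fI ?E {..<J}) <= ennreal (K1 * real J)"
  using dyadic_sum_Ip[OF theta_S theta_ge r] by auto
 obtain t where t: "t \<ge> 0" "T = ennreal t" using T_finite by (cases T) auto
 let ?c = "c * bv * c2"
 have c': "?c > 0" using c c2(1) bv_pos by simp
 have "(NBINT y. ennreal (norm y powr ?E * \<Phi> y)) < \<infinity>"
 proof (rule mass_growth[OF c' r])
  show "0 <= (t * Cb) powr r * K1" using K1 by simp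
  fix d
  obtain N where "\<forall>J i t (z::real^'n). N <= i --> i + N <= J --> 1 / 2 ^ d <= t --> t <= 2 ^ d -->
   2 ^ i / 2 <= norm z --> norm z <= (4 * real ?n) * 2 ^ i -->
   c2 * (t powr ?E * 2 powr (- (real i * ?E))) <= dyadic_sum \<theta> ?E {..<J} ((1 / t) *\<^sub>R z)"
   using c2(2)[THEN spec, of d, folded dyadic_sum_def] by - (elim exE, rule that)
  note N = this[rule_format]
  have "ennreal (real (card {N..<J - N})) * enn_powr (ennreal ?c * mass ?E d) r <= ennreal ((t * Cb) powr r * K1 * real J)" for J
  proof -
   let ?f = "fI ?E {..<J}"
   let ?G = "Op (\<lambda>x. cor (\<kappa> x)) (HH ?f)"
   let ?X = "enn_powr (ennreal ?c * mass ?E d) r"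
   have BB: "B 0 (HH ?f) \<in> borelM" by (intro B_borel HH_tame fI_schwartz)
   have "Ip r ?G <= enn_powr T r * Ip r (B 0 (HH ?f))"
    unfolding Op_kappa_B[OF fI_schwartz] T_def by (intro Ip_cv r BB schwartz_borel theta_S)
   also have "... <= enn_powr T r * (enn_powr (ennreal Cb) r * Ip r ?f)"
   proof (rule mult_left_mono)
    have "Ip r (B 0 (HH ?f)) <= enn_powr (ennreal Cb * nrm p ?f) r"
     unfolding Ip_nrm[OF r] pr[symmetric] using r by (intro enn_powr_mono nrm_B_fI) auto
    also have "... = enn_powr (ennreal Cb) r * Ip r ?f" unfolding Ip_nrm[OF r] pr[symmetric] enn_powr_mult ..
    finally show "Ip r (B 0 (HH ?f)) <= enn_powr (ennreal Cb) r * Ip r ?f" .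
   qed simp
   also have "... <= enn_powr T r * (enn_powr (ennreal Cb) r * ennreal (K1 * real J))"
    by (intro mult_left_mono K1(2)) auto
   also have "... = ennreal ((t * Cb) powr r * K1 * real J)"
    using t Cb K1(1) by (simp add: enn_powr_ennreal ennreal_mult[symmetric] powr_mult mult_ac)
   finally have up: "Ip r ?G <= ennreal ((t * Cb) powr r * K1 * real J)" .
   define b where "b i = ?X * ennreal (inverse ((2 ^ i) ^ ?n))" for i :: nat
   have low: "b i <= enn_powr (enorm (?G x)) r" if i: "i \<in> {N..<J - N}" and x: "x \<in> dyadic_box i" for i x
   proof -
    have xl: "2 ^ i < x $ l" "x $ l < 2 ^ Suc i" for l using x by (auto simp: dyadic_box_def mem_box_cart)
    have xn: "2 ^ i <= norm x" "norm x <= real ?n * 2 ^ Suc i"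
     using norm_coordinate_bounds[of "2 ^ i" x "2 ^ Suc i"] xl by (auto simp: less_imp_le)
    let ?t1 = "c * bv * (c2 * 2 powr (- (real i * ?E)))"
    have "ennreal ?t1 * mass ?E d <= enorm (?G x)"
    proof (rule type_I_point)
     fix y z :: "real^'n" assume y: "1 / 2 ^ d <= norm y" "norm y <= 2 ^ d" and z: "norm (z - x) <= r0"
     have iJ: "N <= i" "i + N <= J" using i by auto
     have "norm (z - x) <= 1/4" using z r0 by simp
     from N[OF iJ y dyadic_ball[OF xn this]]
     show "c2 * 2 powr (- (real i * ?E)) * norm y powr ?E <= dyadic_sum \<theta> ?E {..<J} ((1 / norm y) *\<^sub>R z)"
      by (simp add: mult_ac)
    qed (use c2 in simp)
    then have "enn_powr (ennreal ?t1 * mass ?E d) r <= enn_powr (enorm (?G x)) r"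
     using r by (intro enn_powr_mono) auto
    moreover have "ennreal ?t1 = ennreal ?c * ennreal (2 powr (- (real i * ?E)))"
     using c' by (simp add: ennreal_mult[symmetric] mult.assoc)
    moreover have "enn_powr (ennreal (2 powr (- (real i * ?E)))) r = ennreal (inverse ((2 ^ i) ^ ?n))"
     using powr_dyadic[of r i] r by (simp add: enn_powr_ennreal)
    ultimately show ?thesis by (simp add: b_def enn_powr_mult mult_ac)
   qed
   have below: "(NBINT x. (\<Sum>i\<in>{N..<J - N}. b i * indicator (dyadic_box i) (x::real^'n))) <= Ip r ?G"
    unfolding Ip_def
   proof (rule nn_integral_mono)
    fix x :: "real^'n"
    show "(\<Sum>i\<in>{N..<J - N}. b i * indicator (dyadic_box i) x) <= enn_powr (enorm (?G x)) r"
    proof (cases "\<exists>i\<in>{N..<J - N}. x \<in> dyadic_box i")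
     case True
     then obtain i where i: "i \<in> {N..<J - N}" "x \<in> dyadic_box i" by blast
     \<comment> \<open>Any coordinate determines the box; \<open>undefined\<close> names one index
       of the nonempty index type.\<close>
     have uniq: "j = i" if "x \<in> dyadic_box j" for j
      using that i(2) dyadic_unique[of i "x $ undefined" j] by (auto simp: dyadic_box_def mem_box_cart less_imp_le)
     have "(\<Sum>j\<in>{N..<J - N}. b j * indicator (dyadic_box j) x) = (\<Sum>j\<in>{N..<J - N}. if j = i then b i else 0)"
     proof (rule sum.cong[OF refl])
      fix j show "b j * indicator (dyadic_box j) x = (if j = i then b i else 0)"
       using uniq[of j] i(2) by (cases "x \<in> dyadic_box j") auto
     qed
     also have "... = b i" using i(1) by simp
     also have "... <= enn_powr (enorm (?G x)) r" by (rule low[OF i])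
     finally show ?thesis .
    next
     case False
     then have "(\<Sum>i\<in>{N..<J - N}. b i * indicator (dyadic_box i) x) = 0" by (intro sum.neutral) auto
     then show ?thesis by (simp only: zero_le)
    qed
   qed
   have e: "(NBINT x. (\<Sum>i\<in>{N..<J - N}. b i * indicator (dyadic_box i) (x::real^'n))) = ennreal (real (card {N..<J - N})) * ?X"
   proof -
    have "(NBINT x. (\<Sum>i\<in>{N..<J - N}. b i * indicator (dyadic_box i) (x::real^'n))) = (\<Sum>i\<in>{N..<J - N}. \<integral>\<^sup>+x. b i * indicator (dyadic_box i) (x::real^'n) \<partial>lborel)"
     by (rule nn_integral_sum) (simp add: dyadic_box_def)
    also have "... = (\<Sum>i\<in>{N..<J - N}. ?X)"
    proof (rule sum.cong[OF refl])
     fix i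
     have "(NBINT x. b i * indicator (dyadic_box i) (x::real^'n)) = b i * emeasure lborel (dyadic_box i :: (real^'n) set)"
      by (rule nn_integral_cmult_indicator) (simp add: dyadic_box_def)
     also have "... = ?X * (ennreal (inverse ((2 ^ i) ^ ?n)) * ennreal ((2 ^ i) ^ ?n))"
      by (simp only: b_def emeasure_dyadic_box mult.assoc)
     also have "ennreal (inverse ((2 ^ i) ^ ?n)) * ennreal ((2 ^ i) ^ ?n) = ennreal (inverse ((2 ^ i) ^ ?n) * (2 ^ i) ^ ?n)"
      by (rule ennreal_mult[symmetric]) auto
     also have "inverse ((2 ^ i) ^ ?n) * (2 ^ i) ^ ?n = (1::real)" by simp
     finally show "(NBINT x. b i * indicator (dyadic_box i) (x::real^'n)) = ?X" by simp
    qed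
    finally show ?thesis by (simp add: ennreal_of_nat_eq_real_of_nat)
   qed
   show ?thesis using order_trans[OF below up] unfolding e .
  qed
  then show "\<exists>N. \<forall>J. ennreal (real (card {N..<J - N})) * enn_powr (ennreal ?c * mass ?E d) r <= ennreal ((t * Cb) powr r * K1 * real J)"
   by (intro exI allI)
 qed
 then show ?thesis using pr by (simp add: einv_def)
qed

text \<open>For p = \<infinity> a single dilate by 2^d works: near 0 it stays above \<open>c\<close>
  after every dilation with |y| >= 2^(-d), while its supremum does not depend on d.\<close>

lemma type_I_inf:
 assumes pr: "p = \<infinity>"
 shows "(NBINT y. ennreal (norm y powr (CARD('n) * einv p) * \<Phi> y)) < \<infinity>"
proof -
 obtain t where t: "t \<ge> 0" "T = ennreal t" using T_finite by (cases T) auto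
 obtain S where S: "S > 0" "\<And>x. \<bar>\<theta> x\<bar> <= S" using wboundE[OF schwartz_wbound[OF theta_S, of 0]] by auto
 let ?c = "c * bv * c"
 have c': "?c > 0" using c bv_pos by simp
 have "mass 0 d <= ennreal (t * (Cb * S) / ?c)" for d
 proof -
  let ?f = "fI 0 {d}"
  have "ennreal ?c * mass 0 d <= enorm (Op (\<lambda>x. cor (\<kappa> x)) (HH ?f) 0)"
  proof (rule type_I_point)
   fix y z :: "real^'n" assume y: "1 / 2 ^ d <= norm y" "norm y <= 2 ^ d" and z: "norm (z - 0) <= r0"
   have "(0::real) < 1 / 2 ^ d" by simp
   then have y0: "norm y > 0" using y(1) by linarith
   have "1 <= 2 ^ d * norm y" using y(1) by (simp add: field_simps)
   then have "norm z * 1 <= r0 * (2 ^ d * norm y)" using z r0 by (intro mult_mono) auto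
   then have "norm ((1 / 2 ^ d) *\<^sub>R ((1 / norm y) *\<^sub>R z)) <= r0" using y0 by (simp add: field_simps)
   from theta_c[OF this] show "c * norm y powr 0 <= dyadic_sum \<theta> 0 {d} ((1 / norm y) *\<^sub>R z)"
    using y0 by (simp add: dyadic_sum_def)
  qed (use c in simp)
  also have "... <= T * nrm \<infinity> (B 0 (HH ?f))"
   unfolding Op_kappa_B[OF fI_schwartz] T_def by (intro cv_sup schwartz_borel[OF theta_S] B_borel HH_tame fI_schwartz)
  also have "... <= T * (ennreal Cb * ennreal S)"
  proof (intro mult_left_mono order_trans[OF nrm_B_fI[of "{d}" 0, unfolded pr]])
   show "nrm \<infinity> ?f <= ennreal S" using S by (intro nrm_infI schwartz_borel fI_schwartz) (simp add: dyadic_sum_def ennreal_leI)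
  qed auto
  also have "... = ennreal ?c * ennreal (t * (Cb * S) / ?c)"
   using c bv_pos t Cb S(1) by (simp add: ennreal_mult[symmetric])
  finally show ?thesis using c' by (subst (asm) ennreal_mult_le_mult_iff) (auto simp: ennreal_eq_0_iff)
 qed
 from mass_bounded[OF this] show ?thesis using pr order_le_less_trans[OF _ ennreal_less_top] by (simp add: einv_def)
qed

end

section \<open>Tests spread over the frequency lattice: the weight with exponent n/q'\<close>

lemma dil_fourier:
 fixes g :: "real^'n::finite => complex"
 assumes g: "g \<in> schwartz" and t: "t > 0"
 shows "dil (1 / t) (fourier g) = fourier (\<lambda>\<xi>. of_real (t ^ CARD('n)) * g (t *\<^sub>R \<xi>))"
proof
 fix x
 have dS: "(\<lambda>\<xi>. g (t *\<^sub>R \<xi>)) \<in> schwartz" using t by (intro schwartz_dilate[OF g]) simp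
 have "fourier (\<lambda>\<xi>. g (t *\<^sub>R \<xi>)) x = fourier g (x /\<^sub>R t) /\<^sub>R \<bar>t\<bar> ^ CARD('n)"
  by (rule fourier_dilate[OF schwartz_borel[OF g]]) (use t in simp)
 then show "fourier g ((1 / t) *\<^sub>R x) = fourier (\<lambda>\<xi>. of_real (t ^ CARD('n)) * g (t *\<^sub>R \<xi>)) x"
  unfolding fourier_cmult[OF schwartz_borel[OF dS]] using t by (simp add: scaleR_conv_of_real[where 'a=complex] divide_inverse)
qed

lemma nrm_0: "nrm p (\<lambda>_::real^'n::finite. 0) = 0"
 using nrm_infI[of "\<lambda>_::real^'n. 0" 0] by (cases "p = \<infinity>") (auto simp: lpn_def)

lemma nrm_wbound_finite:
 assumes p: "1 <= p" and g: "\<And>N. wbound N g" shows "nrm p g < \<infinity>"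
 using p
proof (cases rule: ereal_ge_1_cases)
 case 1
 obtain C where C: "C > 0" "\<And>x. norm (g x) <= C" using wboundE[OF g[of 0]] by auto
 have "nrm \<infinity> g <= ennreal C" using C(2) by (intro nrm_infI wbound_borel[OF g[of 0]] ennreal_leI)
 then show ?thesis unfolding 1 using order_le_less_trans[OF _ ennreal_less_top] by simp
next
 case (2 r)
 then show ?thesis using Ip_finite[OF 2(2) g] by (simp add: nrm_Ip)
qed

context hausdorff_test
begin

abbreviation gII :: "real => nat set => real^'n => complex" where
 "gII E I \<equiv> (\<lambda>x. cor (dyadic_sum \<kappa> E I x))"

lemma gII_schwartz: "gII E I \<in> schwartz" by (rule schwartz_dyadic_sum[OF kappa_S])

lemma fII_schwartz: "fourier (gII E I) \<in> schwartz" by (rule schwartz_fourier[OF gII_schwartz])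

text \<open>At the origin a block is the integral of its frequency density, here a product of
  nonnegative functions; positivity in frequency replaces positivity in space.\<close>

lemma B_dil_fII:
 assumes t: "t > 0"
 shows "B k (dil (1 / t) (fourier (gII E I))) 0 = cor (LBINT \<xi>. sigma_window \<eta> k (- \<xi>) * (t ^ CARD('n) * dyadic_sum \<kappa> E I (t *\<^sub>R \<xi>)))"
  "integrable lborel (\<lambda>\<xi>. sigma_window \<eta> k (- \<xi>) * (t ^ CARD('n) * dyadic_sum \<kappa> E I (t *\<^sub>R \<xi>)))"
proof -
 let ?g = "\<lambda>\<xi>. of_real (t ^ CARD('n)) * gII E I (t *\<^sub>R \<xi>)"
 have gS: "?g \<in> schwartz" using t by (intro schwartz_cmult schwartz_dilate[OF gII_schwartz]) simp
 have hS: "(\<lambda>\<xi>. sg k (- \<xi>) * ?g \<xi>) \<in> schwartz" by (rule schwartz_mult[OF schwartz_reflect[OF sg_schwartz] gS])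
 have e: "sg k (- \<xi>) * ?g \<xi> = cor (sigma_window \<eta> k (- \<xi>) * (t ^ CARD('n) * dyadic_sum \<kappa> E I (t *\<^sub>R \<xi>)))" for \<xi>
  by (simp add: sg_def)
 have "B k (dil (1 / t) (fourier (gII E I))) 0 = fourier (\<lambda>\<xi>. sg k (- \<xi>) * ?g \<xi>) 0"
  unfolding dil_fourier[OF gII_schwartz t] Op_fourier[OF sg_schwartz gS] ..
 also have "... = (LBINT \<xi>. sg k (- \<xi>) * ?g \<xi>)"
  unfolding fourier_lborel[OF schwartz_borel[OF hS]] by simp
 also have "... = cor (LBINT \<xi>. sigma_window \<eta> k (- \<xi>) * (t ^ CARD('n) * dyadic_sum \<kappa> E I (t *\<^sub>R \<xi>)))"
  unfolding e by (rule integral_complex_of_real)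
 finally show "B k (dil (1 / t) (fourier (gII E I))) 0 = cor (LBINT \<xi>. sigma_window \<eta> k (- \<xi>) * (t ^ CARD('n) * dyadic_sum \<kappa> E I (t *\<^sub>R \<xi>)))" .
 show "integrable lborel (\<lambda>\<xi>. sigma_window \<eta> k (- \<xi>) * (t ^ CARD('n) * dyadic_sum \<kappa> E I (t *\<^sub>R \<xi>)))"
  using schwartz_integrable[OF hS] unfolding e by (simp only: complex_of_real_integrable_eq)
qed

text \<open>Dilation multiplies the frequency density by |y|^n and the dyadic sum contributes
  |y|^(-E). For E = n/q the exponent n - E is n/q'.\<close>

lemma type_II_point:
 assumes a: "0 <= a"
  and le: "\<And>(y::real^'n) \<xi>. 1 / 2 ^ d <= norm y ==> norm y <= 2 ^ d ==> norm (\<xi> + kv k) <= r0 ==> a * norm y powr (- E) <= dyadic_sum \<kappa> E I (norm y *\<^sub>R \<xi>)"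
 shows "ennreal (bv * a) * mass (real CARD('n) - E) d <= enorm (B k (HH (fourier (gII E I))) 0)"
 unfolding cv_HH(1)[OF fII_schwartz fourier_wbound[OF sg_schwartz]]
proof (rule mass_le[OF cv_HH(2)[OF fII_schwartz fourier_wbound[OF sg_schwartz]]])
 let ?S = "dyadic_sum \<kappa> E I"
 have S0: "0 <= ?S z" for z by (rule dyadic_sum_nonneg[of \<kappa>, OF kappa_ge])
 show "0 <= Re (B k (dil (1 / norm y) (fourier (gII E I))) 0)" if "norm y > 0" for y :: "real^'n"
  unfolding B_dil_fII(1)[OF that] by (simp add: S0 sigma_ge)
 show "0 <= bv * a" using bv_pos a by simp
 fix y :: "real^'n" assume y: "1 / 2 ^ d <= norm y" "norm y <= 2 ^ d"
 have "(0::real) < 1 / 2 ^ d" by simp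
 then have y0: "norm y > 0" using y(1) by linarith
 have pw: "norm y ^ CARD('n) * (a * norm y powr (- E)) = a * norm y powr (real CARD('n) - E)"
  using y0 powr_realpow[OF y0, of "CARD('n)"] by (simp add: powr_diff powr_minus divide_inverse)
 have "(a * norm y powr (real CARD('n) - E)) * (unit_ball_vol (real CARD('n)) * r0 ^ CARD('n)) \<le>
  (LBINT \<xi>. sigma_window \<eta> k (- \<xi>) * (norm y ^ CARD('n) * ?S (norm y *\<^sub>R \<xi>)))"
 proof (rule integral_ge_cball[OF B_dil_fII(2)[OF y0], where v="- kv k"])
  fix \<xi> :: "real^'n" assume "norm (\<xi> - - kv k) <= r0"
  then have x: "norm (\<xi> + kv k) <= r0" by simp
  then have "sigma_window \<eta> k (- \<xi>) = 1" using r0 by (intro sigma_near) linarith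
  moreover have "norm y ^ CARD('n) * (a * norm y powr (- E)) <= norm y ^ CARD('n) * ?S (norm y *\<^sub>R \<xi>)"
   by (intro mult_left_mono le[OF y x]) simp
  ultimately show "a * norm y powr (real CARD('n) - E) <= sigma_window \<eta> k (- \<xi>) * (norm y ^ CARD('n) * ?S (norm y *\<^sub>R \<xi>))"
   by (simp add: pw)
 qed (use a r0 S0 sigma_ge in auto)
 then show "bv * a * norm y powr (real CARD('n) - E) <= Re (B k (dil (1 / norm y) (fourier (gII E I))) 0)"
  unfolding B_dil_fII(1)[OF y0] bv by (simp add: mult_ac)
qed

text \<open>The multiplier \<kappa>(\<xi>/2^j) has a kernel whose L^1 norm is independent of j, so
  Young's inequality gives a uniform bound. If |k| >= 2^j in the maximum norm, window k misses its
  support, because (1 - 3/16) 2^j > 3/4.\<close>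

lemma nrm_fourier_dyadic_piece:
 "\<exists>P\<ge>0. \<forall>(j::nat) k. nrm p (fourier (\<lambda>\<xi>. sg k (- \<xi>) * cor (\<kappa> ((1 / 2 ^ j) *\<^sub>R \<xi>)))) <= ennreal (P * (if infnorm (kv k) < 2 ^ j then 1 else 0))"
proof -
 let ?k = "\<lambda>x. cor (\<kappa> x)"
 define Q where "Q = nrm p (\<lambda>x. fourier (sg 0) (- x))"
 have "Q < \<infinity>" unfolding Q_def by (rule nrm_wbound_finite[OF p wbound_reflect[OF fourier_wbound[OF sg_schwartz]]])
 then have "T * Q < \<top>" using T_finite by (simp add: ennreal_mult_less_top)
 then obtain P where P: "P \<ge> 0" "T * Q = ennreal P" by (cases "T * Q") auto
 have main: "nrm p (fourier (\<lambda>\<xi>. sg k (- \<xi>) * ?k ((1 / 2 ^ j) *\<^sub>R \<xi>))) <= ennreal (P * (if infnorm (kv k) < 2 ^ j then 1 else 0))" for j :: nat and k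
 proof (cases "infnorm (kv k) < 2 ^ j")
  case True
  have hS: "(\<lambda>\<xi>. sg k (- \<xi>)) \<in> schwartz" by (rule schwartz_reflect[OF sg_schwartz])
  have kS: "(\<lambda>\<xi>. ?k ((1 / 2 ^ j) *\<^sub>R \<xi>)) \<in> schwartz" by (rule schwartz_dilate[OF kappa_S]) simp
  note hm [measurable] = schwartz_borel[OF schwartz_fourier[OF hS]] and km [measurable] = schwartz_borel[OF schwartz_fourier[OF kS]]
  let ?K = "\<lambda>z. fourier (\<lambda>\<xi>. ?k ((1 / 2 ^ j) *\<^sub>R \<xi>)) (- z)"
  have Km: "?K \<in> borelM" by measurable
  have cvK: "fourier (\<lambda>\<xi>. sg k (- \<xi>) * ?k ((1 / 2 ^ j) *\<^sub>R \<xi>)) x = cv ?K (fourier (\<lambda>\<xi>. sg k (- \<xi>))) x" for x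
  proof -
   let ?f = "\<lambda>y. fourier (\<lambda>\<xi>. ?k ((1 / 2 ^ j) *\<^sub>R \<xi>)) y * fourier (\<lambda>\<xi>. sg k (- \<xi>)) (x - y)"
   have "fourier (\<lambda>\<xi>. sg k (- \<xi>) * ?k ((1 / 2 ^ j) *\<^sub>R \<xi>)) x = (LBINT y. ?f y)" by (rule fourier_mult[OF hS kS])
   also have "... = (LBINT z. ?f (0 - z))" by (rule integral_shift(3)[symmetric]) measurable
   also have "... = cv ?K (fourier (\<lambda>\<xi>. sg k (- \<xi>))) x" by (simp add: cv_def mult.commute)
   finally show ?thesis .
  qed
  have "nrm p (fourier (\<lambda>\<xi>. sg k (- \<xi>) * ?k ((1 / 2 ^ j) *\<^sub>R \<xi>))) = nrm p (cv ?K (fourier (\<lambda>\<xi>. sg k (- \<xi>))))"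
   unfolding cvK ..
  also have "... <= (NBINT z. enorm (?K z)) * nrm p (fourier (\<lambda>\<xi>. sg k (- \<xi>)))"
   by (rule nrm_cv[OF p hm Km])
  also have "nrm p (fourier (\<lambda>\<xi>. sg k (- \<xi>))) = Q"
  proof -
   have "norm (fourier (\<lambda>\<xi>. sg k (- \<xi>)) x) = norm (fourier (sg 0) (- x))" for x
    unfolding fourier_reflect[OF sg_schwartz] fourier_sg[of k] by (simp add: norm_mult)
   then show ?thesis by (simp add: Q_def)
  qed
  also have "(NBINT z. enorm (?K z)) = T"
  proof -
   have "norm (?K z) = (2 ^ j) ^ CARD('n) * norm (cor (\<theta> (0 + (- (2 ^ j)) *\<^sub>R z)))" for z
   proof -
    have "?K z = fourier ?k ((- z) /\<^sub>R (1 / 2 ^ j)) /\<^sub>R \<bar>1 / 2 ^ j\<bar> ^ CARD('n)"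
     by (rule fourier_dilate[OF schwartz_borel[OF kappa_S]]) simp
    then show ?thesis unfolding fourier_kappa by (simp add: power_divide divide_inverse power_inverse mult.commute)
   qed
   then have "(NBINT z. enorm (?K z)) = (NBINT z. ennreal ((2 ^ j) ^ CARD('n)) * enorm (cor (\<theta> (0 + (- (2 ^ j)) *\<^sub>R z))))"
    by (intro nn_integral_cong) (simp only: ennreal_mult norm_ge_zero zero_le_power zero_le_numeral)
   also have "... = ennreal ((2 ^ j) ^ CARD('n)) * (NBINT z. enorm (cor (\<theta> (0 + (- (2 ^ j)) *\<^sub>R z))))"
   proof (rule nn_integral_cmult)
    note [measurable] = schwartz_borel[OF theta_S]
    show "(\<lambda>z. enorm (cor (\<theta> (0 + (- (2 ^ j)) *\<^sub>R z)))) \<in> borel_measurable lborel"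
     by measurable
   qed
   also have "... = T"
    unfolding T_def
   proof (subst nn_integral_affine[of "\<lambda>z. enorm (cor (\<theta> z))" "- (2 ^ j)" 0])
    show "(\<lambda>z. enorm (cor (\<theta> z))) \<in> borelM"
     using schwartz_borel[OF theta_S] by measurable
   qed simp_all
   finally show ?thesis .
  qed
  finally show ?thesis using True P by simp
 next
  case False
  have z: "sg k (- \<xi>) * ?k ((1 / 2 ^ j) *\<^sub>R \<xi>) = 0" for \<xi>
  proof (cases "infnorm ((1 / 2 ^ j) *\<^sub>R \<xi>) < 3/16")
   case True
   then have "infnorm \<xi> < 3/16 * 2 ^ j" by (simp add: infnorm_mul field_simps)
   moreover have "(1::real) <= 2 ^ j" by simp
   moreover have "infnorm (kv k) <= infnorm (- \<xi> - kv k) + infnorm \<xi>"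
    using infnorm_triangle[of "\<xi> + kv k" "- \<xi>"] infnorm_neg[of "\<xi> + kv k"] infnorm_neg[of \<xi>] by simp
   ultimately have "\<not> infnorm (- \<xi> - kv k) < 3/4" using False by linarith
   then show ?thesis by (simp add: sg_0)
  qed (simp add: kappa_0)
  have "fourier (\<lambda>\<xi>. sg k (- \<xi>) * ?k ((1 / 2 ^ j) *\<^sub>R \<xi>)) = (\<lambda>_. 0)" unfolding z by (simp add: fourier_def[abs_def])
  then show ?thesis using nrm_0[where ?'n='n] by simp
 qed
 show ?thesis by (intro exI[of _ P] conjI allI P(1) main)
qed

lemma nrm_B_fII:
 assumes P: "0 <= P" "\<And>(j::nat) k. nrm p (fourier (\<lambda>\<xi>. sg k (- \<xi>) * cor (\<kappa> ((1 / 2 ^ j) *\<^sub>R \<xi>)))) <= ennreal (P * (if infnorm (kv k) < 2 ^ j then 1 else 0))"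
  and I: "finite I"
 shows "nrm p (B k (fourier (gII E I))) <= ennreal (P * (\<Sum>j\<in>I. 2 powr (- (real j * E)) * (if infnorm (kv k) < 2 ^ j then 1 else 0)))"
proof -
 define h where "h j = (\<lambda>\<xi>. sg k (- \<xi>) * cor (\<kappa> ((1 / 2 ^ j) *\<^sub>R \<xi>)))" for j :: nat
 have hS: "h j \<in> schwartz" for j unfolding h_def by (rule schwartz_mult[OF schwartz_reflect[OF sg_schwartz] schwartz_dilate[OF kappa_S]]) simp
 let ?w = "\<lambda>j. 2 powr (- (real j * E))"
 let ?t1 = "\<lambda>\<xi>. \<Sum>j\<in>I. of_real (?w j) * h j \<xi>"
 have "sg k (- \<xi>) * gII E I \<xi> = (\<Sum>j\<in>I. of_real (?w j) * h j \<xi>)" for \<xi>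
  by (simp add: dyadic_sum_def h_def sum_distrib_left mult_ac)
 then have "B k (fourier (gII E I)) = fourier ?t1"
  unfolding Op_fourier[OF sg_schwartz gII_schwartz] by simp
 also have "... = (\<lambda>x. \<Sum>j\<in>I. of_real (?w j) * fourier (h j) x)"
 proof
  fix x
  have "fourier ?t1 x = (\<Sum>j\<in>I. fourier (\<lambda>\<xi>. of_real (?w j) * h j \<xi>) x)"
   by (intro fourier_sum I schwartz_cmult hS)
  then show "fourier ?t1 x = (\<Sum>j\<in>I. of_real (?w j) * fourier (h j) x)"
   unfolding fourier_cmult[OF schwartz_borel[OF hS]] .
 qed
 finally have e: "B k (fourier (gII E I)) = (\<lambda>x. \<Sum>j\<in>I. of_real (?w j) * fourier (h j) x)" .
 have hm: "fourier (h j) \<in> borelM" for j by (intro schwartz_borel schwartz_fourier hS)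
 have "nrm p (B k (fourier (gII E I))) <= (\<Sum>j\<in>I. nrm p (\<lambda>x. of_real (?w j) * fourier (h j) x))"
  unfolding e using hm by (intro nrm_sum p I) measurable
 also have "... <= (\<Sum>j\<in>I. ennreal (?w j) * ennreal (P * (if infnorm (kv k) < 2 ^ j then 1 else 0)))"
 proof (rule sum_mono)
  fix j
  have "nrm p (\<lambda>x. of_real (?w j) * fourier (h j) x) = lpn lborel p (\<lambda>x. ennreal (?w j) * enorm (fourier (h j) x))"
   by (simp add: norm_mult ennreal_mult)
  also have "... <= ennreal (?w j) * nrm p (fourier (h j))" using hm by (intro lpn_cmult_le p) measurable
  also have "... <= ennreal (?w j) * ennreal (P * (if infnorm (kv k) < 2 ^ j then 1 else 0))"
   unfolding h_def by (intro mult_left_mono P(2)) simp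
  finally show "nrm p (\<lambda>x. of_real (?w j) * fourier (h j) x) <= ennreal (?w j) * ennreal (P * (if infnorm (kv k) < 2 ^ j then 1 else 0))" .
 qed
 also have "... = (\<Sum>j\<in>I. ennreal (P * (?w j * (if infnorm (kv k) < 2 ^ j then 1 else 0))))"
  using P(1) by (intro sum.cong refl) (simp add: ennreal_mult[symmetric] mult.left_commute)
 also have "... = ennreal (P * (\<Sum>j\<in>I. ?w j * (if infnorm (kv k) < 2 ^ j then 1 else 0)))"
  using P(1) unfolding sum_distrib_left by (intro sum_ennreal) auto
 finally show ?thesis .
qed

text \<open>Each block is reproduced by the kernel of its wider window, so its value at the origin
  is controlled by its p-norm uniformly in k.\<close>

lemma bernstein:
 "\<exists>D>0. \<forall>k f. f \<in> schwartz --> enorm (B k (HH f) 0) <= ennreal D * nrm p (B k (HH f))"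
proof -
 obtain A where A: "A > 0" "\<And>l z. norm (fourier (tt l) z) <= A * wt z" by (rule tt_bound, rule that)
 obtain D where D: "D > 0" "\<forall>(g::real^'n => complex) K y. g \<in> borelM \<and> K \<in> borelM \<and> (\<forall>z. norm (K z) <= A * wt z) -->
  enorm (cv K g y) <= ennreal D * nrm p g"
  using cv_pointwise[OF p, of A, where ?'n='n] by - (elim exE conjE, rule that)
 have main: "enorm (B k (HH f) 0) <= ennreal D * nrm p (B k (HH f))" if f: "f \<in> schwartz" for k f
 proof -
  have "enorm (Op (tt k) (B k (HH f)) 0) <= ennreal D * nrm p (B k (HH f))"
   by (intro D(2)[rule_format] conjI allI A(2) B_borel HH_tame f schwartz_borel schwartz_fourier tt_schwartz)
  then show ?thesis unfolding B_tt[OF HH_tame[OF f]] .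
 qed
 show ?thesis by (intro exI[of _ D] conjI allI impI D(1) main)
qed

text \<open>Block 0 and one bump of frequency width 2^d suffice: the bump stays above
  \<open>c\<close> near 0 for |y| <= 2^d, and all its blocks are bounded independently of d.\<close>

lemma type_II_inf:
 assumes qi: "q = \<infinity>"
 shows "(NBINT y. ennreal (norm y powr (CARD('n) * (1 - einv q)) * \<Phi> y)) < \<infinity>"
proof -
 obtain P where P: "0 <= P" "\<forall>(j::nat) k. nrm p (fourier (\<lambda>\<xi>. sg k (- \<xi>) * cor (\<kappa> ((1 / 2 ^ j) *\<^sub>R \<xi>)))) <= ennreal (P * (if infnorm (kv k) < 2 ^ j then 1 else 0))"
  using nrm_fourier_dyadic_piece by - (elim exE conjE, rule that)
 obtain D where D: "D > 0" "\<forall>k f. f \<in> schwartz --> enorm (B k (HH f) 0) <= ennreal D * nrm p (B k (HH f))"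
  using bernstein by - (elim exE conjE, rule that)
 have c': "bv * c > 0" using c bv_pos by simp
 have "mass (real CARD('n) - 0) d <= ennreal (D * (Cb * P) / (bv * c))" for d
 proof -
  let ?f = "fourier (gII 0 {d})"
  have "ennreal (bv * c) * mass (real CARD('n) - 0) d <= enorm (B 0 (HH ?f) 0)"
  proof (rule type_II_point)
   fix y \<xi> :: "real^'n" assume y: "1 / 2 ^ d <= norm y" "norm y <= 2 ^ d" and z: "norm (\<xi> + kv 0) <= r0"
   have "(0::real) < 1 / 2 ^ d" by simp
   then have y0: "norm y > 0" using y(1) by linarith
   have "norm y * norm \<xi> <= 2 ^ d * r0" using z y(2) by (intro mult_mono) auto
   then have "norm ((1 / 2 ^ d) *\<^sub>R (norm y *\<^sub>R \<xi>)) <= r0" by (simp add: field_simps)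
   from kappa_c[OF this] show "c * norm y powr (- 0) <= dyadic_sum \<kappa> 0 {d} (norm y *\<^sub>R \<xi>)"
    using y0 by (simp add: dyadic_sum_def)
  qed (use c in simp)
  also have "... <= ennreal D * nrm p (B 0 (HH ?f))" by (rule D(2)[rule_format, OF fII_schwartz])
  also have "... <= ennreal D * mnorm p q (HH ?f)" by (intro mult_left_mono nrm_le_mnorm q) simp
  also have "... <= ennreal D * (ennreal Cb * mnorm p q ?f)" by (intro mult_left_mono bd fII_schwartz) simp
  also have "... <= ennreal D * (ennreal Cb * ennreal P)"
  proof (intro mult_left_mono)
   show "mnorm p q ?f <= ennreal P" unfolding qi mnorm_inf
   proof (rule SUP_least)
    fix k
    have "nrm p (B k ?f) <= ennreal (P * (\<Sum>j\<in>{d}. 2 powr (- (real j * 0)) * (if infnorm (kv k) < 2 ^ j then 1 else 0)))"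
     by (rule nrm_B_fII[OF P(1) P(2)[rule_format]]) simp
    also have "... <= ennreal P" using P(1) by (intro ennreal_leI) simp
    finally show "nrm p (B k ?f) <= ennreal P" .
   qed
  qed auto
  also have "... = ennreal (bv * c) * ennreal (D * (Cb * P) / (bv * c))"
   using c bv_pos D(1) Cb P(1) by (simp add: ennreal_mult[symmetric])
  finally show ?thesis using c' by (subst (asm) ennreal_mult_le_mult_iff) (auto simp: ennreal_eq_0_iff)
 qed
 from mass_bounded[OF this] show ?thesis using qi order_le_less_trans[OF _ ennreal_less_top] by (simp add: einv_def)
qed

text \<open>Block k sees only the scales with 2^j > |k|, and their geometric sum is comparable to
  its largest term. At most 3^n 2^(jn) lattice points lie below scale j, which cancels the weight
  2^(-jn), so each scale contributes a constant.\<close>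

lemma mnorm_fII:
 assumes w: "1 <= w"
 shows "\<exists>K\<ge>0. \<forall>J. (\<integral>\<^sup>+k. enn_powr (nrm p (B k (fourier (gII (CARD('n) / w) {..<J})))) w \<partial>count_space UNIV) <= ennreal (K * real J)"
proof -
 let ?n = "CARD('n)"
 let ?E = "real ?n / w"
 have E: "0 < ?E" using w by simp
 obtain P where P: "0 <= P" "\<forall>(j::nat) k. nrm p (fourier (\<lambda>\<xi>. sg k (- \<xi>) * cor (\<kappa> ((1 / 2 ^ j) *\<^sub>R \<xi>)))) <= ennreal (P * (if infnorm (kv k) < 2 ^ j then 1 else 0))"
  using nrm_fourier_dyadic_piece by - (elim exE conjE, rule that)
 define \<rho> :: real where "\<rho> = 2 powr (- ?E)"
 have \<rho>: "0 < \<rho>" "\<rho> < 1" using E powr_less_mono[of "- ?E" 0 2] by (auto simp: \<rho>_def)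
 define G where "G = P powr w * (2 / (1 - \<rho>)) powr w"
 have G: "G \<ge> 0" by (simp add: G_def)
 let ?i = "\<lambda>(k::int^'n) (j::nat). if infnorm (kv k) < 2 ^ j then 1 else (0::real)"
 have pt: "enn_powr (nrm p (B k (fourier (gII ?E {..<J})))) w <= ennreal (G * (\<Sum>j<J. inverse ((2 ^ j) ^ ?n) * ?i k j))" for k J
 proof -
  \<comment> \<open>The value 0 switches off the scales that do not reach k; otherwise the inverse
    power is at least 1, so the minimum is \<rho>^j, while the growth required by
    \<open>geometric_min_powr\<close> holds.\<close>
  define v where "v j = (if infnorm (kv k) < 2 ^ j then inverse (\<rho> ^ j) else 0)" for j :: nat
  have v0: "0 <= v j" for j using \<rho> by (simp add: v_def)
  have v: "v j <= \<rho> * v (Suc j)" for j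
  proof (cases "infnorm (kv k) < 2 ^ j")
   case True
   moreover have "(2::real) ^ j <= 2 ^ Suc j" by simp
   ultimately have "infnorm (kv k) < 2 ^ Suc j" by linarith
   then show ?thesis using True \<rho> by (simp add: v_def del: power_Suc) simp
  next
   case False
   then have "v j = 0" by (simp add: v_def)
   then show ?thesis using \<rho> v0[of "Suc j"] by simp
  qed
  have minv: "min (\<rho> ^ j) (v j) = \<rho> ^ j * ?i k j" for j
  proof -
   have "\<rho> ^ j <= 1" using \<rho> by (intro power_le_one) auto
   moreover have "1 <= inverse (\<rho> ^ j)" using \<rho> calculation by (intro one_le_inverse) auto
   ultimately show ?thesis using \<rho> by (cases "infnorm (kv k) < 2 ^ j") (auto simp: v_def min_absorb1 min_absorb2)
  qed
  let ?S = "\<Sum>j<J. min (\<rho> ^ j) (v j)"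
  have S0: "0 <= ?S" using \<rho> v0 by (intro sum_nonneg) auto
  have "nrm p (B k (fourier (gII ?E {..<J}))) <= ennreal (P * (\<Sum>j<J. 2 powr (- (real j * ?E)) * ?i k j))"
   by (rule nrm_B_fII[OF P(1) P(2)[rule_format]]) simp
  also have "(\<Sum>j<J. 2 powr (- (real j * ?E)) * ?i k j) = ?S" by (simp only: minv powr_nat_2 \<rho>_def[symmetric])
  finally have "enn_powr (nrm p (B k (fourier (gII ?E {..<J})))) w <= enn_powr (ennreal (P * ?S)) w" using w by (intro enn_powr_mono) auto
  also have "... = ennreal (P powr w * ?S powr w)" using P(1) S0 by (simp add: enn_powr_ennreal powr_mult)
  also have "... <= ennreal (P powr w * ((2 / (1 - \<rho>)) powr w * (\<Sum>j<J. min (\<rho> ^ j) (v j) powr w)))"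
  proof (intro ennreal_leI mult_left_mono geometric_min_powr)
   show "0 < w" using w by simp
  qed (use \<rho> v0 v in auto)
  also have "(\<Sum>j<J. min (\<rho> ^ j) (v j) powr w) = (\<Sum>j<J. inverse ((2 ^ j) ^ ?n) * ?i k j)"
  proof (rule sum.cong[OF refl])
   fix j
   have "(\<rho> ^ j) powr w = inverse ((2 ^ j) ^ ?n)" unfolding \<rho>_def powr_nat_2[symmetric] using w by (intro powr_dyadic) simp
   then show "min (\<rho> ^ j) (v j) powr w = inverse ((2 ^ j) ^ ?n) * ?i k j" unfolding minv using w by simp
  qed
  finally show ?thesis by (simp add: G_def mult.assoc)
 qed
 have main: "(\<integral>\<^sup>+k. enn_powr (nrm p (B k (fourier (gII ?E {..<J})))) w \<partial>count_space UNIV) <= ennreal (G * 3 ^ ?n * real J)" for J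
 proof (rule nn_integral_count_space_le)
  fix L :: "(int^'n) set" assume L: "finite L"
  have "(\<Sum>k\<in>L. enn_powr (nrm p (B k (fourier (gII ?E {..<J})))) w) <= (\<Sum>k\<in>L. ennreal (G * (\<Sum>j<J. inverse ((2 ^ j) ^ ?n) * ?i k j)))"
   by (intro sum_mono pt)
  also have "... = ennreal (\<Sum>k\<in>L. G * (\<Sum>j<J. inverse ((2 ^ j) ^ ?n) * ?i k j))"
   using G by (intro sum_ennreal mult_nonneg_nonneg sum_nonneg) auto
  also have "(\<Sum>k\<in>L. G * (\<Sum>j<J. inverse ((2 ^ j) ^ ?n) * ?i k j)) = G * (\<Sum>j<J. inverse ((2 ^ j) ^ ?n) * (\<Sum>k\<in>L. ?i k j))"
   unfolding sum_distrib_left by (rule sum.swap)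
  also have "ennreal ... <= ennreal (G * (\<Sum>j<J. 3 ^ ?n))"
  proof (intro ennreal_leI mult_left_mono G sum_mono)
   fix j
   have "(\<Sum>k\<in>L. ?i k j) = real (card {k \<in> L. infnorm (kv k) < 2 ^ j})"
    using L by (simp add: sum.If_cases Int_def)
   also have "... <= real (card {k::int^'n. infnorm (0 - kv k) < 2 ^ j})"
    using finite_int_box[of "0::real^'n" "2 ^ j"] by (intro of_nat_mono card_mono) (auto simp: infnorm_neg)
   also have "... <= (2 * 2 ^ j + 1) ^ ?n" by (rule card_int_box) simp
   also have "... <= (3 * 2 ^ j) ^ ?n" by (intro power_mono) auto
   also have "... = (2 ^ j) ^ ?n * 3 ^ ?n" by (simp add: power_mult_distrib)
   finally have "(\<Sum>k\<in>L. ?i k j) <= (2 ^ j) ^ ?n * 3 ^ ?n" .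
   then have "inverse ((2 ^ j) ^ ?n) * (\<Sum>k\<in>L. ?i k j) <= inverse ((2 ^ j) ^ ?n) * ((2 ^ j) ^ ?n * 3 ^ ?n)" by (intro mult_left_mono) auto
   then show "inverse ((2 ^ j) ^ ?n) * (\<Sum>k\<in>L. ?i k j) <= 3 ^ ?n" by (simp only: mult.assoc[symmetric]) simp
  qed
  also have "G * (\<Sum>j<J. 3 ^ ?n) = G * 3 ^ ?n * real J" by simp
  finally show "(\<Sum>k\<in>L. enn_powr (nrm p (B k (fourier (gII ?E {..<J})))) w) <= ennreal (G * 3 ^ ?n * real J)" .
 qed
 have "G * 3 ^ ?n \<ge> 0" using G by simp
 then show ?thesis by (intro exI[of _ "G * 3 ^ ?n"] conjI allI main)
qed

text \<open>The discrete counterpart of \<open>type_I_fin\<close>: lattice boxes with 2^(in) points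
  replace boxes of that volume, the outer l^q sum replaces the integral, and
  \<open>bernstein\<close> replaces the smoothing by \<kappa>.\<close>

lemma type_II_fin:
 assumes qw: "q = ereal w"
 shows "(NBINT y. ennreal (norm y powr (CARD('n) * (1 - einv q)) * \<Phi> y)) < \<infinity>"
proof -
 let ?n = "CARD('n)"
 have w: "1 <= w" using q qw by simp
 let ?E = "real ?n / w"
 have E: "?E \<ge> 0" using w by simp
 have "1 <= ?n" by (simp add: Suc_leI)
 then have B1: "1 <= 4 * real ?n" by linarith
 have r01: "r0 <= 1" using r0 by linarith
 have "\<exists>c>0. \<forall>d. \<exists>N. \<forall>J i t (z::real^'n). N <= i --> i + N <= J --> 1 / 2 ^ d <= t --> t <= 2 ^ d -->
  2 ^ i / 2 <= norm z --> norm z <= (4 * real ?n) * 2 ^ i -->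
  c * (t powr ?E * 2 powr (- (real i * ?E))) <= (\<Sum>j<J. 2 powr (- (real j * ?E)) * \<kappa> ((1 / 2 ^ j) *\<^sub>R ((1 / t) *\<^sub>R z)))"
  by (rule dyadic_sum_lower[where \<theta>=\<kappa> and ?r0.0=r0 and ?c0.0=c and B="4 * real ?n" and E="?E"]) (fact kappa_ge kappa_c r0(1) r01 c B1 E)+
 then obtain c2 where c2: "c2 > 0" "\<forall>d. \<exists>N. \<forall>J i t (z::real^'n). N <= i --> i + N <= J --> 1 / 2 ^ d <= t --> t <= 2 ^ d -->
  2 ^ i / 2 <= norm z --> norm z <= (4 * real ?n) * 2 ^ i -->
  c2 * (t powr ?E * 2 powr (- (real i * ?E))) <= (\<Sum>j<J. 2 powr (- (real j * ?E)) * \<kappa> ((1 / 2 ^ j) *\<^sub>R ((1 / t) *\<^sub>R z)))"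
  by - (elim exE conjE, rule that)
 obtain K1 where K1: "K1 \<ge> 0" "\<forall>J. (\<integral>\<^sup>+k. enn_powr (nrm p (B k (fourier (gII ?E {..<J})))) w \<partial>count_space UNIV) <= ennreal (K1 * real J)"
  using mnorm_fII[OF w] by - (elim exE conjE, rule that)
 obtain D where D: "D > 0" "\<forall>k f. f \<in> schwartz --> enorm (B k (HH f) 0) <= ennreal D * nrm p (B k (HH f))"
  using bernstein by - (elim exE conjE, rule that)
 let ?c = "bv * c2" and ?a = "real ?n - ?E"
 have c': "?c > 0" using c2(1) bv_pos by simp
 have mw: "enn_powr (mnorm p q g) w = (\<integral>\<^sup>+k. enn_powr (nrm p (B k g)) w \<partial>count_space UNIV)" for g
  unfolding mnorm_def qw lpn_real using w by simp
 have "(NBINT y. ennreal (norm y powr ?a * \<Phi> y)) < \<infinity>"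
 proof (rule mass_growth[OF c' w])
  show "0 <= (D * Cb) powr w * K1" using K1 by simp
  fix d
  obtain N where "\<forall>J i t (z::real^'n). N <= i --> i + N <= J --> 1 / 2 ^ d <= t --> t <= 2 ^ d -->
   2 ^ i / 2 <= norm z --> norm z <= (4 * real ?n) * 2 ^ i -->
   c2 * (t powr ?E * 2 powr (- (real i * ?E))) <= dyadic_sum \<kappa> ?E {..<J} ((1 / t) *\<^sub>R z)"
   using c2(2)[THEN spec, of d, folded dyadic_sum_def] by - (elim exE, rule that)
  note N = this[rule_format]
  have "ennreal (real (card {N..<J - N})) * enn_powr (ennreal ?c * mass ?a d) w <= ennreal ((D * Cb) powr w * K1 * real J)" for J
  proof -
   let ?f = "fourier (gII ?E {..<J})"
   let ?X = "enn_powr (ennreal ?c * mass ?a d) w"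
   define b where "b i = ?X * ennreal (inverse ((2 ^ i) ^ ?n))" for i :: nat
   let ?u = "\<lambda>k. enn_powr (ennreal D) w * enn_powr (nrm p (B k (HH ?f))) w"
   have low: "b i <= ?u k" if i: "i \<in> {N..<J - N}" and k: "k \<in> dyadic_lattice_box i" for i k
   proof -
    have kl: "2 ^ i <= k $ l" "k $ l < 2 ^ Suc i" for l using k by (auto simp: dyadic_lattice_box_def)
    have "of_int (2 ^ i) <= real_of_int (k $ l)" "real_of_int (k $ l) <= of_int (2 ^ Suc i)" for l
     using kl[of l] by (simp_all only: of_int_le_iff less_imp_le)
    then have kr: "2 ^ i <= kv k $ l" "kv k $ l <= 2 ^ Suc i" for l by simp_all
    have xn: "2 ^ i <= norm (- kv k)" "norm (- kv k) <= real ?n * 2 ^ Suc i"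
     using norm_coordinate_bounds[of "2 ^ i" "kv k" "2 ^ Suc i"] kr by simp_all
    let ?t1 = "bv * (c2 * 2 powr (- (real i * ?E)))"
    have "ennreal ?t1 * mass ?a d <= enorm (B k (HH ?f) 0)"
    proof (rule type_II_point)
     fix y \<xi> :: "real^'n" assume y: "1 / 2 ^ d <= norm y" "norm y <= 2 ^ d" and z: "norm (\<xi> + kv k) <= r0"
     have "(0::real) < 1 / 2 ^ d" by simp
     then have y0: "norm y > 0" using y(1) by linarith
     have iJ: "N <= i" "i + N <= J" using i by auto
     \<comment> \<open>In frequency the dilation acts inversely, so the lower bound is used with
       parameter 1/|y|; the truncated range is symmetric under inversion.\<close>
     have y': "1 / 2 ^ d <= 1 / norm y" "1 / norm y <= 2 ^ d" using y y0 by (auto simp: field_simps)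
     have "norm (\<xi> - - kv k) <= 1/4" using z r0 by simp
     from N[OF iJ y' dyadic_ball[OF xn this]]
     have "c2 * ((1 / norm y) powr ?E * 2 powr (- (real i * ?E))) <= dyadic_sum \<kappa> ?E {..<J} (norm y *\<^sub>R \<xi>)" by simp
     moreover have "(1 / norm y) powr ?E = norm y powr (- ?E)" using y0 by (simp add: powr_minus powr_divide inverse_eq_divide)
     ultimately show "c2 * 2 powr (- (real i * ?E)) * norm y powr (- ?E) <= dyadic_sum \<kappa> ?E {..<J} (norm y *\<^sub>R \<xi>)"
      by (simp only: mult_ac)
    qed (use c2 in simp)
    also have "... <= ennreal D * nrm p (B k (HH ?f))" by (rule D(2)[rule_format, OF fII_schwartz])
    finally have "enn_powr (ennreal ?t1 * mass ?a d) w <= enn_powr (ennreal D * nrm p (B k (HH ?f))) w"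
     using w by (intro enn_powr_mono) auto
    moreover have "ennreal ?t1 = ennreal ?c * ennreal (2 powr (- (real i * ?E)))"
     using c' by (simp add: ennreal_mult[symmetric] mult.assoc)
    moreover have "enn_powr (ennreal (2 powr (- (real i * ?E)))) w = ennreal (inverse ((2 ^ i) ^ ?n))"
     using powr_dyadic[of w i] w by (simp add: enn_powr_ennreal)
    ultimately show ?thesis by (simp add: b_def enn_powr_mult mult_ac)
   qed
   let ?L = "\<lambda>i. dyadic_lattice_box i :: (int^'n) set"
   have "ennreal (real (card {N..<J - N})) * ?X = (\<Sum>i\<in>{N..<J - N}. ?X)" by (simp add: ennreal_of_nat_eq_real_of_nat)
   also have "... = (\<Sum>i\<in>{N..<J - N}. \<Sum>k\<in>?L i. b i)"
   proof (rule sum.cong[OF refl])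
    fix i
    have "ennreal ((2 ^ i) ^ ?n) * ennreal (inverse ((2 ^ i) ^ ?n)) = ennreal ((2 ^ i) ^ ?n * inverse ((2 ^ i) ^ ?n))"
     by (rule ennreal_mult[symmetric]) auto
    also have "(2 ^ i) ^ ?n * inverse ((2 ^ i) ^ ?n) = (1::real)" by simp
    finally have 1: "ennreal ((2 ^ i) ^ ?n) * ennreal (inverse ((2 ^ i) ^ ?n)) = 1" by simp
    have "(\<Sum>k\<in>?L i. b i) = ennreal ((2 ^ i) ^ ?n) * b i"
     by (simp add: card_dyadic_lattice_box(2) ennreal_of_nat_eq_real_of_nat)
    also have "... = ?X * (ennreal ((2 ^ i) ^ ?n) * ennreal (inverse ((2 ^ i) ^ ?n)))" unfolding b_def by (simp only: mult_ac)
    finally show "?X = (\<Sum>k\<in>?L i. b i)" unfolding 1 by simp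
   qed
   also have "... <= (\<Sum>i\<in>{N..<J - N}. \<Sum>k\<in>?L i. ?u k)" by (intro sum_mono low)
   also have "... = (\<Sum>k\<in>(\<Union>i\<in>{N..<J - N}. ?L i). ?u k)"
   proof (rule sum.UNION_disjoint[symmetric])
    show "\<forall>i\<in>{N..<J - N}. \<forall>j\<in>{N..<J - N}. i \<noteq> j --> ?L i \<inter> ?L j = {}"
    proof (intro ballI impI equals0I)
     fix i j k assume ij: "i \<noteq> j" and "k \<in> ?L i \<inter> ?L j"
     then have "2 ^ i <= k $ undefined" "k $ undefined < 2 ^ Suc i" "2 ^ j <= k $ undefined" "k $ undefined < 2 ^ Suc j"
      by (auto simp: dyadic_lattice_box_def)
     then have "real_of_int (2 ^ i) <= of_int (k $ undefined)" "real_of_int (k $ undefined) < of_int (2 ^ Suc i)"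
      "real_of_int (2 ^ j) <= of_int (k $ undefined)" "real_of_int (k $ undefined) < of_int (2 ^ Suc j)"
      by (simp_all only: of_int_le_iff of_int_less_iff)
     then show False using dyadic_unique[of i "of_int (k $ undefined)" j] ij by simp
    qed
   qed (auto simp: card_dyadic_lattice_box(1))
   also have "... <= (\<integral>\<^sup>+k. ?u k \<partial>count_space UNIV)"
    by (intro sum_le_nn_integral_count_space finite_UN_I) (auto simp: card_dyadic_lattice_box(1))
   also have "... = enn_powr (ennreal D) w * enn_powr (mnorm p q (HH ?f)) w"
    unfolding mw by (rule nn_integral_cmult) simp
   also have "... <= enn_powr (ennreal D) w * enn_powr (ennreal Cb * mnorm p q ?f) w"
    using w by (intro mult_left_mono enn_powr_mono bd fII_schwartz) auto
   also have "... = enn_powr (ennreal D) w * (enn_powr (ennreal Cb) w * (\<integral>\<^sup>+k. enn_powr (nrm p (B k ?f)) w \<partial>count_space UNIV))"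
    unfolding enn_powr_mult mw ..
   also have "... <= enn_powr (ennreal D) w * (enn_powr (ennreal Cb) w * ennreal (K1 * real J))"
    using K1(2) by (intro mult_left_mono) auto
   also have "... = ennreal ((D * Cb) powr w * K1 * real J)"
    using D(1) Cb K1(1) by (simp add: enn_powr_ennreal ennreal_mult[symmetric] powr_mult mult_ac)
   finally show ?thesis .
  qed
  then show "\<exists>N. \<forall>J. ennreal (real (card {N..<J - N})) * enn_powr (ennreal ?c * mass ?a d) w <= ennreal ((D * Cb) powr w * K1 * real J)"
   by (intro exI allI)
 qed
 moreover have "?a = real ?n * (1 - einv q)" using qw by (simp add: einv_def algebra_simps)
 ultimately show ?thesis by simp
qed

lemma test_integrals:
 "(NBINT y. ennreal (norm y powr (CARD('n) * einv p) * \<Phi> y)) < \<infinity>"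
 "(NBINT y. ennreal (norm y powr (CARD('n) * (1 - einv q)) * \<Phi> y)) < \<infinity>"
proof -
 show "(NBINT y. ennreal (norm y powr (CARD('n) * einv p) * \<Phi> y)) < \<infinity>"
  using p by (cases rule: ereal_ge_1_cases) (erule type_I_inf type_I_fin)+
 show "(NBINT y. ennreal (norm y powr (CARD('n) * (1 - einv q)) * \<Phi> y)) < \<infinity>"
  using q by (cases rule: ereal_ge_1_cases) (erule type_II_inf type_II_fin)+
qed

end

section \<open>Conclusion: exponents and Lebesgue measurable kernels\<close>

lemma (in hausdorff) necessity:
 assumes p: "1 <= p" and q: "1 <= q" and bd: "\<exists>C\<ge>0. \<forall>f\<in>schwartz. mnorm p q (HH f) <= ennreal C * mnorm p q f"
 shows "(NBINT y. ennreal ((norm y powr (CARD('n) * einv p) + norm y powr (CARD('n) * (1 - einv q))) * \<Phi> y)) < \<infinity>"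
proof -
 obtain C where C: "C \<ge> 0" "\<forall>f\<in>schwartz. mnorm p q (HH f) <= ennreal C * mnorm p q f"
  using bd by - (elim exE conjE, rule that)
 obtain \<theta> \<kappa> :: "real^'n => real" and c r0 :: real
 where pr: "0 < c" "0 < r0" "r0 <= 1/4" "(\<lambda>x. cor (\<theta> x)) \<in> schwartz" "(\<lambda>x. cor (\<kappa> x)) \<in> schwartz"
  "\<And>x. 0 <= \<theta> x" "\<And>x. 0 <= \<kappa> x" "fourier (\<lambda>x. cor (\<kappa> x)) = (\<lambda>x. cor (\<theta> x))"
  "\<And>x. \<not> infnorm x < 3/16 ==> \<kappa> x = 0" "\<And>x. norm x <= r0 ==> c <= \<theta> x" "\<And>x. norm x <= r0 ==> c <= \<kappa> x"
  by (rule profile, rule that)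
 interpret hausdorff_test \<eta> \<Phi> p q \<theta> \<kappa> c r0 "unit_ball_vol (real CARD('n)) * r0 ^ CARD('n)" C
  by unfold_locales (use p q C pr in auto)
 have "(NBINT y. ennreal ((norm y powr (CARD('n) * einv p) + norm y powr (CARD('n) * (1 - einv q))) * \<Phi> y))
  = (NBINT y. ennreal (norm y powr (CARD('n) * einv p) * \<Phi> y) + ennreal (norm y powr (CARD('n) * (1 - einv q)) * \<Phi> y))"
  by (intro nn_integral_cong) (simp add: distrib_right Phi_ge flip: ennreal_plus)
 also have "... = (NBINT y. ennreal (norm y powr (CARD('n) * einv p) * \<Phi> y)) + (NBINT y. ennreal (norm y powr (CARD('n) * (1 - einv q)) * \<Phi> y))"
  by (rule nn_integral_add) measurable
 also have "... < \<infinity>" using test_integrals by (simp add: ennreal_add_less_top)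
 finally show ?thesis .
qed

lemma inverse_ereal_einv: "1 <= (p::ereal) ==> 1 / p = ereal (einv p)"
 by (erule ereal_ge_1_cases) (auto simp: einv_def one_ereal_def)

lemma einv_le_iff: "1 <= (p::ereal) ==> 1 <= (q::ereal) ==> einv p <= einv q \<longleftrightarrow> q <= p"
 by (erule ereal_ge_1_cases; erule ereal_ge_1_cases) (auto simp: einv_def field_simps)

lemma exponent_einv: "1 <= (p::ereal) ==> real_of_ereal (ereal a / p) = a * einv p"
 by (erule ereal_ge_1_cases) (auto simp: einv_def)

lemma exponent_region:
 assumes p: "1 <= (p::ereal)" and q: "1 <= (q::ereal)" and reg: "(1 / p - 1 / 2) * (1 / q - 1 / p) \<ge> 0"
 shows "p <= 2 \<and> q <= p \<or> 2 <= p \<and> p <= q"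
proof -
 have two: "1 <= (2::ereal)" by (simp add: one_ereal_def numeral_eq_ereal)
 have e2: "einv 2 = 1/2" by (simp add: einv_def)
 have "ereal ((einv p - 1/2) * (einv q - einv p)) \<ge> 0"
  using reg unfolding inverse_ereal_einv[OF p] inverse_ereal_einv[OF q] inverse_ereal_einv[OF two] e2 by simp
 then have "(einv p - 1/2) * (einv q - einv p) \<ge> 0" by simp
 then have "einv 2 <= einv p \<and> einv p <= einv q \<or> einv p <= einv 2 \<and> einv q <= einv p"
  unfolding e2 zero_le_mult_iff by auto
 then show ?thesis using einv_le_iff[OF two p] einv_le_iff[OF p q] einv_le_iff[OF p two] einv_le_iff[OF q p] by blast
qed

lemma hausdorff_op_cong_AE:
 fixes f :: "real^'n::finite => complex"
 assumes "AE y in lebesgue. \<Phi> y = \<Psi> y" "\<Phi> \<in> borel_measurable lebesgue" "\<Psi> \<in> borel_measurable lebesgue" "f \<in> schwartz"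
 shows "hausdorff_op \<Phi> f x = hausdorff_op \<Psi> f x"
proof -
 note [measurable] = schwartz_borel[OF assms(4)] assms(2,3)
 have "(\<lambda>y. f (x /\<^sub>R norm y)) \<in> borel_measurable lborel" by measurable
 then have [measurable]: "(\<lambda>y. f (x /\<^sub>R norm y)) \<in> borel_measurable lebesgue" by (rule measurable_completion)
 show ?thesis unfolding hausdorff_op_def
 proof (rule integral_cong_AE)
  show "AE y in lebesgue. cor (\<Phi> y) * f (x /\<^sub>R norm y) = cor (\<Psi> y) * f (x /\<^sub>R norm y)"
   using assms(1) by eventually_elim simp
 qed measurable
qed

theorem theorem1p9:
  fixes p q q' :: ereal
    and \<Phi> :: "real^'n::finite \<Rightarrow> real"
    and \<eta> :: "real^'n \<Rightarrow> real"
  assumes "modulation_window \<eta>"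
    and "1 \<le> p" and "1 \<le> q"
    and "1 \<le> q'" and "1 / q + 1 / q' = 1"
    and "(1 / p - 1 / 2) * (1 / q - 1 / p) \<ge> 0"
    and "\<Phi> \<in> borel_measurable lebesgue" and "\<And>y. \<Phi> y \<ge> 0"
    and "(\<integral>\<^sup>+y\<in>ball 0 1. ennreal (norm y ^ CARD('n) * \<Phi> y) \<partial>lebesgue) < \<infinity>"
    and "(\<integral>\<^sup>+y\<in>- ball 0 1. ennreal (\<Phi> y) \<partial>lebesgue) < \<infinity>"
  shows "bounded_on_modulation \<eta> p q (hausdorff_op \<Phi>) \<longleftrightarrow>
    (\<integral>\<^sup>+y. ennreal ((norm y powr real_of_ereal (ereal (real CARD('n)) / p)
               + norm y powr real_of_ereal (ereal (real CARD('n)) / q')) * \<Phi> y) \<partial>lebesgue) < \<infinity>"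
proof -
 note p = assms(2) and q = assms(3) and q' = assms(4)
 obtain \<Phi>0 where \<Phi>0: "\<Phi>0 \<in> borel_measurable lborel" "AE y in lborel. \<Phi> y = \<Phi>0 y"
  using completion_ex_borel_measurable_real[OF assms(7)] by blast
 \<comment> \<open>A Borel representative may be negative on a null set; the maximum makes it
   nonnegative everywhere and still equal to \<Phi> almost everywhere.\<close>
 define \<Psi> where "\<Psi> y = max 0 (\<Phi>0 y)" for y
 have \<Psi>m [measurable]: "\<Psi> \<in> borelM" unfolding \<Psi>_def using \<Phi>0(1) by measurable
 have \<Psi>0: "\<Psi> y \<ge> 0" for y by (simp add: \<Psi>_def)
 have "AE y in lborel. \<Phi> y = \<Psi> y"
  using \<Phi>0(2) by eventually_elim (metis \<Psi>_def assms(8) max.absorb2)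
 then have ae: "AE y in lebesgue. \<Phi> y = \<Psi> y" by (rule AE_completion)
 have \<Psi>l: "\<Psi> \<in> borel_measurable lebesgue" using \<Psi>m by (intro measurable_completion) simp
 have int: "(\<integral>\<^sup>+y. ennreal (h y * \<Phi> y) * g y \<partial>lebesgue) = (NBINT y. ennreal (h y * \<Psi> y) * g y)"
  if [measurable]: "h \<in> borelM" "g \<in> borelM" for h :: "real^'n => real" and g
 proof -
  have "(\<integral>\<^sup>+y. ennreal (h y * \<Phi> y) * g y \<partial>lebesgue) = (\<integral>\<^sup>+y. ennreal (h y * \<Psi> y) * g y \<partial>lebesgue)"
   using ae by (intro nn_integral_cong_AE) (auto elim!: eventually_mono)
  also have "... = (NBINT y. ennreal (h y * \<Psi> y) * g y)" by (rule nn_integral_completion)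
  finally show ?thesis .
 qed
 have ib: "(indicator (ball 0 1) :: real^'n => ennreal) \<in> borelM"
  "(indicator (- ball 0 1) :: real^'n => ennreal) \<in> borelM"
  by (intro borel_measurable_indicator; simp)+
 interpret hausdorff \<eta> \<Psi>
 proof
  show "(\<integral>\<^sup>+y\<in>ball 0 1. ennreal (norm y ^ CARD('n) * \<Psi> y) \<partial>lborel) < \<infinity>"
   using assms(9) int[OF _ ib(1), of "\<lambda>y. norm y ^ CARD('n)"] by simp
  show "(\<integral>\<^sup>+y\<in>- ball 0 1. ennreal (\<Psi> y) \<partial>lborel) < \<infinity>"
   using assms(10) int[OF _ ib(2), of "\<lambda>y. 1"] by simp
 qed (use assms(1) \<Psi>m \<Psi>0 in auto)
 have "einv q + einv q' = 1"
  using assms(5) unfolding inverse_ereal_einv[OF q] inverse_ereal_einv[OF q'] by (simp add: one_ereal_def)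
 then have eq': "einv q' = 1 - einv q" by simp
 have "bounded_on_modulation \<eta> p q (hausdorff_op \<Phi>) \<longleftrightarrow> bounded_on_modulation \<eta> p q (hausdorff_op \<Psi>)"
 proof -
  have "hausdorff_op \<Phi> f = hausdorff_op \<Psi> f" if "f \<in> schwartz" for f
   by (rule ext, rule hausdorff_op_cong_AE[OF ae assms(7) \<Psi>l that])
  then show ?thesis unfolding bounded_on_modulation_def by simp
 qed
 also have "... \<longleftrightarrow> (NBINT y. ennreal ((norm y powr (CARD('n) * einv p) + norm y powr (CARD('n) * (1 - einv q))) * \<Psi> y)) < \<infinity>"
  unfolding bounded_iff[OF p q]
  using sufficiency[OF p q exponent_region[OF p q assms(6)]] necessity[OF p q] by blast
 also have "(NBINT y. ennreal ((norm y powr (CARD('n) * einv p) + norm y powr (CARD('n) * (1 - einv q))) * \<Psi> y))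
  = (\<integral>\<^sup>+y. ennreal ((norm y powr (CARD('n) * einv p) + norm y powr (CARD('n) * (1 - einv q))) * \<Phi> y) \<partial>lebesgue)"
  using int[of "\<lambda>y. norm y powr (CARD('n) * einv p) + norm y powr (CARD('n) * (1 - einv q))" "\<lambda>_. 1"] by simp
 finally show ?thesis unfolding exponent_einv[OF p] exponent_einv[OF q'] eq' .
qed

end
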